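(* Let $\Lambda$ be an Artin algebra and $n\geq 1$ an integer. If $M\in\mathrm{mod}(\Lambda)$ is $\tau_n$-tilting, then $M^{\perp_{\tau_n}}=\mathrm{gen}_n(M)$.
   Context: $\mathrm{mod}(\Lambda)$ is the category of finitely generated left $\Lambda$-modules, $\mathrm{proj}(\Lambda)$ its full subcategory of projectives, and $\mathsf{K}^b(\mathrm{proj}(\Lambda))$ is the homotopy category of bounded cochain complexes in $\mathrm{proj}(\Lambda)$. For each $M\in\mathrm{mod}(\Lambda)$ fix a minimal projective resolution $\cdots\to P^{-1}(M)\to P^0(M)\to M\to 0$; $P^\bullet(M)$ is the cochain complex with components $P^i(M)$ in degrees $i\leq 0$ and zero in positive degrees; $P^\bullet_{\geq -n}(M)$ is its truncated subcomplex with components $P^i(M)$ for $-n\leq i\leq 0$ and $0$ elsewhere. $\tau$ is the Auslander-Reiten translation, $\Omega^i$ the $i$-th syzygy (computed with minimal projective resolutions), and $\tau_n(M):=\tau(\Omega^{n-1}(M))$. $M^{\perp_{\tau_n}}$ is the class of all $N\in\mathrm{mod}(\Lambda)$ such that $\mathrm{Hom}_\Lambda(N,\tau_n(M))=0$ and $\mathrm{Ext}^i_\Lambda(M,N)=0$ for all $1\leq i\leq n-1$. A complex $P^\bullet\in\mathsf{K}^b(\mathrm{proj}(\Lambda))$ is presilting if $\mathrm{Hom}_{\mathsf{K}^b(\mathrm{proj}(\Lambda))}(P^\bullet,P^\bullet[j])=0$ for all $j>0$, and silting if moreover $\mathsf{K}^b(\mathrm{proj}(\Lambda))$ is the smallest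 triangulated subcategory of itself containing $\mathrm{add}(P^\bullet)$ (direct summands of finite direct sums of copies of $P^\bullet$). $M$ is $\tau_n$-tilting if $P^\bullet_{\geq -n}(M)$ is silting in $\mathsf{K}^b(\mathrm{proj}(\Lambda))$. $\mathrm{gen}_n(M)$ is the class of all $X\in\mathrm{mod}(\Lambda)$ admitting an exact sequence $M_n\to M_{n-1}\to\cdots\to M_1\to X\to 0$ with $M_i\in\mathrm{add}(M)$ for all $i\in[1,n]$. *)

theory Defs
  imports "HOL-Algebra.Module" "HOL-Algebra.Ideal" "HOL-Algebra.Elementary_Groups"
begin

section \<open>Modules over a not necessarily commutative ring\<close>

text \<open>
  The locale \<open>module\<close> of HOL-Algebra demands a commutative ring of scalars, so left modules over an
  arbitrary ring get their own locale. The record type is the one of HOL-Algebra; it inherits the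
  fields \<open>mult\<close> and \<open>one\<close> from rings, which carry no meaning for a module and are left
  unspecified by \<open>mk_module\<close>.
\<close>

locale left_module = R?: ring R + M?: abelian_group M
    for R :: "('a, 's) ring_scheme" (structure) and M :: "('a, 'b, 't) module_scheme" (structure) +
  assumes smult_closed [simp, intro]:
      "\<lbrakk>a \<in> carrier R; x \<in> carrier M\<rbrakk> \<Longrightarrow> a \<odot>\<^bsub>M\<^esub> x \<in> carrier M"
    and smult_l_distr:
      "\<lbrakk>a \<in> carrier R; b \<in> carrier R; x \<in> carrier M\<rbrakk> \<Longrightarrow>
        (a \<oplus> b) \<odot>\<^bsub>M\<^esub> x = a \<odot>\<^bsub>M\<^esub> x \<oplus>\<^bsub>M\<^esub> b \<odot>\<^bsub>M\<^esub> x"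
    and smult_r_distr:
      "\<lbrakk>a \<in> carrier R; x \<in> carrier M; y \<in> carrier M\<rbrakk> \<Longrightarrow>
        a \<odot>\<^bsub>M\<^esub> (x \<oplus>\<^bsub>M\<^esub> y) = a \<odot>\<^bsub>M\<^esub> x \<oplus>\<^bsub>M\<^esub> a \<odot>\<^bsub>M\<^esub> y"
    and smult_assoc1:
      "\<lbrakk>a \<in> carrier R; b \<in> carrier R; x \<in> carrier M\<rbrakk> \<Longrightarrow>
        (a \<otimes> b) \<odot>\<^bsub>M\<^esub> x = a \<odot>\<^bsub>M\<^esub> (b \<odot>\<^bsub>M\<^esub> x)"
    and smult_one [simp]:
      "x \<in> carrier M \<Longrightarrow> \<one> \<odot>\<^bsub>M\<^esub> x = x"

lemma module_iff_left_module: "module R M \<longleftrightarrow> cring R \<and> left_module R M"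
  unfolding module_def module_axioms_def left_module_def left_module_axioms_def
  by (auto dest: cring.axioms(1))

definition mk_module :: "'b set \<Rightarrow> 'b \<Rightarrow> ('b \<Rightarrow> 'b \<Rightarrow> 'b) \<Rightarrow> ('a \<Rightarrow> 'b \<Rightarrow> 'b) \<Rightarrow> ('a, 'b) module" where
  "mk_module C z p s =
     \<lparr>carrier = C, mult = undefined, one = undefined, zero = z, add = p, smult = s\<rparr>"

definition finitely_generated :: "'a ring \<Rightarrow> ('a, 'b) module \<Rightarrow> bool" where
  "finitely_generated R M \<longleftrightarrow>
     (\<exists>S. finite S \<and> S \<subseteq> carrier M \<and> (\<forall>H. submodule H R M \<and> S \<subseteq> H \<longrightarrow> H = carrier M))"

definition fg_mod :: "'a ring \<Rightarrow> ('a, 'b) module set" where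
  "fg_mod R = {M. left_module R M \<and> finitely_generated R M}"

text \<open>Homomorphisms are extensional (equal to \<open>undefined\<close> off the carrier), so that equality of
  homomorphisms is equality of HOL functions.\<close>

definition mod_hom :: "'a ring \<Rightarrow> ('a, 'b) module \<Rightarrow> ('a, 'c) module \<Rightarrow> ('b \<Rightarrow> 'c) set" where
  "mod_hom R M N = {f \<in> carrier M \<rightarrow>\<^sub>E carrier N.
     (\<forall>x\<in>carrier M. \<forall>y\<in>carrier M. f (x \<oplus>\<^bsub>M\<^esub> y) = f x \<oplus>\<^bsub>N\<^esub> f y) \<and>
     (\<forall>a\<in>carrier R. \<forall>x\<in>carrier M. f (a \<odot>\<^bsub>M\<^esub> x) = a \<odot>\<^bsub>N\<^esub> f x)}"

definition hom_group :: "'a ring \<Rightarrow> ('a, 'b) module \<Rightarrow> ('a, 'c) module \<Rightarrow> ('b \<Rightarrow> 'c) monoid" where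
  "hom_group R M N =
     \<lparr>carrier = mod_hom R M N,
      mult = (\<lambda>f g. \<lambda>x\<in>carrier M. f x \<oplus>\<^bsub>N\<^esub> g x),
      one = (\<lambda>x\<in>carrier M. \<zero>\<^bsub>N\<^esub>)\<rparr>"

definition mod_iso :: "'a ring \<Rightarrow> ('a, 'b) module \<Rightarrow> ('a, 'c) module \<Rightarrow> bool" where
  "mod_iso R M N \<longleftrightarrow> (\<exists>f\<in>mod_hom R M N. bij_betw f (carrier M) (carrier N))"

definition regular_module :: "'a ring \<Rightarrow> ('a, 'a) module" where
  "regular_module R = mk_module (carrier R) \<zero>\<^bsub>R\<^esub> (\<oplus>\<^bsub>R\<^esub>) (\<otimes>\<^bsub>R\<^esub>)"

definition direct_sum :: "('a, 'b) module \<Rightarrow> ('a, 'c) module \<Rightarrow> ('a, 'b \<times> 'c) module" where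
  "direct_sum M N = mk_module (carrier M \<times> carrier N) (\<zero>\<^bsub>M\<^esub>, \<zero>\<^bsub>N\<^esub>)
     (\<lambda>u v. (fst u \<oplus>\<^bsub>M\<^esub> fst v, snd u \<oplus>\<^bsub>N\<^esub> snd v))
     (\<lambda>a u. (a \<odot>\<^bsub>M\<^esub> fst u, a \<odot>\<^bsub>N\<^esub> snd u))"

definition direct_power :: "('a, 'b) module \<Rightarrow> nat \<Rightarrow> ('a, nat \<Rightarrow> 'b) module" where
  "direct_power M k = mk_module ({..<k} \<rightarrow>\<^sub>E carrier M) (\<lambda>i\<in>{..<k}. \<zero>\<^bsub>M\<^esub>)
     (\<lambda>u v. \<lambda>i\<in>{..<k}. u i \<oplus>\<^bsub>M\<^esub> v i)
     (\<lambda>a u. \<lambda>i\<in>{..<k}. a \<odot>\<^bsub>M\<^esub> u i)"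

definition quotient_module :: "('a, 'b) module \<Rightarrow> 'b set \<Rightarrow> ('a, 'b set) module" where
  "quotient_module M H = mk_module (a_rcosets\<^bsub>M\<^esub> H) H (\<lambda>C D. C <+>\<^bsub>M\<^esub> D)
     (\<lambda>a C. H <+>\<^bsub>M\<^esub> ((\<lambda>x. a \<odot>\<^bsub>M\<^esub> x) ` C))"

text \<open>A complement of a direct summand of \<open>F\<close> is isomorphic to a submodule of \<open>F\<close>, so it may be
  sought among the modules with elements of the same type as those of \<open>F\<close>.\<close>

definition direct_summand :: "'a ring \<Rightarrow> ('a, 'b) module \<Rightarrow> ('a, 'c) module \<Rightarrow> bool" where
  "direct_summand R M F \<longleftrightarrow>
     (\<exists>N :: ('a, 'c) module. left_module R N \<and> mod_iso R (direct_sum M N) F)"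

definition add_closure :: "'a ring \<Rightarrow> ('a, 'b) module \<Rightarrow> ('a, 'c) module set" where
  "add_closure R M = {X \<in> fg_mod R. \<exists>k. direct_summand R X (direct_power M k)}"

text \<open>Finitely generated projective modules: direct summands of free modules of finite rank.\<close>

definition fg_proj :: "'a ring \<Rightarrow> ('a, 'b) module set" where
  "fg_proj R = {P \<in> fg_mod R. \<exists>k. direct_summand R P (direct_power (regular_module R) k)}"


section \<open>Artin algebras\<close>

definition artinian_cring :: "'r ring \<Rightarrow> bool" where
  "artinian_cring R \<longleftrightarrow> cring R \<and>
     (\<forall>I :: nat \<Rightarrow> 'r set. (\<forall>k. ideal (I k) R) \<and> (\<forall>k. I (Suc k) \<subseteq> I k)
        \<longrightarrow> (\<exists>k. \<forall>m\<ge>k. I m = I k))"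

definition restrict_scalars :: "('r \<Rightarrow> 'a) \<Rightarrow> ('a, 'b) module \<Rightarrow> ('r, 'b) module" where
  "restrict_scalars \<phi> M =
     mk_module (carrier M) \<zero>\<^bsub>M\<^esub> (\<oplus>\<^bsub>M\<^esub>) (\<lambda>r x. \<phi> r \<odot>\<^bsub>M\<^esub> x)"

text \<open>\<open>\<phi>\<close> is the structure map of the \<open>R\<close>-algebra \<open>\<Lambda>\<close>.\<close>

definition artin_algebra :: "'r ring \<Rightarrow> 'a ring \<Rightarrow> ('r \<Rightarrow> 'a) \<Rightarrow> bool" where
  "artin_algebra R \<Lambda> \<phi> \<longleftrightarrow>
     artinian_cring R \<and> ring \<Lambda> \<and> \<phi> \<in> ring_hom R \<Lambda> \<and>
     (\<forall>r\<in>carrier R. \<forall>a\<in>carrier \<Lambda>. \<phi> r \<otimes>\<^bsub>\<Lambda>\<^esub> a = a \<otimes>\<^bsub>\<Lambda>\<^esub> \<phi> r) \<and>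
     finitely_generated R (restrict_scalars \<phi> (regular_module \<Lambda>))"


section \<open>Minimal projective resolutions\<close>

record ('a, 'b) cochain_complex =
  obj :: "int \<Rightarrow> ('a, 'b) module"
  dif :: "int \<Rightarrow> 'b \<Rightarrow> 'b"

definition is_complex :: "'a ring \<Rightarrow> ('a, 'b) cochain_complex \<Rightarrow> bool" where
  "is_complex R X \<longleftrightarrow>
     (\<forall>i. left_module R (obj X i)) \<and>
     (\<forall>i. dif X i \<in> mod_hom R (obj X i) (obj X (i + 1))) \<and>
     (\<forall>i. \<forall>x\<in>carrier (obj X i). dif X (i + 1) (dif X i x) = \<zero>\<^bsub>obj X (i + 2)\<^esub>)"

definition superfluous :: "'a ring \<Rightarrow> 'b set \<Rightarrow> ('a, 'b) module \<Rightarrow> bool" where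
  "superfluous R K P \<longleftrightarrow> submodule K R P \<and>
     (\<forall>L. submodule L R P \<and> L <+>\<^bsub>P\<^esub> K = carrier P \<longrightarrow> L = carrier P)"

definition projective_cover ::
    "'a ring \<Rightarrow> ('a, 'b) module \<Rightarrow> ('a, 'c) module \<Rightarrow> ('b \<Rightarrow> 'c) \<Rightarrow> bool" where
  "projective_cover R P M f \<longleftrightarrow>
     P \<in> fg_proj R \<and> f \<in> mod_hom R P M \<and> f ` carrier P = carrier M \<and>
     superfluous R (a_kernel P M f) P"

text \<open>For a complex \<open>P\<close> with augmentation \<open>\<epsilon>\<close> from the degree \<open>0\<close> term to \<open>M\<close>, \<open>syzygy_of M P \<epsilon> k\<close> is, for
  \<open>k \<ge> 1\<close>, the kernel of the map leaving the term in degree \<open>-(k - 1)\<close> of the augmented complex.\<close>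

definition syzygy_of :: "('a, 'm) module \<Rightarrow> ('a, 'b) cochain_complex \<Rightarrow> ('b \<Rightarrow> 'm) \<Rightarrow> nat \<Rightarrow> ('a, 'b) module"
  where
  "syzygy_of M P \<epsilon> k = (let i = 1 - int k in
     (obj P i)\<lparr>carrier := if k = 1 then a_kernel (obj P 0) M \<epsilon>
                          else a_kernel (obj P i) (obj P (i + 1)) (dif P i)\<rparr>)"

definition minimal_projective_resolution ::
    "'a ring \<Rightarrow> ('a, 'm) module \<Rightarrow> ('a, 'b) cochain_complex \<Rightarrow> ('b \<Rightarrow> 'm) \<Rightarrow> bool" where
  "minimal_projective_resolution R M P \<epsilon> \<longleftrightarrow>
     is_complex R P \<and> (\<forall>i>0. carrier (obj P i) = {\<zero>\<^bsub>obj P i\<^esub>}) \<and>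
     projective_cover R (obj P 0) M \<epsilon> \<and>
     (\<forall>k\<ge>1. projective_cover R (obj P (- int k)) (syzygy_of M P \<epsilon> k) (dif P (- int k)))"

text \<open>Every finitely generated projective module is isomorphic to a submodule of some \<open>R\<^sup>k\<close>, whose
  elements are functions \<open>nat \<Rightarrow> 'a\<close>. Hence complexes of finitely generated projectives are, up to
  isomorphism, complexes with elements of this type, and a minimal projective resolution may be
  chosen among them.\<close>

type_synonym 'a pcomplex = "('a, nat \<Rightarrow> 'a) cochain_complex"

definition chosen_res :: "'a ring \<Rightarrow> ('a, 'm) module \<Rightarrow> 'a pcomplex \<times> ((nat \<Rightarrow> 'a) \<Rightarrow> 'm)" where
  "chosen_res R M = (SOME (P, \<epsilon>). minimal_projective_resolution R M P \<epsilon>)"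

definition min_res :: "'a ring \<Rightarrow> ('a, 'm) module \<Rightarrow> 'a pcomplex" where
  "min_res R M = fst (chosen_res R M)"

definition min_res_aug :: "'a ring \<Rightarrow> ('a, 'm) module \<Rightarrow> (nat \<Rightarrow> 'a) \<Rightarrow> 'm" where
  "min_res_aug R M = snd (chosen_res R M)"

text \<open>The syzygy \<open>\<Omega>\<^sup>k M\<close>, for \<open>k \<ge> 1\<close> only, because \<open>\<Omega>\<^sup>0 M = M\<close> has elements of another type.\<close>

definition syzygy :: "'a ring \<Rightarrow> nat \<Rightarrow> ('a, 'm) module \<Rightarrow> ('a, nat \<Rightarrow> 'a) module" where
  "syzygy R k M = syzygy_of M (min_res R M) (min_res_aug R M) k"

text \<open>\<open>Ext\<^sup>i(M, N)\<close> is the cohomology of \<open>Hom(P\<^sup>\<bullet>(M), N)\<close>, cocycles modulo coboundaries.\<close>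

definition ext_cocycles ::
    "'a ring \<Rightarrow> nat \<Rightarrow> ('a, 'm) module \<Rightarrow> ('a, 'n) module \<Rightarrow> ((nat \<Rightarrow> 'a) \<Rightarrow> 'n) set" where
  "ext_cocycles R i M N = (let P = min_res R M in
     {f \<in> mod_hom R (obj P (- int i)) N.
        \<forall>x\<in>carrier (obj P (- int i - 1)). f (dif P (- int i - 1) x) = \<zero>\<^bsub>N\<^esub>})"

definition ext_coboundaries ::
    "'a ring \<Rightarrow> nat \<Rightarrow> ('a, 'm) module \<Rightarrow> ('a, 'n) module \<Rightarrow> ((nat \<Rightarrow> 'a) \<Rightarrow> 'n) set" where
  "ext_coboundaries R i M N = (let P = min_res R M in
     (\<lambda>g. compose (carrier (obj P (- int i))) g (dif P (- int i)))
       ` mod_hom R (obj P (- int i + 1)) N)"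

definition ext_group ::
    "'a ring \<Rightarrow> nat \<Rightarrow> ('a, 'm) module \<Rightarrow> ('a, 'n) module \<Rightarrow> ((nat \<Rightarrow> 'a) \<Rightarrow> 'n) set monoid" where
  "ext_group R i M N =
     (hom_group R (obj (min_res R M) (- int i)) N)\<lparr>carrier := ext_cocycles R i M N\<rparr>
       Mod ext_coboundaries R i M N"


section \<open>The Auslander-Reiten translation\<close>

text \<open>Right \<open>\<Lambda>\<close>-modules are left modules over the opposite ring.\<close>

definition op_ring :: "'a ring \<Rightarrow> 'a ring" where
  "op_ring \<Lambda> = \<Lambda>\<lparr>mult := (\<lambda>a b. b \<otimes>\<^bsub>\<Lambda>\<^esub> a)\<rparr>"

text \<open>\<open>Hom\<^sub>\<Lambda>(P, \<Lambda>)\<close> as a right \<open>\<Lambda>\<close>-module.\<close>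

definition ring_dual :: "'a ring \<Rightarrow> ('a, 'b) module \<Rightarrow> ('a, 'b \<Rightarrow> 'a) module" where
  "ring_dual \<Lambda> P = mk_module (mod_hom \<Lambda> P (regular_module \<Lambda>))
     (\<lambda>x\<in>carrier P. \<zero>\<^bsub>\<Lambda>\<^esub>)
     (\<lambda>f g. \<lambda>x\<in>carrier P. f x \<oplus>\<^bsub>\<Lambda>\<^esub> g x)
     (\<lambda>a f. \<lambda>x\<in>carrier P. f x \<otimes>\<^bsub>\<Lambda>\<^esub> a)"

text \<open>The transpose of \<open>X\<close>: the cokernel of \<open>Hom\<^sub>\<Lambda>(P\<^sup>0(X), \<Lambda>) \<rightarrow> Hom\<^sub>\<Lambda>(P\<^sup>-\<^sup>1(X), \<Lambda>)\<close>.\<close>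

definition transpose_module ::
    "'a ring \<Rightarrow> ('a, 'm) module \<Rightarrow> ('a, ((nat \<Rightarrow> 'a) \<Rightarrow> 'a) set) module" where
  "transpose_module \<Lambda> X = (let P = min_res \<Lambda> X in
     quotient_module (ring_dual \<Lambda> (obj P (-1)))
       ((\<lambda>g. compose (carrier (obj P (-1))) g (dif P (-1))) ` carrier (ring_dual \<Lambda> (obj P 0))))"

definition jacobson_radical :: "'r ring \<Rightarrow> 'r set" where
  "jacobson_radical R = carrier R \<inter> \<Inter>{I. maximalideal I R}"

text \<open>By Baer's criterion it does not matter which modules are used to test injectivity, provided
  they include isomorphic copies of all ideals of \<open>R\<close> and of \<open>R\<close> itself. The type
  \<open>(nat \<Rightarrow> 'r) set\<close> of cosets in \<open>R\<^sup>k\<close> houses a copy of every finitely generated module.\<close>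

definition injective_module :: "'r ring \<Rightarrow> ('r, 'j) module \<Rightarrow> bool" where
  "injective_module R J \<longleftrightarrow> left_module R J \<and>
     (\<forall>(X :: ('r, (nat \<Rightarrow> 'r) set) module) (Y :: ('r, (nat \<Rightarrow> 'r) set) module).
        left_module R X \<longrightarrow> left_module R Y \<longrightarrow>
        (\<forall>f\<in>mod_hom R X Y. inj_on f (carrier X) \<longrightarrow>
           (\<forall>g\<in>mod_hom R X J. \<exists>h\<in>mod_hom R Y J. \<forall>x\<in>carrier X. h (f x) = g x)))"

definition injective_envelope ::
    "'r ring \<Rightarrow> ('r, 'b) module \<Rightarrow> ('r, 'j) module \<Rightarrow> ('b \<Rightarrow> 'j) \<Rightarrow> bool" where
  "injective_envelope R S J e \<longleftrightarrow>
     injective_module R J \<and> e \<in> mod_hom R S J \<and> inj_on e (carrier S) \<and>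
     (\<forall>H. submodule H R J \<and> H \<inter> e ` carrier S = {\<zero>\<^bsub>J\<^esub>} \<longrightarrow> H = {\<zero>\<^bsub>J\<^esub>})"

text \<open>The standard duality \<open>Hom\<^sub>R(-, J)\<close>, where \<open>J\<close> is an injective envelope of \<open>R / rad R\<close>. It takes a
  right \<open>\<Lambda>\<close>-module \<open>Y\<close> to a left one; \<open>a \<odot>\<^bsub>Y\<^esub> y\<close> is the right action \<open>y a\<close>.\<close>

definition duality_cogenerator :: "'r ring \<Rightarrow> ('r, 'j) module \<Rightarrow> bool" where
  "duality_cogenerator R J \<longleftrightarrow>
     (\<exists>e. injective_envelope R (quotient_module (regular_module R) (jacobson_radical R)) J e)"

definition duality ::
    "'r ring \<Rightarrow> ('r \<Rightarrow> 'a) \<Rightarrow> ('r, 'j) module \<Rightarrow> ('a, 'b) module \<Rightarrow> ('a, 'b \<Rightarrow> 'j) module" where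
  "duality R \<phi> J Y = mk_module (mod_hom R (restrict_scalars \<phi> Y) J)
     (\<lambda>y\<in>carrier Y. \<zero>\<^bsub>J\<^esub>)
     (\<lambda>f g. \<lambda>y\<in>carrier Y. f y \<oplus>\<^bsub>J\<^esub> g y)
     (\<lambda>a f. \<lambda>y\<in>carrier Y. f (a \<odot>\<^bsub>Y\<^esub> y))"

definition ar_translation ::
    "'r ring \<Rightarrow> 'a ring \<Rightarrow> ('r \<Rightarrow> 'a) \<Rightarrow> ('r, 'j) module \<Rightarrow> ('a, 'm) module
       \<Rightarrow> ('a, ((nat \<Rightarrow> 'a) \<Rightarrow> 'a) set \<Rightarrow> 'j) module" where
  "ar_translation R \<Lambda> \<phi> J X = duality R \<phi> J (transpose_module \<Lambda> X)"

text \<open>\<open>\<tau>\<^sub>n(M) = \<tau>(\<Omega>\<^sup>n\<^sup>-\<^sup>1(M))\<close> for \<open>n \<ge> 1\<close>.\<close>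

definition tau_n ::
    "'r ring \<Rightarrow> 'a ring \<Rightarrow> ('r \<Rightarrow> 'a) \<Rightarrow> ('r, 'j) module \<Rightarrow> nat \<Rightarrow> ('a, 'm) module
       \<Rightarrow> ('a, ((nat \<Rightarrow> 'a) \<Rightarrow> 'a) set \<Rightarrow> 'j) module" where
  "tau_n R \<Lambda> \<phi> J n M =
     (if n = 1 then ar_translation R \<Lambda> \<phi> J M
      else ar_translation R \<Lambda> \<phi> J (syzygy \<Lambda> (n - 1) M))"

definition tau_n_perp ::
    "'r ring \<Rightarrow> 'a ring \<Rightarrow> ('r \<Rightarrow> 'a) \<Rightarrow> ('r, 'j) module \<Rightarrow> nat \<Rightarrow> ('a, 'm) module
       \<Rightarrow> ('a, 'n) module set" where
  "tau_n_perp R \<Lambda> \<phi> J n M =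
     {N \<in> fg_mod \<Lambda>. trivial_group (hom_group \<Lambda> N (tau_n R \<Lambda> \<phi> J n M)) \<and>
        (\<forall>i\<in>{1..n - 1}. trivial_group (ext_group \<Lambda> i M N))}"


section \<open>The homotopy category\<close>

definition chain_maps ::
    "'a ring \<Rightarrow> ('a, 'b) cochain_complex \<Rightarrow> ('a, 'c) cochain_complex \<Rightarrow> (int \<Rightarrow> 'b \<Rightarrow> 'c) set" where
  "chain_maps R X Y = {f. \<forall>i. f i \<in> mod_hom R (obj X i) (obj Y i) \<and>
     (\<forall>x\<in>carrier (obj X i). f (i + 1) (dif X i x) = dif Y i (f i x))}"

definition null_homotopic ::
    "'a ring \<Rightarrow> ('a, 'b) cochain_complex \<Rightarrow> ('a, 'c) cochain_complex \<Rightarrow> (int \<Rightarrow> 'b \<Rightarrow> 'c) set" where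
  "null_homotopic R X Y = {f \<in> chain_maps R X Y.
     \<exists>h. (\<forall>i. h i \<in> mod_hom R (obj X i) (obj Y (i - 1))) \<and>
         (\<forall>i. \<forall>x\<in>carrier (obj X i).
            f i x = dif Y (i - 1) (h i x) \<oplus>\<^bsub>obj Y i\<^esub> h (i + 1) (dif X i x))}"

definition chain_map_group ::
    "'a ring \<Rightarrow> ('a, 'b) cochain_complex \<Rightarrow> ('a, 'c) cochain_complex \<Rightarrow> (int \<Rightarrow> 'b \<Rightarrow> 'c) monoid" where
  "chain_map_group R X Y =
     \<lparr>carrier = chain_maps R X Y,
      mult = (\<lambda>f g i. \<lambda>x\<in>carrier (obj X i). f i x \<oplus>\<^bsub>obj Y i\<^esub> g i x),
      one = (\<lambda>i. \<lambda>x\<in>carrier (obj X i). \<zero>\<^bsub>obj Y i\<^esub>)\<rparr>"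

definition K_hom ::
    "'a ring \<Rightarrow> ('a, 'b) cochain_complex \<Rightarrow> ('a, 'c) cochain_complex \<Rightarrow> (int \<Rightarrow> 'b \<Rightarrow> 'c) set monoid" where
  "K_hom R X Y = chain_map_group R X Y Mod null_homotopic R X Y"

definition chain_compose ::
    "('a, 'b) cochain_complex \<Rightarrow> (int \<Rightarrow> 'c \<Rightarrow> 'd) \<Rightarrow> (int \<Rightarrow> 'b \<Rightarrow> 'c) \<Rightarrow> int \<Rightarrow> 'b \<Rightarrow> 'd" where
  "chain_compose X g f = (\<lambda>i. compose (carrier (obj X i)) (g i) (f i))"

definition chain_id :: "('a, 'b) cochain_complex \<Rightarrow> int \<Rightarrow> 'b \<Rightarrow> 'b" where
  "chain_id X = (\<lambda>i. \<lambda>x\<in>carrier (obj X i). x)"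

definition homotopic ::
    "'a ring \<Rightarrow> ('a, 'b) cochain_complex \<Rightarrow> ('a, 'c) cochain_complex
       \<Rightarrow> (int \<Rightarrow> 'b \<Rightarrow> 'c) \<Rightarrow> (int \<Rightarrow> 'b \<Rightarrow> 'c) \<Rightarrow> bool" where
  "homotopic R X Y f g \<longleftrightarrow>
     (\<lambda>i. \<lambda>x\<in>carrier (obj X i). f i x \<ominus>\<^bsub>obj Y i\<^esub> g i x) \<in> null_homotopic R X Y"

definition K_iso :: "'a ring \<Rightarrow> ('a, 'b) cochain_complex \<Rightarrow> ('a, 'c) cochain_complex \<Rightarrow> bool" where
  "K_iso R X Y \<longleftrightarrow> (\<exists>f\<in>chain_maps R X Y. \<exists>g\<in>chain_maps R Y X.
     homotopic R X X (chain_compose X g f) (chain_id X) \<and>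
     homotopic R Y Y (chain_compose Y f g) (chain_id Y))"

definition Kb_proj :: "'a ring \<Rightarrow> 'a pcomplex set" where
  "Kb_proj R = {X. is_complex R X \<and> (\<forall>i. obj X i \<in> fg_proj R) \<and>
     finite {i. carrier (obj X i) \<noteq> {\<zero>\<^bsub>obj X i\<^esub>}}}"

text \<open>\<open>X[j]\<close>, with differential \<open>(-1)\<^sup>j d\<close>.\<close>

definition shift_complex :: "('a, 'b) cochain_complex \<Rightarrow> int \<Rightarrow> ('a, 'b) cochain_complex" where
  "shift_complex X j =
     \<lparr>obj = (\<lambda>i. obj X (i + j)),
      dif = (\<lambda>i. \<lambda>x\<in>carrier (obj X (i + j)).
        if even j then dif X (i + j) x else \<ominus>\<^bsub>obj X (i + j + 1)\<^esub> dif X (i + j) x)\<rparr>"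

definition cone ::
    "('a, 'b) cochain_complex \<Rightarrow> ('a, 'c) cochain_complex \<Rightarrow> (int \<Rightarrow> 'b \<Rightarrow> 'c)
       \<Rightarrow> ('a, 'b \<times> 'c) cochain_complex" where
  "cone X Y f =
     \<lparr>obj = (\<lambda>i. direct_sum (obj X (i + 1)) (obj Y i)),
      dif = (\<lambda>i. \<lambda>u\<in>carrier (obj X (i + 1)) \<times> carrier (obj Y i).
        (\<ominus>\<^bsub>obj X (i + 2)\<^esub> dif X (i + 1) (fst u),
         f (i + 1) (fst u) \<oplus>\<^bsub>obj Y (i + 1)\<^esub> dif Y i (snd u)))\<rparr>"

definition complex_sum ::
    "('a, 'b) cochain_complex \<Rightarrow> ('a, 'c) cochain_complex \<Rightarrow> ('a, 'b \<times> 'c) cochain_complex" where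
  "complex_sum X Y =
     \<lparr>obj = (\<lambda>i. direct_sum (obj X i) (obj Y i)),
      dif = (\<lambda>i. \<lambda>u\<in>carrier (obj X i) \<times> carrier (obj Y i). (dif X i (fst u), dif Y i (snd u)))\<rparr>"

definition complex_power ::
    "('a, 'b) cochain_complex \<Rightarrow> nat \<Rightarrow> ('a, nat \<Rightarrow> 'b) cochain_complex" where
  "complex_power X k =
     \<lparr>obj = (\<lambda>i. direct_power (obj X i) k),
      dif = (\<lambda>i. \<lambda>u\<in>{..<k} \<rightarrow>\<^sub>E carrier (obj X i). \<lambda>l\<in>{..<k}. dif X i (u l))\<rparr>"

definition K_add :: "'a ring \<Rightarrow> 'a pcomplex \<Rightarrow> 'a pcomplex set" where
  "K_add R X = {Y \<in> Kb_proj R. \<exists>k. \<exists>Z\<in>Kb_proj R. K_iso R (complex_sum Y Z) (complex_power X k)}"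

text \<open>Full triangulated subcategories, given by their classes of objects, which are closed under
  isomorphism in the homotopy category. The cone of a morphism of \<open>Kb_proj R\<close> has elements of a
  product type; its copies in \<open>Kb_proj R\<close> are the objects isomorphic to it.\<close>

definition triangulated_subcategory :: "'a ring \<Rightarrow> 'a pcomplex set \<Rightarrow> bool" where
  "triangulated_subcategory R T \<longleftrightarrow>
     T \<subseteq> Kb_proj R \<and> T \<noteq> {} \<and>
     (\<forall>X\<in>T. \<forall>Y\<in>Kb_proj R. K_iso R Y X \<longrightarrow> Y \<in> T) \<and>
     (\<forall>X\<in>T. \<forall>j. shift_complex X j \<in> T) \<and>
     (\<forall>X\<in>T. \<forall>Y\<in>T. \<forall>f\<in>chain_maps R X Y. \<forall>Z\<in>Kb_proj R. K_iso R Z (cone X Y f) \<longrightarrow> Z \<in> T)"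

definition presilting :: "'a ring \<Rightarrow> 'a pcomplex \<Rightarrow> bool" where
  "presilting R X \<longleftrightarrow>
     X \<in> Kb_proj R \<and> (\<forall>j>0. trivial_group (K_hom R X (shift_complex X j)))"

definition silting :: "'a ring \<Rightarrow> 'a pcomplex \<Rightarrow> bool" where
  "silting R X \<longleftrightarrow> presilting R X \<and>
     \<Inter>{T. triangulated_subcategory R T \<and> K_add R X \<subseteq> T} = Kb_proj R"


section \<open>Higher tau-tilting modules\<close>

text \<open>The subcomplex obtained by replacing the terms in degrees below \<open>-n\<close> by zero.\<close>

definition truncate_complex :: "('a, 'b) cochain_complex \<Rightarrow> nat \<Rightarrow> ('a, 'b) cochain_complex" where
  "truncate_complex X n = (let C = (\<lambda>i. if - int n \<le> i then carrier (obj X i) else {\<zero>\<^bsub>obj X i\<^esub>}) in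
     \<lparr>obj = (\<lambda>i. (obj X i)\<lparr>carrier := C i\<rparr>), dif = (\<lambda>i. restrict (dif X i) (C i))\<rparr>)"

definition tau_n_tilting :: "'a ring \<Rightarrow> nat \<Rightarrow> ('a, 'm) module \<Rightarrow> bool" where
  "tau_n_tilting \<Lambda> n M \<longleftrightarrow> M \<in> fg_mod \<Lambda> \<and> silting \<Lambda> (truncate_complex (min_res \<Lambda> M) n)"

text \<open>Every object of \<open>add(M)\<close> is isomorphic to a submodule of some \<open>M\<^sup>k\<close>, so the modules \<open>L i\<close> in
  the exact sequence \<open>L n \<rightarrow> \<dots> \<rightarrow> L 1 \<rightarrow> X \<rightarrow> 0\<close> may be taken with elements of type \<open>nat \<Rightarrow> 'm\<close>.
  Here \<open>f i\<close> is the map from \<open>L (i + 1)\<close> to \<open>L i\<close>.\<close>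

definition gen_n :: "'a ring \<Rightarrow> nat \<Rightarrow> ('a, 'm) module \<Rightarrow> ('a, 'n) module set" where
  "gen_n \<Lambda> n M = {X \<in> fg_mod \<Lambda>.
     \<exists>(L :: nat \<Rightarrow> ('a, nat \<Rightarrow> 'm) module) f g.
       (\<forall>i\<in>{1..n}. L i \<in> add_closure \<Lambda> M) \<and>
       (\<forall>i\<in>{1..<n}. f i \<in> mod_hom \<Lambda> (L (i + 1)) (L i)) \<and>
       g \<in> mod_hom \<Lambda> (L 1) X \<and> g ` carrier (L 1) = carrier X \<and>
       (1 < n \<longrightarrow> f 1 ` carrier (L 2) = a_kernel (L 1) X g) \<and>
       (\<forall>i. 1 \<le> i \<and> i + 1 < n \<longrightarrow>
          f (i + 1) ` carrier (L (i + 2)) = a_kernel (L (i + 1)) (L i) (f i))}"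

end

theory Submission
  imports Defs
begin

text \<open>
  Let \<open>P\<close> be the minimal resolution of \<open>M\<close> and \<open>T\<close> its truncation. By Auslander-Reiten duality
  \<open>Hom(N, \<tau>\<^sub>n M) = 0\<close> if and only if every map \<open>P\<^sup>-\<^sup>n \<rightarrow> N\<close> factors through \<open>P\<^sup>-\<^sup>n \<rightarrow> P\<^sup>-\<^sup>n\<^sup>+\<^sup>1\<close>, so that
  \<open>N\<close> lies in \<open>M\<^sup>\<bottom>\<close> precisely when \<open>Hom(T, N[j]) = 0\<close> for all \<open>j > 0\<close>. As \<open>T\<close> is presilting, this holds for
  \<open>M\<close>, and dimension shifting along an exact sequence \<open>M\<^sub>n \<rightarrow> \<dots> \<rightarrow> M\<^sub>1 \<rightarrow> X \<rightarrow> 0\<close> gives it for \<open>X\<close>.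

  Conversely, let \<open>Y\<close> be a complex of finitely generated modules with \<open>Hom(T, Y[j]) = 0\<close> for all
  \<open>j > 0\<close>. Since \<open>\<Lambda>\<close> is built from \<open>T\<close> in finitely many steps, the cohomology of \<open>Y\<close> vanishes above a
  degree that depends on \<open>T\<close> only. The cocone of a right approximation of \<open>Y\<close> by a power of \<open>T\<close>
  satisfies the same hypothesis, and \<open>T\<close> has no terms in positive degrees; hence exactness of all such
  complexes in degree \<open>j + 1\<close> implies their exactness in degree \<open>j > 0\<close>. Descending to \<open>j = 0\<close> one finds
  that the degree \<open>0\<close> cohomology of \<open>Y\<close> is generated by that of \<open>T\<close>. For \<open>Y = N\<close> this says that \<open>M\<close>
  generates \<open>N\<close>. The kernel of a surjective right approximation \<open>M\<^sup>a \<rightarrow> N\<close> lies in \<open>M\<^sup>\<bottom>\<close> again, and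
  iteration produces the exact sequence.
\<close>

section \<open>Linear algebra over a ring\<close>

text \<open>Right approximations exist because \<open>\<Lambda>\<close> is finitely generated over
  the artinian commutative ring \<open>R\<close>, which acts centrally: maps out of a bounded
  complex of finitely generated modules form a finitely generated \<open>R\<close>-module. This
  rests on the fact that artinian modules over \<open>R\<close> are noetherian. The obstacle in the
  converse is that the cocone of an approximation is no longer a module, so the descent has to range
  over all complexes of finitely generated modules orthogonal to \<open>T\<close>. As every step
  replaces \<open>Y\<close> by another complex, the degree above which exactness is known must be
  common to all of them. Therefore generation by \<open>T\<close> is applied to the bound itself and
  not to one fixed \<open>Y\<close>. Two gaps remain to be bridged. \<open>tau_n\<close> is computed
  from the chosen resolution of a syzygy, not from the tail of the resolution of \<open>M\<close>;
  minimality identifies both presentations up to automorphisms. And truncation at \<open>-n\<close>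
  removes the cocycle condition in degree \<open>-n\<close>, which is the difference between
  vanishing of Ext in degree \<open>n\<close> and the condition on \<open>tau_n\<close>.\<close>

locale rng = fixes R :: "'a ring" (structure) assumes is_ring: "ring R"

sublocale rng \<subseteq> ring R by (rule is_ring)

text \<open>The recursion reads only the zero and the addition of the record, so a sum keeps its
  value when the carrier is cut down to a submodule or the scalars are restricted
  (\<open>msum_carrier_upd\<close>, \<open>msum_restrict_scalars\<close>).\<close>

primrec msum :: "('a, 'b, 't) module_scheme \<Rightarrow> (nat \<Rightarrow> 'b) \<Rightarrow> nat \<Rightarrow> 'b" where
  "msum M f 0 = \<zero>\<^bsub>M\<^esub>"
| "msum M f (Suc k) = msum M f k \<oplus>\<^bsub>M\<^esub> f k"

context rng begin

abbreviation lmod :: "('a, 'b) module \<Rightarrow> bool" where "lmod M \<equiv> left_module R M"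
abbreviation sub :: "'b set \<Rightarrow> ('a, 'b) module \<Rightarrow> bool" where "sub H M \<equiv> submodule H R M"

text \<open>Modules mostly occur as members of families such as \<open>obj X i\<close>; hence the
  laws of an abelian group are restated as rules conditional on \<open>lmod M\<close>.\<close>

lemma lmod_simps [simp]:
  assumes "lmod M"
  shows "\<zero>\<^bsub>M\<^esub> \<in> carrier M"
    and "\<lbrakk>x \<in> carrier M; y \<in> carrier M\<rbrakk> \<Longrightarrow> x \<oplus>\<^bsub>M\<^esub> y \<in> carrier M"
    and "x \<in> carrier M \<Longrightarrow> \<ominus>\<^bsub>M\<^esub> x \<in> carrier M"
    and "\<lbrakk>x \<in> carrier M; y \<in> carrier M\<rbrakk> \<Longrightarrow> x \<ominus>\<^bsub>M\<^esub> y \<in> carrier M"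
    and "\<lbrakk>a \<in> carrier R; x \<in> carrier M\<rbrakk> \<Longrightarrow> a \<odot>\<^bsub>M\<^esub> x \<in> carrier M"
    and "x \<in> carrier M \<Longrightarrow> \<zero>\<^bsub>M\<^esub> \<oplus>\<^bsub>M\<^esub> x = x"
    and "x \<in> carrier M \<Longrightarrow> x \<oplus>\<^bsub>M\<^esub> \<zero>\<^bsub>M\<^esub> = x"
    and "x \<in> carrier M \<Longrightarrow> x \<oplus>\<^bsub>M\<^esub> \<ominus>\<^bsub>M\<^esub> x = \<zero>\<^bsub>M\<^esub>"
    and "x \<in> carrier M \<Longrightarrow> \<ominus>\<^bsub>M\<^esub> x \<oplus>\<^bsub>M\<^esub> x = \<zero>\<^bsub>M\<^esub>"
    and "x \<in> carrier M \<Longrightarrow> \<ominus>\<^bsub>M\<^esub> (\<ominus>\<^bsub>M\<^esub> x) = x"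
    and "x \<in> carrier M \<Longrightarrow> \<one> \<odot>\<^bsub>M\<^esub> x = x"
    and "\<ominus>\<^bsub>M\<^esub> \<zero>\<^bsub>M\<^esub> = \<zero>\<^bsub>M\<^esub>"
    and "\<lbrakk>x \<in> carrier M; y \<in> carrier M\<rbrakk> \<Longrightarrow> \<ominus>\<^bsub>M\<^esub> x \<oplus>\<^bsub>M\<^esub> (x \<oplus>\<^bsub>M\<^esub> y) = y"
    and "\<lbrakk>x \<in> carrier M; y \<in> carrier M\<rbrakk> \<Longrightarrow> x \<oplus>\<^bsub>M\<^esub> (\<ominus>\<^bsub>M\<^esub> x \<oplus>\<^bsub>M\<^esub> y) = y"
    and "\<lbrakk>x \<in> carrier M; y \<in> carrier M; z \<in> carrier M\<rbrakk> \<Longrightarrow> x \<oplus>\<^bsub>M\<^esub> y = x \<oplus>\<^bsub>M\<^esub> z \<longleftrightarrow> y = z"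
    and "\<lbrakk>x \<in> carrier M; y \<in> carrier M; z \<in> carrier M\<rbrakk> \<Longrightarrow> y \<oplus>\<^bsub>M\<^esub> x = z \<oplus>\<^bsub>M\<^esub> x \<longleftrightarrow> y = z"
proof -
  interpret M: left_module R M by fact
  note c = M.M.a_comm and a = M.M.a_assoc
  show "\<ominus>\<^bsub>M\<^esub> \<zero>\<^bsub>M\<^esub> = \<zero>\<^bsub>M\<^esub>" by (simp add: M.M.minus_equality)
  show "\<lbrakk>x \<in> carrier M; y \<in> carrier M\<rbrakk> \<Longrightarrow> \<ominus>\<^bsub>M\<^esub> x \<oplus>\<^bsub>M\<^esub> (x \<oplus>\<^bsub>M\<^esub> y) = y" by (rule M.M.r_neg1)
  show "\<lbrakk>x \<in> carrier M; y \<in> carrier M\<rbrakk> \<Longrightarrow> x \<oplus>\<^bsub>M\<^esub> (\<ominus>\<^bsub>M\<^esub> x \<oplus>\<^bsub>M\<^esub> y) = y" by (rule M.M.r_neg2)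
  show "\<zero>\<^bsub>M\<^esub> \<in> carrier M"
    "\<lbrakk>x \<in> carrier M; y \<in> carrier M\<rbrakk> \<Longrightarrow> x \<oplus>\<^bsub>M\<^esub> y \<in> carrier M"
    "x \<in> carrier M \<Longrightarrow> \<ominus>\<^bsub>M\<^esub> x \<in> carrier M"
    "\<lbrakk>x \<in> carrier M; y \<in> carrier M\<rbrakk> \<Longrightarrow> x \<ominus>\<^bsub>M\<^esub> y \<in> carrier M"
    "\<lbrakk>a \<in> carrier R; x \<in> carrier M\<rbrakk> \<Longrightarrow> a \<odot>\<^bsub>M\<^esub> x \<in> carrier M"
    "x \<in> carrier M \<Longrightarrow> \<zero>\<^bsub>M\<^esub> \<oplus>\<^bsub>M\<^esub> x = x"
    "x \<in> carrier M \<Longrightarrow> x \<oplus>\<^bsub>M\<^esub> \<zero>\<^bsub>M\<^esub> = x"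
    "x \<in> carrier M \<Longrightarrow> x \<oplus>\<^bsub>M\<^esub> \<ominus>\<^bsub>M\<^esub> x = \<zero>\<^bsub>M\<^esub>"
    "x \<in> carrier M \<Longrightarrow> \<ominus>\<^bsub>M\<^esub> x \<oplus>\<^bsub>M\<^esub> x = \<zero>\<^bsub>M\<^esub>"
    "x \<in> carrier M \<Longrightarrow> \<ominus>\<^bsub>M\<^esub> (\<ominus>\<^bsub>M\<^esub> x) = x"
    "x \<in> carrier M \<Longrightarrow> \<one> \<odot>\<^bsub>M\<^esub> x = x"
    by (simp_all add: M.M.l_neg M.M.r_neg)
  show l: "\<lbrakk>x \<in> carrier M; y \<in> carrier M; z \<in> carrier M\<rbrakk> \<Longrightarrow> x \<oplus>\<^bsub>M\<^esub> y = x \<oplus>\<^bsub>M\<^esub> z \<longleftrightarrow> y = z" for x y z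
    using M.M.r_neg1 by metis
  show "\<lbrakk>x \<in> carrier M; y \<in> carrier M; z \<in> carrier M\<rbrakk> \<Longrightarrow> y \<oplus>\<^bsub>M\<^esub> x = z \<oplus>\<^bsub>M\<^esub> x \<longleftrightarrow> y = z"
    using l[of x y z] by (simp add: c)
qed

lemma lmod_ac:
  assumes "lmod M"
  shows "\<lbrakk>x \<in> carrier M; y \<in> carrier M; z \<in> carrier M\<rbrakk> \<Longrightarrow> (x \<oplus>\<^bsub>M\<^esub> y) \<oplus>\<^bsub>M\<^esub> z = x \<oplus>\<^bsub>M\<^esub> (y \<oplus>\<^bsub>M\<^esub> z)"
    and "\<lbrakk>x \<in> carrier M; y \<in> carrier M\<rbrakk> \<Longrightarrow> x \<oplus>\<^bsub>M\<^esub> y = y \<oplus>\<^bsub>M\<^esub> x"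
    and "\<lbrakk>x \<in> carrier M; y \<in> carrier M; z \<in> carrier M\<rbrakk> \<Longrightarrow> x \<oplus>\<^bsub>M\<^esub> (y \<oplus>\<^bsub>M\<^esub> z) = y \<oplus>\<^bsub>M\<^esub> (x \<oplus>\<^bsub>M\<^esub> z)"
proof -
  interpret M: left_module R M by fact
  show "\<lbrakk>x \<in> carrier M; y \<in> carrier M; z \<in> carrier M\<rbrakk> \<Longrightarrow> (x \<oplus>\<^bsub>M\<^esub> y) \<oplus>\<^bsub>M\<^esub> z = x \<oplus>\<^bsub>M\<^esub> (y \<oplus>\<^bsub>M\<^esub> z)"
    "\<lbrakk>x \<in> carrier M; y \<in> carrier M\<rbrakk> \<Longrightarrow> x \<oplus>\<^bsub>M\<^esub> y = y \<oplus>\<^bsub>M\<^esub> x"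
    "\<lbrakk>x \<in> carrier M; y \<in> carrier M; z \<in> carrier M\<rbrakk> \<Longrightarrow> x \<oplus>\<^bsub>M\<^esub> (y \<oplus>\<^bsub>M\<^esub> z) = y \<oplus>\<^bsub>M\<^esub> (x \<oplus>\<^bsub>M\<^esub> z)"
    by (simp_all add: M.M.a_ac)
qed

lemma smult_distr:
  assumes "lmod M"
  shows "\<lbrakk>a \<in> carrier R; b \<in> carrier R; x \<in> carrier M\<rbrakk> \<Longrightarrow> (a \<oplus> b) \<odot>\<^bsub>M\<^esub> x = a \<odot>\<^bsub>M\<^esub> x \<oplus>\<^bsub>M\<^esub> b \<odot>\<^bsub>M\<^esub> x"
    and "\<lbrakk>a \<in> carrier R; x \<in> carrier M; y \<in> carrier M\<rbrakk> \<Longrightarrow> a \<odot>\<^bsub>M\<^esub> (x \<oplus>\<^bsub>M\<^esub> y) = a \<odot>\<^bsub>M\<^esub> x \<oplus>\<^bsub>M\<^esub> a \<odot>\<^bsub>M\<^esub> y"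
    and "\<lbrakk>a \<in> carrier R; b \<in> carrier R; x \<in> carrier M\<rbrakk> \<Longrightarrow> (a \<otimes> b) \<odot>\<^bsub>M\<^esub> x = a \<odot>\<^bsub>M\<^esub> (b \<odot>\<^bsub>M\<^esub> x)"
  using assms by (simp_all add: left_module.smult_l_distr left_module.smult_r_distr left_module.smult_assoc1)

lemma add_idem_zero:
  assumes "lmod M" "x \<in> carrier M" "x \<oplus>\<^bsub>M\<^esub> x = x" shows "x = \<zero>\<^bsub>M\<^esub>"
  using lmod_simps(13)[OF assms(1,2,2)] lmod_simps(9)[OF assms(1,2)] assms(3) by simp

lemma smult_null [simp]:
  assumes "lmod M"
  shows "x \<in> carrier M \<Longrightarrow> \<zero> \<odot>\<^bsub>M\<^esub> x = \<zero>\<^bsub>M\<^esub>"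
    and "a \<in> carrier R \<Longrightarrow> a \<odot>\<^bsub>M\<^esub> \<zero>\<^bsub>M\<^esub> = \<zero>\<^bsub>M\<^esub>"
  using smult_distr(1)[OF assms, of \<zero> \<zero> x] smult_distr(2)[OF assms, of a "\<zero>\<^bsub>M\<^esub>" "\<zero>\<^bsub>M\<^esub>"] assms
  by (auto intro!: add_idem_zero)

lemma neg_eqI:
  assumes "lmod M" "x \<in> carrier M" "y \<in> carrier M" "y \<oplus>\<^bsub>M\<^esub> x = \<zero>\<^bsub>M\<^esub>"
  shows "\<ominus>\<^bsub>M\<^esub> x = y"
proof -
  interpret M: left_module R M by fact
  show ?thesis using assms M.M.minus_equality by blast
qed

lemma smult_minus_one: "\<lbrakk>lmod M; x \<in> carrier M\<rbrakk> \<Longrightarrow> (\<ominus> \<one>) \<odot>\<^bsub>M\<^esub> x = \<ominus>\<^bsub>M\<^esub> x"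
  using smult_distr(1)[of M "\<ominus> \<one>" \<one> x] by (intro neg_eqI[symmetric]) (simp_all add: l_neg)

lemma smult_minus:
  assumes "lmod M" "a \<in> carrier R" "x \<in> carrier M"
  shows "a \<odot>\<^bsub>M\<^esub> (\<ominus>\<^bsub>M\<^esub> x) = \<ominus>\<^bsub>M\<^esub> (a \<odot>\<^bsub>M\<^esub> x)" "(\<ominus> a) \<odot>\<^bsub>M\<^esub> x = \<ominus>\<^bsub>M\<^esub> (a \<odot>\<^bsub>M\<^esub> x)"
  using smult_distr(2)[of M a "\<ominus>\<^bsub>M\<^esub> x" x] smult_distr(1)[of M "\<ominus> a" a x] assms
  by (auto intro!: neg_eqI[symmetric] simp: l_neg)

lemma minus_distr:
  assumes "lmod M" "x \<in> carrier M" "y \<in> carrier M"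
  shows "\<ominus>\<^bsub>M\<^esub> (x \<oplus>\<^bsub>M\<^esub> y) = \<ominus>\<^bsub>M\<^esub> x \<oplus>\<^bsub>M\<^esub> \<ominus>\<^bsub>M\<^esub> y"
  using assms smult_distr(2)[of M "\<ominus> \<one>" x y] by (simp add: smult_minus_one)

lemma diff_eq_iff:
  assumes "lmod M" "x \<in> carrier M" "y \<in> carrier M" "z \<in> carrier M"
  shows "x \<ominus>\<^bsub>M\<^esub> y = z \<longleftrightarrow> x = z \<oplus>\<^bsub>M\<^esub> y"
  using assms lmod_simps(16)[of M y "x \<ominus>\<^bsub>M\<^esub> y" z] by (simp add: a_minus_def lmod_ac(1))

lemma add_diff_swap:
  assumes "lmod M" "a \<in> carrier M" "b \<in> carrier M" "c \<in> carrier M" "d \<in> carrier M"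
  shows "(a \<oplus>\<^bsub>M\<^esub> b) \<ominus>\<^bsub>M\<^esub> (c \<oplus>\<^bsub>M\<^esub> d) = (a \<ominus>\<^bsub>M\<^esub> c) \<oplus>\<^bsub>M\<^esub> (b \<ominus>\<^bsub>M\<^esub> d)"
  using assms by (simp add: a_minus_def minus_distr lmod_ac)

text \<open>Minus one times \<open>x\<close> is a negative of \<open>x\<close> by distributivity and
  the unit law, so the law for the zero scalar takes the place of the existence of inverses.\<close>

lemma left_moduleI:
  assumes "\<zero>\<^bsub>M\<^esub> \<in> carrier M"
    "\<And>x y. \<lbrakk>x \<in> carrier M; y \<in> carrier M\<rbrakk> \<Longrightarrow> x \<oplus>\<^bsub>M\<^esub> y \<in> carrier M"
    "\<And>a x. \<lbrakk>a \<in> carrier R; x \<in> carrier M\<rbrakk> \<Longrightarrow> a \<odot>\<^bsub>M\<^esub> x \<in> carrier M"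
    "\<And>x y z. \<lbrakk>x \<in> carrier M; y \<in> carrier M; z \<in> carrier M\<rbrakk> \<Longrightarrow> (x \<oplus>\<^bsub>M\<^esub> y) \<oplus>\<^bsub>M\<^esub> z = x \<oplus>\<^bsub>M\<^esub> (y \<oplus>\<^bsub>M\<^esub> z)"
    "\<And>x y. \<lbrakk>x \<in> carrier M; y \<in> carrier M\<rbrakk> \<Longrightarrow> x \<oplus>\<^bsub>M\<^esub> y = y \<oplus>\<^bsub>M\<^esub> x"
    "\<And>x. x \<in> carrier M \<Longrightarrow> \<zero>\<^bsub>M\<^esub> \<oplus>\<^bsub>M\<^esub> x = x"
    "\<And>a b x. \<lbrakk>a \<in> carrier R; b \<in> carrier R; x \<in> carrier M\<rbrakk> \<Longrightarrow> (a \<oplus> b) \<odot>\<^bsub>M\<^esub> x = a \<odot>\<^bsub>M\<^esub> x \<oplus>\<^bsub>M\<^esub> b \<odot>\<^bsub>M\<^esub> x"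
    "\<And>a x y. \<lbrakk>a \<in> carrier R; x \<in> carrier M; y \<in> carrier M\<rbrakk> \<Longrightarrow> a \<odot>\<^bsub>M\<^esub> (x \<oplus>\<^bsub>M\<^esub> y) = a \<odot>\<^bsub>M\<^esub> x \<oplus>\<^bsub>M\<^esub> a \<odot>\<^bsub>M\<^esub> y"
    "\<And>a b x. \<lbrakk>a \<in> carrier R; b \<in> carrier R; x \<in> carrier M\<rbrakk> \<Longrightarrow> (a \<otimes> b) \<odot>\<^bsub>M\<^esub> x = a \<odot>\<^bsub>M\<^esub> (b \<odot>\<^bsub>M\<^esub> x)"
    "\<And>x. x \<in> carrier M \<Longrightarrow> \<one> \<odot>\<^bsub>M\<^esub> x = x"
    "\<And>x. x \<in> carrier M \<Longrightarrow> \<zero> \<odot>\<^bsub>M\<^esub> x = \<zero>\<^bsub>M\<^esub>"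
  shows "lmod M"
proof -
  have inv: "\<exists>y\<in>carrier M. y \<oplus>\<^bsub>M\<^esub> x = \<zero>\<^bsub>M\<^esub>" if "x \<in> carrier M" for x
    using assms(3)[of "\<ominus> \<one>" x] assms(7)[of "\<ominus> \<one>" \<one> x] assms(10,11) that by (auto simp: l_neg)
  have "abelian_group M" by (rule abelian_groupI) (use assms inv in auto)
  then show ?thesis unfolding left_module_def left_module_axioms_def using assms is_ring by auto
qed

section \<open>Submodules and their sums\<close>

lemma subI:
  assumes "lmod M" "H \<subseteq> carrier M" "\<zero>\<^bsub>M\<^esub> \<in> H" "\<And>x y. \<lbrakk>x \<in> H; y \<in> H\<rbrakk> \<Longrightarrow> x \<oplus>\<^bsub>M\<^esub> y \<in> H"
    "\<And>a x. \<lbrakk>a \<in> carrier R; x \<in> H\<rbrakk> \<Longrightarrow> a \<odot>\<^bsub>M\<^esub> x \<in> H"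
  shows "sub H M"
proof -
  have "\<ominus>\<^bsub>M\<^esub> x \<in> H" if "x \<in> H" for x
    using assms(5)[of "\<ominus> \<one>" x] smult_minus_one[of M x] assms(1,2) that by auto
  then show ?thesis using assms
    by (intro submodule.intro subgroup.intro) (auto simp: submodule_axioms_def a_inv_def)
qed

lemma subD:
  assumes "sub H M"
  shows "H \<subseteq> carrier M" "x \<in> H \<Longrightarrow> x \<in> carrier M" "\<zero>\<^bsub>M\<^esub> \<in> H"
    "\<lbrakk>x \<in> H; y \<in> H\<rbrakk> \<Longrightarrow> x \<oplus>\<^bsub>M\<^esub> y \<in> H"
    "\<lbrakk>a \<in> carrier R; x \<in> H\<rbrakk> \<Longrightarrow> a \<odot>\<^bsub>M\<^esub> x \<in> H"
    "x \<in> H \<Longrightarrow> \<ominus>\<^bsub>M\<^esub> x \<in> H"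
    "\<lbrakk>x \<in> H; y \<in> H\<rbrakk> \<Longrightarrow> x \<ominus>\<^bsub>M\<^esub> y \<in> H"
proof -
  interpret submodule H R M by fact
  show "H \<subseteq> carrier M" "x \<in> H \<Longrightarrow> x \<in> carrier M" "\<zero>\<^bsub>M\<^esub> \<in> H"
    "\<lbrakk>x \<in> H; y \<in> H\<rbrakk> \<Longrightarrow> x \<oplus>\<^bsub>M\<^esub> y \<in> H"
    "\<lbrakk>a \<in> carrier R; x \<in> H\<rbrakk> \<Longrightarrow> a \<odot>\<^bsub>M\<^esub> x \<in> H"
    using subset one_closed m_closed by auto
  show i: "x \<in> H \<Longrightarrow> \<ominus>\<^bsub>M\<^esub> x \<in> H" for x using m_inv_closed by (simp add: a_inv_def)
  show "\<lbrakk>x \<in> H; y \<in> H\<rbrakk> \<Longrightarrow> x \<ominus>\<^bsub>M\<^esub> y \<in> H" using m_closed i by (simp add: a_minus_def)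
qed

lemma sub_carrier: "lmod M \<Longrightarrow> sub (carrier M) M" by (rule subI) auto
lemma sub_zero: "lmod M \<Longrightarrow> sub {\<zero>\<^bsub>M\<^esub>} M" by (rule subI) auto
lemma sub_Int: "\<lbrakk>lmod M; sub H M; sub K M\<rbrakk> \<Longrightarrow> sub (H \<inter> K) M"
  by (rule subI) (auto dest: subD)

lemma lmod_sub: "\<lbrakk>lmod M; sub H M\<rbrakk> \<Longrightarrow> lmod (M\<lparr>carrier := H\<rparr>)"
  using subD[of H M] by (intro left_moduleI) (auto simp: lmod_ac smult_distr subset_iff)

lemma sub_sub:
  assumes "lmod M" "sub H M" shows "sub G (M\<lparr>carrier := H\<rparr>) \<longleftrightarrow> sub G M \<and> G \<subseteq> H"
proof safe
  assume G: "sub G (M\<lparr>carrier := H\<rparr>)"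
  show GH: "\<And>x. x \<in> G \<Longrightarrow> x \<in> H" using subD(2)[OF G] by simp
  show "sub G M" by (rule subI) (use assms subD(3-5)[OF G] GH subD(2)[OF assms(2)] in auto)
next
  assume G: "sub G M" "G \<subseteq> H"
  show "sub G (M\<lparr>carrier := H\<rparr>)"
    by (rule subI) (use lmod_sub[OF assms] G(2) subD(3-5)[OF G(1)] in auto)
qed

lemma set_add_iff: "z \<in> H <+>\<^bsub>M\<^esub> K \<longleftrightarrow> (\<exists>x\<in>H. \<exists>y\<in>K. z = x \<oplus>\<^bsub>M\<^esub> y)"
  by (auto simp: set_add_def')

lemma sub_set_add:
  assumes M: "lmod M" and H: "sub H M" and K: "sub K M" shows "sub (H <+>\<^bsub>M\<^esub> K) M"
proof (rule subI[OF M])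
  show "H <+>\<^bsub>M\<^esub> K \<subseteq> carrier M" using M subD(2)[OF H] subD(2)[OF K] by (auto simp: set_add_iff)
  show "\<zero>\<^bsub>M\<^esub> \<in> H <+>\<^bsub>M\<^esub> K" using M subD(3)[OF H] subD(3)[OF K] by (auto simp: set_add_iff intro!: bexI)
next
  fix x y assume "x \<in> H <+>\<^bsub>M\<^esub> K" "y \<in> H <+>\<^bsub>M\<^esub> K"
  then obtain a b c d where *: "a \<in> H" "b \<in> K" "c \<in> H" "d \<in> K" "x = a \<oplus>\<^bsub>M\<^esub> b" "y = c \<oplus>\<^bsub>M\<^esub> d"
    by (auto simp: set_add_iff)
  then have "x \<oplus>\<^bsub>M\<^esub> y = (a \<oplus>\<^bsub>M\<^esub> c) \<oplus>\<^bsub>M\<^esub> (b \<oplus>\<^bsub>M\<^esub> d)"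
    using M subD(2)[OF H] subD(2)[OF K] by (simp add: lmod_ac)
  then show "x \<oplus>\<^bsub>M\<^esub> y \<in> H <+>\<^bsub>M\<^esub> K" unfolding set_add_iff using * subD(4)[OF H] subD(4)[OF K] by blast
next
  fix a x assume a: "a \<in> carrier R" and "x \<in> H <+>\<^bsub>M\<^esub> K"
  then obtain h k where "h \<in> H" "k \<in> K" "x = h \<oplus>\<^bsub>M\<^esub> k" by (auto simp: set_add_iff)
  then show "a \<odot>\<^bsub>M\<^esub> x \<in> H <+>\<^bsub>M\<^esub> K" unfolding set_add_iff
    using smult_distr(2)[OF M a subD(2)[OF H] subD(2)[OF K]] subD(5)[OF H a] subD(5)[OF K a] by blast
qed

lemma set_add_upper:
  assumes M: "lmod M" and H: "sub H M" and K: "sub K M" shows "H \<subseteq> H <+>\<^bsub>M\<^esub> K" "K \<subseteq> H <+>\<^bsub>M\<^esub> K"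
proof -
  show "H \<subseteq> H <+>\<^bsub>M\<^esub> K" using subD(2)[OF H] subD(3)[OF K] M by (force simp: set_add_iff)
  show "K \<subseteq> H <+>\<^bsub>M\<^esub> K" using subD(2)[OF K] subD(3)[OF H] M by (force simp: set_add_iff)
qed

lemma set_add_least:
  assumes G: "sub G M" and "H \<subseteq> G" "K \<subseteq> G" shows "H <+>\<^bsub>M\<^esub> K \<subseteq> G"
  using subD(4)[OF G] assms(2,3) by (fastforce simp: set_add_iff)

text \<open>In contrast to \<open>mod_hom\<close>, nothing is prescribed off the carrier, so linear
  maps can be composed, added and restricted to submodules as plain functions;
  \<open>restrict_mod_hom\<close> leads back to \<open>mod_hom\<close>.\<close>

definition lin :: "('a, 'b) module \<Rightarrow> ('a, 'c) module \<Rightarrow> ('b \<Rightarrow> 'c) \<Rightarrow> bool" where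
  "lin M N f \<longleftrightarrow> (\<forall>x\<in>carrier M. f x \<in> carrier N) \<and>
     (\<forall>x\<in>carrier M. \<forall>y\<in>carrier M. f (x \<oplus>\<^bsub>M\<^esub> y) = f x \<oplus>\<^bsub>N\<^esub> f y) \<and>
     (\<forall>a\<in>carrier R. \<forall>x\<in>carrier M. f (a \<odot>\<^bsub>M\<^esub> x) = a \<odot>\<^bsub>N\<^esub> f x)"

lemma linI:
  assumes "\<And>x. x \<in> carrier M \<Longrightarrow> f x \<in> carrier N"
    "\<And>x y. \<lbrakk>x \<in> carrier M; y \<in> carrier M\<rbrakk> \<Longrightarrow> f (x \<oplus>\<^bsub>M\<^esub> y) = f x \<oplus>\<^bsub>N\<^esub> f y"
    "\<And>a x. \<lbrakk>a \<in> carrier R; x \<in> carrier M\<rbrakk> \<Longrightarrow> f (a \<odot>\<^bsub>M\<^esub> x) = a \<odot>\<^bsub>N\<^esub> f x"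
  shows "lin M N f"
  using assms by (simp add: lin_def)

lemma linD:
  assumes "lin M N f"
  shows "x \<in> carrier M \<Longrightarrow> f x \<in> carrier N"
    "\<lbrakk>x \<in> carrier M; y \<in> carrier M\<rbrakk> \<Longrightarrow> f (x \<oplus>\<^bsub>M\<^esub> y) = f x \<oplus>\<^bsub>N\<^esub> f y"
    "\<lbrakk>a \<in> carrier R; x \<in> carrier M\<rbrakk> \<Longrightarrow> f (a \<odot>\<^bsub>M\<^esub> x) = a \<odot>\<^bsub>N\<^esub> f x"
  using assms by (simp_all add: lin_def)

lemma lin_zero: "\<lbrakk>lin M N f; lmod M; lmod N\<rbrakk> \<Longrightarrow> f \<zero>\<^bsub>M\<^esub> = \<zero>\<^bsub>N\<^esub>"
  using linD(3)[of M N f \<zero> "\<zero>\<^bsub>M\<^esub>"] linD(1)[of M N f "\<zero>\<^bsub>M\<^esub>"] by simp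

lemma lin_neg: "\<lbrakk>lin M N f; lmod M; lmod N; x \<in> carrier M\<rbrakk> \<Longrightarrow> f (\<ominus>\<^bsub>M\<^esub> x) = \<ominus>\<^bsub>N\<^esub> f x"
  using linD(3)[of M N f "\<ominus> \<one>" x] linD(1)[of M N f x] by (simp add: smult_minus_one)

lemma lin_diff: "\<lbrakk>lin M N f; lmod M; lmod N; x \<in> carrier M; y \<in> carrier M\<rbrakk> \<Longrightarrow> f (x \<ominus>\<^bsub>M\<^esub> y) = f x \<ominus>\<^bsub>N\<^esub> f y"
  by (simp add: a_minus_def linD lin_neg)

lemma lin_comp: "\<lbrakk>lin M N f; lin N P g\<rbrakk> \<Longrightarrow> lin M P (\<lambda>x. g (f x))"
  by (simp add: lin_def)

lemma lin_cong: "\<lbrakk>lin M N f; \<And>x. x \<in> carrier M \<Longrightarrow> f x = g x; lmod M\<rbrakk> \<Longrightarrow> lin M N g"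
  by (simp add: lin_def)

lemma lin_add:
  assumes "lin M N f" "lin M N g" "lmod N" shows "lin M N (\<lambda>x. f x \<oplus>\<^bsub>N\<^esub> g x)"
  using assms by (intro linI) (auto simp: linD lmod_ac smult_distr)

lemma lin_minus:
  assumes "lin M N f" "lmod N" shows "lin M N (\<lambda>x. \<ominus>\<^bsub>N\<^esub> f x)"
  using assms by (intro linI) (auto simp: linD minus_distr smult_minus)

lemma lin_sub: "\<lbrakk>lin M N f; lin M N g; lmod N\<rbrakk> \<Longrightarrow> lin M N (\<lambda>x. f x \<ominus>\<^bsub>N\<^esub> g x)"
  unfolding a_minus_def by (intro lin_add lin_minus)

lemma lin_const_zero: "lmod N \<Longrightarrow> lin M N (\<lambda>x. \<zero>\<^bsub>N\<^esub>)"
  by (intro linI) auto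

lemma lin_id: "lin M M (\<lambda>x. x)" by (simp add: lin_def)

lemma mod_homD: "f \<in> mod_hom R M N \<Longrightarrow> lin M N f"
  by (auto simp: mod_hom_def lin_def)

lemma mod_hom_iff: "f \<in> mod_hom R M N \<longleftrightarrow> lin M N f \<and> f \<in> extensional (carrier M)"
  by (auto simp: mod_hom_def lin_def PiE_def)

lemma restrict_mod_hom: "\<lbrakk>lin M N f; lmod M\<rbrakk> \<Longrightarrow> restrict f (carrier M) \<in> mod_hom R M N"
  by (auto simp: mod_hom_iff intro: lin_cong)

lemma a_kernel_iff: "x \<in> a_kernel M N f \<longleftrightarrow> x \<in> carrier M \<and> f x = \<zero>\<^bsub>N\<^esub>"
  by (auto simp: a_kernel_def kernel_def)

lemma sub_preimage:
  assumes "lin M N f" "lmod M" "lmod N" "sub H N" shows "sub {x \<in> carrier M. f x \<in> H} M"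
  using assms subD[OF assms(4)] by (intro subI) (auto simp: linD lin_zero)

lemma sub_kernel: "\<lbrakk>lin M N f; lmod M; lmod N\<rbrakk> \<Longrightarrow> sub (a_kernel M N f) M"
  by (rule subI) (auto simp: a_kernel_iff linD lin_zero)

lemma sub_image:
  assumes "lin M N f" "lmod M" "lmod N" "sub H M" shows "sub (f ` H) N"
proof (rule subI)
  note H = subD[OF assms(4)]
  show "f ` H \<subseteq> carrier N" using assms(1) H(2) by (auto simp: linD)
  show "\<zero>\<^bsub>N\<^esub> \<in> f ` H" using lin_zero[OF assms(1-3)] H(3) by force
  show "x \<oplus>\<^bsub>N\<^esub> y \<in> f ` H" if xy: "x \<in> f ` H" "y \<in> f ` H" for x y
  proof -
    obtain u v where "u \<in> H" "v \<in> H" "x = f u" "y = f v" using xy by auto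
    then show ?thesis using linD(2)[OF assms(1) H(2) H(2), of u v] H(4)[of u v] by force
  qed
  show "a \<odot>\<^bsub>N\<^esub> x \<in> f ` H" if "a \<in> carrier R" "x \<in> f ` H" for a x
    using linD(3)[OF assms(1) that(1)] H(2,5) that by force
qed (rule assms)

lemma lin_into_sub: "lin M N f \<Longrightarrow> (\<And>x. x \<in> carrier M \<Longrightarrow> f x \<in> H) \<Longrightarrow> lin M (N\<lparr>carrier := H\<rparr>) f"
  by (auto simp: lin_def)
lemma lin_from_sub: "lin M N f \<Longrightarrow> H \<subseteq> carrier M \<Longrightarrow> lin (M\<lparr>carrier := H\<rparr>) N f"
  by (auto simp: lin_def subset_iff)
lemma lin_out_sub: "lin M (N\<lparr>carrier := H\<rparr>) f \<Longrightarrow> H \<subseteq> carrier N \<Longrightarrow> lin M N f"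
  by (auto simp: lin_def subset_iff)

lemma lin_inj_iff:
  assumes "lin M N f" "lmod M" "lmod N"
  shows "inj_on f (carrier M) \<longleftrightarrow> (\<forall>x\<in>carrier M. f x = \<zero>\<^bsub>N\<^esub> \<longrightarrow> x = \<zero>\<^bsub>M\<^esub>)"
proof
  assume "inj_on f (carrier M)"
  then show "\<forall>x\<in>carrier M. f x = \<zero>\<^bsub>N\<^esub> \<longrightarrow> x = \<zero>\<^bsub>M\<^esub>"
    using lin_zero[OF assms] assms by (auto simp: inj_on_def)
next
  assume *: "\<forall>x\<in>carrier M. f x = \<zero>\<^bsub>N\<^esub> \<longrightarrow> x = \<zero>\<^bsub>M\<^esub>"
  show "inj_on f (carrier M)"
  proof (rule inj_onI)
    fix x y assume xy: "x \<in> carrier M" "y \<in> carrier M" "f x = f y"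
    then have "f (x \<ominus>\<^bsub>M\<^esub> y) = \<zero>\<^bsub>N\<^esub>" using assms by (simp add: lin_diff linD diff_eq_iff)
    then have "x \<ominus>\<^bsub>M\<^esub> y = \<zero>\<^bsub>M\<^esub>" using * xy assms by simp
    then show "x = y" using xy assms by (simp add: diff_eq_iff)
  qed
qed

lemma lin_inverse:
  assumes f: "lin M N f" "bij_betw f (carrier M) (carrier N)" and "lmod M" "lmod N"
  shows "lin N M (inv_into (carrier M) f)"
proof -
  let ?g = "inv_into (carrier M) f"
  have g: "x \<in> carrier N \<Longrightarrow> ?g x \<in> carrier M" "x \<in> carrier N \<Longrightarrow> f (?g x) = x" for x
    using f(2) by (auto simp: bij_betw_def inv_into_into f_inv_into_f)
  have u: "x \<in> carrier M \<Longrightarrow> f x = y \<Longrightarrow> ?g y = x" for x y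
    using f(2) by (auto simp: bij_betw_def)
  show ?thesis by (rule linI) (use g assms in \<open>auto intro!: u simp: linD[OF f(1)]\<close>)
qed

section \<open>Finite sums, spans and finite generation\<close>

lemma msum_closed: "\<lbrakk>lmod M; \<And>i. i < k \<Longrightarrow> f i \<in> carrier M\<rbrakk> \<Longrightarrow> msum M f k \<in> carrier M"
  by (induction k) auto

lemma msum_cong: "(\<And>i. i < k \<Longrightarrow> f i = g i) \<Longrightarrow> msum M f k = msum M g k"
  by (induction k) auto

lemma msum_sub: "\<lbrakk>sub H M; \<And>i. i < k \<Longrightarrow> f i \<in> H\<rbrakk> \<Longrightarrow> msum M f k \<in> H"
  by (induction k) (auto dest: subD)

lemma msum_carrier_upd [simp]: "msum (M\<lparr>carrier := H\<rparr>) f k = msum M f k"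
  by (induction k) auto

lemma msum_zero: "\<lbrakk>lmod M; \<And>i. i < k \<Longrightarrow> f i = \<zero>\<^bsub>M\<^esub>\<rbrakk> \<Longrightarrow> msum M f k = \<zero>\<^bsub>M\<^esub>"
  by (induction k) auto

lemma msum_add:
  "\<lbrakk>lmod M; \<And>i. i < k \<Longrightarrow> f i \<in> carrier M; \<And>i. i < k \<Longrightarrow> g i \<in> carrier M\<rbrakk> \<Longrightarrow>
    msum M (\<lambda>i. f i \<oplus>\<^bsub>M\<^esub> g i) k = msum M f k \<oplus>\<^bsub>M\<^esub> msum M g k"
  by (induction k) (auto simp: lmod_ac msum_closed)

lemma msum_lin:
  "\<lbrakk>lin M N h; lmod M; lmod N; \<And>i. i < k \<Longrightarrow> f i \<in> carrier M\<rbrakk> \<Longrightarrow> h (msum M f k) = msum N (\<lambda>i. h (f i)) k"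
  by (induction k) (auto simp: lin_zero linD msum_closed)

lemma msum_smult:
  "\<lbrakk>lmod M; a \<in> carrier R; \<And>i. i < k \<Longrightarrow> f i \<in> carrier M\<rbrakk> \<Longrightarrow> a \<odot>\<^bsub>M\<^esub> msum M f k = msum M (\<lambda>i. a \<odot>\<^bsub>M\<^esub> f i) k"
  by (induction k) (auto simp: smult_distr msum_closed)

lemma msum_delta:
  "\<lbrakk>lmod M; j < k; x \<in> carrier M\<rbrakk> \<Longrightarrow> msum M (\<lambda>i. if i = j then x else \<zero>\<^bsub>M\<^esub>) k = x"
proof (induction k)
  case (Suc k)
  then show ?case using msum_zero[OF Suc.prems(1), of k "\<lambda>i. if i = j then x else \<zero>\<^bsub>M\<^esub>"]
    by (cases "j = k") auto
qed simp

lemma lin_msum: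
  "\<lbrakk>lmod M; lmod N; \<And>i. i < k \<Longrightarrow> lin M N (f i)\<rbrakk> \<Longrightarrow> lin M N (\<lambda>x. msum N (\<lambda>i. f i x) k)"
  by (induction k) (auto intro: lin_const_zero lin_add)

definition lspan :: "('a, 'b) module \<Rightarrow> nat \<Rightarrow> (nat \<Rightarrow> 'b) \<Rightarrow> 'b set" where
  "lspan M k s = {msum M (\<lambda>i. r i \<odot>\<^bsub>M\<^esub> s i) k | r. \<forall>i<k. r i \<in> carrier R}"

lemma lspanI: "\<forall>i<k. r i \<in> carrier R \<Longrightarrow> msum M (\<lambda>i. r i \<odot>\<^bsub>M\<^esub> s i) k \<in> lspan M k s"
  by (auto simp: lspan_def)

lemma lspanE:
  assumes "x \<in> lspan M k s"
  obtains r where "\<forall>i<k. r i \<in> carrier R" "x = msum M (\<lambda>i. r i \<odot>\<^bsub>M\<^esub> s i) k"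
  using assms by (auto simp: lspan_def)

lemma lspan_0: "lspan M 0 s = {\<zero>\<^bsub>M\<^esub>}" by (auto simp: lspan_def)

lemma lspan_Suc: "lspan M (Suc k) s = {x \<oplus>\<^bsub>M\<^esub> r \<odot>\<^bsub>M\<^esub> s k | x r. x \<in> lspan M k s \<and> r \<in> carrier R}"
proof (rule equalityI; rule subsetI)
  fix z assume "z \<in> lspan M (Suc k) s"
  then show "z \<in> {x \<oplus>\<^bsub>M\<^esub> r \<odot>\<^bsub>M\<^esub> s k | x r. x \<in> lspan M k s \<and> r \<in> carrier R}"
    by (fastforce simp: lspan_def)
next
  fix z assume "z \<in> {x \<oplus>\<^bsub>M\<^esub> r \<odot>\<^bsub>M\<^esub> s k | x r. x \<in> lspan M k s \<and> r \<in> carrier R}"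
  then obtain r a where "\<forall>i<k. r i \<in> carrier R" "a \<in> carrier R"
    "z = msum M (\<lambda>i. r i \<odot>\<^bsub>M\<^esub> s i) k \<oplus>\<^bsub>M\<^esub> a \<odot>\<^bsub>M\<^esub> s k" by (auto simp: lspan_def)
  then have "z = msum M (\<lambda>i. (r(k := a)) i \<odot>\<^bsub>M\<^esub> s i) (Suc k)" "\<forall>i<Suc k. (r(k := a)) i \<in> carrier R"
    by (auto intro!: arg_cong2[of _ _ _ _ "add M"] msum_cong simp: less_Suc_eq)
  then show "z \<in> lspan M (Suc k) s" using lspanI by metis
qed

lemma sub_lspan:
  assumes M: "lmod M" and s: "\<And>i. i < k \<Longrightarrow> s i \<in> carrier M" shows "sub (lspan M k s) M"
proof (rule subI[OF M])
  show "lspan M k s \<subseteq> carrier M" using s M by (auto simp: lspan_def intro!: msum_closed)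
  show "\<zero>\<^bsub>M\<^esub> \<in> lspan M k s"
    using lspanI[of k "\<lambda>_. \<zero>" M s] msum_zero[OF M, of k "\<lambda>i. \<zero> \<odot>\<^bsub>M\<^esub> s i"] s M by simp
next
  fix x y assume "x \<in> lspan M k s" "y \<in> lspan M k s"
  then obtain r q where *: "\<forall>i<k. r i \<in> carrier R" "\<forall>i<k. q i \<in> carrier R"
    "x = msum M (\<lambda>i. r i \<odot>\<^bsub>M\<^esub> s i) k" "y = msum M (\<lambda>i. q i \<odot>\<^bsub>M\<^esub> s i) k" by (auto simp: lspan_def)
  then have "x \<oplus>\<^bsub>M\<^esub> y = msum M (\<lambda>i. (r i \<oplus> q i) \<odot>\<^bsub>M\<^esub> s i) k"
    using s M by (subst msum_add[symmetric] | auto intro!: msum_cong simp: smult_distr)+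
  moreover have "\<forall>i<k. r i \<oplus> q i \<in> carrier R" using * by auto
  ultimately show "x \<oplus>\<^bsub>M\<^esub> y \<in> lspan M k s" by (auto simp: lspan_def)
next
  fix a x assume a: "a \<in> carrier R" and "x \<in> lspan M k s"
  then obtain r where *: "\<forall>i<k. r i \<in> carrier R" "x = msum M (\<lambda>i. r i \<odot>\<^bsub>M\<^esub> s i) k" by (auto simp: lspan_def)
  then have "a \<odot>\<^bsub>M\<^esub> x = msum M (\<lambda>i. (a \<otimes> r i) \<odot>\<^bsub>M\<^esub> s i) k"
    using s M a by (auto simp: msum_smult smult_distr intro!: msum_cong)
  moreover have "\<forall>i<k. a \<otimes> r i \<in> carrier R" using * a by auto
  ultimately show "a \<odot>\<^bsub>M\<^esub> x \<in> lspan M k s" by (auto simp: lspan_def)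
qed

lemma lspan_gen:
  assumes M: "lmod M" and s: "\<And>i. i < k \<Longrightarrow> s i \<in> carrier M" and j: "j < k" shows "s j \<in> lspan M k s"
proof -
  have "msum M (\<lambda>i. (if i = j then \<one> else \<zero>) \<odot>\<^bsub>M\<^esub> s i) k = msum M (\<lambda>i. if i = j then s j else \<zero>\<^bsub>M\<^esub>) k"
    using M s by (intro msum_cong) auto
  then have "s j = msum M (\<lambda>i. (if i = j then \<one> else \<zero>) \<odot>\<^bsub>M\<^esub> s i) k"
    using msum_delta[OF M j s[OF j]] by simp
  then show ?thesis using lspanI[of k "\<lambda>i. if i = j then \<one> else \<zero>" M s] by auto
qed

lemma lspan_least: "\<lbrakk>sub H M; \<And>i. i < k \<Longrightarrow> s i \<in> H\<rbrakk> \<Longrightarrow> lspan M k s \<subseteq> H"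
  by (auto simp: lspan_def intro!: msum_sub subD(5))

text \<open>A relative form of finite generation: the submodule \<open>H\<close> varies inside a
  fixed \<open>M\<close>, and the generators lie in \<open>H\<close>, so that the inclusion in the
  span is an equality for submodules.\<close>

definition fgs :: "('a, 'b) module \<Rightarrow> 'b set \<Rightarrow> bool" where
  "fgs M H \<longleftrightarrow> (\<exists>k s. (\<forall>i<k. s i \<in> H) \<and> H \<subseteq> lspan M k s)"

text \<open>Spans provide coefficients, whereas the right side speaks of submodules only. It matches
  \<open>finitely_generated\<close> and can be compared between two rings acting on the same group,
  which is how finite generation passes from \<open>R\<close> to \<open>\<Lambda>\<close>.\<close>

lemma fgs_iff_finite:
  assumes M: "lmod M" and H: "sub H M"
  shows "fgs M H \<longleftrightarrow> (\<exists>S. finite S \<and> S \<subseteq> H \<and> (\<forall>G. sub G M \<and> S \<subseteq> G \<longrightarrow> H \<subseteq> G))"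
proof
  assume "fgs M H"
  then obtain k s where s: "\<forall>i<k. s i \<in> H" "H \<subseteq> lspan M k s" by (auto simp: fgs_def)
  show "\<exists>S. finite S \<and> S \<subseteq> H \<and> (\<forall>G. sub G M \<and> S \<subseteq> G \<longrightarrow> H \<subseteq> G)"
  proof (intro exI[of _ "s ` {..<k}"] conjI allI impI)
    fix G assume "sub G M \<and> s ` {..<k} \<subseteq> G"
    then show "H \<subseteq> G" using s(2) lspan_least[of G M k s] by auto
  qed (use s in auto)
next
  assume "\<exists>S. finite S \<and> S \<subseteq> H \<and> (\<forall>G. sub G M \<and> S \<subseteq> G \<longrightarrow> H \<subseteq> G)"
  then obtain S where S: "finite S" "S \<subseteq> H" "\<And>G. sub G M \<Longrightarrow> S \<subseteq> G \<Longrightarrow> H \<subseteq> G"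
    by (metis (no_types, lifting))
  obtain k and s :: "nat \<Rightarrow> 'b" where s: "S = s ` {..<k}" using finite_imp_nat_seg_image_inj_on[OF S(1)]
    by (metis lessThan_def)
  have sc: "s i \<in> carrier M" if "i < k" for i using that s S(2) subD(2)[OF H] by auto
  have "H \<subseteq> lspan M k s"
    using S(3)[OF sub_lspan[of M k s]] lspan_gen[OF M, of k s] M sc s by auto
  then show "fgs M H" unfolding fgs_def using s S(2) by (intro exI[of _ k] exI[of _ s]) auto
qed

lemma fg_iff: "lmod M \<Longrightarrow> finitely_generated R M \<longleftrightarrow> fgs M (carrier M)"
  unfolding finitely_generated_def fgs_iff_finite[OF _ sub_carrier]
  using subD(1) by (metis subset_antisym order_refl)

lemma lspan_carrier_upd [simp]: "lspan (M\<lparr>carrier := H\<rparr>) k s = lspan M k s"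
  by (simp add: lspan_def)

lemma fgs_carrier_upd [simp]: "fgs (M\<lparr>carrier := G\<rparr>) H \<longleftrightarrow> fgs M H"
  by (simp add: fgs_def)

lemma fg_modI: "\<lbrakk>lmod M; fgs M (carrier M)\<rbrakk> \<Longrightarrow> M \<in> fg_mod R" by (simp add: fg_mod_def fg_iff)
lemma fg_modD: "M \<in> fg_mod R \<Longrightarrow> lmod M" "M \<in> fg_mod R \<Longrightarrow> fgs M (carrier M)"
  by (auto simp: fg_mod_def fg_iff)

lemma fgs_image:
  assumes "lin M N f" "lmod M" "lmod N" "sub H M" "fgs M H" shows "fgs N (f ` H)"
proof -
  obtain k s where s: "\<forall>i<k. s i \<in> H" "H \<subseteq> lspan M k s" using assms(5) by (auto simp: fgs_def)
  have "f x \<in> lspan N k (\<lambda>i. f (s i))" if x: "x \<in> H" for x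
  proof -
    obtain r where r: "\<forall>i<k. r i \<in> carrier R" "x = msum M (\<lambda>i. r i \<odot>\<^bsub>M\<^esub> s i) k"
      by (rule lspanE[OF subsetD[OF s(2) x]])
    then have "f x = msum N (\<lambda>i. r i \<odot>\<^bsub>N\<^esub> f (s i)) k"
      using s(1) subD(2)[OF assms(4)] assms by (auto simp: msum_lin linD intro!: msum_cong)
    then show ?thesis using r by (auto simp: lspan_def)
  qed
  then show ?thesis unfolding fgs_def using s(1) by (intro exI[of _ k] exI[of _ "\<lambda>i. f (s i)"]) auto
qed

section \<open>Direct powers, direct sums and the regular module\<close>

lemma direct_power_simps [simp]:
  "carrier (direct_power M k) = {..<k} \<rightarrow>\<^sub>E carrier M"
  "\<zero>\<^bsub>direct_power M k\<^esub> = (\<lambda>i\<in>{..<k}. \<zero>\<^bsub>M\<^esub>)"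
  "u \<oplus>\<^bsub>direct_power M k\<^esub> v = (\<lambda>i\<in>{..<k}. u i \<oplus>\<^bsub>M\<^esub> v i)"
  "a \<odot>\<^bsub>direct_power M k\<^esub> u = (\<lambda>i\<in>{..<k}. a \<odot>\<^bsub>M\<^esub> u i)"
  by (simp_all add: direct_power_def mk_module_def)

lemma direct_sum_simps [simp]:
  "carrier (direct_sum M N) = carrier M \<times> carrier N"
  "\<zero>\<^bsub>direct_sum M N\<^esub> = (\<zero>\<^bsub>M\<^esub>, \<zero>\<^bsub>N\<^esub>)"
  "u \<oplus>\<^bsub>direct_sum M N\<^esub> v = (fst u \<oplus>\<^bsub>M\<^esub> fst v, snd u \<oplus>\<^bsub>N\<^esub> snd v)"
  "a \<odot>\<^bsub>direct_sum M N\<^esub> u = (a \<odot>\<^bsub>M\<^esub> fst u, a \<odot>\<^bsub>N\<^esub> snd u)"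
  by (simp_all add: direct_sum_def mk_module_def)

lemma regular_simps [simp]:
  "carrier (regular_module R) = carrier R" "\<zero>\<^bsub>regular_module R\<^esub> = \<zero>"
  "x \<oplus>\<^bsub>regular_module R\<^esub> y = x \<oplus> y" "a \<odot>\<^bsub>regular_module R\<^esub> x = a \<otimes> x"
  by (simp_all add: regular_module_def mk_module_def)

lemma lmod_regular: "lmod (regular_module R)"
  by (rule left_moduleI) (auto simp: a_ac l_distr r_distr m_assoc)

lemma lmod_power:
  assumes M: "lmod M" shows "lmod (direct_power M k)"
proof -
  have m: "u i \<in> carrier M" if "u \<in> carrier (direct_power M k)" "i < k" for u i using that by auto
  have e: "(\<lambda>i\<in>{..<k}. f i) = u" if "u \<in> carrier (direct_power M k)" "\<And>i. i < k \<Longrightarrow> f i = u i" for u f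
  proof (rule PiE_ext[of _ "{..<k}" "\<lambda>_. carrier M"])
    show "(\<lambda>i\<in>{..<k}. f i) \<in> {..<k} \<rightarrow>\<^sub>E carrier M" using that(2) m[OF that(1)] by simp
  qed (use that in simp_all)
  show ?thesis
  proof (rule left_moduleI, goal_cases)
    case 1 then show ?case using M by simp
  next
    case (2 x y) then show ?case using M m[OF 2(1)] m[OF 2(2)] by simp
  next
    case (3 a x) then show ?case using M m[OF 3(2)] by simp
  next
    case (4 x y z) then show ?case
      using M m[OF 4(1)] m[OF 4(2)] m[OF 4(3)] by (simp add: lmod_ac(1) cong: restrict_cong)
  next
    case (5 x y) then show ?case using M m[OF 5(1)] m[OF 5(2)] by (simp add: lmod_ac(2)[of M "x _"] cong: restrict_cong)
  next
    case (6 x) then show ?case using M e[OF 6] m[OF 6] by simp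
  next
    case (7 a b x) then show ?case using M m[OF 7(3)] by (simp add: smult_distr cong: restrict_cong)
  next
    case (8 a x y) then show ?case using M m[OF 8(2)] m[OF 8(3)] by (simp add: smult_distr cong: restrict_cong)
  next
    case (9 a b x) then show ?case using M m[OF 9(3)] by (simp add: smult_distr cong: restrict_cong)
  next
    case (10 x) then show ?case using M e[OF 10] m[OF 10] by simp
  next
    case (11 x) then show ?case using M m[OF 11] by (simp cong: restrict_cong)
  qed
qed

lemma lmod_direct_sum: "\<lbrakk>lmod M; lmod N\<rbrakk> \<Longrightarrow> lmod (direct_sum M N)"
  by (rule left_moduleI) (auto simp: lmod_ac smult_distr)

end

section \<open>Chain conditions\<close>

context rng begin

text \<open>The minimum condition is the form in which descending chains are used throughout;
  relative to \<open>H\<close> it can be proved by adding one generator at a time.\<close>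

definition dccs :: "('a, 'b) module \<Rightarrow> 'b set \<Rightarrow> bool" where
  "dccs M H \<longleftrightarrow> (\<forall>\<G>. \<G> \<noteq> {} \<and> (\<forall>G\<in>\<G>. sub G M \<and> G \<subseteq> H) \<longrightarrow> (\<exists>G\<in>\<G>. \<forall>G'\<in>\<G>. G' \<subseteq> G \<longrightarrow> G' = G))"

abbreviation dcc :: "('a, 'b) module \<Rightarrow> bool" where "dcc M \<equiv> dccs M (carrier M)"

definition noe :: "('a, 'b) module \<Rightarrow> bool" where "noe M \<longleftrightarrow> (\<forall>H. sub H M \<longrightarrow> fgs M H)"

lemma dccsE:
  assumes "dccs M H" "G0 \<in> \<G>" "\<And>G. G \<in> \<G> \<Longrightarrow> sub G M" "\<And>G. G \<in> \<G> \<Longrightarrow> G \<subseteq> H"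
  obtains G where "G \<in> \<G>" "\<And>G'. G' \<in> \<G> \<Longrightarrow> G' \<subseteq> G \<Longrightarrow> G' = G"
proof -
  have "\<G> \<noteq> {} \<and> (\<forall>G\<in>\<G>. sub G M \<and> G \<subseteq> H)" using assms by auto
  then have "\<exists>G\<in>\<G>. \<forall>G'\<in>\<G>. G' \<subseteq> G \<longrightarrow> G' = G"
    by (rule assms(1)[unfolded dccs_def, rule_format])
  then obtain G where "G \<in> \<G>" "\<forall>G'\<in>\<G>. G' \<subseteq> G \<longrightarrow> G' = G" by (elim bexE)
  then show ?thesis by (intro that[of G]) simp_all
qed

text \<open>A family without minimal members yields, by dependent choice, a chain that descends
  strictly for ever.\<close>

lemma dccs_chainI:
  assumes "\<And>G. (\<And>k. sub (G k) M) \<Longrightarrow> (\<And>k. G (Suc k) \<subseteq> G k) \<Longrightarrow> \<exists>k. \<forall>m\<ge>k. G m = G k"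
  shows "dcc M"
  unfolding dccs_def
proof (intro allI impI, rule ccontr)
  fix \<G> :: "'b set set"
  assume G: "\<G> \<noteq> {} \<and> (\<forall>G\<in>\<G>. sub G M \<and> G \<subseteq> carrier M)"
    and "\<not> (\<exists>G\<in>\<G>. \<forall>G'\<in>\<G>. G' \<subseteq> G \<longrightarrow> G' = G)"
  then have *: "\<And>G. G \<in> \<G> \<Longrightarrow> \<exists>G'. G' \<in> \<G> \<and> G' \<subset> G" by (metis psubsetI)
  obtain G0 where "G0 \<in> \<G>" using G by auto
  then obtain f where f: "\<And>k. f k \<in> \<G> \<and> f (Suc k) \<subset> f k"
    using dependent_nat_choice[of "\<lambda>_ G. G \<in> \<G>" "\<lambda>_ G G'. G' \<subset> G"] * by metis
  have "\<exists>k. \<forall>m\<ge>k. f m = f k" using f G by (intro assms) auto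
  then show False using f by (metis le_Suc_eq order_refl psubsetE)
qed

text \<open>A submodule \<open>G\<close> of \<open>H + R s\<close> is controlled by
  \<open>G \<inter> H\<close> and by the coefficients of \<open>s\<close> that occur in
  \<open>G\<close>: nested submodules for which both agree are equal. The two invariants are
  minimised one after the other.\<close>

lemma dccs_step:
  assumes M: "lmod M" and H: "sub H M" and s: "s \<in> carrier M"
    and R: "dcc (regular_module R)" and d: "dccs M H"
  shows "dccs M {x \<oplus>\<^bsub>M\<^esub> r \<odot>\<^bsub>M\<^esub> s | x r. x \<in> H \<and> r \<in> carrier R}" (is "dccs M ?H'")
  unfolding dccs_def
proof (intro allI impI)
  fix \<G> :: "'b set set"
  assume G: "\<G> \<noteq> {} \<and> (\<forall>G\<in>\<G>. sub G M \<and> G \<subseteq> ?H')"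
  then have Gs: "sub G M" if "G \<in> \<G>" for G using that by blast
  obtain B where B: "B \<in> \<G>" using G by auto
  have "B \<inter> H \<in> (\<lambda>G. G \<inter> H) ` \<G>" using B by auto
  moreover have "sub A M" "A \<subseteq> H" if "A \<in> (\<lambda>G. G \<inter> H) ` \<G>" for A
    using that sub_Int[OF M Gs H] by auto
  ultimately obtain A where A: "A \<in> (\<lambda>G. G \<inter> H) ` \<G>"
    and Am: "\<And>A'. A' \<in> (\<lambda>G. G \<inter> H) ` \<G> \<Longrightarrow> A' \<subseteq> A \<Longrightarrow> A' = A"
    using dccsE[OF d] by metis
  define G1 where "G1 = {G \<in> \<G>. G \<inter> H = A}"
  \<comment> \<open>The image of \<open>G\<close> in the cyclic quotient
    \<open>(H + R s) / H\<close>, pulled back to an ideal of the ring.\<close>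
  define I where "I G = {r \<in> carrier R. \<exists>h\<in>H. h \<oplus>\<^bsub>M\<^esub> r \<odot>\<^bsub>M\<^esub> s \<in> G}" for G
  have I: "sub (I G) (regular_module R)" if "G \<in> \<G>" for G
  proof (rule subI[OF lmod_regular])
    note g = subD[OF Gs[OF that]] and h = subD[OF H]
    show "I G \<subseteq> carrier (regular_module R)" by (auto simp: I_def)
    show "\<zero>\<^bsub>regular_module R\<^esub> \<in> I G" using g(3) h(3) M s by (auto simp: I_def intro!: bexI[of _ "\<zero>\<^bsub>M\<^esub>"])
    fix x assume x: "x \<in> I G"
    then obtain u where u: "x \<in> carrier R" "u \<in> H" "u \<oplus>\<^bsub>M\<^esub> x \<odot>\<^bsub>M\<^esub> s \<in> G" by (auto simp: I_def)
    { fix y assume "y \<in> I G"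
      then obtain v where v: "y \<in> carrier R" "v \<in> H" "v \<oplus>\<^bsub>M\<^esub> y \<odot>\<^bsub>M\<^esub> s \<in> G" by (auto simp: I_def)
      have "(u \<oplus>\<^bsub>M\<^esub> v) \<oplus>\<^bsub>M\<^esub> (x \<oplus> y) \<odot>\<^bsub>M\<^esub> s = (u \<oplus>\<^bsub>M\<^esub> x \<odot>\<^bsub>M\<^esub> s) \<oplus>\<^bsub>M\<^esub> (v \<oplus>\<^bsub>M\<^esub> y \<odot>\<^bsub>M\<^esub> s)"
        using u v h(2) M s by (simp add: smult_distr lmod_ac)
      then show "x \<oplus>\<^bsub>regular_module R\<^esub> y \<in> I G"
        using u v g(4)[OF u(3) v(3)] h(4)[OF u(2) v(2)] by (auto simp: I_def intro!: bexI[of _ "u \<oplus>\<^bsub>M\<^esub> v"]) }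
    { fix a assume a: "a \<in> carrier R"
      have "a \<odot>\<^bsub>M\<^esub> u \<oplus>\<^bsub>M\<^esub> (a \<otimes> x) \<odot>\<^bsub>M\<^esub> s = a \<odot>\<^bsub>M\<^esub> (u \<oplus>\<^bsub>M\<^esub> x \<odot>\<^bsub>M\<^esub> s)"
        using u a h(2) M s by (simp add: smult_distr)
      then show "a \<odot>\<^bsub>regular_module R\<^esub> x \<in> I G"
        using u a g(5)[OF a u(3)] h(5)[OF a u(2)] by (auto simp: I_def intro!: bexI[of _ "a \<odot>\<^bsub>M\<^esub> u"]) }
  qed
  obtain B' where B': "B' \<in> G1" using A by (auto simp: G1_def)
  have "I B' \<in> I ` G1" using B' by auto
  moreover have "sub J (regular_module R)" "J \<subseteq> carrier (regular_module R)" if "J \<in> I ` G1" for J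
    using that I subD(1)[OF I] by (auto simp: G1_def)
  ultimately obtain J where J: "J \<in> I ` G1" and Jm: "\<And>J'. J' \<in> I ` G1 \<Longrightarrow> J' \<subseteq> J \<Longrightarrow> J' = J"
    using dccsE[OF R] by metis
  obtain C where C: "C \<in> G1" "J = I C" using J by auto
  have CG: "C \<in> \<G>" "C \<inter> H = A" using C by (auto simp: G1_def)
  have "G' = C" if G': "G' \<in> \<G>" "G' \<subseteq> C" for G'
  proof
    have 1: "G' \<inter> H = A" using Am[of "G' \<inter> H"] G' CG by blast
    then have "G' \<in> G1" using G' by (simp add: G1_def)
    moreover have "I G' \<subseteq> I C" using G'(2) by (auto simp: I_def)
    ultimately have 2: "I G' = I C" using Jm[of "I G'"] C by blast
    show "C \<subseteq> G'"
    proof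
      fix x assume x: "x \<in> C"
      have "x \<in> ?H'" using G CG(1) x by blast
      then obtain h r where h: "h \<in> H" "r \<in> carrier R" "x = h \<oplus>\<^bsub>M\<^esub> r \<odot>\<^bsub>M\<^esub> s" by auto
      then have "r \<in> I G'" using x 2 by (auto simp: I_def)
      then obtain h' where h': "h' \<in> H" "h' \<oplus>\<^bsub>M\<^esub> r \<odot>\<^bsub>M\<^esub> s \<in> G'" by (auto simp: I_def)
      let ?y = "h' \<oplus>\<^bsub>M\<^esub> r \<odot>\<^bsub>M\<^esub> s"
      have hc: "h \<in> carrier M" "h' \<in> carrier M" using h h' subD(2)[OF H] by auto
      have "x \<ominus>\<^bsub>M\<^esub> ?y = (h \<ominus>\<^bsub>M\<^esub> h') \<oplus>\<^bsub>M\<^esub> (r \<odot>\<^bsub>M\<^esub> s \<ominus>\<^bsub>M\<^esub> r \<odot>\<^bsub>M\<^esub> s)"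
        unfolding h(3) using hc h M s by (intro add_diff_swap) auto
      then have e: "x \<ominus>\<^bsub>M\<^esub> ?y = h \<ominus>\<^bsub>M\<^esub> h'" using hc h M s by (simp add: a_minus_def)
      have "x \<ominus>\<^bsub>M\<^esub> ?y \<in> C" using x h' G' subD(7)[OF Gs[OF CG(1)]] by blast
      moreover have "x \<ominus>\<^bsub>M\<^esub> ?y \<in> H" unfolding e using h h' subD(7)[OF H] by blast
      ultimately have "x \<ominus>\<^bsub>M\<^esub> ?y \<in> G'" using CG 1 by blast
      then have "(x \<ominus>\<^bsub>M\<^esub> ?y) \<oplus>\<^bsub>M\<^esub> ?y \<in> G'" using h' subD(4)[OF Gs[OF G'(1)]] by blast
      moreover have "(x \<ominus>\<^bsub>M\<^esub> ?y) \<oplus>\<^bsub>M\<^esub> ?y = x"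
        using diff_eq_iff[OF M, of x ?y "x \<ominus>\<^bsub>M\<^esub> ?y"] hc h M s by simp
      ultimately show "x \<in> G'" by simp
    qed
  qed (rule G')
  then show "\<exists>G\<in>\<G>. \<forall>G'\<in>\<G>. G' \<subseteq> G \<longrightarrow> G' = G" using CG(1) by blast
qed

lemma dccs_lspan:
  assumes M: "lmod M" and R: "dcc (regular_module R)"
  shows "(\<And>i. i < k \<Longrightarrow> s i \<in> carrier M) \<Longrightarrow> dccs M (lspan M k s)"
proof (induction k)
  case 0
  have "G = {\<zero>\<^bsub>M\<^esub>}" if "sub G M" "G \<subseteq> {\<zero>\<^bsub>M\<^esub>}" for G using subD(3)[OF that(1)] that by auto
  then show ?case unfolding dccs_def lspan_0 by (metis equals0I)
next
  case (Suc k)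
  show ?case unfolding lspan_Suc
    using Suc.prems by (intro dccs_step[OF M sub_lspan[OF M] _ R Suc.IH]) auto
qed

lemma dccs_mono: "dccs M H \<Longrightarrow> G \<subseteq> H \<Longrightarrow> dccs M G"
  unfolding dccs_def by (meson subset_trans)

lemma fg_dcc: "\<lbrakk>M \<in> fg_mod R; dcc (regular_module R)\<rbrakk> \<Longrightarrow> dcc M"
  using fg_modD[of M] dccs_lspan[of M] dccs_mono unfolding fgs_def by metis

text \<open>Generators \<open>S\<close> of the kernel part and preimages \<open>U\<close> of
  generators of the image generate together: an element of \<open>H\<close> is corrected by an
  element of the submodule with the same image, and the difference lies in the kernel.\<close>

lemma fgs_extension:
  assumes f: "lin M N f" and M: "lmod M" and N: "lmod N" and H: "sub H M"
    and im: "fgs N (f ` H)" and ker: "fgs M (H \<inter> a_kernel M N f)"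
  shows "fgs M H"
proof -
  have fH: "sub (f ` H) N" and K: "sub (H \<inter> a_kernel M N f) M"
    using sub_image[OF f M N H] sub_Int[OF M H sub_kernel[OF f M N]] by auto
  obtain T where T: "finite T" "T \<subseteq> f ` H" "\<forall>G. sub G N \<and> T \<subseteq> G \<longrightarrow> f ` H \<subseteq> G"
    using im unfolding fgs_iff_finite[OF N fH] by (elim exE conjE)
  obtain S where S: "finite S" "S \<subseteq> H \<inter> a_kernel M N f"
    "\<forall>G. sub G M \<and> S \<subseteq> G \<longrightarrow> H \<inter> a_kernel M N f \<subseteq> G"
    using ker unfolding fgs_iff_finite[OF M K] by (elim exE conjE)
  obtain U where U: "finite U" "U \<subseteq> H" "f ` U = T" using finite_subset_image[OF T(1,2)] by metis
  show ?thesis unfolding fgs_iff_finite[OF M H]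
  proof (intro exI[of _ "S \<union> U"] conjI allI impI subsetI)
    fix G x assume G: "sub G M \<and> S \<union> U \<subseteq> G" and x: "x \<in> H"
    have "sub (f ` (G \<inter> H)) N" by (intro sub_image[OF f M N] sub_Int[OF M] H) (use G in auto)
    moreover have "T \<subseteq> f ` (G \<inter> H)" using U G by auto
    ultimately have "f x \<in> f ` (G \<inter> H)" using T(3) x by blast
    then obtain g where g: "g \<in> G" "g \<in> H" "f x = f g" by auto
    have c: "x \<in> carrier M" "g \<in> carrier M" using subD(2)[OF H] x g by auto
    then have "f (x \<ominus>\<^bsub>M\<^esub> g) = \<zero>\<^bsub>N\<^esub>" using g f M N by (simp add: lin_diff linD diff_eq_iff)
    then have "x \<ominus>\<^bsub>M\<^esub> g \<in> H \<inter> a_kernel M N f"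
      using subD(7)[OF H x g(2)] c M by (simp add: a_kernel_iff)
    then have "x \<ominus>\<^bsub>M\<^esub> g \<in> G" using S(3) G by blast
    then have "(x \<ominus>\<^bsub>M\<^esub> g) \<oplus>\<^bsub>M\<^esub> g \<in> G" using G g subD(4)[of G M] by blast
    then show "x \<in> G" using diff_eq_iff[OF M c, of "x \<ominus>\<^bsub>M\<^esub> g"] c M by simp
  qed (use S U in auto)
qed

lemma sub_cyclic: "\<lbrakk>lmod M; w \<in> carrier M\<rbrakk> \<Longrightarrow> sub ((\<lambda>r. r \<odot>\<^bsub>M\<^esub> w) ` carrier R) M"
proof -
  assume M: "lmod M" and w: "w \<in> carrier M"
  have l: "lin (regular_module R) M (\<lambda>r. r \<odot>\<^bsub>M\<^esub> w)"
    by (rule linI) (use M w in \<open>auto simp: smult_distr\<close>)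
  show ?thesis using sub_image[OF l lmod_regular M sub_carrier[OF lmod_regular]] by simp
qed

text \<open>Zorn's lemma, as avoiding a single element survives unions of chains. The result serves
  as a hyperplane complementary to \<open>w\<close>.\<close>

lemma maximal_sub_avoiding:
  assumes M: "lmod M" and H: "sub H M" and w: "w \<in> H" "w \<noteq> \<zero>\<^bsub>M\<^esub>"
  obtains W where "sub W M" "W \<subseteq> H" "w \<notin> W"
    "\<And>V. \<lbrakk>sub V M; V \<subseteq> H; w \<notin> V; W \<subseteq> V\<rbrakk> \<Longrightarrow> V = W"
proof -
  define \<W> where "\<W> = {W. sub W M \<and> W \<subseteq> H \<and> w \<notin> W}"
  have "\<exists>W\<in>\<W>. \<forall>V\<in>\<W>. W \<subseteq> V \<longrightarrow> V = W"
  proof (rule subset_Zorn_nonempty)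
    show "\<W> \<noteq> {}" using sub_zero[OF M] w subD(3)[OF H] by (auto simp: \<W>_def)
    fix C assume C: "C \<noteq> {}" "subset.chain \<W> C"
    have CW: "sub W M" "W \<subseteq> H" "w \<notin> W" if "W \<in> C" for W
      using C that by (auto simp: subset_chain_def \<W>_def)
    have "sub (\<Union>C) M"
    proof (rule subI[OF M])
      show "\<Union>C \<subseteq> carrier M" using CW(1) subD(1) by blast
      show "\<zero>\<^bsub>M\<^esub> \<in> \<Union>C" using C(1) CW(1) subD(3) by blast
      show "x \<oplus>\<^bsub>M\<^esub> y \<in> \<Union>C" if xy: "x \<in> \<Union>C" "y \<in> \<Union>C" for x y
      proof -
        obtain A B where "A \<in> C" "B \<in> C" "x \<in> A" "y \<in> B" using xy by auto
        moreover have "A \<subseteq> B \<or> B \<subseteq> A" using C(2) calculation by (auto simp: subset_chain_def)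
        ultimately obtain E where E: "E \<in> C" "x \<in> E" "y \<in> E" by auto
        then show ?thesis using subD(4)[OF CW(1)[OF E(1)] E(2,3)] by auto
      qed
      show "a \<odot>\<^bsub>M\<^esub> x \<in> \<Union>C" if "a \<in> carrier R" "x \<in> \<Union>C" for a x
        using that subD(5)[OF CW(1) that(1), of _ x] by auto
    qed
    then show "\<Union>C \<in> \<W>" using CW by (auto simp: \<W>_def)
  qed
  then obtain W where "W \<in> \<W>" "\<forall>V\<in>\<W>. W \<subseteq> V \<longrightarrow> V = W" by blast
  then show ?thesis by (intro that[of W]) (auto simp: \<W>_def)
qed

text \<open>A minimal submodule \<open>H\<close> among those that are not finitely generated is annihilated by a maximal ideal:
  every scalar acts on \<open>H\<close> as zero or surjectively. A submodule of \<open>H\<close> maximal among those avoiding a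
  given \<open>w \<noteq> 0\<close> then has codimension one, although it is finitely generated.\<close>

lemma artinian_noe:
  assumes comm: "\<And>a b. \<lbrakk>a \<in> carrier R; b \<in> carrier R\<rbrakk> \<Longrightarrow> a \<otimes> b = b \<otimes> a"
    and R: "dcc (regular_module R)" and M: "lmod M" and d: "dcc M"
  shows "noe M"
proof (rule ccontr)
  assume "\<not> noe M"
  then obtain H0 where "H0 \<in> {H. sub H M \<and> \<not> fgs M H}" by (auto simp: noe_def)
  then obtain H where H: "sub H M" "\<not> fgs M H" and min: "\<And>G. \<lbrakk>sub G M; \<not> fgs M G; G \<subseteq> H\<rbrakk> \<Longrightarrow> G = H"
    using dccsE[OF d, of H0 "{H. sub H M \<and> \<not> fgs M H}"] subD(1) by (smt (verit, best) mem_Collect_eq)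
  note Hc = subD(2)[OF H(1)]
  have lr: "lin M M (\<lambda>x. r \<odot>\<^bsub>M\<^esub> x)" if "r \<in> carrier R" for r
    by (rule linI) (use that M in \<open>auto simp: smult_distr comm simp flip: smult_distr(3)\<close>)
  define I where "I = {r \<in> carrier R. \<forall>x\<in>H. r \<odot>\<^bsub>M\<^esub> x = \<zero>\<^bsub>M\<^esub>}"
  \<comment> \<open>If \<open>r\<close> acts on \<open>H\<close> neither as zero nor onto, its image
    and its kernel are both proper, hence finitely generated by minimality of \<open>H\<close>, and
    so would be \<open>H\<close>.\<close>
  have onto: "(\<lambda>x. r \<odot>\<^bsub>M\<^esub> x) ` H = H" if r: "r \<in> carrier R" "r \<notin> I" for r
  proof (rule ccontr)
    assume ne: "(\<lambda>x. r \<odot>\<^bsub>M\<^esub> x) ` H \<noteq> H"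
    have "sub ((\<lambda>x. r \<odot>\<^bsub>M\<^esub> x) ` H) M" by (rule sub_image[OF lr[OF r(1)] M M H(1)])
    moreover have "(\<lambda>x. r \<odot>\<^bsub>M\<^esub> x) ` H \<subseteq> H" using subD(5)[OF H(1) r(1)] by auto
    ultimately have 1: "fgs M ((\<lambda>x. r \<odot>\<^bsub>M\<^esub> x) ` H)" using ne min by blast
    let ?K = "H \<inter> a_kernel M M (\<lambda>x. r \<odot>\<^bsub>M\<^esub> x)"
    have "?K \<noteq> H" using r by (auto simp: I_def a_kernel_iff)
    moreover have "sub ?K M" by (intro sub_Int M H sub_kernel[OF lr[OF r(1)] M M])
    ultimately have 2: "fgs M ?K" using min by blast
    show False using fgs_extension[OF lr[OF r(1)] M M H(1) 1 2] H(2) by simp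
  qed
  have Hz: "H \<noteq> {\<zero>\<^bsub>M\<^esub>}"
    using H(2) lspan_0[of M] unfolding fgs_def by (metis less_zeroE order_refl)
  have Isub: "sub I (regular_module R)"
    by (rule subI[OF lmod_regular]) (use M Hc in \<open>auto simp: I_def smult_distr\<close>)
  have one: "\<one> \<notin> I" using Hz subD(3)[OF H(1)] M Hc by (auto simp: I_def)
  have prime: "t \<otimes> r \<notin> I" if "t \<in> carrier R" "t \<notin> I" "r \<in> carrier R" "r \<notin> I" for t r
  proof
    assume tr: "t \<otimes> r \<in> I"
    have "t \<odot>\<^bsub>M\<^esub> x = \<zero>\<^bsub>M\<^esub>" if "x \<in> H" for x
    proof -
      obtain y where "y \<in> H" "x = r \<odot>\<^bsub>M\<^esub> y" using onto[of r] \<open>x \<in> H\<close> \<open>r \<in> carrier R\<close> \<open>r \<notin> I\<close> by (metis imageE)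
      then show ?thesis using tr \<open>t \<in> carrier R\<close> \<open>r \<in> carrier R\<close> M Hc
        by (simp add: I_def smult_distr(3)[symmetric])
    qed
    then show False using that by (auto simp: I_def)
  qed
  \<comment> \<open>The principal ideals of \<open>R / I\<close>, pulled back to \<open>R\<close>. A
    minimal one \<open>P t\<close> with \<open>t\<close> outside \<open>I\<close> equals
    \<open>P (t \<otimes> r)\<close>, and this equation inverts \<open>r\<close> on
    \<open>H\<close>: an artinian domain is a field.\<close>
  define P where "P t = I <+>\<^bsub>regular_module R\<^esub> (\<lambda>r. r \<odot>\<^bsub>regular_module R\<^esub> t) ` carrier R" for t
  have Psub: "sub (P t) (regular_module R)" if "t \<in> carrier R" for t
    unfolding P_def by (rule sub_set_add[OF lmod_regular Isub sub_cyclic[OF lmod_regular]]) (use that in simp)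
  have Piff: "z \<in> P t \<longleftrightarrow> (\<exists>i\<in>I. \<exists>r\<in>carrier R. z = i \<oplus> r \<otimes> t)" for z t
    by (auto simp: P_def set_add_iff)
  have "P \<one> \<in> P ` (carrier R - I)" using one by auto
  moreover have "sub J (regular_module R)" "J \<subseteq> carrier (regular_module R)" if "J \<in> P ` (carrier R - I)" for J
    using that Psub subD(1)[OF Psub] by auto
  ultimately obtain J where "J \<in> P ` (carrier R - I)"
    and Jm: "\<And>J'. J' \<in> P ` (carrier R - I) \<Longrightarrow> J' \<subseteq> J \<Longrightarrow> J' = J"
    using dccsE[OF R] by metis
  then obtain t where t: "t \<in> carrier R" "t \<notin> I" "J = P t" by auto
  have inv: "\<exists>a\<in>carrier R. \<forall>x\<in>H. a \<odot>\<^bsub>M\<^esub> (r \<odot>\<^bsub>M\<^esub> x) = x" if r: "r \<in> carrier R" "r \<notin> I" for r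
  proof -
    have "P (t \<otimes> r) \<subseteq> P t"
    proof
      fix z assume "z \<in> P (t \<otimes> r)"
      then obtain i b where "i \<in> I" "b \<in> carrier R" "z = i \<oplus> b \<otimes> (t \<otimes> r)" by (auto simp: Piff)
      moreover have "b \<otimes> (t \<otimes> r) = (b \<otimes> r) \<otimes> t" if "b \<in> carrier R"
        using that r t by (simp add: m_assoc comm[of t r])
      ultimately show "z \<in> P t" using r by (auto simp: Piff)
    qed
    then have e: "P (t \<otimes> r) = P t" using Jm[of "P (t \<otimes> r)"] prime[OF t(1,2) r] t r by auto
    have "\<zero> \<in> I" "t = \<zero> \<oplus> \<one> \<otimes> t" using subD(3)[OF Isub] t by auto
    then have "t \<in> P t" unfolding Piff by (metis one_closed)
    then obtain i a where a: "i \<in> I" "a \<in> carrier R" "t = i \<oplus> a \<otimes> (t \<otimes> r)" unfolding e[symmetric] Piff by auto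
    have "a \<odot>\<^bsub>M\<^esub> (r \<odot>\<^bsub>M\<^esub> x) = x" if x: "x \<in> H" for x
    proof -
      obtain y where y: "y \<in> H" "x = t \<odot>\<^bsub>M\<^esub> y" using onto[OF t(1,2)] x by (metis imageE)
      have ic: "i \<in> carrier R" "i \<odot>\<^bsub>M\<^esub> y = \<zero>\<^bsub>M\<^esub>" using a y by (auto simp: I_def)
      have "x = (i \<oplus> a \<otimes> (t \<otimes> r)) \<odot>\<^bsub>M\<^esub> y" using y a by simp
      also have "\<dots> = (a \<otimes> (r \<otimes> t)) \<odot>\<^bsub>M\<^esub> y"
        using ic a(2) t r Hc[OF y(1)] M by (simp add: smult_distr(1) comm[of t r])
      also have "\<dots> = a \<odot>\<^bsub>M\<^esub> (r \<odot>\<^bsub>M\<^esub> x)"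
        using a(2) t r Hc[OF y(1)] M y(2) by (simp add: smult_distr(3))
      finally show ?thesis by simp
    qed
    then show ?thesis using a(2) by blast
  qed
  obtain w where w: "w \<in> H" "w \<noteq> \<zero>\<^bsub>M\<^esub>" using Hz subD(3)[OF H(1)] by blast
  obtain W where W: "sub W M" "W \<subseteq> H" "w \<notin> W" "\<And>V. \<lbrakk>sub V M; V \<subseteq> H; w \<notin> V; W \<subseteq> V\<rbrakk> \<Longrightarrow> V = W"
    using maximal_sub_avoiding[OF M H(1) w] by metis
  have "fgs M W" using min[OF W(1) _ W(2)] W(3) w(1) by blast
  then obtain S where S: "finite S" "S \<subseteq> W" "\<forall>G. sub G M \<and> S \<subseteq> G \<longrightarrow> W \<subseteq> G"
    unfolding fgs_iff_finite[OF M W(1)] by (elim exE conjE)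
  \<comment> \<open>For \<open>y\<close> outside \<open>W\<close>, maximality of \<open>W\<close>
    puts \<open>w\<close> into \<open>W + R y\<close>. The coefficient of \<open>y\<close> there
    acts invertibly on \<open>H\<close>, so \<open>y\<close> is expressed through \<open>W\<close>
    and \<open>w\<close>.\<close>
  have "H \<subseteq> G" if G: "sub G M" "insert w S \<subseteq> G" for G
  proof
    fix y assume y: "y \<in> H"
    have WG: "W \<subseteq> G" using S G by blast
    show "y \<in> G"
    proof (cases "y \<in> W")
      case False
      let ?V = "W <+>\<^bsub>M\<^esub> (\<lambda>r. r \<odot>\<^bsub>M\<^esub> y) ` carrier R"
      have c: "sub ((\<lambda>r. r \<odot>\<^bsub>M\<^esub> y) ` carrier R) M" by (rule sub_cyclic[OF M Hc[OF y]])
      have V: "sub ?V M" by (rule sub_set_add[OF M W(1) c])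
      have "y = \<zero>\<^bsub>M\<^esub> \<oplus>\<^bsub>M\<^esub> \<one> \<odot>\<^bsub>M\<^esub> y" using M Hc[OF y] by simp
      then have "y \<in> ?V" unfolding set_add_iff using subD(3)[OF W(1)] by blast
      moreover have "?V \<subseteq> H" by (rule set_add_least[OF H(1) W(2)]) (use y subD(5)[OF H(1)] in auto)
      ultimately have "w \<in> ?V" using W(4)[OF V] set_add_upper(1)[OF M W(1) c] False by blast
      then obtain w' r where w': "w' \<in> W" "r \<in> carrier R" "w = w' \<oplus>\<^bsub>M\<^esub> r \<odot>\<^bsub>M\<^esub> y" by (auto simp: set_add_iff)
      have w'c: "w' \<in> carrier M" using subD(2)[OF W(1)] w' by simp
      have "r \<notin> I"
      proof
        assume "r \<in> I"
        then have "w = w'" using w' y w'c M by (simp add: I_def)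
        then show False using w' W by simp
      qed
      then obtain a where a: "a \<in> carrier R" "a \<odot>\<^bsub>M\<^esub> (r \<odot>\<^bsub>M\<^esub> y) = y" using inv w' y by blast
      have "r \<odot>\<^bsub>M\<^esub> y = w \<ominus>\<^bsub>M\<^esub> w'"
        using w' w'c Hc[OF y] Hc[OF w(1)] M diff_eq_iff[OF M, of w w' "r \<odot>\<^bsub>M\<^esub> y"] by (simp add: lmod_ac)
      moreover have "w \<ominus>\<^bsub>M\<^esub> w' \<in> G" using subD(7)[OF G(1)] w' WG G(2) by blast
      ultimately show ?thesis using a subD(5)[OF G(1) a(1)] by metis
    qed (use WG in blast)
  qed
  then have "fgs M H" unfolding fgs_iff_finite[OF M H(1)] using S W(2) w(1)
    by (intro exI[of _ "insert w S"]) auto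
  then show False using H(2) by simp
qed

section \<open>Finite generation of families of functions\<close>

lemma msum_append:
  "\<lbrakk>lmod M; \<And>i. i < a \<Longrightarrow> f i \<in> carrier M; \<And>i. i < b \<Longrightarrow> g i \<in> carrier M\<rbrakk> \<Longrightarrow>
    msum M (\<lambda>i. if i < a then f i else g (i - a)) (a + b) = msum M f a \<oplus>\<^bsub>M\<^esub> msum M g b"
proof (induction b)
  case 0
  then show ?case by (simp add: msum_closed) (rule msum_cong, simp)
next
  case (Suc b)
  then show ?case by (simp add: msum_closed lmod_ac(1))
qed

text \<open>Restriction to \<open>K\<close> maps \<open>F\<close> into a finite product of
  noetherian modules \<open>D k\<close>, and induction on \<open>K\<close> splits off one coordinate
  at a time. \<open>F\<close> stays a set of functions closed under \<open>v + r w\<close> and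
  compared on \<open>K\<close> only, so that sets of linear maps, or of families of maps, fit
  without being turned into modules.\<close>

lemma function_family_fg:
  fixes D :: "'k \<Rightarrow> ('a, 'y) module"
  assumes "finite K" "\<And>k. k \<in> K \<Longrightarrow> lmod (D k)" "\<And>k. k \<in> K \<Longrightarrow> noe (D k)"
    and "F \<noteq> {}" "\<And>v k. \<lbrakk>v \<in> F; k \<in> K\<rbrakk> \<Longrightarrow> v k \<in> carrier (D k)"
    and "\<And>v w r. \<lbrakk>v \<in> F; w \<in> F; r \<in> carrier R\<rbrakk> \<Longrightarrow> \<exists>z\<in>F. \<forall>k\<in>K. z k = v k \<oplus>\<^bsub>D k\<^esub> r \<odot>\<^bsub>D k\<^esub> w k"
  shows "\<exists>a vs. (\<forall>l<a. vs l \<in> F) \<and>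
    (\<forall>v\<in>F. \<exists>r. (\<forall>l<a. r l \<in> carrier R) \<and> (\<forall>k\<in>K. v k = msum (D k) (\<lambda>l. r l \<odot>\<^bsub>D k\<^esub> vs l k) a))"
  using assms
proof (induction K arbitrary: F rule: finite_induct)
  case empty
  then show ?case by (intro exI[of _ 0]) auto
next
  case (insert p K)
  let ?D = "D p"
  have Dl: "lmod (D k)" if "k \<in> insert p K" for k using insert.prems(1) that by simp
  have val: "v k \<in> carrier (D k)" if "v \<in> F" "k \<in> insert p K" for v k using insert.prems(4) that by blast
  have comb: "\<exists>z\<in>F. \<forall>k\<in>insert p K. z k = v k \<oplus>\<^bsub>D k\<^esub> r \<odot>\<^bsub>D k\<^esub> w k" if "v \<in> F" "w \<in> F" "r \<in> carrier R" for v w r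
    using insert.prems(5)[OF that] .
  obtain v0 where v0: "v0 \<in> F" using insert.prems(3) by auto
  \<comment> \<open>\<open>v0\<close> minus itself, a member of \<open>F\<close> vanishing on the
    whole index set.\<close>
  obtain n0 where n0: "n0 \<in> F" "\<And>k. k \<in> insert p K \<Longrightarrow> n0 k = \<zero>\<^bsub>D k\<^esub>"
    using comb[OF v0 v0, of "\<ominus> \<one>"] Dl val[OF v0] by (auto simp: smult_minus_one)
  have Hs: "sub ((\<lambda>v. v p) ` F) ?D"
  proof (rule subI)
    show "\<zero>\<^bsub>?D\<^esub> \<in> (\<lambda>v. v p) ` F" using n0(1) n0(2)[of p] by (auto simp: image_iff intro!: bexI[of _ n0])
    show "x \<oplus>\<^bsub>?D\<^esub> y \<in> (\<lambda>v. v p) ` F" if xy: "x \<in> (\<lambda>v. v p) ` F" "y \<in> (\<lambda>v. v p) ` F" for x y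
    proof -
      obtain v w where vw: "v \<in> F" "w \<in> F" "x = v p" "y = w p" using xy by auto
      obtain z where "z \<in> F" "z p = v p \<oplus>\<^bsub>?D\<^esub> \<one> \<odot>\<^bsub>?D\<^esub> w p" using comb[OF vw(1,2) one_closed] by auto
      then show ?thesis using vw Dl val[OF vw(2)] by (auto simp: image_iff intro!: bexI[of _ z])
    qed
    show "a \<odot>\<^bsub>?D\<^esub> x \<in> (\<lambda>v. v p) ` F" if ax: "a \<in> carrier R" "x \<in> (\<lambda>v. v p) ` F" for a x
    proof -
      obtain v where v: "v \<in> F" "x = v p" using ax by auto
      obtain z where "z \<in> F" "z p = n0 p \<oplus>\<^bsub>?D\<^esub> a \<odot>\<^bsub>?D\<^esub> v p" using comb[OF n0(1) v(1) ax(1)] by auto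
      then show ?thesis using v ax Dl n0(2) val[OF v(1)] by (auto simp: image_iff intro!: bexI[of _ z])
    qed
  qed (use Dl val in auto)
  have "fgs ?D ((\<lambda>v. v p) ` F)" using insert.prems(2) Hs by (simp add: noe_def)
  then obtain a s where s: "\<And>l. l < a \<Longrightarrow> s l \<in> (\<lambda>v. v p) ` F" "(\<lambda>v. v p) ` F \<subseteq> lspan ?D a s"
    by (auto simp: fgs_def)
  have "\<forall>l. \<exists>v. l < a \<longrightarrow> v \<in> F \<and> v p = s l" using s(1) by (metis imageE)
  then obtain vs where vs: "\<And>l. l < a \<Longrightarrow> vs l \<in> F" "\<And>l. l < a \<Longrightarrow> vs l p = s l" by metis
  \<comment> \<open>The kernel of evaluation at \<open>p\<close>, on which the coordinates in
    \<open>K\<close> decide.\<close>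
  define F' where "F' = {v \<in> F. v p = \<zero>\<^bsub>?D\<^esub>}"
  have "\<exists>b us. (\<forall>l<b. us l \<in> F') \<and>
    (\<forall>v\<in>F'. \<exists>r. (\<forall>l<b. r l \<in> carrier R) \<and> (\<forall>k\<in>K. v k = msum (D k) (\<lambda>l. r l \<odot>\<^bsub>D k\<^esub> us l k) b))"
  proof (rule insert.IH)
    show "F' \<noteq> {}" using n0 by (auto simp: F'_def)
    fix v w r assume vw: "v \<in> F'" "w \<in> F'" "r \<in> carrier R"
    then obtain z where "z \<in> F" "\<forall>k\<in>insert p K. z k = v k \<oplus>\<^bsub>D k\<^esub> r \<odot>\<^bsub>D k\<^esub> w k"
      using comb[of v w r] by (auto simp: F'_def)
    then show "\<exists>z\<in>F'. \<forall>k\<in>K. z k = v k \<oplus>\<^bsub>D k\<^esub> r \<odot>\<^bsub>D k\<^esub> w k"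
      using vw Dl by (intro bexI[of _ z]) (auto simp: F'_def)
  qed (use insert.prems in \<open>auto simp: F'_def\<close>)
  then obtain b us where us: "\<And>l. l < b \<Longrightarrow> us l \<in> F'"
    "\<And>v. v \<in> F' \<Longrightarrow> \<exists>r. (\<forall>l<b. r l \<in> carrier R) \<and> (\<forall>k\<in>K. v k = msum (D k) (\<lambda>l. r l \<odot>\<^bsub>D k\<^esub> us l k) b)"
    by metis
  \<comment> \<open>A linear combination of the \<open>vs l\<close> is subtracted term by term, as
    \<open>F\<close> is known to be closed for one summand at a time only.\<close>
  have diff: "\<exists>z\<in>F. \<forall>k\<in>insert p K. z k \<oplus>\<^bsub>D k\<^esub> msum (D k) (\<lambda>l. r l \<odot>\<^bsub>D k\<^esub> vs l k) c = v k"
    if "v \<in> F" "\<forall>l<a. r l \<in> carrier R" "c \<le> a" for v r c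
    using that(3)
  proof (induction c)
    case 0
    then show ?case using that Dl val by auto
  next
    case (Suc c)
    then obtain z where z: "z \<in> F" "\<And>k. k \<in> insert p K \<Longrightarrow> z k \<oplus>\<^bsub>D k\<^esub> msum (D k) (\<lambda>l. r l \<odot>\<^bsub>D k\<^esub> vs l k) c = v k"
      by auto
    have c: "c < a" "r c \<in> carrier R" using Suc that by auto
    obtain z' where z': "z' \<in> F" "\<And>k. k \<in> insert p K \<Longrightarrow> z' k = z k \<oplus>\<^bsub>D k\<^esub> (\<ominus> r c) \<odot>\<^bsub>D k\<^esub> vs c k"
      using comb[OF z(1) vs(1)[OF c(1)], of "\<ominus> r c"] c(2) by auto
    show ?case
    proof (intro bexI[of _ z'] ballI z'(1))
      fix k assume k: "k \<in> insert p K"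
      have m: "msum (D k) (\<lambda>l. r l \<odot>\<^bsub>D k\<^esub> vs l k) c \<in> carrier (D k)"
        using Suc.prems that(2) val[OF vs(1) k] Dl[OF k] by (intro msum_closed) auto
      show "z' k \<oplus>\<^bsub>D k\<^esub> msum (D k) (\<lambda>l. r l \<odot>\<^bsub>D k\<^esub> vs l k) (Suc c) = v k"
        using z'(2)[OF k] z(2)[OF k] Dl[OF k] val[OF z(1) k] val[OF vs(1)[OF c(1)] k] c(2) m
        by (simp add: smult_minus lmod_ac)
    qed
  qed
  define ws where "ws l = (if l < b then us l else vs (l - b))" for l
  show ?case
  proof (intro exI[of _ "b + a"] exI[of _ ws] conjI allI impI ballI)
    fix l assume "l < b + a" then show "ws l \<in> F" using us(1)[of l] vs(1)[of "l - b"] by (auto simp: ws_def F'_def)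
  next
    fix v assume v: "v \<in> F"
    then have "v p \<in> lspan ?D a s" using s(2) by auto
    then obtain r where r: "\<forall>l<a. r l \<in> carrier R" "v p = msum ?D (\<lambda>l. r l \<odot>\<^bsub>?D\<^esub> s l) a" by (rule lspanE)
    obtain z where z: "z \<in> F" "\<And>k. k \<in> insert p K \<Longrightarrow> z k \<oplus>\<^bsub>D k\<^esub> msum (D k) (\<lambda>l. r l \<odot>\<^bsub>D k\<^esub> vs l k) a = v k"
      using diff[OF v r(1) order_refl] by auto
    have m: "msum (D k) (\<lambda>l. r l \<odot>\<^bsub>D k\<^esub> vs l k) a \<in> carrier (D k)" if "k \<in> insert p K" for k
      using r(1) val[OF vs(1) that] Dl[OF that] by (intro msum_closed) auto
    have e: "msum ?D (\<lambda>l. r l \<odot>\<^bsub>?D\<^esub> s l) a = msum ?D (\<lambda>l. r l \<odot>\<^bsub>?D\<^esub> vs l p) a"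
      using vs(2) by (intro msum_cong) simp
    have "z p \<oplus>\<^bsub>?D\<^esub> v p = \<zero>\<^bsub>?D\<^esub> \<oplus>\<^bsub>?D\<^esub> v p" using z(2)[of p] r(2) e Dl[of p] val[OF v, of p] by simp
    then have "z p = \<zero>\<^bsub>?D\<^esub>" using Dl[of p] val[OF v, of p] val[OF z(1), of p] lmod_simps(16)[of ?D "v p" "z p" "\<zero>\<^bsub>?D\<^esub>"] by simp
    then have zF: "z \<in> F'" using z(1) by (simp add: F'_def)
    obtain q where q: "\<forall>l<b. q l \<in> carrier R" "\<And>k. k \<in> K \<Longrightarrow> z k = msum (D k) (\<lambda>l. q l \<odot>\<^bsub>D k\<^esub> us l k) b"
      using us(2)[OF zF] by auto
    have usp: "l < b \<Longrightarrow> us l p = \<zero>\<^bsub>?D\<^esub>" "l < b \<Longrightarrow> us l \<in> F" for l using us(1)[of l] by (auto simp: F'_def)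
    have zk: "z k = msum (D k) (\<lambda>l. q l \<odot>\<^bsub>D k\<^esub> us l k) b" if "k \<in> insert p K" for k
    proof (cases "k \<in> K")
      case False
      then have "k = p" using that by simp
      then show ?thesis using \<open>z p = \<zero>\<^bsub>?D\<^esub>\<close> usp(1) q(1) Dl[of p] by (simp add: msum_zero)
    qed (rule q)
    show "\<exists>r. (\<forall>l<b + a. r l \<in> carrier R) \<and> (\<forall>k\<in>insert p K. v k = msum (D k) (\<lambda>l. r l \<odot>\<^bsub>D k\<^esub> ws l k) (b + a))"
    proof (intro exI[of _ "\<lambda>l. if l < b then q l else r (l - b)"] conjI allI impI ballI)
      fix k assume k: "k \<in> insert p K"
      have "msum (D k) (\<lambda>l. (if l < b then q l else r (l - b)) \<odot>\<^bsub>D k\<^esub> ws l k) (b + a) =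
        msum (D k) (\<lambda>l. if l < b then q l \<odot>\<^bsub>D k\<^esub> us l k else r (l - b) \<odot>\<^bsub>D k\<^esub> vs (l - b) k) (b + a)"
        by (intro msum_cong) (auto simp: ws_def)
      also have "\<dots> = msum (D k) (\<lambda>l. q l \<odot>\<^bsub>D k\<^esub> us l k) b \<oplus>\<^bsub>D k\<^esub> msum (D k) (\<lambda>l. r l \<odot>\<^bsub>D k\<^esub> vs l k) a"
        using q(1) r(1) Dl[OF k] val[OF usp(2) k] val[OF vs(1) k] by (intro msum_append) auto
      also have "\<dots> = v k" using zk[OF k] z(2)[OF k] by simp
      finally show "v k = msum (D k) (\<lambda>l. (if l < b then q l else r (l - b)) \<odot>\<^bsub>D k\<^esub> ws l k) (b + a)" by simp
    qed (use q r in auto)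
  qed
qed

end

section \<open>Modules over an Artin algebra\<close>

lemma restrict_scalars_simps [simp]:
  "carrier (restrict_scalars \<phi> M) = carrier M" "\<zero>\<^bsub>restrict_scalars \<phi> M\<^esub> = \<zero>\<^bsub>M\<^esub>"
  "x \<oplus>\<^bsub>restrict_scalars \<phi> M\<^esub> y = x \<oplus>\<^bsub>M\<^esub> y" "a \<odot>\<^bsub>restrict_scalars \<phi> M\<^esub> x = \<phi> a \<odot>\<^bsub>M\<^esub> x"
  by (simp_all add: restrict_scalars_def mk_module_def)

lemma msum_restrict_scalars [simp]: "msum (restrict_scalars \<phi> M) f k = msum M f k"
  by (induction k) auto

locale artin =
  fixes R :: "'r ring" and \<Lambda> :: "'a ring" and \<phi> :: "'r \<Rightarrow> 'a"
  assumes artin: "artin_algebra R \<Lambda> \<phi>"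

sublocale artin \<subseteq> L: rng \<Lambda>
  using artin by (intro rng.intro) (simp add: artin_algebra_def)

sublocale artin \<subseteq> R: cring R
  using artin by (simp only: artin_algebra_def artinian_cring_def)

sublocale artin \<subseteq> R: rng R
  by (intro rng.intro R.ring_axioms)

context rng begin

lemma sub_regular_iff_ideal:
  assumes comm: "\<And>a b. \<lbrakk>a \<in> carrier R; b \<in> carrier R\<rbrakk> \<Longrightarrow> a \<otimes> b = b \<otimes> a"
  shows "sub I (regular_module R) \<longleftrightarrow> ideal I R"
proof
  assume I: "sub I (regular_module R)"
  note i = subD[OF I]
  have neg: "\<ominus> x \<in> I" if "x \<in> I" for x
    using i(5)[of "\<ominus> \<one>" x] i(2)[OF that] that by (simp add: l_minus)
  show "ideal I R"
  proof (rule idealI[OF ring_axioms])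
    show "subgroup I (add_monoid R)"
      using i neg by (intro subgroup.intro) (auto simp: a_inv_def)
    show "x \<otimes> a \<in> I" if "a \<in> I" "x \<in> carrier R" for a x using i(5)[of x a] that by simp
    then show "a \<otimes> x \<in> I" if "a \<in> I" "x \<in> carrier R" for a x using i(2)[of a] comm[of a x] that by simp
  qed
next
  assume "ideal I R"
  then interpret ideal I R .
  show "sub I (regular_module R)" by (rule subI[OF lmod_regular]) (auto simp: a_subset I_l_closed)
qed

end

context artin begin

abbreviation rs :: "('a, 'b) module \<Rightarrow> ('r, 'b) module" where "rs \<equiv> restrict_scalars \<phi>"

lemma phi [simp]:
  "r \<in> carrier R \<Longrightarrow> \<phi> r \<in> carrier \<Lambda>"
  "\<lbrakk>r \<in> carrier R; s \<in> carrier R\<rbrakk> \<Longrightarrow> \<phi> (r \<oplus>\<^bsub>R\<^esub> s) = \<phi> r \<oplus>\<^bsub>\<Lambda>\<^esub> \<phi> s"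
  "\<lbrakk>r \<in> carrier R; s \<in> carrier R\<rbrakk> \<Longrightarrow> \<phi> (r \<otimes>\<^bsub>R\<^esub> s) = \<phi> r \<otimes>\<^bsub>\<Lambda>\<^esub> \<phi> s"
  "\<phi> \<one>\<^bsub>R\<^esub> = \<one>\<^bsub>\<Lambda>\<^esub>"
  using artin by (auto simp: artin_algebra_def ring_hom_def)

lemma phi_central: "\<lbrakk>r \<in> carrier R; a \<in> carrier \<Lambda>\<rbrakk> \<Longrightarrow> \<phi> r \<otimes>\<^bsub>\<Lambda>\<^esub> a = a \<otimes>\<^bsub>\<Lambda>\<^esub> \<phi> r"
  using artin by (auto simp: artin_algebra_def)

lemma phi_zero [simp]: "\<phi> \<zero>\<^bsub>R\<^esub> = \<zero>\<^bsub>\<Lambda>\<^esub>"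
proof -
  have "\<phi> \<zero>\<^bsub>R\<^esub> \<oplus>\<^bsub>\<Lambda>\<^esub> \<phi> \<zero>\<^bsub>R\<^esub> = \<phi> \<zero>\<^bsub>R\<^esub>" using phi(2)[of "\<zero>\<^bsub>R\<^esub>" "\<zero>\<^bsub>R\<^esub>"] by simp
  then show ?thesis using L.add.r_cancel_one by simp
qed

lemma rs_lmod: "L.lmod M \<Longrightarrow> R.lmod (rs M)"
  by (rule R.left_moduleI) (auto simp: L.lmod_ac L.smult_distr)

lemma rs_sub: "\<lbrakk>L.lmod M; L.sub H M\<rbrakk> \<Longrightarrow> R.sub H (rs M)"
  using L.subD[of H M] by (intro R.subI rs_lmod) auto

text \<open>The image of \<open>\<phi>\<close> is central, so scalars from \<open>R\<close> act by
  \<open>\<Lambda>\<close>-linear maps. This is the source of the \<open>R\<close>-module structure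
  on all Hom sets.\<close>

lemma central_lin: "\<lbrakk>L.lmod M; r \<in> carrier R\<rbrakk> \<Longrightarrow> L.lin M M (\<lambda>x. \<phi> r \<odot>\<^bsub>M\<^esub> x)"
  by (rule L.linI) (auto simp: L.smult_distr phi_central simp flip: L.smult_distr(3))

lemma lin_central: "\<lbrakk>L.lin M N f; L.lmod N; r \<in> carrier R\<rbrakk> \<Longrightarrow> L.lin M N (\<lambda>x. \<phi> r \<odot>\<^bsub>N\<^esub> f x)"
  by (rule L.lin_comp[OF _ central_lin])

lemma dcc_R: "R.dcc (regular_module R)"
proof (rule R.dccs_chainI)
  fix G :: "nat \<Rightarrow> 'r set" assume "\<And>k. R.sub (G k) (regular_module R)" "\<And>k. G (Suc k) \<subseteq> G k"
  then have "(\<forall>k. ideal (G k) R) \<and> (\<forall>k. G (Suc k) \<subseteq> G k)"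
    using R.sub_regular_iff_ideal[OF R.m_comm] by auto
  then show "\<exists>k. \<forall>m\<ge>k. G m = G k" using artin by (auto simp: artin_algebra_def artinian_cring_def)
qed

lemma R_noe: "V \<in> fg_mod R \<Longrightarrow> R.noe V"
  by (rule R.artinian_noe[OF R.m_comm dcc_R R.fg_modD(1) R.fg_dcc[OF _ dcc_R]])

lemma rs_fg:
  assumes "M \<in> fg_mod \<Lambda>" shows "rs M \<in> fg_mod R"
proof -
  note M = L.fg_modD(1)[OF assms]
  obtain k s where s: "\<And>j. j < k \<Longrightarrow> s j \<in> carrier M" "carrier M \<subseteq> L.lspan M k s"
    using L.fg_modD(2)[OF assms] unfolding L.fgs_def by metis
  obtain S where S: "finite S" "S \<subseteq> carrier \<Lambda>"
    "\<And>H. R.sub H (rs (regular_module \<Lambda>)) \<Longrightarrow> S \<subseteq> H \<Longrightarrow> H = carrier \<Lambda>"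
    using artin unfolding artin_algebra_def finitely_generated_def by auto
  \<comment> \<open>Products of generators of \<open>\<Lambda>\<close> over \<open>R\<close> with
    generators of \<open>M\<close> over \<open>\<Lambda>\<close>.\<close>
  let ?T = "(\<lambda>(j, a). a \<odot>\<^bsub>M\<^esub> s j) ` ({..<k} \<times> S)"
  have "finitely_generated R (rs M)" unfolding finitely_generated_def
  proof (intro exI[of _ ?T] conjI allI impI)
    show "?T \<subseteq> carrier (rs M)" using S(2) s(1) M by auto
    fix H assume "R.sub H (rs M) \<and> ?T \<subseteq> H"
    then have H: "R.sub H (rs M)" "?T \<subseteq> H" by auto
    have *: "a \<odot>\<^bsub>M\<^esub> s j \<in> H" if j: "j < k" and a: "a \<in> carrier \<Lambda>" for j a
    proof -
      have l: "R.lin (rs (regular_module \<Lambda>)) (rs M) (\<lambda>a. a \<odot>\<^bsub>M\<^esub> s j)"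
        by (rule R.linI) (use s(1)[OF j] M in \<open>auto simp: L.smult_distr\<close>)
      have "{x \<in> carrier \<Lambda>. x \<odot>\<^bsub>M\<^esub> s j \<in> H} = carrier \<Lambda>"
        using R.sub_preimage[OF l rs_lmod[OF L.lmod_regular] rs_lmod[OF M] H(1)] H(2) S(2) j
        by (intro S(3)) auto
      then show ?thesis using a by auto
    qed
    show "H = carrier (rs M)"
    proof
      show "carrier (rs M) \<subseteq> H"
      proof
        fix x assume "x \<in> carrier (rs M)"
        then have "x \<in> L.lspan M k s" using s(2) by auto
        then obtain r where "\<forall>i<k. r i \<in> carrier \<Lambda>" "x = msum M (\<lambda>i. r i \<odot>\<^bsub>M\<^esub> s i) k" by (rule L.lspanE)
        then show "x \<in> H" using R.msum_sub[OF H(1), of k "\<lambda>i. r i \<odot>\<^bsub>M\<^esub> s i"] * by simp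
      qed
    qed (use R.subD(1)[OF H(1)] in simp)
  qed (use S(1) in simp)
  then show ?thesis using rs_lmod[OF M] by (simp add: fg_mod_def)
qed

text \<open>Every \<open>\<Lambda>\<close>-submodule is an \<open>R\<close>-submodule, so both chain
  conditions are inherited from \<open>R\<close>.\<close>

lemma L_dcc: assumes "M \<in> fg_mod \<Lambda>" shows "L.dcc M"
proof -
  have "R.dcc (rs M)" by (rule R.fg_dcc[OF rs_fg[OF assms] dcc_R])
  then show ?thesis unfolding R.dccs_def L.dccs_def
    using rs_sub[OF L.fg_modD(1)[OF assms]] by simp
qed

lemma L_noe: assumes M: "M \<in> fg_mod \<Lambda>" shows "L.noe M"
  unfolding L.noe_def
proof (intro allI impI)
  fix H assume H: "L.sub H M"
  note l = L.fg_modD(1)[OF M]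
  have "R.fgs (rs M) H" using R_noe[OF rs_fg[OF M]] rs_sub[OF l H] by (simp add: R.noe_def)
  then obtain S where "finite S" "S \<subseteq> H" "\<forall>G. R.sub G (rs M) \<and> S \<subseteq> G \<longrightarrow> H \<subseteq> G"
    unfolding R.fgs_iff_finite[OF rs_lmod[OF l] rs_sub[OF l H]] by (elim exE conjE)
  then show "L.fgs M H" unfolding L.fgs_iff_finite[OF l H] using rs_sub[OF l] by metis
qed

lemma fg_sub: "\<lbrakk>M \<in> fg_mod \<Lambda>; L.sub H M\<rbrakk> \<Longrightarrow> M\<lparr>carrier := H\<rparr> \<in> fg_mod \<Lambda>"
  using L_noe[of M] L.lmod_sub[of M H] L.fg_modD(1)[of M] by (intro L.fg_modI) (auto simp: L.noe_def)

end

section \<open>Free modules, transport of structure and projectives\<close>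

context rng begin

lemma fg_image:
  assumes "M \<in> fg_mod R" "lin M N f" "lmod N" "f ` carrier M = carrier N" shows "N \<in> fg_mod R"
  using fgs_image[OF assms(2) fg_modD(1)[OF assms(1)] assms(3) sub_carrier] fg_modD[OF assms(1)] assms
  by (intro fg_modI) auto

definition unit_vec :: "nat \<Rightarrow> nat \<Rightarrow> nat \<Rightarrow> 'a" where
  "unit_vec k j = (\<lambda>i\<in>{..<k}. if i = j then \<one> else \<zero>)"

lemma unit_vec_closed [simp]: "unit_vec k j \<in> {..<k} \<rightarrow>\<^sub>E carrier R"
  by (auto simp: unit_vec_def)

lemma msum_power:
  assumes "lmod M" "\<And>l. l < m \<Longrightarrow> f l \<in> carrier (direct_power M k)"
  shows "msum (direct_power M k) f m = (\<lambda>i\<in>{..<k}. msum M (\<lambda>l. f l i) m)"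
  using assms(2)
proof (induction m)
  case (Suc m)
  then show ?case by (auto simp: fun_eq_iff)
qed simp

lemma power_elem:
  assumes "u \<in> carrier (direct_power (regular_module R) k)"
  shows "u = msum (direct_power (regular_module R) k) (\<lambda>j. u j \<odot>\<^bsub>direct_power (regular_module R) k\<^esub> unit_vec k j) k"
proof -
  have u: "u i \<in> carrier R" if "i < k" for i using assms that by auto
  have "msum (direct_power (regular_module R) k) (\<lambda>j. u j \<odot>\<^bsub>direct_power (regular_module R) k\<^esub> unit_vec k j) k
    = (\<lambda>i\<in>{..<k}. msum (regular_module R) (\<lambda>j. (u j \<odot>\<^bsub>direct_power (regular_module R) k\<^esub> unit_vec k j) i) k)"
    using u by (intro msum_power lmod_regular) (auto simp: unit_vec_def)
  also have "\<dots> = (\<lambda>i\<in>{..<k}. u i)"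
  proof (rule restrict_ext)
    fix i assume i: "i \<in> {..<k}"
    have "msum (regular_module R) (\<lambda>j. (u j \<odot>\<^bsub>direct_power (regular_module R) k\<^esub> unit_vec k j) i) k
      = msum (regular_module R) (\<lambda>j. if j = i then u i else \<zero>\<^bsub>regular_module R\<^esub>) k"
      using i u by (intro msum_cong) (auto simp: unit_vec_def)
    then show "msum (regular_module R) (\<lambda>j. (u j \<odot>\<^bsub>direct_power (regular_module R) k\<^esub> unit_vec k j) i) k = u i"
      using i u by (simp only: msum_delta[OF lmod_regular, of i k "u i"]) (simp add: msum_delta[OF lmod_regular, of i k "u i", simplified])
  qed
  also have "\<dots> = u" using assms by (auto simp: PiE_def extensional_restrict)
  finally show ?thesis by simp
qed

lemma lin_comb_map:
  assumes "lmod M" "\<And>i. i < k \<Longrightarrow> s i \<in> carrier M"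
  shows "lin (direct_power (regular_module R) k) M (\<lambda>u. msum M (\<lambda>i. u i \<odot>\<^bsub>M\<^esub> s i) k)"
proof (rule lin_msum[OF lmod_power[OF lmod_regular] assms(1)])
  fix i assume i: "i < k"
  show "lin (direct_power (regular_module R) k) M (\<lambda>u. u i \<odot>\<^bsub>M\<^esub> s i)"
  proof (rule linI)
    fix x y a assume x: "x \<in> carrier (direct_power (regular_module R) k)"
    have xi: "x i \<in> carrier R" using x i by auto
    show "x i \<odot>\<^bsub>M\<^esub> s i \<in> carrier M" using xi assms i by simp
    { assume y: "y \<in> carrier (direct_power (regular_module R) k)"
      have yi: "y i \<in> carrier R" using y i by auto
      show "(x \<oplus>\<^bsub>direct_power (regular_module R) k\<^esub> y) i \<odot>\<^bsub>M\<^esub> s i = x i \<odot>\<^bsub>M\<^esub> s i \<oplus>\<^bsub>M\<^esub> y i \<odot>\<^bsub>M\<^esub> s i"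
        using xi yi assms i by (simp add: smult_distr) }
    { assume a: "a \<in> carrier R"
      show "(a \<odot>\<^bsub>direct_power (regular_module R) k\<^esub> x) i \<odot>\<^bsub>M\<^esub> s i = a \<odot>\<^bsub>M\<^esub> (x i \<odot>\<^bsub>M\<^esub> s i)"
        using xi a assms i by (simp add: smult_distr) }
  qed
qed

lemma fg_surj:
  assumes "M \<in> fg_mod R"
  obtains k p where "lin (direct_power (regular_module R) k) M p"
    "p ` carrier (direct_power (regular_module R) k) = carrier M"
proof -
  note M = fg_modD(1)[OF assms]
  obtain k s where s: "\<And>j. j < k \<Longrightarrow> s j \<in> carrier M" "carrier M \<subseteq> lspan M k s"
    using fg_modD(2)[OF assms] unfolding fgs_def by metis
  let ?p = "\<lambda>u. msum M (\<lambda>i. u i \<odot>\<^bsub>M\<^esub> s i) k"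
  have l: "lin (direct_power (regular_module R) k) M ?p" by (rule lin_comb_map[OF M s(1)])
  moreover have "?p ` carrier (direct_power (regular_module R) k) = carrier M"
  proof
    show "?p ` carrier (direct_power (regular_module R) k) \<subseteq> carrier M" using linD(1)[OF l] by blast
    show "carrier M \<subseteq> ?p ` carrier (direct_power (regular_module R) k)"
    proof
      fix x assume "x \<in> carrier M"
      then obtain r where r: "\<forall>i<k. r i \<in> carrier R" "x = msum M (\<lambda>i. r i \<odot>\<^bsub>M\<^esub> s i) k"
        using s(2) lspanE by (metis subsetD)
      then have "x = ?p (restrict r {..<k})" by (auto intro!: msum_cong)
      moreover have "restrict r {..<k} \<in> carrier (direct_power (regular_module R) k)" using r by simp
      ultimately show "x \<in> ?p ` carrier (direct_power (regular_module R) k)" by blast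
    qed
  qed
  ultimately show ?thesis using that by blast
qed

lemma power_fg: "direct_power (regular_module R) k \<in> fg_mod R"
proof (rule fg_modI[OF lmod_power[OF lmod_regular]])
  show "fgs (direct_power (regular_module R) k) (carrier (direct_power (regular_module R) k))" unfolding fgs_def
  proof (intro exI[of _ k] exI[of _ "unit_vec k"] conjI allI impI subsetI)
    fix u assume u: "u \<in> carrier (direct_power (regular_module R) k)"
    then show "u \<in> lspan (direct_power (regular_module R) k) k (unit_vec k)"
      unfolding lspan_def using power_elem[OF u] by auto
  qed simp
qed

text \<open>Module structure carried along an injection of the carrier. It moves modules to the
  element types that \<open>Kb_proj\<close>, \<open>fgc\<close> and the test modules of
  \<open>injective_module\<close> prescribe.\<close>

definition transport :: "('b \<Rightarrow> 'c) \<Rightarrow> ('a, 'b) module \<Rightarrow> ('a, 'c) module" where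
  "transport e M = (let g = inv_into (carrier M) e in
     mk_module (e ` carrier M) (e \<zero>\<^bsub>M\<^esub>) (\<lambda>x y. e (g x \<oplus>\<^bsub>M\<^esub> g y)) (\<lambda>a x. e (a \<odot>\<^bsub>M\<^esub> g x)))"

lemma transport:
  assumes M: "lmod M" and e: "inj_on e (carrier M)"
  shows "lmod (transport e M)" "lin M (transport e M) e" "bij_betw e (carrier M) (carrier (transport e M))"
proof -
  have s [simp]: "carrier (transport e M) = e ` carrier M" "\<zero>\<^bsub>transport e M\<^esub> = e \<zero>\<^bsub>M\<^esub>"
    "\<And>x y. \<lbrakk>x \<in> carrier M; y \<in> carrier M\<rbrakk> \<Longrightarrow> e x \<oplus>\<^bsub>transport e M\<^esub> e y = e (x \<oplus>\<^bsub>M\<^esub> y)"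
    "\<And>a x. x \<in> carrier M \<Longrightarrow> a \<odot>\<^bsub>transport e M\<^esub> e x = e (a \<odot>\<^bsub>M\<^esub> x)"
    using e by (simp_all add: transport_def mk_module_def Let_def)
  show "lmod (transport e M)"
    by (rule left_moduleI) (use M in \<open>auto simp: lmod_ac smult_distr\<close>)
  show "lin M (transport e M) e" by (rule linI) auto
  show "bij_betw e (carrier M) (carrier (transport e M))" using e by (simp add: bij_betw_def)
qed

text \<open>A set-theoretic section of a surjection from a free module is injective; linearity of
  the section is immaterial, because the structure is transported along it.\<close>

lemma fg_transport:
  assumes "M \<in> fg_mod R"
  obtains e :: "'b \<Rightarrow> nat \<Rightarrow> 'a" where "inj_on e (carrier M)"
proof -
  obtain k p where p: "lin (direct_power (regular_module R) k) M p"
    "p ` carrier (direct_power (regular_module R) k) = carrier M"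
    using fg_surj[OF assms] by metis
  show ?thesis using that[OF inj_on_inv_into[of "carrier M" p]] p(2) by auto
qed

lemma transport_fg: "\<lbrakk>M \<in> fg_mod R; inj_on e (carrier M)\<rbrakk> \<Longrightarrow> transport e M \<in> fg_mod R"
  using fg_image[OF _ transport(2) transport(1)] transport(3) fg_modD(1) by (metis bij_betw_imp_surj_on)

lemma direct_summand_power:
  assumes M: "lmod M" shows "direct_summand R (direct_power M k) (direct_power M k)"
  unfolding direct_summand_def mod_iso_def
\<comment> \<open>The complement is the zeroth power, whose only element is the function that is
  \<open>undefined\<close> everywhere.\<close>
proof (intro exI[of _ "direct_power M 0"] conjI bexI)
  let ?P = "direct_power M k" and ?S = "direct_sum (direct_power M k) (direct_power M 0)"
  show "lmod (direct_power M 0)" by (rule lmod_power[OF M])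
  have c: "carrier ?S = carrier ?P \<times> {\<lambda>_. undefined}" by auto
  show "restrict fst (carrier ?S) \<in> mod_hom R ?S ?P"
    by (rule restrict_mod_hom[OF linI lmod_direct_sum[OF lmod_power[OF M] lmod_power[OF M]]])
      (simp_all add: mem_Times_iff)
  show "bij_betw (restrict fst (carrier ?S)) (carrier ?S) (carrier ?P)"
    unfolding c by (auto simp: bij_betw_def inj_on_def image_iff)
qed

lemma power_fg_proj: "direct_power (regular_module R) k \<in> fg_proj R"
  unfolding fg_proj_def using power_fg direct_summand_power[OF lmod_regular] by blast

lemma summandE:
  assumes "direct_summand R P F" "lmod P" "lmod F"
  obtains i p where "lin P F i" "lin F P p" "\<And>x. x \<in> carrier P \<Longrightarrow> p (i x) = x"
proof -
  obtain N :: "('a, 'c) module" and h where N: "lmod N" and h: "h \<in> mod_hom R (direct_sum P N) F"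
    "bij_betw h (carrier (direct_sum P N)) (carrier F)"
    using assms(1) by (auto simp: direct_summand_def mod_iso_def)
  let ?g = "inv_into (carrier (direct_sum P N)) h"
  have S: "lmod (direct_sum P N)" by (rule lmod_direct_sum[OF assms(2) N])
  have g: "lin F (direct_sum P N) ?g" by (rule lin_inverse[OF mod_homD[OF h(1)] h(2) S assms(3)])
  have i: "lin P (direct_sum P N) (\<lambda>x. (x, \<zero>\<^bsub>N\<^esub>))" by (rule linI) (use N in auto)
  have f: "lin (direct_sum P N) P fst" by (rule linI) auto
  show ?thesis
  proof
    show "lin P F (\<lambda>x. h (x, \<zero>\<^bsub>N\<^esub>))" by (rule lin_comp[OF i mod_homD[OF h(1)]])
    show "lin F P (\<lambda>x. fst (?g x))" by (rule lin_comp[OF g f])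
    show "fst (?g (h (x, \<zero>\<^bsub>N\<^esub>))) = x" if "x \<in> carrier P" for x
      using h(2) that N by (simp add: bij_betw_def)
  qed
qed

lemma fg_projD: "P \<in> fg_proj R \<Longrightarrow> P \<in> fg_mod R" "P \<in> fg_proj R \<Longrightarrow> lmod P"
  by (auto simp: fg_proj_def fg_modD)

text \<open>The dual basis lemma: the \<open>fs i\<close> are the coordinates of an embedding into a
  free module, the \<open>xs i\<close> the images of the unit vectors under a retraction. It
  replaces the free module in lifting arguments and in the computations with the transpose.\<close>

lemma dual_basis:
  assumes "P \<in> fg_proj R"
  obtains k xs fs where "\<And>i. i < k \<Longrightarrow> xs i \<in> carrier P" "\<And>i. i < k \<Longrightarrow> lin P (regular_module R) (fs i)"
    "\<And>x. x \<in> carrier P \<Longrightarrow> x = msum P (\<lambda>i. fs i x \<odot>\<^bsub>P\<^esub> xs i) k"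
proof -
  note P = fg_projD(2)[OF assms]
  obtain k where k: "direct_summand R P (direct_power (regular_module R) k)"
    using assms by (auto simp: fg_proj_def)
  let ?F = "direct_power (regular_module R) k"
  note F = lmod_power[OF lmod_regular, of k]
  obtain i p where ip: "lin P ?F i" "lin ?F P p" "\<And>x. x \<in> carrier P \<Longrightarrow> p (i x) = x"
    using summandE[OF k P F] by metis
  show ?thesis
  proof
    show "p (unit_vec k j) \<in> carrier P" for j using linD(1)[OF ip(2), of "unit_vec k j"] by simp
    show "lin P (regular_module R) (\<lambda>x. i x j)" if "j < k" for j
    proof (rule lin_comp[OF ip(1)])
      show "lin ?F (regular_module R) (\<lambda>u. u j)" by (rule linI) (use that in auto)
    qed
    fix x assume x: "x \<in> carrier P"
    have ix: "i x \<in> carrier ?F" by (rule linD(1)[OF ip(1) x])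
    then have ixj: "i x j \<in> carrier R" if "j < k" for j using that by auto
    have c: "i x j \<odot>\<^bsub>?F\<^esub> unit_vec k j \<in> carrier ?F" if "j < k" for j
      using F ixj[OF that] by (intro lmod_simps(5)) auto
    have "x = p (msum ?F (\<lambda>j. i x j \<odot>\<^bsub>?F\<^esub> unit_vec k j) k)" using power_elem[OF ix] ip(3)[OF x] by simp
    also have "\<dots> = msum P (\<lambda>j. p (i x j \<odot>\<^bsub>?F\<^esub> unit_vec k j)) k" by (rule msum_lin[OF ip(2) F P c])
    also have "\<dots> = msum P (\<lambda>j. i x j \<odot>\<^bsub>P\<^esub> p (unit_vec k j)) k"
      using linD(3)[OF ip(2)] ixj by (intro msum_cong) (simp del: direct_power_simps(4))
    finally show "x = msum P (\<lambda>j. i x j \<odot>\<^bsub>P\<^esub> p (unit_vec k j)) k" .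
  qed
qed

text \<open>Only the finitely many values \<open>f (xs i)\<close> have to be lifted; the lifts are
  then recombined with the coordinates \<open>fs i\<close>. Accordingly \<open>e\<close> has to
  reach the values of \<open>f\<close>, not all of \<open>B\<close>.\<close>

lemma proj_lift:
  assumes P: "P \<in> fg_proj R" and A: "lmod A" and B: "lmod B" and e: "lin A B e" and f: "lin P B f"
    and sur: "\<And>x. x \<in> carrier P \<Longrightarrow> \<exists>a\<in>carrier A. e a = f x"
  obtains g where "lin P A g" "\<And>x. x \<in> carrier P \<Longrightarrow> e (g x) = f x"
proof -
  note Pl = fg_projD(2)[OF P]
  obtain k xs fs where d: "\<And>i. i < k \<Longrightarrow> xs i \<in> carrier P" "\<And>i. i < k \<Longrightarrow> lin P (regular_module R) (fs i)"
    "\<And>x. x \<in> carrier P \<Longrightarrow> x = msum P (\<lambda>i. fs i x \<odot>\<^bsub>P\<^esub> xs i) k"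
    by (rule dual_basis[OF P]) (rule that)
  have "\<forall>i. \<exists>a. i < k \<longrightarrow> a \<in> carrier A \<and> e a = f (xs i)" using sur d(1) by metis
  then obtain as where as: "\<And>i. i < k \<Longrightarrow> as i \<in> carrier A" "\<And>i. i < k \<Longrightarrow> e (as i) = f (xs i)" by metis
  have fc: "fs i x \<in> carrier R" if "i < k" "x \<in> carrier P" for i x using linD(1)[OF d(2)] that by simp
  show ?thesis
  proof
    show "lin P A (\<lambda>x. msum A (\<lambda>i. fs i x \<odot>\<^bsub>A\<^esub> as i) k)"
    proof (rule lin_msum[OF Pl A])
      fix i assume i: "i < k"
      show "lin P A (\<lambda>x. fs i x \<odot>\<^bsub>A\<^esub> as i)"
        by (rule linI) (use A as(1)[OF i] fc[OF i] linD[OF d(2)[OF i]] in \<open>auto simp: smult_distr\<close>)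
    qed
    fix x assume x: "x \<in> carrier P"
    have "e (msum A (\<lambda>i. fs i x \<odot>\<^bsub>A\<^esub> as i) k) = msum B (\<lambda>i. fs i x \<odot>\<^bsub>B\<^esub> f (xs i)) k"
      using msum_lin[OF e A B, of k "\<lambda>i. fs i x \<odot>\<^bsub>A\<^esub> as i"] as fc x A linD(3)[OF e]
      by (auto intro!: msum_cong)
    also have "\<dots> = f (msum P (\<lambda>i. fs i x \<odot>\<^bsub>P\<^esub> xs i) k)"
      using msum_lin[OF f Pl B, of k "\<lambda>i. fs i x \<odot>\<^bsub>P\<^esub> xs i"] d(1) fc x Pl linD(3)[OF f]
      by (auto intro!: msum_cong)
    finally show "e (msum A (\<lambda>i. fs i x \<odot>\<^bsub>A\<^esub> as i) k) = f x" using d(3)[OF x] by simp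
  qed
qed

end

section \<open>Projective covers and minimal resolutions\<close>

context rng begin

lemma funpow_lin: "lin M M f \<Longrightarrow> lin M M (f ^^ j)"
  by (induction j) (auto simp: lin_id[unfolded id_def[symmetric]] id_def lin_def)

text \<open>The kernels of the powers of \<open>f\<close> become stationary, at \<open>m\<close>
  say. An element of the kernel is the image of some \<open>y\<close> under the power
  \<open>m\<close>, which puts \<open>y\<close> into the kernel of the power \<open>m + 1\<close>,
  that is, of the power \<open>m\<close>.\<close>

lemma surj_endo_inj:
  assumes M: "lmod M" and n: "noe M" and f: "lin M M f" "f ` carrier M = carrier M"
  shows "inj_on f (carrier M)"
proof -
  let ?K = "\<lambda>j. a_kernel M M (f ^^ j)"
  note fj = funpow_lin[OF f(1)]
  have fz: "(f ^^ j) \<zero>\<^bsub>M\<^esub> = \<zero>\<^bsub>M\<^esub>" for j by (rule lin_zero[OF fj M M])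
  have mono: "?K i \<subseteq> ?K j" if "i \<le> j" for i j
  proof -
    obtain d where j: "j = d + i" using \<open>i \<le> j\<close> by (metis le_iff_add add.commute)
    show ?thesis unfolding j by (auto simp: a_kernel_iff funpow_add fz)
  qed
  define U where "U = (\<Union>j. ?K j)"
  have Kj: "sub (?K j) M" for j by (rule sub_kernel[OF fj M M])
  have U: "sub U M"
  proof (rule subI[OF M])
    show "U \<subseteq> carrier M" by (auto simp: U_def a_kernel_iff)
    show "\<zero>\<^bsub>M\<^esub> \<in> U" using subD(3)[OF Kj] by (auto simp: U_def)
    show "x \<oplus>\<^bsub>M\<^esub> y \<in> U" if xy: "x \<in> U" "y \<in> U" for x y
    proof -
      obtain i j where "x \<in> ?K i" "y \<in> ?K j" using xy by (auto simp: U_def)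
      then have "x \<in> ?K (max i j)" "y \<in> ?K (max i j)" using mono[of i "max i j"] mono[of j "max i j"] by auto
      then have "x \<oplus>\<^bsub>M\<^esub> y \<in> ?K (max i j)" by (rule subD(4)[OF Kj])
      then show ?thesis unfolding U_def by blast
    qed
    show "a \<odot>\<^bsub>M\<^esub> x \<in> U" if "a \<in> carrier R" "x \<in> U" for a x
      using that subD(5)[OF Kj that(1), of x] by (auto simp: U_def)
  qed
  obtain S where S: "finite S" "S \<subseteq> U" "\<forall>G. sub G M \<and> S \<subseteq> G \<longrightarrow> U \<subseteq> G"
    using n U fgs_iff_finite[OF M U] unfolding noe_def by metis
  have "\<forall>x. \<exists>j. x \<in> S \<longrightarrow> x \<in> ?K j" using S(2) by (auto simp: U_def)
  then obtain J where J: "\<And>x. x \<in> S \<Longrightarrow> x \<in> ?K (J x)" by metis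
  obtain m where m: "\<And>x. x \<in> S \<Longrightarrow> J x \<le> m" using S(1) by (metis finite_nat_set_iff_bounded_le finite_imageI imageI)
  have "S \<subseteq> ?K m" using J mono[OF m] by blast
  then have UK: "U \<subseteq> ?K m" using S(3) Kj by blast
  have onto: "(f ^^ j) ` carrier M = carrier M" for j
  proof (induction j)
    case (Suc j)
    have "(f ^^ Suc j) ` carrier M = f ` ((f ^^ j) ` carrier M)" by (auto simp: image_comp)
    then show ?case using Suc f(2) by simp
  qed simp
  show ?thesis unfolding lin_inj_iff[OF f(1) M M]
  proof (intro ballI impI)
    fix x assume x: "x \<in> carrier M" "f x = \<zero>\<^bsub>M\<^esub>"
    obtain y where y: "y \<in> carrier M" "x = (f ^^ m) y" using onto[of m] x(1) by (metis imageE)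
    have "y \<in> ?K (Suc m)" using y x by (simp add: a_kernel_iff)
    then have "y \<in> ?K m" using UK unfolding U_def by blast
    then show "x = \<zero>\<^bsub>M\<^esub>" using y by (simp add: a_kernel_iff)
  qed
qed

lemma projective_coverD:
  assumes "projective_cover R P M f"
  shows "P \<in> fg_proj R" "lin P M f" "f \<in> mod_hom R P M" "f ` carrier P = carrier M"
  using assms by (auto simp: projective_cover_def mod_homD)

lemma sub_neg_sum: "\<lbrakk>lmod M; x \<in> carrier M; y \<in> carrier M\<rbrakk> \<Longrightarrow> x = y \<oplus>\<^bsub>M\<^esub> (x \<ominus>\<^bsub>M\<^esub> y)"
  by (simp add: a_minus_def lmod_ac)

lemma projective_cover_superfluous:
  assumes c: "projective_cover R P M f" and M: "lmod M" and L: "sub L P"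
    and *: "\<And>x. x \<in> carrier P \<Longrightarrow> \<exists>l\<in>L. f l = f x"
  shows "L = carrier P"
proof -
  note P = fg_projD(2)[OF projective_coverD(1)[OF c]] and f = projective_coverD(2)[OF c]
  have "L <+>\<^bsub>P\<^esub> a_kernel P M f = carrier P"
  proof
    show "L <+>\<^bsub>P\<^esub> a_kernel P M f \<subseteq> carrier P"
      by (rule set_add_least[OF sub_carrier[OF P] subD(1)[OF L] subD(1)[OF sub_kernel[OF f P M]]])
    show "carrier P \<subseteq> L <+>\<^bsub>P\<^esub> a_kernel P M f"
    proof
      fix x assume x: "x \<in> carrier P"
      then obtain l where l: "l \<in> L" "f l = f x" using * by blast
      then have lc: "l \<in> carrier P" using subD(2)[OF L] by simp
      have "x \<ominus>\<^bsub>P\<^esub> l \<in> a_kernel P M f"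
        using x lc l P M f by (simp add: a_kernel_iff lin_diff linD diff_eq_iff)
      then show "x \<in> L <+>\<^bsub>P\<^esub> a_kernel P M f"
        unfolding set_add_iff using l(1) sub_neg_sum[OF P x lc] by blast
    qed
  qed
  then show ?thesis using c L by (simp add: projective_cover_def superfluous_def)
qed

text \<open>The image of \<open>\<theta>\<close> meets every fibre of \<open>f\<close>, so
  \<open>\<theta>\<close> is onto and splits by projectivity. The hypothesis on the kernel makes the
  image of the splitting \<open>s\<close> meet every fibre too; hence \<open>s\<close> is onto and
  \<open>\<theta>\<close> is injective.\<close>

lemma projective_cover_endo_bij:
  assumes c: "projective_cover R P M f" and M: "lmod M" and t: "lin P P \<theta>"
    and onto: "\<And>x. x \<in> carrier P \<Longrightarrow> \<exists>y\<in>carrier P. f (\<theta> y) = f x"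
    and ker: "\<And>x. x \<in> carrier P \<Longrightarrow> \<theta> x = \<zero>\<^bsub>P\<^esub> \<Longrightarrow> f x = \<zero>\<^bsub>M\<^esub>"
  shows "bij_betw \<theta> (carrier P) (carrier P)"
proof -
  note Pp = projective_coverD(1)[OF c] and P = fg_projD(2)[OF projective_coverD(1)[OF c]] and f = projective_coverD(2)[OF c]
  have surj: "\<theta> ` carrier P = carrier P"
    by (rule projective_cover_superfluous[OF c M sub_image[OF t P P sub_carrier[OF P]]]) (use onto in blast)
  obtain s where s: "lin P P s" "\<And>x. x \<in> carrier P \<Longrightarrow> \<theta> (s x) = x"
  proof (rule proj_lift[OF Pp P P t lin_id])
    fix x assume "x \<in> carrier P" then show "\<exists>a\<in>carrier P. \<theta> a = x" using surj by (metis imageE)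
  qed (rule that)
  have "s ` carrier P = carrier P"
  proof (rule projective_cover_superfluous[OF c M sub_image[OF s(1) P P sub_carrier[OF P]]])
    fix x assume x: "x \<in> carrier P"
    have tx: "\<theta> x \<in> carrier P" and sx: "s (\<theta> x) \<in> carrier P" using linD(1)[OF t x] linD(1)[OF s(1)] by auto
    have "\<theta> (s (\<theta> x) \<ominus>\<^bsub>P\<^esub> x) = \<zero>\<^bsub>P\<^esub>" using t P x sx tx s(2)[OF tx] by (simp add: lin_diff diff_eq_iff)
    then have "f (s (\<theta> x) \<ominus>\<^bsub>P\<^esub> x) = \<zero>\<^bsub>M\<^esub>" using ker P x sx by simp
    then have "f (s (\<theta> x)) = f x" using f P M x sx by (simp add: lin_diff diff_eq_iff linD)
    then show "\<exists>l\<in>s ` carrier P. f l = f x" using tx by blast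
  qed
  then have "inj_on \<theta> (carrier P)" unfolding lin_inj_iff[OF t P P]
    using s(2) lin_zero[OF s(1) P P] by (metis imageE)
  then show ?thesis using surj by (simp add: bij_betw_def)
qed

end

text \<open>Compares the chosen resolution of a syzygy of \<open>M\<close> with the resolution of \<open>M\<close> itself.\<close>

lemma extends_along_transfer:
  assumes R: "rng R" and X: "left_module R X" and N: "left_module R N"
    and P: "projective_cover R P0 X p" "projective_cover R P1 (P0\<lparr>carrier := a_kernel P0 X p\<rparr>) dP"
    and Q: "projective_cover R Q0 X q" "projective_cover R Q1 (Q0\<lparr>carrier := a_kernel Q0 X q\<rparr>) dQ"
    and ext: "\<And>f. rng.lin R Q1 N f \<Longrightarrow> \<exists>g. rng.lin R Q0 N g \<and> (\<forall>x\<in>carrier Q1. f x = g (dQ x))"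
    and f: "rng.lin R P1 N f"
  shows "\<exists>g. rng.lin R P0 N g \<and> (\<forall>x\<in>carrier P1. f x = g (dP x))"
proof -
  interpret rng R by (rule R)
  have p1: "P0 \<in> fg_proj R" "lin P0 X p" "p ` carrier P0 = carrier X" "lmod P0"
    and q1: "Q0 \<in> fg_proj R" "lin Q0 X q" "q ` carrier Q0 = carrier X" "lmod Q0"
    using projective_coverD[OF P(1)] projective_coverD[OF Q(1)] fg_projD by auto
  let ?KP = "P0\<lparr>carrier := a_kernel P0 X p\<rparr>" and ?KQ = "Q0\<lparr>carrier := a_kernel Q0 X q\<rparr>"
  have KP: "sub (a_kernel P0 X p) P0" "lmod ?KP" and KQ: "sub (a_kernel Q0 X q) Q0" "lmod ?KQ"
    using sub_kernel[OF p1(2,4) X] sub_kernel[OF q1(2,4) X] lmod_sub[OF p1(4)] lmod_sub[OF q1(4)] by auto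
  have p2: "P1 \<in> fg_proj R" "lin P1 ?KP dP" "dP ` carrier P1 = a_kernel P0 X p" "lmod P1"
    and q2: "Q1 \<in> fg_proj R" "lin Q1 ?KQ dQ" "dQ ` carrier Q1 = a_kernel Q0 X q" "lmod Q1"
    using projective_coverD[OF P(2)] projective_coverD[OF Q(2)] fg_projD by auto
  have dPl: "lin P1 P0 dP" and dQl: "lin Q1 Q0 dQ"
    using lin_out_sub[OF p2(2) subD(1)[OF KP(1)]] lin_out_sub[OF q2(2) subD(1)[OF KQ(1)]] by auto
  have pd: "p (dP x) = \<zero>\<^bsub>X\<^esub>" if "x \<in> carrier P1" for x using p2(3) that by (auto simp: a_kernel_iff)
  have qd: "q (dQ x) = \<zero>\<^bsub>X\<^esub>" if "x \<in> carrier Q1" for x using q2(3) that by (auto simp: a_kernel_iff)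
  obtain a0 where a0: "lin P0 Q0 a0" "\<And>x. x \<in> carrier P0 \<Longrightarrow> q (a0 x) = p x"
  proof (rule proj_lift[OF p1(1) q1(4) X q1(2) p1(2)])
    show "\<exists>y\<in>carrier Q0. q y = p x" if "x \<in> carrier P0" for x using linD(1)[OF p1(2) that] q1(3) by (metis imageE)
  qed (rule that)
  obtain b0 where b0: "lin Q0 P0 b0" "\<And>x. x \<in> carrier Q0 \<Longrightarrow> p (b0 x) = q x"
  proof (rule proj_lift[OF q1(1) p1(4) X p1(2) q1(2)])
    show "\<exists>y\<in>carrier P0. p y = q x" if "x \<in> carrier Q0" for x using linD(1)[OF q1(2) that] p1(3) by (metis imageE)
  qed (rule that)
  have a0d: "lin P1 Q0 (\<lambda>x. a0 (dP x))" by (rule lin_comp[OF dPl a0(1)])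
  have b0d: "lin Q1 P0 (\<lambda>x. b0 (dQ x))" by (rule lin_comp[OF dQl b0(1)])
  obtain a1 where a1: "lin P1 Q1 a1" "\<And>x. x \<in> carrier P1 \<Longrightarrow> dQ (a1 x) = a0 (dP x)"
  proof (rule proj_lift[OF p2(1) q2(4) q1(4) dQl a0d])
    fix x assume "x \<in> carrier P1"
    then have "a0 (dP x) \<in> a_kernel Q0 X q"
      using pd linD(1)[OF dPl] a0(2) linD(1)[OF a0d] by (simp add: a_kernel_iff)
    then show "\<exists>y\<in>carrier Q1. dQ y = a0 (dP x)" using q2(3) by (metis imageE)
  qed (rule that)
  obtain b1 where b1: "lin Q1 P1 b1" "\<And>x. x \<in> carrier Q1 \<Longrightarrow> dP (b1 x) = b0 (dQ x)"
  proof (rule proj_lift[OF q2(1) p2(4) p1(4) dPl b0d])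
    fix x assume "x \<in> carrier Q1"
    then have "b0 (dQ x) \<in> a_kernel P0 X p"
      using qd linD(1)[OF dQl] b0(2) linD(1)[OF b0d] by (simp add: a_kernel_iff)
    then show "\<exists>y\<in>carrier P1. dP y = b0 (dQ x)" using p2(3) by (metis imageE)
  qed (rule that)
  \<comment> \<open>The comparison maps are composed to endomorphisms of the first presentation;
    being compatible with the covers, they are bijective by minimality.\<close>
  define t0 where "t0 = (\<lambda>x. b0 (a0 x))"
  define t1 where "t1 = (\<lambda>x. b1 (a1 x))"
  have t0: "lin P0 P0 t0" unfolding t0_def by (rule lin_comp[OF a0(1) b0(1)])
  have t1: "lin P1 P1 t1" unfolding t1_def by (rule lin_comp[OF a1(1) b1(1)])
  have pt0: "p (t0 x) = p x" if "x \<in> carrier P0" for x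
    using that a0 b0(2) linD(1)[OF a0(1)] by (simp add: t0_def)
  have bij0: "bij_betw t0 (carrier P0) (carrier P0)"
  proof (rule projective_cover_endo_bij[OF P(1) X t0])
    show "\<exists>y\<in>carrier P0. p (t0 y) = p x" if "x \<in> carrier P0" for x using that pt0 by blast
    show "p x = \<zero>\<^bsub>X\<^esub>" if "x \<in> carrier P0" "t0 x = \<zero>\<^bsub>P0\<^esub>" for x
      using that pt0[OF that(1)] lin_zero[OF p1(2) p1(4) X] by simp
  qed
  have dt: "dP (t1 x) = t0 (dP x)" if "x \<in> carrier P1" for x
    using that a1 b1(2) linD(1)[OF a1(1)] by (simp add: t0_def t1_def)
  have bij1: "bij_betw t1 (carrier P1) (carrier P1)"
  proof (rule projective_cover_endo_bij[OF P(2) KP(2) t1])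
    fix x assume x: "x \<in> carrier P1"
    have dx: "dP x \<in> carrier P0" using linD(1)[OF dPl x] .
    obtain y where y: "y \<in> carrier P0" "t0 y = dP x" using bij0 dx by (metis bij_betw_imp_surj_on imageE)
    then have "y \<in> a_kernel P0 X p" using pt0[OF y(1)] pd[OF x] by (simp add: a_kernel_iff)
    then obtain z where "z \<in> carrier P1" "y = dP z" using p2(3) by (metis imageE)
    then show "\<exists>y\<in>carrier P1. dP (t1 y) = dP x" using dt y by metis
    show "dP x = \<zero>\<^bsub>?KP\<^esub>" if "t1 x = \<zero>\<^bsub>P1\<^esub>"
    proof -
      have "t0 (dP x) = \<zero>\<^bsub>P0\<^esub>" using dt[OF x] that lin_zero[OF dPl p2(4) p1(4)] by simp
      then show ?thesis using bij0 dx lin_inj_iff[OF t0 p1(4) p1(4)] by (simp add: bij_betw_def)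
    qed
  qed
  let ?s = "inv_into (carrier P1) t1"
  have s: "lin P1 P1 ?s" by (rule lin_inverse[OF t1 bij1 p2(4) p2(4)])
  have st: "?s (t1 x) = x" if "x \<in> carrier P1" for x using bij1 that by (simp add: bij_betw_def)
  \<comment> \<open>The automorphism \<open>t1\<close> is undone before the extension property of
    the second presentation is used, so that composing with \<open>a1\<close> returns
    \<open>f\<close> itself.\<close>
  have "lin Q1 N (\<lambda>x. f (?s (b1 x)))" by (rule lin_comp[OF lin_comp[OF b1(1) s] f])
  then obtain g where g: "lin Q0 N g" "\<And>x. x \<in> carrier Q1 \<Longrightarrow> f (?s (b1 x)) = g (dQ x)" using ext by blast
  have "f x = g (a0 (dP x))" if x: "x \<in> carrier P1" for x
    using g(2)[OF linD(1)[OF a1(1) x]] st[OF x] a1(2)[OF x] by (simp add: t1_def)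
  then show ?thesis using lin_comp[OF a0(1) g(1)] by blast
qed

context artin begin

text \<open>A projective cover of \<open>F / K\<close>, with \<open>F\<close> free, is a submodule \<open>L\<close> of \<open>F\<close> minimal with \<open>L + K = F\<close>.
  It is a direct summand because an endomorphism of \<open>F\<close> into \<open>L\<close> that is the identity modulo \<open>K\<close>
  restricts to a surjection, hence an automorphism, of \<open>L\<close>.\<close>

lemma projective_cover_exists:
  assumes M: "M \<in> fg_mod \<Lambda>"
  shows "\<exists>(P :: ('a, nat \<Rightarrow> 'a) module) f. projective_cover \<Lambda> P M f"
proof -
  note Ml = L.fg_modD(1)[OF M]
  obtain k p where p: "L.lin (direct_power (regular_module \<Lambda>) k) M p"
    "p ` carrier (direct_power (regular_module \<Lambda>) k) = carrier M"
    using L.fg_surj[OF M] by metis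
  define F where "F = direct_power (regular_module \<Lambda>) k"
  have Ff: "F \<in> fg_mod \<Lambda>" and Fl: "L.lmod F" unfolding F_def using L.power_fg L.fg_modD by auto
  have pl: "L.lin F M p" and pi: "p ` carrier F = carrier M" using p by (auto simp: F_def)
  let ?K = "a_kernel F M p"
  have K: "L.sub ?K F" by (rule L.sub_kernel[OF pl Fl Ml])
  have covers: "H <+>\<^bsub>F\<^esub> ?K = carrier F \<longleftrightarrow> (\<forall>x\<in>carrier F. \<exists>h\<in>H. p h = p x)" if H: "L.sub H F" for H
  proof
    assume e: "H <+>\<^bsub>F\<^esub> ?K = carrier F"
    show "\<forall>x\<in>carrier F. \<exists>h\<in>H. p h = p x"
    proof
      fix x assume "x \<in> carrier F"
      then obtain h z where hz: "h \<in> H" "z \<in> ?K" "x = h \<oplus>\<^bsub>F\<^esub> z" unfolding e[symmetric] L.set_add_iff by blast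
      then have "p h = p x" using L.subD(2)[OF H] pl Ml by (simp add: L.a_kernel_iff L.linD)
      then show "\<exists>h\<in>H. p h = p x" using hz by blast
    qed
  next
    assume *: "\<forall>x\<in>carrier F. \<exists>h\<in>H. p h = p x"
    show "H <+>\<^bsub>F\<^esub> ?K = carrier F"
    proof
      show "H <+>\<^bsub>F\<^esub> ?K \<subseteq> carrier F"
        by (rule L.set_add_least[OF L.sub_carrier[OF Fl] L.subD(1)[OF H] L.subD(1)[OF K]])
      show "carrier F \<subseteq> H <+>\<^bsub>F\<^esub> ?K"
      proof
        fix x assume x: "x \<in> carrier F"
        then obtain h where h: "h \<in> H" "p h = p x" using * by blast
        have hc: "h \<in> carrier F" using L.subD(2)[OF H h(1)] .
        have "x \<ominus>\<^bsub>F\<^esub> h \<in> ?K" using x hc h Fl Ml pl by (simp add: L.a_kernel_iff L.lin_diff L.linD L.diff_eq_iff)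
        then show "x \<in> H <+>\<^bsub>F\<^esub> ?K" unfolding L.set_add_iff using h(1) L.sub_neg_sum[OF Fl x hc] by blast
      qed
    qed
  qed
  let ?\<G> = "{H. L.sub H F \<and> (\<forall>x\<in>carrier F. \<exists>h\<in>H. p h = p x)}"
  have G0: "carrier F \<in> ?\<G>" using L.sub_carrier[OF Fl] by blast
  obtain H where H: "H \<in> ?\<G>" and Hmin: "\<And>G. G \<in> ?\<G> \<Longrightarrow> G \<subseteq> H \<Longrightarrow> G = H"
  proof (rule L.dccsE[OF L_dcc[OF Ff] G0])
    show "L.sub G F" if "G \<in> ?\<G>" for G using that by simp
    then show "G \<subseteq> carrier F" if "G \<in> ?\<G>" for G using L.subD(1)[of G F] that by simp
  qed (rule that)
  then have Hs: "L.sub H F" and Hp: "\<And>x. x \<in> carrier F \<Longrightarrow> \<exists>h\<in>H. p h = p x" by auto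
  note Hc = L.subD(2)[OF Hs]
  have uc: "L.unit_vec k j \<in> carrier F" for j by (simp add: F_def)
  have "\<forall>j. \<exists>l. l \<in> H \<and> p l = p (L.unit_vec k j)" using Hp uc by metis
  then obtain l where l: "\<And>j. l j \<in> H" "\<And>j. p (l j) = p (L.unit_vec k j)" by metis
  define t where "t u = msum F (\<lambda>i. u i \<odot>\<^bsub>F\<^esub> l i) k" for u
  have t: "L.lin F F t" unfolding t_def using L.lin_comb_map[OF Fl, of k l] l(1) Hc by (simp add: F_def[symmetric])
  have tH: "t u \<in> H" if "u \<in> carrier F" for u
  proof -
    have "\<forall>i<k. u i \<in> carrier \<Lambda>" using that by (auto simp: F_def)
    then show ?thesis unfolding t_def using L.subD(5)[OF Hs _ l(1)] by (intro L.msum_sub[OF Hs]) simp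
  qed
  have pt: "p (t u) = p u" if u: "u \<in> carrier F" for u
  proof -
    have ui: "u i \<in> carrier \<Lambda>" if "i < k" for i using u that by (auto simp: F_def)
    have uv: "L.unit_vec k j \<in> carrier F" for j by (simp add: F_def)
    have "p (t u) = msum M (\<lambda>i. p (u i \<odot>\<^bsub>F\<^esub> l i)) k"
      unfolding t_def using ui l(1) Hc Fl by (intro L.msum_lin[OF pl Fl Ml]) auto
    also have "\<dots> = msum M (\<lambda>i. p (u i \<odot>\<^bsub>F\<^esub> L.unit_vec k i)) k"
      using ui l Hc uv L.linD(3)[OF pl] by (intro L.msum_cong) auto
    also have "\<dots> = p (msum F (\<lambda>i. u i \<odot>\<^bsub>F\<^esub> L.unit_vec k i) k)"
      using ui uv Fl by (intro L.msum_lin[OF pl Fl Ml, symmetric]) auto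
    also have "\<dots> = p u" using L.power_elem[of u k] u by (simp add: F_def del: L.direct_power_simps(4))
    finally show ?thesis .
  qed
  \<comment> \<open>As \<open>t\<close> is the identity modulo the kernel of \<open>p\<close>, the
    image of \<open>H\<close> still covers \<open>M\<close>; minimality of \<open>H\<close> leaves
    no room for it to shrink.\<close>
  have tHH: "t ` H = H"
  proof (rule Hmin)
    have "\<exists>h\<in>t ` H. p h = p x" if x: "x \<in> carrier F" for x
    proof -
      obtain h where "h \<in> H" "p h = p x" using Hp[OF x] by metis
      then show ?thesis using pt[of h] Hc by auto
    qed
    then show "t ` H \<in> ?\<G>" using L.sub_image[OF t Fl Fl Hs] by blast
    show "t ` H \<subseteq> H" using tH Hc by blast
  qed
  define P where "P = F\<lparr>carrier := H\<rparr>"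
  have Pl: "L.lmod P" and Pf: "P \<in> fg_mod \<Lambda>" unfolding P_def using L.lmod_sub[OF Fl Hs] fg_sub[OF Ff Hs] by auto
  have tP: "L.lin P P t" unfolding P_def
    by (rule L.lin_into_sub[OF L.lin_from_sub[OF t L.subD(1)[OF Hs]]]) (use tH Hc in auto)
  have inj: "inj_on t H" using L.surj_endo_inj[OF Pl L_noe[OF Pf] tP] tHH by (simp add: P_def)
  \<comment> \<open>The complement of \<open>H\<close> in \<open>F\<close> is the kernel of
    \<open>t\<close>, because \<open>t\<close> maps \<open>F\<close> into \<open>H\<close> and
    restricts to an automorphism of \<open>H\<close>.\<close>
  define N where "N = F\<lparr>carrier := a_kernel F F t\<rparr>"
  have Nl: "L.lmod N" unfolding N_def by (rule L.lmod_sub[OF Fl L.sub_kernel[OF t Fl Fl]])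
  have N0: "z \<in> carrier N \<longleftrightarrow> z \<in> carrier F \<and> t z = \<zero>\<^bsub>F\<^esub>" for z by (simp add: N_def L.a_kernel_iff)
  let ?h = "\<lambda>u. fst u \<oplus>\<^bsub>F\<^esub> snd u"
  have S: "L.lmod (direct_sum P N)" by (rule L.lmod_direct_sum[OF Pl Nl])
  have hl: "L.lin (direct_sum P N) F ?h"
    by (rule L.linI) (use Hc Fl in \<open>auto simp: P_def N_def L.a_kernel_iff L.lmod_ac L.smult_distr\<close>)
  have hb: "bij_betw ?h (carrier (direct_sum P N)) (carrier F)" unfolding bij_betw_def
  proof
    show "inj_on ?h (carrier (direct_sum P N))" unfolding L.lin_inj_iff[OF hl S Fl]
    proof (intro ballI impI)
      fix u assume u: "u \<in> carrier (direct_sum P N)" "?h u = \<zero>\<^bsub>F\<^esub>"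
      have c: "fst u \<in> H" "fst u \<in> carrier F" "snd u \<in> carrier F" "t (snd u) = \<zero>\<^bsub>F\<^esub>"
        using u Hc N0 by (auto simp: P_def)
      have "t (fst u) = \<zero>\<^bsub>F\<^esub>"
        using arg_cong[OF u(2), of t] c Fl L.linD(1)[OF t] by (simp add: L.linD(2)[OF t] L.lin_zero[OF t Fl Fl])
      then have "fst u = \<zero>\<^bsub>F\<^esub>"
        using inj c(1) L.subD(3)[OF Hs] L.lin_zero[OF t Fl Fl] by (simp add: inj_on_def)
      then show "u = \<zero>\<^bsub>direct_sum P N\<^esub>" using u(2) c Fl by (simp add: P_def N_def prod_eq_iff)
    qed
    show "?h ` carrier (direct_sum P N) = carrier F"
    proof
      show "?h ` carrier (direct_sum P N) \<subseteq> carrier F" using L.linD(1)[OF hl] by blast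
      show "carrier F \<subseteq> ?h ` carrier (direct_sum P N)"
      proof
        fix x assume x: "x \<in> carrier F"
        obtain h where h: "h \<in> H" "t h = t x" using tH[OF x] tHH by (metis imageE)
        have "x \<ominus>\<^bsub>F\<^esub> h \<in> carrier N"
          using x h Hc[OF h(1)] Fl t by (simp add: N0 L.lin_diff L.linD L.diff_eq_iff)
        then have "(h, x \<ominus>\<^bsub>F\<^esub> h) \<in> carrier (direct_sum P N)" using h by (simp add: P_def)
        then show "x \<in> ?h ` carrier (direct_sum P N)"
          using L.sub_neg_sum[OF Fl x Hc[OF h(1)]] by (intro image_eqI[where x = "(h, x \<ominus>\<^bsub>F\<^esub> h)"]) auto
      qed
    qed
  qed
  have hb': "bij_betw (restrict ?h (carrier (direct_sum P N))) (carrier (direct_sum P N)) (carrier F)"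
    using hb by (rule bij_betw_cong[THEN iffD1, rotated]) simp
  have "direct_summand \<Lambda> P F" unfolding direct_summand_def mod_iso_def
    using Nl L.restrict_mod_hom[OF hl S] hb' by blast
  then have Pp: "P \<in> fg_proj \<Lambda>" using Pf unfolding fg_proj_def F_def by blast
  have pP: "L.lin P M p" unfolding P_def by (rule L.lin_from_sub[OF pl L.subD(1)[OF Hs]])
  let ?f = "restrict p (carrier P)"
  have fP: "?f \<in> mod_hom \<Lambda> P M" by (rule L.restrict_mod_hom[OF pP Pl])
  have "projective_cover \<Lambda> P M ?f" unfolding projective_cover_def superfluous_def
  proof (intro conjI allI impI Pp fP L.sub_kernel[OF L.mod_homD[OF fP] Pl Ml])
    show "?f ` carrier P = carrier M"
    proof
      show "?f ` carrier P \<subseteq> carrier M" using L.linD(1)[OF pP] by auto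
      show "carrier M \<subseteq> ?f ` carrier P"
      proof
        fix y assume "y \<in> carrier M"
        then obtain x where "x \<in> carrier F" "y = p x" using pi by (metis imageE)
        then obtain h where "h \<in> H" "y = p h" using Hp by metis
        then show "y \<in> ?f ` carrier P" by (auto simp: P_def)
      qed
    qed
    fix G assume "L.sub G P \<and> G <+>\<^bsub>P\<^esub> a_kernel P M ?f = carrier P"
    then have G: "L.sub G P" "G <+>\<^bsub>P\<^esub> a_kernel P M ?f = H" by (auto simp: P_def)
    have GF: "L.sub G F" "G \<subseteq> H" using L.sub_sub[OF Fl Hs] G(1) by (auto simp: P_def)
    have "\<exists>g\<in>G. p g = p x" if "x \<in> carrier F" for x
    proof -
      obtain h where h: "h \<in> H" "p h = p x" using Hp \<open>x \<in> carrier F\<close> by blast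
      then obtain g z where gz: "g \<in> G" "z \<in> a_kernel P M ?f" "h = g \<oplus>\<^bsub>P\<^esub> z"
        unfolding G(2)[symmetric] L.set_add_iff by blast
      then have zz: "z \<in> H" "p z = \<zero>\<^bsub>M\<^esub>" by (auto simp: L.a_kernel_iff P_def)
      have "g \<in> carrier F" "z \<in> carrier F" using gz GF zz Hc by auto
      then have "p g = p h" using gz(3) zz pl Ml by (simp add: P_def L.linD)
      then show ?thesis using gz h by auto
    qed
    then show "G = carrier P" using Hmin[of G] GF by (simp add: P_def)
  qed
  then show ?thesis by blast
qed

text \<open>Dependent choice along covers of successive syzygies: a syzygy is a submodule of a
  finitely generated module, hence finitely generated over an Artin algebra, and has a cover
  again.\<close>

lemma minimal_resolution_exists:
  assumes M: "M \<in> fg_mod \<Lambda>"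
  shows "\<exists>(P :: 'a pcomplex) \<epsilon>. minimal_projective_resolution \<Lambda> M P \<epsilon>"
proof -
  note Ml = L.fg_modD(1)[OF M]
  \<comment> \<open>A state holds a term of the resolution, the carrier of the syzygy inside it, and
    the differential leaving it. The initial state has the identity as a placeholder for the
    differential.\<close>
  define st :: "('a, nat \<Rightarrow> 'a) module \<times> (nat \<Rightarrow> 'a) set \<times> ((nat \<Rightarrow> 'a) \<Rightarrow> nat \<Rightarrow> 'a) \<Rightarrow> bool"
    where "st s \<longleftrightarrow> fst s \<in> fg_mod \<Lambda> \<and> L.sub (fst (snd s)) (fst s)" for s
  define om where "om s = (fst s)\<lparr>carrier := fst (snd s)\<rparr>"
    for s :: "('a, nat \<Rightarrow> 'a) module \<times> (nat \<Rightarrow> 'a) set \<times> ((nat \<Rightarrow> 'a) \<Rightarrow> nat \<Rightarrow> 'a)"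
  define nx where "nx s s' \<longleftrightarrow> projective_cover \<Lambda> (fst s') (om s) (snd (snd s')) \<and>
      fst (snd s') = a_kernel (fst s') (fst s) (snd (snd s'))"
    for s s' :: "('a, nat \<Rightarrow> 'a) module \<times> (nat \<Rightarrow> 'a) set \<times> ((nat \<Rightarrow> 'a) \<Rightarrow> nat \<Rightarrow> 'a)"
  obtain P0 :: "('a, nat \<Rightarrow> 'a) module" and \<epsilon> where P0: "projective_cover \<Lambda> P0 M \<epsilon>"
    using projective_cover_exists[OF M] by metis
  let ?s0 = "(P0, a_kernel P0 M \<epsilon>, \<lambda>x. x)"
  have P0f: "P0 \<in> fg_mod \<Lambda>" "L.lin P0 M \<epsilon>" "L.lmod P0"
    using L.projective_coverD[OF P0] L.fg_projD by auto
  have "st ?s0" unfolding st_def using P0f L.sub_kernel[OF P0f(2,3) Ml] by simp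
  moreover have "\<exists>s'. st s' \<and> nx s s'" if s: "st s" for s
  proof -
    have f: "fst s \<in> fg_mod \<Lambda>" and H: "L.sub (fst (snd s)) (fst s)" using s by (auto simp: st_def)
    have o: "om s \<in> fg_mod \<Lambda>" unfolding om_def by (rule fg_sub[OF f H])
    obtain Q :: "('a, nat \<Rightarrow> 'a) module" and g where Q: "projective_cover \<Lambda> Q (om s) g"
      using projective_cover_exists[OF o] by metis
    have q: "Q \<in> fg_mod \<Lambda>" "L.lin Q (om s) g" "L.lmod Q"
      using L.projective_coverD[OF Q] L.fg_projD by auto
    have "L.lin Q (fst s) g" using L.lin_out_sub[OF q(2)[unfolded om_def] L.subD(1)[OF H]] .
    then have "L.sub (a_kernel Q (fst s) g) Q" by (rule L.sub_kernel[OF _ q(3) L.fg_modD(1)[OF f]])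
    then have "st (Q, a_kernel Q (fst s) g, g) \<and> nx s (Q, a_kernel Q (fst s) g, g)"
      using q Q by (simp add: st_def nx_def)
    then show ?thesis by blast
  qed
  ultimately obtain S where S: "\<And>n. st (S n)" "\<And>n. nx (S n) (S (Suc n))" "S 0 = ?s0"
    using dependent_nat_choice[of "\<lambda>n s. st s \<and> (n = 0 \<longrightarrow> s = ?s0)" "\<lambda>n. nx"] by (metis nat.distinct(1))
  define Z :: "('a, nat \<Rightarrow> 'a) module" where "Z = direct_power (regular_module \<Lambda>) 0"
  have Z: "L.lmod Z" "carrier Z = {\<zero>\<^bsub>Z\<^esub>}" unfolding Z_def using L.lmod_power[OF L.lmod_regular] by auto
  define Q where "Q i = (if i > 0 then Z else fst (S (nat (- i))))" for i :: int
  define d where "d i = (if i \<ge> 0 then restrict (\<lambda>_. \<zero>\<^bsub>Z\<^esub>) (carrier (Q i)) else snd (snd (S (nat (- i)))))" for i :: int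
  define P where "P = \<lparr>obj = Q, dif = d\<rparr>"
  have Sl: "L.lmod (fst (S n))" "fst (S n) \<in> fg_mod \<Lambda>" "L.sub (fst (snd (S n))) (fst (S n))" for n
    using S(1)[of n] L.fg_modD(1) by (auto simp: st_def)
  have Ql: "L.lmod (Q i)" for i unfolding Q_def using Z Sl by auto
  have cov: "projective_cover \<Lambda> (fst (S (Suc n))) (om (S n)) (snd (snd (S (Suc n))))" for n
    using S(2)[of n] by (simp add: nx_def)
  have ker: "fst (snd (S (Suc n))) = a_kernel (fst (S (Suc n))) (fst (S n)) (snd (snd (S (Suc n))))" for n
    using S(2)[of n] by (simp add: nx_def)
  have ind: "nat (- (- int k)) = k" "nat (- (1 - int (Suc k))) = k" for k by auto
  have dneg: "d (- int (Suc n)) = snd (snd (S (Suc n)))" for n by (simp add: d_def del: of_nat_Suc)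
  have Qneg: "Q (- int n) = fst (S n)" for n by (simp add: Q_def)
  have dh: "d (- int (Suc n)) \<in> mod_hom \<Lambda> (Q (- int (Suc n))) (om (S n))" for n
    unfolding dneg Qneg using L.projective_coverD(3)[OF cov] .
  have dO: "d (- int (Suc n)) x \<in> fst (snd (S n))" if "x \<in> carrier (Q (- int (Suc n)))" for n x
    using L.linD(1)[OF L.mod_homD[OF dh] that] by (simp add: om_def)
  have dh': "d i \<in> mod_hom \<Lambda> (Q i) (Q (i + 1))" for i
  proof (cases "i < 0")
    case True
    then obtain n where n: "i = - int (Suc n)" by (metis zero_less_imp_eq_int neg_0_less_iff_less minus_minus Suc_pred)
    have e: "Q (i + 1) = fst (S n)" unfolding n using Qneg[of n] by simp
    have "L.lin (Q i) (fst (S n)) (d i)" using L.lin_out_sub[OF L.mod_homD[OF dh[of n, unfolded om_def]] L.subD(1)[OF Sl(3)]] n by simp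
    then show ?thesis unfolding e using dh[of n] n by (simp add: L.mod_hom_iff)
  next
    case False
    then show ?thesis unfolding d_def using L.restrict_mod_hom[OF L.lin_const_zero[OF Z(1)] Ql[of i], of] by (simp add: Q_def)
  qed
  have dd: "d (i + 1) (d i x) = \<zero>\<^bsub>Q (i + 2)\<^esub>" if x: "x \<in> carrier (Q i)" for i x
  proof (cases "i + 1 < 0")
    case True
    define n where "n = nat (- i) - 2"
    have n: "i = - int (Suc (Suc n))" "i + 1 = - int (Suc n)" "i + 2 = - int n" using True by (auto simp: n_def)
    have "d i x \<in> fst (snd (S (Suc n)))" using dO[of x "Suc n", folded n(1)] x by blast
    then have "snd (snd (S (Suc n))) (d i x) = \<zero>\<^bsub>fst (S n)\<^esub>" unfolding ker by (simp add: L.a_kernel_iff)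
    then show ?thesis unfolding n(2,3) dneg Qneg .
  next
    case False
    then have "d i x \<in> carrier (Q (i + 1))" using L.linD(1)[OF L.mod_homD[OF dh'] x] by simp
    then show ?thesis using False by (simp add: d_def) (simp add: Q_def)
  qed
  have "is_complex \<Lambda> P" using Ql dh' dd by (simp add: is_complex_def P_def)
  moreover have "\<forall>i>0. carrier (obj P i) = {\<zero>\<^bsub>obj P i\<^esub>}" using Z(2) by (simp add: P_def Q_def)
  moreover have "projective_cover \<Lambda> (obj P 0) M \<epsilon>" using P0 S(3) by (simp add: P_def Q_def)
  moreover have "projective_cover \<Lambda> (obj P (- int k)) (syzygy_of M P \<epsilon> k) (dif P (- int k))" if k: "k \<ge> 1" for k
  proof -
    obtain n where n: "k = Suc n" using k by (metis Suc_le_D One_nat_def)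
    have i: "1 - int k = - int n" using n by simp
    have "syzygy_of M P \<epsilon> k = om (S n)"
    proof (cases n)
      case 0
      then show ?thesis unfolding syzygy_of_def om_def Let_def i using n S(3) by (simp add: P_def Q_def)
    next
      case (Suc m)
      have e: "- int (Suc m) + 1 = - int m" "1 - int (Suc m) = - int m" by simp_all
      show ?thesis unfolding syzygy_of_def om_def Let_def i using n Suc ker[of m]
        by (simp add: P_def Qneg dneg e del: of_nat_Suc)
    qed
    then show ?thesis using cov[of n] n dneg[of n] Qneg[of k] by (simp add: P_def del: of_nat_Suc)
  qed
  ultimately have "minimal_projective_resolution \<Lambda> M P \<epsilon>"
    unfolding minimal_projective_resolution_def by blast
  then show ?thesis by blast
qed

lemma min_res:
  assumes "M \<in> fg_mod \<Lambda>"
  shows "minimal_projective_resolution \<Lambda> M (min_res \<Lambda> M) (min_res_aug \<Lambda> M)"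
proof -
  have "\<exists>pe. case pe of (P, \<epsilon>) \<Rightarrow> minimal_projective_resolution \<Lambda> M (P :: 'a pcomplex) \<epsilon>"
    using minimal_resolution_exists[OF assms] by auto
  then have "case chosen_res \<Lambda> M of (P, \<epsilon>) \<Rightarrow> minimal_projective_resolution \<Lambda> M P \<epsilon>"
    unfolding chosen_res_def by (rule someI_ex)
  then show ?thesis by (simp add: min_res_def min_res_aug_def case_prod_beta)
qed

end

section \<open>The chosen minimal resolution of the module\<close>

locale artin_res = artin R \<Lambda> \<phi> for R :: "'r ring" and \<Lambda> :: "'a ring" and \<phi> +
  fixes M :: "('a, 'm) module"
  assumes Mfg: "M \<in> fg_mod \<Lambda>"
begin

abbreviation "P \<equiv> min_res \<Lambda> M"
abbreviation "\<epsilon> \<equiv> min_res_aug \<Lambda> M"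

lemma Ml [simp]: "L.lmod M" by (rule L.fg_modD(1)[OF Mfg])

lemma res: "minimal_projective_resolution \<Lambda> M P \<epsilon>" by (rule min_res[OF Mfg])

lemma P_complex: "is_complex \<Lambda> P" using res by (simp add: minimal_projective_resolution_def)

lemma P_lmod [simp]: "L.lmod (obj P i)" using P_complex by (simp add: is_complex_def)
lemma P_dif: "dif P i \<in> mod_hom \<Lambda> (obj P i) (obj P (i + 1))" using P_complex by (simp add: is_complex_def)
lemma P_lin: "L.lin (obj P i) (obj P (i + 1)) (dif P i)" by (rule L.mod_homD[OF P_dif])
lemma P_dd: "x \<in> carrier (obj P i) \<Longrightarrow> dif P (i + 1) (dif P i x) = \<zero>\<^bsub>obj P (i + 2)\<^esub>"
  using P_complex by (simp add: is_complex_def)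

lemma cover0: "projective_cover \<Lambda> (obj P 0) M \<epsilon>"
  using res by (simp add: minimal_projective_resolution_def)

lemma cover: "k \<ge> 1 \<Longrightarrow> projective_cover \<Lambda> (obj P (- int k)) (syzygy_of M P \<epsilon> k) (dif P (- int k))"
  using res by (simp add: minimal_projective_resolution_def)

lemma P_pos: "i > 0 \<Longrightarrow> carrier (obj P i) = {\<zero>\<^bsub>obj P i\<^esub>}"
  using res by (simp add: minimal_projective_resolution_def)

lemma P_proj: "i \<le> 0 \<Longrightarrow> obj P i \<in> fg_proj \<Lambda>"
  using L.projective_coverD(1)[OF cover0] L.projective_coverD(1)[OF cover[of "nat (- i)"]] by (cases "i = 0") auto

lemma eps_lin: "L.lin (obj P 0) M \<epsilon>" by (rule L.projective_coverD(2)[OF cover0])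
lemma eps_surj: "\<epsilon> ` carrier (obj P 0) = carrier M" by (rule L.projective_coverD(4)[OF cover0])

lemma syzygy_carrier:
  "carrier (syzygy_of M P \<epsilon> 1) = a_kernel (obj P 0) M \<epsilon>"
  "k \<ge> 2 \<Longrightarrow> carrier (syzygy_of M P \<epsilon> k) = a_kernel (obj P (1 - int k)) (obj P (2 - int k)) (dif P (1 - int k))"
  by (auto simp: syzygy_of_def Let_def)

lemma exact0: "dif P (- 1) ` carrier (obj P (- 1)) = a_kernel (obj P 0) M \<epsilon>"
  using L.projective_coverD(4)[OF cover[of 1]] syzygy_carrier(1) by simp

lemma exact: "i < 0 \<Longrightarrow> dif P (i - 1) ` carrier (obj P (i - 1)) = a_kernel (obj P i) (obj P (i + 1)) (dif P i)"
  using L.projective_coverD(4)[OF cover[of "nat (1 - i)"]] syzygy_carrier(2)[of "nat (1 - i)"]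
  by (auto simp: algebra_simps)

lemma syzygy_fg: "k \<ge> 1 \<Longrightarrow> syzygy_of M P \<epsilon> k \<in> fg_mod \<Lambda>"
proof -
  assume k: "k \<ge> 1"
  have f: "obj P (1 - int k) \<in> fg_mod \<Lambda>" using P_proj[of "1 - int k"] k L.fg_projD(1) by auto
  show ?thesis unfolding syzygy_of_def Let_def
    using L.sub_kernel[OF eps_lin P_lmod Ml] L.sub_kernel[OF P_lin P_lmod P_lmod, of "1 - int k"] f
    by (auto intro!: fg_sub)
qed

end

section \<open>The duality and the Auslander-Reiten translation\<close>

lemma op_ring_simps [simp]:
  "carrier (op_ring \<Lambda>) = carrier \<Lambda>" "zero (op_ring \<Lambda>) = zero \<Lambda>" "one (op_ring \<Lambda>) = one \<Lambda>"
  "add (op_ring \<Lambda>) = add \<Lambda>" "a \<otimes>\<^bsub>op_ring \<Lambda>\<^esub> b = b \<otimes>\<^bsub>\<Lambda>\<^esub> a"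
  by (simp_all add: op_ring_def)

section \<open>Opposite rings and quotient modules\<close>

context rng begin

lemma op_rng: "rng (op_ring R)"
  by (intro rng.intro ringI abelian_groupI monoidI)
    (auto simp: a_ac m_assoc l_distr r_distr intro!: bexI[of _ "\<ominus> _"] l_neg)

text \<open>All axioms are inherited along a surjection preserving the operations; quotients become
  modules in this way without calculations with cosets.\<close>

lemma lmod_surj_image:
  assumes M: "lmod M" and f: "lin M N f" "f ` carrier M = carrier N" "f \<zero>\<^bsub>M\<^esub> = \<zero>\<^bsub>N\<^esub>"
  shows "lmod N"
proof -
  note l = linD(2)[OF f(1), symmetric] linD(3)[OF f(1), symmetric] f(3)[symmetric]
  show ?thesis
    by (rule left_moduleI; unfold f(2)[symmetric]; use M in \<open>auto simp: l lmod_ac smult_distr\<close>)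
qed

lemma quotient_simps [simp]:
  "carrier (quotient_module M H) = a_rcosets\<^bsub>M\<^esub> H" "\<zero>\<^bsub>quotient_module M H\<^esub> = H"
  "C \<oplus>\<^bsub>quotient_module M H\<^esub> D = C <+>\<^bsub>M\<^esub> D"
  "a \<odot>\<^bsub>quotient_module M H\<^esub> C = H <+>\<^bsub>M\<^esub> ((\<lambda>x. a \<odot>\<^bsub>M\<^esub> x) ` C)"
  by (simp_all add: quotient_module_def mk_module_def)

lemma coset_iff: "z \<in> H +>\<^bsub>M\<^esub> x \<longleftrightarrow> (\<exists>h\<in>H. z = h \<oplus>\<^bsub>M\<^esub> x)"
  by (auto simp: a_r_coset_def')

lemma coset_eq_iff:
  assumes M: "lmod M" and H: "sub H M" and x: "x \<in> carrier M" and y: "y \<in> carrier M"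
  shows "H +>\<^bsub>M\<^esub> x = H +>\<^bsub>M\<^esub> y \<longleftrightarrow> x \<ominus>\<^bsub>M\<^esub> y \<in> H"
proof
  assume e: "H +>\<^bsub>M\<^esub> x = H +>\<^bsub>M\<^esub> y"
  have "x \<in> H +>\<^bsub>M\<^esub> x" unfolding coset_iff using subD(3)[OF H] x M by (intro bexI[of _ "\<zero>\<^bsub>M\<^esub>"]) auto
  then obtain h where h: "h \<in> H" "x = h \<oplus>\<^bsub>M\<^esub> y" unfolding e coset_iff by blast
  then have "x \<ominus>\<^bsub>M\<^esub> y = h" using subD(2)[OF H h(1)] x y M by (simp add: diff_eq_iff)
  then show "x \<ominus>\<^bsub>M\<^esub> y \<in> H" using h by simp
next
  assume d: "x \<ominus>\<^bsub>M\<^esub> y \<in> H"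
  note hc = subD(2)[OF H]
  have xy: "x = (x \<ominus>\<^bsub>M\<^esub> y) \<oplus>\<^bsub>M\<^esub> y" using x y M diff_eq_iff[OF M x y, of "x \<ominus>\<^bsub>M\<^esub> y"] by simp
  have yx: "y = \<ominus>\<^bsub>M\<^esub> (x \<ominus>\<^bsub>M\<^esub> y) \<oplus>\<^bsub>M\<^esub> x"
    using x y M by (simp add: a_minus_def minus_distr lmod_ac(2)[of M "\<ominus>\<^bsub>M\<^esub> x" y] lmod_ac(1))
  show "H +>\<^bsub>M\<^esub> x = H +>\<^bsub>M\<^esub> y"
  proof (rule equalityI; rule subsetI)
    fix z assume "z \<in> H +>\<^bsub>M\<^esub> x"
    then obtain h where h: "h \<in> H" "z = h \<oplus>\<^bsub>M\<^esub> x" unfolding coset_iff by blast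
    have "z = h \<oplus>\<^bsub>M\<^esub> ((x \<ominus>\<^bsub>M\<^esub> y) \<oplus>\<^bsub>M\<^esub> y)" using h xy by simp
    then have "z = (h \<oplus>\<^bsub>M\<^esub> (x \<ominus>\<^bsub>M\<^esub> y)) \<oplus>\<^bsub>M\<^esub> y" using hc[OF h(1)] x y M by (simp add: lmod_ac(1))
    then show "z \<in> H +>\<^bsub>M\<^esub> y" unfolding coset_iff using subD(4)[OF H h(1) d] by blast
  next
    fix z assume "z \<in> H +>\<^bsub>M\<^esub> y"
    then obtain h where h: "h \<in> H" "z = h \<oplus>\<^bsub>M\<^esub> y" unfolding coset_iff by blast
    have "z = h \<oplus>\<^bsub>M\<^esub> (\<ominus>\<^bsub>M\<^esub> (x \<ominus>\<^bsub>M\<^esub> y) \<oplus>\<^bsub>M\<^esub> x)" using h yx by simp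
    then have "z = (h \<oplus>\<^bsub>M\<^esub> \<ominus>\<^bsub>M\<^esub> (x \<ominus>\<^bsub>M\<^esub> y)) \<oplus>\<^bsub>M\<^esub> x" using hc[OF h(1)] x y M by (simp add: lmod_ac(1))
    then show "z \<in> H +>\<^bsub>M\<^esub> x" unfolding coset_iff using subD(4)[OF H h(1) subD(6)[OF H d]] by blast
  qed
qed

text \<open>In \<open>quotient_module\<close> the multiple of a coset has \<open>H\<close> added
  back, since the elementwise multiples alone need not fill a coset. Linearity of the projection
  reduces the set operations to representatives, and the module axioms follow.\<close>

lemma quotient:
  assumes M: "lmod M" and H: "sub H M"
  shows "lin M (quotient_module M H) (\<lambda>x. H +>\<^bsub>M\<^esub> x)"
    and "(\<lambda>x. H +>\<^bsub>M\<^esub> x) ` carrier M = carrier (quotient_module M H)"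
    and "x \<in> carrier M \<Longrightarrow> H +>\<^bsub>M\<^esub> x = \<zero>\<^bsub>quotient_module M H\<^esub> \<longleftrightarrow> x \<in> H"
    and "lmod (quotient_module M H)"
proof -
  note hc = subD(2)[OF H]
  show l: "lin M (quotient_module M H) (\<lambda>x. H +>\<^bsub>M\<^esub> x)"
  proof (rule linI)
    show "H +>\<^bsub>M\<^esub> x \<in> carrier (quotient_module M H)" if "x \<in> carrier M" for x
      using that by (auto simp: A_RCOSETS_def')
    fix x y assume x: "x \<in> carrier M" and y: "y \<in> carrier M"
    show "H +>\<^bsub>M\<^esub> (x \<oplus>\<^bsub>M\<^esub> y) = (H +>\<^bsub>M\<^esub> x) \<oplus>\<^bsub>quotient_module M H\<^esub> (H +>\<^bsub>M\<^esub> y)"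
    proof (rule equalityI; rule subsetI)
      fix z assume "z \<in> H +>\<^bsub>M\<^esub> (x \<oplus>\<^bsub>M\<^esub> y)"
      then obtain h where h: "h \<in> H" "z = h \<oplus>\<^bsub>M\<^esub> (x \<oplus>\<^bsub>M\<^esub> y)" unfolding coset_iff by blast
      then have "z = (h \<oplus>\<^bsub>M\<^esub> x) \<oplus>\<^bsub>M\<^esub> (\<zero>\<^bsub>M\<^esub> \<oplus>\<^bsub>M\<^esub> y)" using hc x y M by (simp add: lmod_ac(1))
      then show "z \<in> (H +>\<^bsub>M\<^esub> x) \<oplus>\<^bsub>quotient_module M H\<^esub> (H +>\<^bsub>M\<^esub> y)"
        unfolding quotient_simps set_add_iff
        using coset_iff[of "h \<oplus>\<^bsub>M\<^esub> x" M H x] coset_iff[of "\<zero>\<^bsub>M\<^esub> \<oplus>\<^bsub>M\<^esub> y" M H y] h(1) subD(3)[OF H] by blast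
    next
      fix z assume "z \<in> (H +>\<^bsub>M\<^esub> x) \<oplus>\<^bsub>quotient_module M H\<^esub> (H +>\<^bsub>M\<^esub> y)"
      then obtain h k where h: "h \<in> H" "k \<in> H" "z = (h \<oplus>\<^bsub>M\<^esub> x) \<oplus>\<^bsub>M\<^esub> (k \<oplus>\<^bsub>M\<^esub> y)"
        unfolding quotient_simps set_add_iff by (auto simp: coset_iff)
      then have "z = (h \<oplus>\<^bsub>M\<^esub> k) \<oplus>\<^bsub>M\<^esub> (x \<oplus>\<^bsub>M\<^esub> y)" using hc x y M by (simp add: lmod_ac)
      then show "z \<in> H +>\<^bsub>M\<^esub> (x \<oplus>\<^bsub>M\<^esub> y)" unfolding coset_iff using subD(4)[OF H h(1,2)] by blast
    qed
  next
    fix a x assume a: "a \<in> carrier R" and x: "x \<in> carrier M"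
    show "H +>\<^bsub>M\<^esub> (a \<odot>\<^bsub>M\<^esub> x) = a \<odot>\<^bsub>quotient_module M H\<^esub> (H +>\<^bsub>M\<^esub> x)"
    proof (rule equalityI; rule subsetI)
      fix z assume "z \<in> H +>\<^bsub>M\<^esub> (a \<odot>\<^bsub>M\<^esub> x)"
      then obtain h where h: "h \<in> H" "z = h \<oplus>\<^bsub>M\<^esub> a \<odot>\<^bsub>M\<^esub> (\<zero>\<^bsub>M\<^esub> \<oplus>\<^bsub>M\<^esub> x)" unfolding coset_iff using x M by auto
      moreover have "\<zero>\<^bsub>M\<^esub> \<oplus>\<^bsub>M\<^esub> x \<in> H +>\<^bsub>M\<^esub> x" unfolding coset_iff using subD(3)[OF H] by blast
      ultimately show "z \<in> a \<odot>\<^bsub>quotient_module M H\<^esub> (H +>\<^bsub>M\<^esub> x)"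
        unfolding quotient_simps set_add_iff by blast
    next
      fix z assume "z \<in> a \<odot>\<^bsub>quotient_module M H\<^esub> (H +>\<^bsub>M\<^esub> x)"
      then obtain h k where h: "h \<in> H" "k \<in> H" "z = h \<oplus>\<^bsub>M\<^esub> a \<odot>\<^bsub>M\<^esub> (k \<oplus>\<^bsub>M\<^esub> x)"
        unfolding quotient_simps set_add_iff by (auto simp: coset_iff)
      then have "z = (h \<oplus>\<^bsub>M\<^esub> a \<odot>\<^bsub>M\<^esub> k) \<oplus>\<^bsub>M\<^esub> a \<odot>\<^bsub>M\<^esub> x" using hc a x M by (simp add: smult_distr lmod_ac(1))
      then show "z \<in> H +>\<^bsub>M\<^esub> (a \<odot>\<^bsub>M\<^esub> x)" unfolding coset_iff using subD(4)[OF H h(1) subD(5)[OF H a h(2)]] by blast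
    qed
  qed
  show s: "(\<lambda>x. H +>\<^bsub>M\<^esub> x) ` carrier M = carrier (quotient_module M H)"
    by (auto simp: A_RCOSETS_def')
  have z0: "H +>\<^bsub>M\<^esub> \<zero>\<^bsub>M\<^esub> = H" using hc M by (auto simp: coset_iff)
  show "x \<in> carrier M \<Longrightarrow> H +>\<^bsub>M\<^esub> x = \<zero>\<^bsub>quotient_module M H\<^esub> \<longleftrightarrow> x \<in> H" for x
    using coset_eq_iff[OF M H, of x "\<zero>\<^bsub>M\<^esub>"] z0 M by (simp add: a_minus_def)
  show "lmod (quotient_module M H)"
    by (rule lmod_surj_image[OF M l s]) (simp add: z0)
qed

end

section \<open>Maximal ideals of the base ring and the injective cogenerator\<close>

context artin begin

lemma R_reg: "R.lmod (regular_module R)" by (rule R.lmod_regular)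

lemma sub_ideal: "R.sub I (regular_module R) \<longleftrightarrow> ideal I R"
  by (rule R.sub_regular_iff_ideal) (rule R.m_comm)

lemma maximal_sub:
  assumes "maximalideal p R"
  shows "ideal p R" "p \<subseteq> carrier R" "primeideal p R" "\<one>\<^bsub>R\<^esub> \<notin> p"
    "ideal q R \<Longrightarrow> p \<subseteq> q \<Longrightarrow> q \<noteq> carrier R \<Longrightarrow> q = p"
proof -
  interpret maximalideal p R by fact
  show "ideal p R" by (rule is_ideal)
  show "p \<subseteq> carrier R" by (rule a_subset)
  show "primeideal p R" by (rule R.maximalideal_prime[OF assms])
  show "\<one>\<^bsub>R\<^esub> \<notin> p" using I_notcarr one_imp_carrier by auto
  show "ideal q R \<Longrightarrow> p \<subseteq> q \<Longrightarrow> q \<noteq> carrier R \<Longrightarrow> q = p"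
    using I_maximal[of q] additive_subgroup.a_subset[OF ideal.axioms(1), of q R] by auto
qed

lemma rad_ideal: "ideal (jacobson_radical R) R"
  unfolding sub_ideal[symmetric]
proof (rule R.subI[OF R_reg])
  have m: "R.sub p (regular_module R)" if "maximalideal p R" for p
    using sub_ideal maximal_sub(1)[OF that] by auto
  show "jacobson_radical R \<subseteq> carrier (regular_module R)" by (auto simp: jacobson_radical_def)
  show "\<zero>\<^bsub>regular_module R\<^esub> \<in> jacobson_radical R"
    using R.subD(3)[OF m] by (auto simp: jacobson_radical_def)
  show "x \<oplus>\<^bsub>regular_module R\<^esub> y \<in> jacobson_radical R"
    if "x \<in> jacobson_radical R" "y \<in> jacobson_radical R" for x y
    using that R.subD(4)[OF m] by (auto simp: jacobson_radical_def)
  show "a \<odot>\<^bsub>regular_module R\<^esub> x \<in> jacobson_radical R"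
    if "a \<in> carrier R" "x \<in> jacobson_radical R" for a x
    using that R.subD(5)[OF m] by (auto simp: jacobson_radical_def)
qed

text \<open>Says that the simple module \<open>R / m\<close> embeds into \<open>R\<close> modulo its
  radical. A minimal finite intersection \<open>D\<close> of maximal ideals other than
  \<open>m\<close> lies in all of them, but not in \<open>m\<close>, which is prime. An element of
  \<open>D\<close> outside \<open>m\<close> is sent into every maximal ideal by
  \<open>m\<close>.\<close>

lemma socle_element:
  assumes m: "maximalideal m R"
  obtains x where "x \<in> carrier R" "x \<notin> jacobson_radical R" "\<And>r. r \<in> m \<Longrightarrow> r \<otimes>\<^bsub>R\<^esub> x \<in> jacobson_radical R"
proof -
  let ?ok = "\<lambda>S. finite S \<and> (\<forall>p\<in>S. maximalideal p R \<and> p \<noteq> m)"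
  let ?D = "{carrier R \<inter> \<Inter>S | S. ?ok S}"
  have idl: "R.sub p (regular_module R)" if "maximalideal p R" for p
    using sub_ideal maximal_sub(1)[OF that] by auto
  have subs: "R.sub (carrier R \<inter> \<Inter>S) (regular_module R)" if "?ok S" for S
  proof (rule R.subI[OF R_reg])
    have i: "R.sub p (regular_module R)" if "p \<in> S" for p using idl \<open>?ok S\<close> that by blast
    show "\<zero>\<^bsub>regular_module R\<^esub> \<in> carrier R \<inter> \<Inter>S" using R.subD(3)[OF i] by auto
    show "x \<oplus>\<^bsub>regular_module R\<^esub> y \<in> carrier R \<inter> \<Inter>S" if "x \<in> carrier R \<inter> \<Inter>S" "y \<in> carrier R \<inter> \<Inter>S" for x y
      using that R.subD(4)[OF i] by auto
    show "a \<odot>\<^bsub>regular_module R\<^esub> x \<in> carrier R \<inter> \<Inter>S" if "a \<in> carrier R" "x \<in> carrier R \<inter> \<Inter>S" for a x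
      using that R.subD(5)[OF i] by auto
  qed auto
  \<comment> \<open>An element outside \<open>m\<close> is built factor by factor: each further
    ideal \<open>p\<close> contributes an element of \<open>p\<close> not in \<open>m\<close>, and
    products stay outside the prime \<open>m\<close>.\<close>
  have notm: "\<exists>x\<in>carrier R \<inter> \<Inter>S. x \<notin> m" if "finite S" "\<forall>p\<in>S. maximalideal p R \<and> p \<noteq> m" for S
    using that
  proof (induction S)
    case empty
    then show ?case using maximal_sub(4)[OF m] by (intro bexI[of _ "\<one>\<^bsub>R\<^esub>"]) auto
  next
    case (insert p S)
    then obtain x where x: "x \<in> carrier R" "x \<in> \<Inter>S" "x \<notin> m" by auto
    have p: "maximalideal p R" "p \<noteq> m" using insert by auto
    have "\<not> p \<subseteq> m" using maximal_sub(5)[OF p(1) maximal_sub(1)[OF m]] maximal_sub(4)[OF m] p(2) by auto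
    then obtain y where y: "y \<in> p" "y \<notin> m" by auto
    have yc: "y \<in> carrier R" using y maximal_sub(2)[OF p(1)] by auto
    interpret primeideal m R by (rule maximal_sub(3)[OF m])
    have "x \<otimes>\<^bsub>R\<^esub> y \<notin> m" using I_prime[OF x(1) yc] x y by auto
    moreover have "x \<otimes>\<^bsub>R\<^esub> y \<in> q" if "q \<in> insert p S" for q
    proof (cases "q = p")
      case True
      then show ?thesis using ideal.I_l_closed[OF maximal_sub(1)[OF p(1)] y(1) x(1)] by simp
    next
      case False
      then have "maximalideal q R" "x \<in> q" using insert that x by auto
      then show ?thesis using ideal.I_r_closed[OF maximal_sub(1) _ yc] by blast
    qed
    ultimately show ?case using x(1) yc by (intro bexI[of _ "x \<otimes>\<^bsub>R\<^esub> y"]) auto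
  qed
  have "carrier R \<inter> \<Inter>{} \<in> ?D" by (intro CollectI exI[of _ "{}"]) simp
  then obtain D where D: "D \<in> ?D" and Dm: "\<And>D'. D' \<in> ?D \<Longrightarrow> D' \<subseteq> D \<Longrightarrow> D' = D"
  proof (rule R.dccsE[OF dcc_R])
    show "R.sub G (regular_module R)" if "G \<in> ?D" for G using that subs by blast
    show "G \<subseteq> carrier (regular_module R)" if "G \<in> ?D" for G using that by auto
  qed (rule that)
  obtain S where S: "?ok S" "D = carrier R \<inter> \<Inter>S" using D by auto
  have sm: "D \<subseteq> p" if p: "maximalideal p R" "p \<noteq> m" for p
  proof -
    have "carrier R \<inter> \<Inter>(insert p S) \<in> ?D" using S(1) p by (intro CollectI exI[of _ "insert p S"]) auto
    then have "carrier R \<inter> \<Inter>(insert p S) = D" by (rule Dm) (auto simp: S(2))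
    then show ?thesis by auto
  qed
  obtain x where x: "x \<in> D" "x \<in> carrier R" "x \<notin> m" using notm[of S] S by auto
  show ?thesis
  proof
    show "x \<in> carrier R" by (rule x)
    show "x \<notin> jacobson_radical R" using x m by (auto simp: jacobson_radical_def)
    fix r assume r: "r \<in> m"
    have rc: "r \<in> carrier R" using r maximal_sub(2)[OF m] by auto
    have "r \<otimes>\<^bsub>R\<^esub> x \<in> p" if p: "maximalideal p R" for p
    proof (cases "p = m")
      case True
      then show ?thesis using ideal.I_r_closed[OF maximal_sub(1)[OF m] r x(2)] by simp
    next
      case False
      then have "x \<in> p" using sm[OF p] x(1) by auto
      then show ?thesis using ideal.I_l_closed[OF maximal_sub(1)[OF p] _ rc] by simp
    qed
    then show "r \<otimes>\<^bsub>R\<^esub> x \<in> jacobson_radical R" using rc x by (auto simp: jacobson_radical_def)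
  qed
qed

text \<open>A minimal submodule \<open>H\<close> strictly above \<open>W\<close> has a simple
  quotient \<open>H / W\<close>, isomorphic to some \<open>R / m\<close>. This embeds into
  \<open>R\<close> modulo its radical and so into \<open>J\<close>; injectivity extends the map from
  \<open>H\<close> to \<open>V\<close>.\<close>

lemma cogenerator_separates:
  fixes J :: "('r, 'j) module" and V :: "('r, 'v) module"
  assumes J: "duality_cogenerator R J" and V: "V \<in> fg_mod R" and W: "R.sub W V" "W \<noteq> carrier V"
  shows "\<exists>f. R.lin V J f \<and> (\<forall>w\<in>W. f w = \<zero>\<^bsub>J\<^esub>) \<and> (\<exists>v\<in>carrier V. f v \<noteq> \<zero>\<^bsub>J\<^esub>)"
proof -
  note Vl = R.fg_modD(1)[OF V]
  let ?reg = "regular_module R" and ?rad = "jacobson_radical R"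
  obtain e where e: "injective_module R J" "e \<in> mod_hom R (quotient_module ?reg ?rad) J"
    "inj_on e (carrier (quotient_module ?reg ?rad))"
    using J by (auto simp: duality_cogenerator_def injective_envelope_def)
  have Jl: "R.lmod J" using e(1) by (simp add: injective_module_def)
  have rad: "R.sub ?rad ?reg" using rad_ideal sub_ideal by auto
  note Q = R.quotient[OF R_reg rad]
  define \<rho> where "\<rho> x = e (?rad +>\<^bsub>?reg\<^esub> x)" for x
  have \<rho>: "R.lin ?reg J \<rho>" unfolding \<rho>_def by (rule R.lin_comp[OF Q(1) R.mod_homD[OF e(2)]])
  have \<rho>0: "\<rho> x = \<zero>\<^bsub>J\<^esub> \<longleftrightarrow> x \<in> ?rad" if "x \<in> carrier R" for x
  proof -
    have "?rad +>\<^bsub>?reg\<^esub> x \<in> carrier (quotient_module ?reg ?rad)" using R.linD(1)[OF Q(1)] that by simp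
    then show ?thesis unfolding \<rho>_def
      using e(3) R.lin_inj_iff[OF R.mod_homD[OF e(2)] Q(4) Jl] R.lin_zero[OF R.mod_homD[OF e(2)] Q(4) Jl]
        Q(3)[of x] that by (metis R.regular_simps(1))
  qed
  let ?\<H> = "{H. R.sub H V \<and> W \<subseteq> H \<and> H \<noteq> W}"
  have "carrier V \<in> ?\<H>" using R.sub_carrier[OF Vl] W R.subD(1)[OF W(1)] by auto
  then obtain H where H: "H \<in> ?\<H>" and Hm: "\<And>G. G \<in> ?\<H> \<Longrightarrow> G \<subseteq> H \<Longrightarrow> G = H"
  proof (rule R.dccsE[OF R.fg_dcc[OF V dcc_R]])
    show "R.sub G V" if "G \<in> ?\<H>" for G using that by simp
    then show "G \<subseteq> carrier V" if "G \<in> ?\<H>" for G using R.subD(1)[of G V] that by simp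
  qed (rule that)
  have Hs: "R.sub H V" "W \<subseteq> H" using H by auto
  obtain c where c: "c \<in> H" "c \<notin> W" using H by auto
  note Hc = R.subD(2)[OF Hs(1)] and Wc = R.subD(2)[OF W(1)]
  have cc: "c \<in> carrier V" using Hc c by simp
  have span: "\<exists>w\<in>W. \<exists>r\<in>carrier R. h = w \<oplus>\<^bsub>V\<^esub> r \<odot>\<^bsub>V\<^esub> b" if h: "h \<in> H" and b: "b \<in> H" "b \<notin> W" for h b
  proof -
    have bc: "b \<in> carrier V" using b Hc by simp
    note cy = R.sub_cyclic[OF Vl bc]
    let ?G = "W <+>\<^bsub>V\<^esub> (\<lambda>r. r \<odot>\<^bsub>V\<^esub> b) ` carrier R"
    have "b \<in> (\<lambda>r. r \<odot>\<^bsub>V\<^esub> b) ` carrier R" using Vl bc by (intro image_eqI[of _ _ "\<one>\<^bsub>R\<^esub>"]) auto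
    then have "b \<in> ?G" using R.set_add_upper(2)[OF Vl W(1) cy] by blast
    moreover have "W \<subseteq> ?G" by (rule R.set_add_upper(1)[OF Vl W(1) cy])
    moreover have "?G \<subseteq> H" using R.subD(5)[OF Hs(1) _ b(1)] by (intro R.set_add_least[OF Hs(1) Hs(2)]) auto
    ultimately have "?G = H" using R.sub_set_add[OF Vl W(1) cy] b(2) by (intro Hm) auto
    then show ?thesis using h unfolding R.set_add_iff[symmetric] by (auto simp: R.set_add_iff)
  qed
  \<comment> \<open>The annihilator of the class of \<open>c\<close> in the simple module
    \<open>H / W\<close>.\<close>
  define m where "m = {r \<in> carrier R. r \<odot>\<^bsub>V\<^esub> c \<in> W}"
  have mi: "ideal m R" unfolding sub_ideal[symmetric] m_def
    by (rule R.subI[OF R_reg])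
      (use Vl cc R.subD[OF W(1)] in \<open>auto simp: R.smult_distr\<close>)
  have mm: "maximalideal m R"
  proof (rule maximalidealI[OF mi])
    have "\<one>\<^bsub>R\<^esub> \<notin> m" using c Vl cc by (simp add: m_def)
    then show "carrier R \<noteq> m" by blast
    fix I assume I: "ideal I R" "m \<subseteq> I" "I \<subseteq> carrier R"
    show "I = m \<or> I = carrier R"
    proof (cases "I \<subseteq> m")
      case False
      then obtain r where r: "r \<in> I" "r \<in> carrier R" "r \<odot>\<^bsub>V\<^esub> c \<notin> W" using I by (auto simp: m_def)
      obtain w s where ws: "w \<in> W" "s \<in> carrier R" "c = w \<oplus>\<^bsub>V\<^esub> s \<odot>\<^bsub>V\<^esub> (r \<odot>\<^bsub>V\<^esub> c)"
        using span[OF c(1) R.subD(5)[OF Hs(1) r(2) c(1)] r(3)] by blast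
      have sr: "s \<otimes>\<^bsub>R\<^esub> r \<in> carrier R" "s \<otimes>\<^bsub>R\<^esub> r \<in> I" using ws r ideal.I_l_closed[OF I(1) r(1)] by auto
      have 1: "\<one>\<^bsub>R\<^esub> \<odot>\<^bsub>V\<^esub> c = (\<one>\<^bsub>R\<^esub> \<ominus>\<^bsub>R\<^esub> s \<otimes>\<^bsub>R\<^esub> r) \<odot>\<^bsub>V\<^esub> c \<oplus>\<^bsub>V\<^esub> (s \<otimes>\<^bsub>R\<^esub> r) \<odot>\<^bsub>V\<^esub> c"
        using sr Vl cc R.smult_distr(1)[OF Vl, of "\<one>\<^bsub>R\<^esub> \<ominus>\<^bsub>R\<^esub> s \<otimes>\<^bsub>R\<^esub> r" "s \<otimes>\<^bsub>R\<^esub> r" c]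
        by (simp add: a_minus_def R.a_assoc R.l_neg)
      have "(\<one>\<^bsub>R\<^esub> \<ominus>\<^bsub>R\<^esub> s \<otimes>\<^bsub>R\<^esub> r) \<odot>\<^bsub>V\<^esub> c \<oplus>\<^bsub>V\<^esub> (s \<otimes>\<^bsub>R\<^esub> r) \<odot>\<^bsub>V\<^esub> c = w \<oplus>\<^bsub>V\<^esub> (s \<otimes>\<^bsub>R\<^esub> r) \<odot>\<^bsub>V\<^esub> c"
        using 1 ws(3) Vl cc ws(2) r(2) by (simp add: R.smult_distr(3))
      then have "(\<one>\<^bsub>R\<^esub> \<ominus>\<^bsub>R\<^esub> s \<otimes>\<^bsub>R\<^esub> r) \<odot>\<^bsub>V\<^esub> c = w" using Vl cc sr Wc[OF ws(1)] by simp
      then have "\<one>\<^bsub>R\<^esub> \<ominus>\<^bsub>R\<^esub> s \<otimes>\<^bsub>R\<^esub> r \<in> I" using ws sr I(2) by (auto simp: m_def)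
      then have "(\<one>\<^bsub>R\<^esub> \<ominus>\<^bsub>R\<^esub> s \<otimes>\<^bsub>R\<^esub> r) \<oplus>\<^bsub>R\<^esub> s \<otimes>\<^bsub>R\<^esub> r \<in> I"
        using sr(2) additive_subgroup.a_closed[OF ideal.axioms(1)[OF I(1)]] by blast
      moreover have "(\<one>\<^bsub>R\<^esub> \<ominus>\<^bsub>R\<^esub> s \<otimes>\<^bsub>R\<^esub> r) \<oplus>\<^bsub>R\<^esub> s \<otimes>\<^bsub>R\<^esub> r = \<one>\<^bsub>R\<^esub>"
        using sr by (simp add: a_minus_def R.a_assoc R.l_neg)
      ultimately have "\<one>\<^bsub>R\<^esub> \<in> I" by simp
      then show ?thesis using ideal.one_imp_carrier[OF I(1)] by simp
    qed (use I in blast)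
  qed
  obtain x where x: "x \<in> carrier R" "x \<notin> ?rad" "\<And>r. r \<in> m \<Longrightarrow> r \<otimes>\<^bsub>R\<^esub> x \<in> ?rad"
    by (rule socle_element[OF mm]) (rule that)
  \<comment> \<open>The map \<open>H / W \<rightarrow> R / m \<rightarrow> J\<close>, in terms of a
    coefficient of \<open>c\<close>. Two coefficients of the same element differ by an element of
    \<open>m\<close>, which sends \<open>x\<close> into the radical, so the choice does not affect
    the value.\<close>
  define \<kappa> where "\<kappa> h = \<rho> ((SOME r. r \<in> carrier R \<and> (\<exists>w\<in>W. h = w \<oplus>\<^bsub>V\<^esub> r \<odot>\<^bsub>V\<^esub> c)) \<otimes>\<^bsub>R\<^esub> x)" for h
  have \<kappa>: "\<kappa> (w \<oplus>\<^bsub>V\<^esub> r \<odot>\<^bsub>V\<^esub> c) = \<rho> (r \<otimes>\<^bsub>R\<^esub> x)" if w: "w \<in> W" and r: "r \<in> carrier R" for w r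
  proof -
    let ?h = "w \<oplus>\<^bsub>V\<^esub> r \<odot>\<^bsub>V\<^esub> c"
    define s where "s = (SOME r. r \<in> carrier R \<and> (\<exists>w\<in>W. ?h = w \<oplus>\<^bsub>V\<^esub> r \<odot>\<^bsub>V\<^esub> c))"
    have "s \<in> carrier R \<and> (\<exists>w\<in>W. ?h = w \<oplus>\<^bsub>V\<^esub> s \<odot>\<^bsub>V\<^esub> c)"
      unfolding s_def by (rule someI[of _ r]) (use w r in blast)
    then obtain w' where s: "s \<in> carrier R" "w' \<in> W" "?h = w' \<oplus>\<^bsub>V\<^esub> s \<odot>\<^bsub>V\<^esub> c" by blast
    have rc: "r \<odot>\<^bsub>V\<^esub> c \<in> carrier V" "s \<odot>\<^bsub>V\<^esub> c \<in> carrier V" using Vl cc r s by auto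
    have "(s \<ominus>\<^bsub>R\<^esub> r) \<odot>\<^bsub>V\<^esub> c = s \<odot>\<^bsub>V\<^esub> c \<ominus>\<^bsub>V\<^esub> r \<odot>\<^bsub>V\<^esub> c"
      using Vl cc r s by (simp add: a_minus_def R.smult_distr(1) R.smult_minus)
    also have "\<dots> = w \<ominus>\<^bsub>V\<^esub> w'"
    proof -
      have "s \<odot>\<^bsub>V\<^esub> c \<oplus>\<^bsub>V\<^esub> w' = w \<oplus>\<^bsub>V\<^esub> r \<odot>\<^bsub>V\<^esub> c" using s rc Wc[OF s(2)] Vl by (simp add: R.lmod_ac(2))
      then have "s \<odot>\<^bsub>V\<^esub> c = (w \<oplus>\<^bsub>V\<^esub> r \<odot>\<^bsub>V\<^esub> c) \<ominus>\<^bsub>V\<^esub> w'"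
        using rc Wc[OF s(2)] Wc[OF w] Vl R.diff_eq_iff[OF Vl, of "w \<oplus>\<^bsub>V\<^esub> r \<odot>\<^bsub>V\<^esub> c" w' "s \<odot>\<^bsub>V\<^esub> c"] by simp
      also have "\<dots> = (w \<ominus>\<^bsub>V\<^esub> w') \<oplus>\<^bsub>V\<^esub> r \<odot>\<^bsub>V\<^esub> c"
        using rc Wc[OF s(2)] Wc[OF w] Vl by (simp add: a_minus_def R.lmod_ac)
      finally show ?thesis using rc Wc[OF s(2)] Wc[OF w] Vl
          R.diff_eq_iff[OF Vl, of "s \<odot>\<^bsub>V\<^esub> c" "r \<odot>\<^bsub>V\<^esub> c" "w \<ominus>\<^bsub>V\<^esub> w'"] by simp
    qed
    finally have "s \<ominus>\<^bsub>R\<^esub> r \<in> m" using s r R.subD(7)[OF W(1) w s(2)] by (simp add: m_def)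
    then have "(s \<ominus>\<^bsub>R\<^esub> r) \<otimes>\<^bsub>R\<^esub> x \<in> ?rad" by (rule x(3))
    then have "\<rho> ((s \<ominus>\<^bsub>R\<^esub> r) \<otimes>\<^bsub>R\<^esub> x) = \<zero>\<^bsub>J\<^esub>" using \<rho>0[of "(s \<ominus>\<^bsub>R\<^esub> r) \<otimes>\<^bsub>R\<^esub> x"] s r x by simp
    then have "\<rho> (((s \<ominus>\<^bsub>R\<^esub> r) \<otimes>\<^bsub>R\<^esub> x) \<oplus>\<^bsub>R\<^esub> r \<otimes>\<^bsub>R\<^esub> x) = \<rho> (r \<otimes>\<^bsub>R\<^esub> x)"
      using R.linD(2)[OF \<rho>, of "(s \<ominus>\<^bsub>R\<^esub> r) \<otimes>\<^bsub>R\<^esub> x" "r \<otimes>\<^bsub>R\<^esub> x"] R.linD(1)[OF \<rho>, of "r \<otimes>\<^bsub>R\<^esub> x"] s r x Jl by simp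
    moreover have "((s \<ominus>\<^bsub>R\<^esub> r) \<otimes>\<^bsub>R\<^esub> x) \<oplus>\<^bsub>R\<^esub> r \<otimes>\<^bsub>R\<^esub> x = s \<otimes>\<^bsub>R\<^esub> x"
      using s r x by (simp add: a_minus_def R.l_distr[symmetric] R.a_assoc R.l_neg)
    ultimately show ?thesis by (simp add: \<kappa>_def s_def[symmetric])
  qed
  let ?H = "V\<lparr>carrier := H\<rparr>"
  have \<kappa>l: "R.lin ?H J \<kappa>"
  proof (rule R.linI)
    fix h assume "h \<in> carrier ?H"
    then obtain w r where h: "w \<in> W" "r \<in> carrier R" "h = w \<oplus>\<^bsub>V\<^esub> r \<odot>\<^bsub>V\<^esub> c" using span[OF _ c] by fastforce
    have hr: "\<kappa> h = \<rho> (r \<otimes>\<^bsub>R\<^esub> x)" using \<kappa> h by simp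
    show "\<kappa> h \<in> carrier J" unfolding hr using R.linD(1)[OF \<rho>] h x by simp
    { fix h' assume "h' \<in> carrier ?H"
      then obtain w' r' where h': "w' \<in> W" "r' \<in> carrier R" "h' = w' \<oplus>\<^bsub>V\<^esub> r' \<odot>\<^bsub>V\<^esub> c" using span[OF _ c] by fastforce
      have "h \<oplus>\<^bsub>V\<^esub> h' = (w \<oplus>\<^bsub>V\<^esub> w') \<oplus>\<^bsub>V\<^esub> (r \<oplus>\<^bsub>R\<^esub> r') \<odot>\<^bsub>V\<^esub> c"
        using h h' Wc cc Vl by (simp add: R.smult_distr(1) R.lmod_ac)
      then have "\<kappa> (h \<oplus>\<^bsub>V\<^esub> h') = \<rho> ((r \<oplus>\<^bsub>R\<^esub> r') \<otimes>\<^bsub>R\<^esub> x)" using \<kappa>[OF R.subD(4)[OF W(1) h(1) h'(1)]] h h' by simp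
      then show "\<kappa> (h \<oplus>\<^bsub>?H\<^esub> h') = \<kappa> h \<oplus>\<^bsub>J\<^esub> \<kappa> h'"
        using hr \<kappa> h h' x R.linD(2)[OF \<rho>, of "r \<otimes>\<^bsub>R\<^esub> x" "r' \<otimes>\<^bsub>R\<^esub> x"] by (simp add: R.l_distr) }
    { fix a assume a: "a \<in> carrier R"
      have "a \<odot>\<^bsub>V\<^esub> h = (a \<odot>\<^bsub>V\<^esub> w) \<oplus>\<^bsub>V\<^esub> (a \<otimes>\<^bsub>R\<^esub> r) \<odot>\<^bsub>V\<^esub> c"
        using h a Wc cc Vl by (simp add: R.smult_distr)
      then have "\<kappa> (a \<odot>\<^bsub>V\<^esub> h) = \<rho> ((a \<otimes>\<^bsub>R\<^esub> r) \<otimes>\<^bsub>R\<^esub> x)" using \<kappa>[OF R.subD(5)[OF W(1) a h(1)]] h a by simp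
      then show "\<kappa> (a \<odot>\<^bsub>?H\<^esub> h) = a \<odot>\<^bsub>J\<^esub> \<kappa> h"
        using hr h x a R.linD(3)[OF \<rho>, of a "r \<otimes>\<^bsub>R\<^esub> x"] by (simp add: R.m_assoc) }
  qed
  \<comment> \<open>The test modules of \<open>injective_module\<close> consist of sets of
    functions; singletons provide a copy of \<open>V\<close> of that type.\<close>
  obtain t0 :: "'v \<Rightarrow> nat \<Rightarrow> 'r" where t0: "inj_on t0 (carrier V)" by (rule R.fg_transport[OF V]) (rule that)
  define t where "t v = {t0 v}" for v
  have ti: "inj_on t (carrier V)" using t0 by (auto simp: t_def inj_on_def)
  let ?Y = "R.transport t V"
  note T = R.transport[OF Vl ti]
  let ?X = "?Y\<lparr>carrier := t ` H\<rparr>" and ?u = "inv_into (carrier V) t"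
  have Xs: "R.sub (t ` H) ?Y" by (rule R.sub_image[OF T(2) Vl T(1) Hs(1)])
  have Xl: "R.lmod ?X" by (rule R.lmod_sub[OF T(1) Xs])
  have u: "R.lin ?Y V ?u" by (rule R.lin_inverse[OF T(2,3) Vl T(1)])
  have ut: "?u (t v) = v" if "v \<in> carrier V" for v using ti that by simp
  have uX: "R.lin ?X ?H ?u"
    by (rule R.lin_into_sub[OF R.lin_from_sub[OF u R.subD(1)[OF Xs]]]) (use ut Hc in auto)
  have inc: "restrict (\<lambda>x. x) (t ` H) \<in> mod_hom R ?X ?Y"
    using R.restrict_mod_hom[OF R.lin_from_sub[OF R.lin_id R.subD(1)[OF Xs]] Xl] by simp
  have g: "restrict (\<lambda>y. \<kappa> (?u y)) (t ` H) \<in> mod_hom R ?X J"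
    using R.restrict_mod_hom[OF R.lin_comp[OF uX \<kappa>l] Xl] by simp
  have inj: "inj_on (restrict (\<lambda>x. x) (t ` H)) (carrier ?X)" by (simp add: inj_on_def)
  obtain q where q: "q \<in> mod_hom R ?Y J" "\<forall>y\<in>carrier ?X. q (restrict (\<lambda>x. x) (t ` H) y) = restrict (\<lambda>y. \<kappa> (?u y)) (t ` H) y"
    using e(1)[unfolded injective_module_def, THEN conjunct2, rule_format, OF Xl T(1) inc inj g] by (elim bexE) (rule that, simp_all)
  have qt: "q (t h) = \<kappa> h" if "h \<in> H" for h using q(2) that ut[OF Hc[OF that]] by auto
  have k0: "\<kappa> w = \<zero>\<^bsub>J\<^esub>" if w: "w \<in> W" for w
  proof -
    have "w = w \<oplus>\<^bsub>V\<^esub> \<zero>\<^bsub>R\<^esub> \<odot>\<^bsub>V\<^esub> c" using Vl cc Wc[OF w] by simp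
    then show ?thesis using \<kappa>[OF w, of "\<zero>\<^bsub>R\<^esub>"] x R.lin_zero[OF \<rho> R_reg Jl] by simp
  qed
  have "c = \<zero>\<^bsub>V\<^esub> \<oplus>\<^bsub>V\<^esub> \<one>\<^bsub>R\<^esub> \<odot>\<^bsub>V\<^esub> c" using Vl cc by simp
  then have "\<kappa> c = \<rho> x" using \<kappa>[OF R.subD(3)[OF W(1)], of "\<one>\<^bsub>R\<^esub>"] x by simp
  then have "\<kappa> c \<noteq> \<zero>\<^bsub>J\<^esub>" using \<rho>0[of x] x by simp
  then show ?thesis
    using R.lin_comp[OF T(2) R.mod_homD[OF q(1)]] qt k0 Hs(2) c(1) cc
    by (intro exI[of _ "\<lambda>v. q (t v)"] conjI bexI[of _ c]) auto
qed

text \<open>A linear map is determined by its values on generators of \<open>M\<close>, so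
  \<open>Hom(M, N)\<close> is contained in a finite power of \<open>N\<close>, which is noetherian
  over \<open>R\<close>. Both the duality and the approximations by \<open>M\<close> depend on these
  generators.\<close>

lemma hom_fg:
  assumes M: "M \<in> fg_mod \<Lambda>" and N: "N \<in> fg_mod \<Lambda>"
  obtains a gs where "\<And>l. l < a \<Longrightarrow> L.lin M N (gs l)"
    "\<And>g. L.lin M N g \<Longrightarrow> \<exists>r. (\<forall>l<a. r l \<in> carrier R) \<and>
      (\<forall>x\<in>carrier M. g x = msum N (\<lambda>l. \<phi> (r l) \<odot>\<^bsub>N\<^esub> gs l x) a)"
proof -
  note Ml = L.fg_modD(1)[OF M] and Nl = L.fg_modD(1)[OF N]
  obtain k s where s: "\<And>j. j < k \<Longrightarrow> s j \<in> carrier M" "carrier M \<subseteq> L.lspan M k s"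
    using L.fg_modD(2)[OF M] unfolding L.fgs_def by metis
  let ?K = "s ` {..<k}" and ?F = "{g. L.lin M N g}"
  have "\<exists>a vs. (\<forall>l<a. vs l \<in> ?F) \<and>
    (\<forall>v\<in>?F. \<exists>r. (\<forall>l<a. r l \<in> carrier R) \<and> (\<forall>k\<in>?K. v k = msum (rs N) (\<lambda>l. r l \<odot>\<^bsub>rs N\<^esub> vs l k) a))"
  proof (rule R.function_family_fg[where D = "\<lambda>_. rs N"])
    show "R.lmod (rs N)" "R.noe (rs N)" using rs_lmod[OF Nl] R_noe[OF rs_fg[OF N]] by auto
    show "?F \<noteq> {}" using L.lin_const_zero[OF Nl] by auto
    show "v x \<in> carrier (rs N)" if "v \<in> ?F" "x \<in> ?K" for v x using that s(1) L.linD(1) by fastforce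
    fix v w r assume "v \<in> ?F" "w \<in> ?F" "r \<in> carrier R"
    then show "\<exists>z\<in>?F. \<forall>x\<in>?K. z x = v x \<oplus>\<^bsub>rs N\<^esub> r \<odot>\<^bsub>rs N\<^esub> w x"
      using L.lin_add[OF _ lin_central Nl] Nl
      by (intro bexI[of _ "\<lambda>x. v x \<oplus>\<^bsub>N\<^esub> \<phi> r \<odot>\<^bsub>N\<^esub> w x"]) auto
  qed simp
  then obtain a vs where vs: "\<And>l. l < a \<Longrightarrow> L.lin M N (vs l)"
    "\<And>v. L.lin M N v \<Longrightarrow> \<exists>r. (\<forall>l<a. r l \<in> carrier R) \<and> (\<forall>k\<in>?K. v k = msum N (\<lambda>l. \<phi> (r l) \<odot>\<^bsub>N\<^esub> vs l k) a)"
    by auto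
  show ?thesis
  proof (rule that[of a vs])
    fix g assume g: "L.lin M N g"
    then obtain r where r: "\<forall>l<a. r l \<in> carrier R" "\<And>x. x \<in> ?K \<Longrightarrow> g x = msum N (\<lambda>l. \<phi> (r l) \<odot>\<^bsub>N\<^esub> vs l x) a"
      using vs(2)[OF g] by auto
    let ?g = "\<lambda>x. msum N (\<lambda>l. \<phi> (r l) \<odot>\<^bsub>N\<^esub> vs l x) a"
    have g': "L.lin M N ?g" using r(1) vs(1) by (intro L.lin_msum[OF Ml Nl] lin_central Nl) auto
    have "g x = ?g x" if "x \<in> carrier M" for x
    proof -
      obtain q where q: "\<forall>i<k. q i \<in> carrier \<Lambda>" "x = msum M (\<lambda>i. q i \<odot>\<^bsub>M\<^esub> s i) k"
        using L.lspanE subsetD[OF s(2) \<open>x \<in> carrier M\<close>] by metis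
      have c: "\<And>i. i < k \<Longrightarrow> q i \<odot>\<^bsub>M\<^esub> s i \<in> carrier M" using q s Ml by simp
      have "g x = msum N (\<lambda>i. g (q i \<odot>\<^bsub>M\<^esub> s i)) k" unfolding q(2) by (rule L.msum_lin[OF g Ml Nl c])
      also have "\<dots> = msum N (\<lambda>i. ?g (q i \<odot>\<^bsub>M\<^esub> s i)) k"
        using q(1) s(1) r(2) by (intro L.msum_cong) (simp add: L.linD(3)[OF g] L.linD(3)[OF g'])
      also have "\<dots> = ?g x" unfolding q(2) by (rule L.msum_lin[OF g' Ml Nl c, symmetric])
      finally show ?thesis .
    qed
    then show "\<exists>r. (\<forall>l<a. r l \<in> carrier R) \<and> (\<forall>x\<in>carrier M. g x = msum N (\<lambda>l. \<phi> (r l) \<odot>\<^bsub>N\<^esub> vs l x) a)"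
      using r(1) by blast
  qed (rule vs)
qed

end

section \<open>Maps into the dual of the transpose\<close>

lemma mk_module_simps [simp]:
  "carrier (mk_module C z p s) = C" "zero (mk_module C z p s) = z"
  "add (mk_module C z p s) = p" "smult (mk_module C z p s) = s"
  by (simp_all add: mk_module_def)

lemma restrict_eqI: "\<lbrakk>f \<in> extensional A; \<And>x. x \<in> A \<Longrightarrow> g x = f x\<rbrakk> \<Longrightarrow> restrict g A = f"
  by (auto simp: extensional_def fun_eq_iff)

lemma compose_alt: "compose A g f = (\<lambda>x\<in>A. g (f x))"
  by (simp add: compose_def)

context rng begin

text \<open>Homomorphisms into \<open>N\<close> form a module over any ring \<open>S\<close> acting on \<open>N\<close> by endomorphisms; \<open>N'\<close> is
  \<open>N\<close> with this action.\<close>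

definition hom_module :: "('a, 'b) module \<Rightarrow> ('a, 'c) module \<Rightarrow> ('s, 'c) module \<Rightarrow> ('s, 'b \<Rightarrow> 'c) module" where
  "hom_module P N N' = mk_module (mod_hom R P N) (\<lambda>x\<in>carrier P. \<zero>\<^bsub>N\<^esub>)
     (\<lambda>f g. \<lambda>x\<in>carrier P. f x \<oplus>\<^bsub>N\<^esub> g x) (\<lambda>a f. \<lambda>x\<in>carrier P. a \<odot>\<^bsub>N'\<^esub> f x)"

lemma hom_module_lmod:
  fixes S :: "'s ring" and N' :: "('s, 'c) module" and N :: "('a, 'c) module"
  assumes S: "rng S" and N': "left_module S N'" and N: "lmod N" and P: "lmod P"
    and same: "carrier N' = carrier N" "zero N' = zero N" "add N' = add N"
    and act: "\<And>a. a \<in> carrier S \<Longrightarrow> lin N N (\<lambda>x. a \<odot>\<^bsub>N'\<^esub> x)"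
  shows "left_module S (hom_module P N N')"
proof -
  interpret S: rng S by (rule S)
  have c: "f x \<in> carrier N" if "f \<in> mod_hom R P N" "x \<in> carrier P" for f x
    by (rule linD(1)[OF mod_homD[OF that(1)] that(2)])
  note n = S.lmod_simps[OF N', unfolded same] S.smult_distr[OF N', unfolded same] S.smult_null[OF N', unfolded same]
  note z = n(1)
  show ?thesis
  proof (rule S.left_moduleI, goal_cases)
    case 1
    show ?case unfolding hom_module_def using restrict_mod_hom[OF lin_const_zero[OF N] P] by simp
  next
    case (2 f g)
    then show ?case unfolding hom_module_def using restrict_mod_hom[OF lin_add[OF mod_homD mod_homD N] P, of f g] by simp
  next
    case (3 a f)
    then show ?case unfolding hom_module_def using restrict_mod_hom[OF lin_comp[OF mod_homD act] P, of f a] by simp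
  next
    case (4 f g h)
    then show ?case unfolding hom_module_def using c[of f] c[of g] c[of h] N by (simp add: lmod_ac(1) cong: restrict_cong)
  next
    case (5 f g)
    then show ?case unfolding hom_module_def using c[of f] c[of g] N by (simp add: lmod_ac(2)[of N "f _"] cong: restrict_cong)
  next
    case (6 f)
    then have "f \<in> extensional (carrier P)" "f \<in> mod_hom R P N" by (simp_all add: hom_module_def mod_hom_iff)
    then show ?case unfolding hom_module_def using c[of f] N by (simp add: restrict_eqI)
  next
    case (7 a b f)
    then show ?case unfolding hom_module_def using c[of f] n by (simp cong: restrict_cong)
  next
    case (8 a f g)
    then show ?case unfolding hom_module_def using c[of f] c[of g] n by (simp cong: restrict_cong)
  next
    case (9 a b f)
    then show ?case unfolding hom_module_def using c[of f] n by (simp cong: restrict_cong)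
  next
    case (10 f)
    then have "f \<in> extensional (carrier P)" "f \<in> mod_hom R P N" by (simp_all add: hom_module_def mod_hom_iff)
    then show ?case unfolding hom_module_def using c[of f] n by (simp add: restrict_eqI)
  next
    case (11 f)
    then show ?case unfolding hom_module_def using c[of f] n by (simp cong: restrict_cong)
  qed
qed

lemma msum_hom_module:
  "(\<And>i. i < k \<Longrightarrow> u i \<in> extensional (carrier P)) \<Longrightarrow>
    msum (hom_module P N N') u k = (\<lambda>x\<in>carrier P. msum N (\<lambda>i. u i x) k)"
  by (induction k) (auto simp: hom_module_def fun_eq_iff)

text \<open>The zero map alone forms a group as soon as the zero of \<open>D\<close> is stable under
  addition and scalars. In this form the criterion applies directly to the module built by
  \<open>duality\<close>.\<close>

lemma trivial_hom_group_iff: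
  assumes N: "lmod N" and D: "\<zero>\<^bsub>D\<^esub> \<in> carrier D" "\<zero>\<^bsub>D\<^esub> \<oplus>\<^bsub>D\<^esub> \<zero>\<^bsub>D\<^esub> = \<zero>\<^bsub>D\<^esub>" "\<And>a. a \<in> carrier R \<Longrightarrow> a \<odot>\<^bsub>D\<^esub> \<zero>\<^bsub>D\<^esub> = \<zero>\<^bsub>D\<^esub>"
  shows "trivial_group (hom_group R N D) \<longleftrightarrow> (\<forall>h\<in>mod_hom R N D. \<forall>n\<in>carrier N. h n = \<zero>\<^bsub>D\<^esub>)"
proof
  assume "trivial_group (hom_group R N D)"
  then have "mod_hom R N D = {\<lambda>x\<in>carrier N. \<zero>\<^bsub>D\<^esub>}" by (simp add: trivial_group_def hom_group_def)
  then show "\<forall>h\<in>mod_hom R N D. \<forall>n\<in>carrier N. h n = \<zero>\<^bsub>D\<^esub>" by auto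
next
  assume *: "\<forall>h\<in>mod_hom R N D. \<forall>n\<in>carrier N. h n = \<zero>\<^bsub>D\<^esub>"
  let ?z = "\<lambda>x\<in>carrier N. \<zero>\<^bsub>D\<^esub>"
  have "lin N D (\<lambda>x. \<zero>\<^bsub>D\<^esub>)" using D by (intro linI) auto
  then have z: "?z \<in> mod_hom R N D" using restrict_mod_hom N by blast
  have hz: "h = ?z" if h: "h \<in> mod_hom R N D" for h
    using * h by (intro extensionalityI[of _ "carrier N"]) (auto simp: mod_hom_iff)
  have "mod_hom R N D = {?z}"
  proof
    show "mod_hom R N D \<subseteq> {?z}" using hz by (intro subsetI) simp
  qed (use z in simp)
  then have c: "carrier (hom_group R N D) = {?z}" by (simp add: hom_group_def)
  have m: "?z \<otimes>\<^bsub>hom_group R N D\<^esub> ?z = ?z" "\<one>\<^bsub>hom_group R N D\<^esub> = ?z"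
    by (simp_all add: hom_group_def D(2) cong: restrict_cong)
  have "group (hom_group R N D)" by (rule groupI) (simp_all add: c m)
  then show "trivial_group (hom_group R N D)" using c by (simp add: trivial_group_def hom_group_def)
qed

end

context artin begin

lemma O: "rng (op_ring \<Lambda>)" by (rule L.op_rng)

lemma ring_dual_eq: "ring_dual \<Lambda> P = L.hom_module P (regular_module \<Lambda>) (regular_module (op_ring \<Lambda>))"
  using rng.regular_simps(4)[OF O] by (simp add: ring_dual_def L.hom_module_def)

lemma ring_dual_lmod: "L.lmod P \<Longrightarrow> left_module (op_ring \<Lambda>) (ring_dual \<Lambda> P)"
  unfolding ring_dual_eq
  by (rule L.hom_module_lmod[OF O rng.lmod_regular[OF O] L.lmod_regular])
    (auto simp: rng.regular_simps[OF O] fun_eq_iff L.l_distr L.m_assoc regular_module_def intro!: L.linI)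

text \<open>The order of multiplication, reversed in \<open>op_ring\<close>, is restored by
  commutativity of \<open>R\<close>.\<close>

lemma rs_op_lmod:
  assumes Y: "left_module (op_ring \<Lambda>) Y" shows "R.lmod (restrict_scalars \<phi> Y)"
proof -
  interpret O: rng "op_ring \<Lambda>" by (rule O)
  have star: "\<phi> (a \<otimes>\<^bsub>R\<^esub> b) \<odot>\<^bsub>Y\<^esub> x = \<phi> a \<odot>\<^bsub>Y\<^esub> (\<phi> b \<odot>\<^bsub>Y\<^esub> x)"
    if "a \<in> carrier R" "b \<in> carrier R" "x \<in> carrier Y" for a b x
    using O.smult_distr(3)[OF Y, of "\<phi> a" "\<phi> b" x] that by (simp add: R.m_comm[of a b])
  show ?thesis
    by (rule R.left_moduleI)
      (use Y star O.smult_distr(1)[OF Y] O.lmod_simps(11)[OF Y] O.smult_null(1)[OF Y] in \<open>auto simp: O.lmod_ac O.smult_distr(1,2) simp del: phi(3)\<close>)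
qed

text \<open>Elements of \<open>Hom(N, D(Tr X))\<close> are balanced maps \<open>N \<times> Tr X \<rightarrow> J\<close>; by means of a dual basis of \<open>P1\<close> these
  correspond to the \<open>R\<close>-linear maps \<open>Hom(P1, N) \<rightarrow> J\<close> vanishing on the maps that factor through \<open>d\<close>.\<close>

lemma trivial_hom_duality_iff:
  fixes J :: "('r, 'j) module" and N :: "('a, 'n) module" and P0 :: "('a, 'p) module" and P1 :: "('a, 'q) module"
  assumes J: "duality_cogenerator R J" and N: "N \<in> fg_mod \<Lambda>"
    and P0: "P0 \<in> fg_proj \<Lambda>" and P1: "P1 \<in> fg_proj \<Lambda>" and d: "L.lin P1 P0 d"
  defines "Y \<equiv> quotient_module (ring_dual \<Lambda> P1) ((\<lambda>g. compose (carrier P1) g d) ` carrier (ring_dual \<Lambda> P0))"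
  shows "trivial_group (hom_group \<Lambda> N (duality R \<phi> J Y)) \<longleftrightarrow>
    (\<forall>f. L.lin P1 N f \<longrightarrow> (\<exists>g. L.lin P0 N g \<and> (\<forall>x\<in>carrier P1. f x = g (d x))))"
proof -
  interpret O: rng "op_ring \<Lambda>" by (rule O)
  note Nl = L.fg_modD(1)[OF N] and P0l = L.fg_projD(2)[OF P0] and P1l = L.fg_projD(2)[OF P1]
  have Jl: "R.lmod J" using J by (auto simp: duality_cogenerator_def injective_envelope_def injective_module_def)
  define D1 where "D1 = ring_dual \<Lambda> P1"
  define D0 where "D0 = ring_dual \<Lambda> P0"
  define B where "B = (\<lambda>g. compose (carrier P1) g d) ` carrier D0"
  have Yd: "Y = quotient_module D1 B" by (simp add: Y_def D1_def B_def D0_def)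
  have D1l: "O.lmod D1" and D0l: "O.lmod D0" unfolding D1_def D0_def using ring_dual_lmod P1l P0l by auto
  have D1s: "carrier D1 = mod_hom \<Lambda> P1 (regular_module \<Lambda>)" "\<And>f g. f \<oplus>\<^bsub>D1\<^esub> g = (\<lambda>x\<in>carrier P1. f x \<oplus>\<^bsub>\<Lambda>\<^esub> g x)"
    "\<And>a f. a \<odot>\<^bsub>D1\<^esub> f = (\<lambda>x\<in>carrier P1. f x \<otimes>\<^bsub>\<Lambda>\<^esub> a)"
    by (simp_all add: D1_def ring_dual_def)
  have D0s: "carrier D0 = mod_hom \<Lambda> P0 (regular_module \<Lambda>)" "\<And>f g. f \<oplus>\<^bsub>D0\<^esub> g = (\<lambda>x\<in>carrier P0. f x \<oplus>\<^bsub>\<Lambda>\<^esub> g x)"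
    "\<And>a f. a \<odot>\<^bsub>D0\<^esub> f = (\<lambda>x\<in>carrier P0. f x \<otimes>\<^bsub>\<Lambda>\<^esub> a)"
    by (simp_all add: D0_def ring_dual_def)
  have D1c: "f x \<in> carrier \<Lambda>" if "f \<in> carrier D1" "x \<in> carrier P1" for f x
    using L.linD(1)[OF L.mod_homD] that unfolding D1s by fastforce
  have D1lin: "L.lin P1 (regular_module \<Lambda>) f" if "f \<in> carrier D1" for f using L.mod_homD that unfolding D1s by blast
  have dc: "d x \<in> carrier P0" if "x \<in> carrier P1" for x by (rule L.linD(1)[OF d that])
  have "O.lin D0 D1 (\<lambda>g. compose (carrier P1) g d)"
  proof (rule O.linI)
    show "compose (carrier P1) g d \<in> carrier D1" if "g \<in> carrier D0" for g
      unfolding compose_alt D1s using that D0s L.restrict_mod_hom[OF L.lin_comp[OF d L.mod_homD] P1l] by simp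
  qed (use dc in \<open>auto simp: D1s D0s compose_alt cong: restrict_cong\<close>)
  then have B: "O.sub B D1" unfolding B_def by (rule O.sub_image[OF _ D0l D1l O.sub_carrier[OF D0l]])
  define \<rho> where "\<rho> f = B +>\<^bsub>D1\<^esub> f" for f
  have \<rho>: "O.lin D1 Y \<rho>" "\<rho> ` carrier D1 = carrier Y" "\<And>f. f \<in> carrier D1 \<Longrightarrow> \<rho> f = \<zero>\<^bsub>Y\<^esub> \<longleftrightarrow> f \<in> B" "O.lmod Y"
    using O.quotient[OF D1l B] unfolding Yd \<rho>_def[abs_def] by auto
  have Yl: "R.lmod (restrict_scalars \<phi> Y)" by (rule rs_op_lmod[OF \<rho>(4)])
  have \<rho>c: "\<rho> f \<in> carrier Y" if "f \<in> carrier D1" for f by (rule O.linD(1)[OF \<rho>(1) that])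
  let ?D = "duality R \<phi> J Y"
  have Ds: "carrier ?D = mod_hom R (restrict_scalars \<phi> Y) J" "\<zero>\<^bsub>?D\<^esub> = (\<lambda>y\<in>carrier Y. \<zero>\<^bsub>J\<^esub>)"
    "\<And>f g. f \<oplus>\<^bsub>?D\<^esub> g = (\<lambda>y\<in>carrier Y. f y \<oplus>\<^bsub>J\<^esub> g y)" "\<And>a f. a \<odot>\<^bsub>?D\<^esub> f = (\<lambda>y\<in>carrier Y. f (a \<odot>\<^bsub>Y\<^esub> y))"
    by (simp_all add: duality_def)
  have ti: "trivial_group (hom_group \<Lambda> N ?D) \<longleftrightarrow> (\<forall>h\<in>mod_hom \<Lambda> N ?D. \<forall>n\<in>carrier N. h n = \<zero>\<^bsub>?D\<^esub>)"
  proof (rule L.trivial_hom_group_iff[OF Nl])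
    show "\<zero>\<^bsub>?D\<^esub> \<in> carrier ?D" unfolding Ds using R.restrict_mod_hom[OF R.lin_const_zero[OF Jl] Yl] by simp
    show "\<zero>\<^bsub>?D\<^esub> \<oplus>\<^bsub>?D\<^esub> \<zero>\<^bsub>?D\<^esub> = \<zero>\<^bsub>?D\<^esub>" unfolding Ds using Jl by (simp cong: restrict_cong)
    show "a \<odot>\<^bsub>?D\<^esub> \<zero>\<^bsub>?D\<^esub> = \<zero>\<^bsub>?D\<^esub>" if "a \<in> carrier \<Lambda>" for a
      unfolding Ds using O.lmod_simps(5)[OF \<rho>(4), of a] that by (simp cong: restrict_cong)
  qed
  obtain k xs fs where db: "\<And>i. i < k \<Longrightarrow> xs i \<in> carrier P1" "\<And>i. i < k \<Longrightarrow> L.lin P1 (regular_module \<Lambda>) (fs i)"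
    "\<And>x. x \<in> carrier P1 \<Longrightarrow> x = msum P1 (\<lambda>i. fs i x \<odot>\<^bsub>P1\<^esub> xs i) k"
    by (rule L.dual_basis[OF P1]) (rule that)
  define F where "F i = restrict (fs i) (carrier P1)" for i
  have F: "F i \<in> carrier D1" if "i < k" for i unfolding F_def D1s by (rule L.restrict_mod_hom[OF db(2)[OF that] P1l])
  have fsc: "fs i x \<in> carrier \<Lambda>" if "i < k" "x \<in> carrier P1" for i x using L.linD(1)[OF db(2)] that by simp
  have expand: "g x = msum Q (\<lambda>i. fs i x \<odot>\<^bsub>Q\<^esub> g (xs i)) k"
    if Q: "L.lmod Q" and g: "L.lin P1 Q g" and x: "x \<in> carrier P1" for g x and Q :: "('a, 'z) module"
  proof -
    have "g x = g (msum P1 (\<lambda>i. fs i x \<odot>\<^bsub>P1\<^esub> xs i) k)" using db(3)[OF x] by simp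
    also have "\<dots> = msum Q (\<lambda>i. g (fs i x \<odot>\<^bsub>P1\<^esub> xs i)) k"
      using db(1) fsc x P1l by (intro L.msum_lin[OF g P1l Q]) auto
    also have "\<dots> = msum Q (\<lambda>i. fs i x \<odot>\<^bsub>Q\<^esub> g (xs i)) k"
      using db(1) fsc x by (intro L.msum_cong) (auto simp: L.linD[OF g])
    finally show ?thesis .
  qed
  have lsm: "L.lin P1 N (\<lambda>x. f x \<odot>\<^bsub>N\<^esub> n)" if "f \<in> carrier D1" "n \<in> carrier N" for f n
    using that(2) D1c[OF that(1)] L.linD[OF D1lin[OF that(1)]] Nl
    by (intro L.linI) (auto simp: L.smult_distr)
  show ?thesis unfolding ti
  proof (intro iffI allI impI ballI)
    fix h n assume fact: "\<forall>f. L.lin P1 N f \<longrightarrow> (\<exists>g. L.lin P0 N g \<and> (\<forall>x\<in>carrier P1. f x = g (d x)))"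
      and h: "h \<in> mod_hom \<Lambda> N ?D" and n: "n \<in> carrier N"
    have hc: "h c \<in> mod_hom R (restrict_scalars \<phi> Y) J" if "c \<in> carrier N" for c
      using L.linD(1)[OF L.mod_homD[OF h] that] by (simp add: Ds)
    have hl: "R.lin (restrict_scalars \<phi> Y) J (h c)" if "c \<in> carrier N" for c by (rule R.mod_homD[OF hc[OF that]])
    have hJ: "h c y \<in> carrier J" if "c \<in> carrier N" "y \<in> carrier Y" for c y
      using R.linD(1)[OF hl[OF that(1)], of y] that(2) by simp
    have h0: "h c \<zero>\<^bsub>Y\<^esub> = \<zero>\<^bsub>J\<^esub>" if "c \<in> carrier N" for c using R.lin_zero[OF hl[OF that] Yl Jl] by simp
    have hadd: "h (b \<oplus>\<^bsub>N\<^esub> c) y = h b y \<oplus>\<^bsub>J\<^esub> h c y" if "b \<in> carrier N" "c \<in> carrier N" "y \<in> carrier Y" for b c y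
      using L.linD(2)[OF L.mod_homD[OF h] that(1,2)] that(3) by (simp add: Ds)
    have hsm: "h (a \<odot>\<^bsub>N\<^esub> c) y = h c (a \<odot>\<^bsub>Y\<^esub> y)" if "a \<in> carrier \<Lambda>" "c \<in> carrier N" "y \<in> carrier Y" for a c y
      using L.linD(3)[OF L.mod_homD[OF h] that(1,2)] that(3) by (simp add: Ds)
    \<comment> \<open>The functional on \<open>Hom(P1, N)\<close> that belongs to \<open>h\<close>:
      by the dual basis, \<open>g\<close> is the sum of the maps sending \<open>x\<close> to
      \<open>fs i x\<close> times \<open>g (xs i)\<close>, and \<open>h\<close> evaluates each
      summand.\<close>
    define lam where "lam g = msum J (\<lambda>i. h (g (xs i)) (\<rho> (F i))) k" for g
    have add: "lam (\<lambda>x. msum N (\<lambda>j. G j x) m) = msum J (\<lambda>j. lam (G j)) m"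
      if "\<And>j i. \<lbrakk>j < m; i < k\<rbrakk> \<Longrightarrow> G j (xs i) \<in> carrier N" for G and m :: nat
      using that
    proof (induction m)
      case 0
      have "h \<zero>\<^bsub>N\<^esub> y = \<zero>\<^bsub>J\<^esub>" if "y \<in> carrier Y" for y
      proof -
        have "h \<zero>\<^bsub>N\<^esub> y = h (\<zero>\<^bsub>\<Lambda>\<^esub> \<odot>\<^bsub>N\<^esub> \<zero>\<^bsub>N\<^esub>) y" using Nl by simp
        also have "\<dots> = h \<zero>\<^bsub>N\<^esub> \<zero>\<^bsub>Y\<^esub>" using hsm[of "\<zero>\<^bsub>\<Lambda>\<^esub>" "\<zero>\<^bsub>N\<^esub>" y] O.smult_null(1)[OF \<rho>(4) that] Nl that by simp
        finally show ?thesis using h0 Nl by simp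
      qed
      then show ?case unfolding lam_def using F \<rho>c by (simp add: R.msum_zero[OF Jl])
    next
      case (Suc m)
      have mc: "msum N (\<lambda>j. G j (xs i)) m \<in> carrier N" if "i < k" for i
        using Suc.prems that by (intro L.msum_closed[OF Nl]) auto
      have "lam (\<lambda>x. msum N (\<lambda>j. G j x) (Suc m)) =
          msum J (\<lambda>i. h (msum N (\<lambda>j. G j (xs i)) m) (\<rho> (F i)) \<oplus>\<^bsub>J\<^esub> h (G m (xs i)) (\<rho> (F i))) k"
        unfolding lam_def using mc Suc.prems F \<rho>c by (intro L.msum_cong) (simp add: hadd)
      also have "\<dots> = lam (\<lambda>x. msum N (\<lambda>j. G j x) m) \<oplus>\<^bsub>J\<^esub> lam (G m)"
        unfolding lam_def using mc Suc.prems F \<rho>c by (intro R.msum_add[OF Jl] hJ) auto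
      finally show ?case using Suc by simp
    qed
    \<comment> \<open>The scalars \<open>f (xs i)\<close> move from the first to the second argument
      of \<open>h\<close>, and \<open>f\<close> is the combination of the coordinate forms
      \<open>F i\<close> with these scalars.\<close>
    have eval: "lam (\<lambda>x. f x \<odot>\<^bsub>N\<^esub> c) = h c (\<rho> f)" if f: "f \<in> carrier D1" and c: "c \<in> carrier N" for f c
    proof -
      have fx: "f (xs i) \<in> carrier \<Lambda>" if "i < k" for i using D1c[OF f db(1)[OF that]] .
      have sc: "f (xs i) \<odot>\<^bsub>D1\<^esub> F i \<in> carrier D1" if "i < k" for i
        using O.lmod_simps(5)[OF D1l, of "f (xs i)" "F i"] fx F that by simp
      have "lam (\<lambda>x. f x \<odot>\<^bsub>N\<^esub> c) = msum J (\<lambda>i. h c (\<rho> (f (xs i) \<odot>\<^bsub>D1\<^esub> F i))) k"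
        unfolding lam_def using fx c F \<rho>c O.linD(3)[OF \<rho>(1)] by (intro L.msum_cong) (simp add: hsm)
      also have "\<dots> = h c (msum Y (\<lambda>i. \<rho> (f (xs i) \<odot>\<^bsub>D1\<^esub> F i)) k)"
        using R.msum_lin[OF hl[OF c] Yl Jl, of k "\<lambda>i. \<rho> (f (xs i) \<odot>\<^bsub>D1\<^esub> F i)"] sc \<rho>c by simp
      also have "msum Y (\<lambda>i. \<rho> (f (xs i) \<odot>\<^bsub>D1\<^esub> F i)) k = \<rho> (msum D1 (\<lambda>i. f (xs i) \<odot>\<^bsub>D1\<^esub> F i) k)"
        by (rule O.msum_lin[OF \<rho>(1) D1l \<rho>(4) sc, symmetric])
      also have "msum D1 (\<lambda>i. f (xs i) \<odot>\<^bsub>D1\<^esub> F i) k = f"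
      proof -
        have "msum D1 (\<lambda>i. f (xs i) \<odot>\<^bsub>D1\<^esub> F i) k
          = (\<lambda>x\<in>carrier P1. msum (regular_module \<Lambda>) (\<lambda>i. (f (xs i) \<odot>\<^bsub>D1\<^esub> F i) x) k)"
          unfolding D1_def ring_dual_eq by (rule L.msum_hom_module) (simp add: L.hom_module_def)
        also have "\<dots> = f"
        proof (rule restrict_eqI)
          show "f \<in> extensional (carrier P1)" using f by (simp add: D1s L.mod_hom_iff)
          fix x assume x: "x \<in> carrier P1"
          show "msum (regular_module \<Lambda>) (\<lambda>i. (f (xs i) \<odot>\<^bsub>D1\<^esub> F i) x) k = f x"
            unfolding expand[OF L.lmod_regular D1lin[OF f] x]
            using x by (intro L.msum_cong) (simp add: D1s F_def)
        qed
        finally show ?thesis .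
      qed
      finally show ?thesis .
    qed
    have "h n (\<rho> f) = \<zero>\<^bsub>J\<^esub>" if f: "f \<in> carrier D1" for f
    proof -
      obtain g where g: "L.lin P0 N g" "\<And>x. x \<in> carrier P1 \<Longrightarrow> f x \<odot>\<^bsub>N\<^esub> n = g (d x)"
        using fact[rule_format, OF lsm[OF f n]] by auto
      obtain m ys ps where d0: "\<And>i. i < m \<Longrightarrow> ys i \<in> carrier P0" "\<And>i. i < m \<Longrightarrow> L.lin P0 (regular_module \<Lambda>) (ps i)"
        "\<And>x. x \<in> carrier P0 \<Longrightarrow> x = msum P0 (\<lambda>i. ps i x \<odot>\<^bsub>P0\<^esub> ys i) m"
        by (rule L.dual_basis[OF P0]) (rule that)
      \<comment> \<open>Expanding \<open>g\<close> along a dual basis of \<open>P0\<close> writes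
        the map as a sum of elementary maps whose forms \<open>G j\<close> factor through
        \<open>d\<close> and hence vanish in \<open>Y\<close>.\<close>
      define G where "G j = compose (carrier P1) (restrict (ps j) (carrier P0)) d" for j
      have GB: "G j \<in> B" if "j < m" for j
        unfolding G_def B_def D0s using L.restrict_mod_hom[OF d0(2)[OF that] P0l] by blast
      have GD: "G j \<in> carrier D1" if "j < m" for j using O.subD(2)[OF B GB[OF that]] .
      have Gx: "G j x = ps j (d x)" if "x \<in> carrier P1" for j x using that dc by (simp add: G_def compose_alt)
      have psc: "ps j y \<in> carrier \<Lambda>" if "j < m" "y \<in> carrier P0" for j y using L.linD(1)[OF d0(2)[OF that(1)] that(2)] by simp
      have gy: "g (ys j) \<in> carrier N" if "j < m" for j using L.linD(1)[OF g(1)] d0(1) that by simp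
      have fx: "f x \<odot>\<^bsub>N\<^esub> n = msum N (\<lambda>j. G j x \<odot>\<^bsub>N\<^esub> g (ys j)) m" if x: "x \<in> carrier P1" for x
      proof -
        have "f x \<odot>\<^bsub>N\<^esub> n = g (msum P0 (\<lambda>j. ps j (d x) \<odot>\<^bsub>P0\<^esub> ys j) m)" using g(2)[OF x] d0(3)[OF dc[OF x]] by simp
        also have "\<dots> = msum N (\<lambda>j. g (ps j (d x) \<odot>\<^bsub>P0\<^esub> ys j)) m"
          using d0(1) psc dc[OF x] P0l by (intro L.msum_lin[OF g(1) P0l Nl]) auto
        also have "\<dots> = msum N (\<lambda>j. G j x \<odot>\<^bsub>N\<^esub> g (ys j)) m"
          using d0(1) psc dc[OF x] x by (intro L.msum_cong) (simp add: Gx L.linD(3)[OF g(1)])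
        finally show ?thesis .
      qed
      have "h n (\<rho> f) = lam (\<lambda>x. f x \<odot>\<^bsub>N\<^esub> n)" using eval[OF f n] by simp
      also have "\<dots> = lam (\<lambda>x. msum N (\<lambda>j. G j x \<odot>\<^bsub>N\<^esub> g (ys j)) m)"
        unfolding lam_def using db(1) fx by (intro L.msum_cong) simp
      also have "\<dots> = msum J (\<lambda>j. lam (\<lambda>x. G j x \<odot>\<^bsub>N\<^esub> g (ys j))) m"
        using Nl gy D1c[OF GD db(1)] by (intro add) auto
      also have "\<dots> = \<zero>\<^bsub>J\<^esub>"
        using eval[OF GD gy] \<rho>(3)[OF GD] GB h0[OF gy] by (intro R.msum_zero[OF Jl]) simp
      finally show ?thesis .
    qed
    then have "h n y = \<zero>\<^bsub>J\<^esub>" if "y \<in> carrier Y" for y using that \<rho>(2) by (metis imageE)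
    then show "h n = \<zero>\<^bsub>?D\<^esub>"
      using hc[OF n] unfolding Ds R.mod_hom_iff by (intro restrict_eqI[symmetric]) auto
  next
    fix f0 assume triv: "\<forall>h\<in>mod_hom \<Lambda> N ?D. \<forall>n\<in>carrier N. h n = \<zero>\<^bsub>?D\<^esub>" and f0: "L.lin P1 N f0"
    show "\<exists>g. L.lin P0 N g \<and> (\<forall>x\<in>carrier P1. f0 x = g (d x))"
    proof (rule ccontr)
      assume no: "\<not> (\<exists>g. L.lin P0 N g \<and> (\<forall>x\<in>carrier P1. f0 x = g (d x)))"
      define V where "V = L.hom_module P1 N (rs N)"
      define V0 where "V0 = L.hom_module P0 N (rs N)"
      have Vl: "R.lmod V" and V0l: "R.lmod V0" unfolding V_def V0_def
        using L.hom_module_lmod[OF R.rng_axioms rs_lmod[OF Nl] Nl P1l] L.hom_module_lmod[OF R.rng_axioms rs_lmod[OF Nl] Nl P0l]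
          central_lin[OF Nl] by (simp_all add: fun_eq_iff restrict_scalars_def)
      have Vs: "carrier V = mod_hom \<Lambda> P1 N" "\<And>f g. f \<oplus>\<^bsub>V\<^esub> g = (\<lambda>x\<in>carrier P1. f x \<oplus>\<^bsub>N\<^esub> g x)"
        "\<And>r f. r \<odot>\<^bsub>V\<^esub> f = (\<lambda>x\<in>carrier P1. \<phi> r \<odot>\<^bsub>N\<^esub> f x)" by (simp_all add: V_def L.hom_module_def)
      have V0s: "carrier V0 = mod_hom \<Lambda> P0 N" "\<And>f g. f \<oplus>\<^bsub>V0\<^esub> g = (\<lambda>x\<in>carrier P0. f x \<oplus>\<^bsub>N\<^esub> g x)"
        "\<And>r f. r \<odot>\<^bsub>V0\<^esub> f = (\<lambda>x\<in>carrier P0. \<phi> r \<odot>\<^bsub>N\<^esub> f x)" by (simp_all add: V0_def L.hom_module_def)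
      \<comment> \<open>The maps that factor through \<open>d\<close>. If \<open>f0\<close> were not
        among them, some functional to \<open>J\<close> would vanish on \<open>W\<close> but not on
        all of \<open>V\<close>.\<close>
      define W where "W = (\<lambda>g. compose (carrier P1) g d) ` carrier V0"
      have "R.lin V0 V (\<lambda>g. compose (carrier P1) g d)"
      proof (rule R.linI)
        show "compose (carrier P1) g d \<in> carrier V" if "g \<in> carrier V0" for g
          unfolding compose_alt Vs using that V0s L.restrict_mod_hom[OF L.lin_comp[OF d L.mod_homD] P1l] by simp
      qed (use dc in \<open>auto simp: Vs V0s compose_alt cong: restrict_cong\<close>)
      then have W: "R.sub W V" unfolding W_def by (rule R.sub_image[OF _ V0l Vl R.sub_carrier[OF V0l]])
      have WI: "(\<lambda>x\<in>carrier P1. f x) \<in> W" if "L.lin P0 N g" "\<And>x. x \<in> carrier P1 \<Longrightarrow> f x = g (d x)" for f g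
        unfolding W_def V0s compose_alt using L.restrict_mod_hom[OF that(1) P0l] that(2) dc
        by (intro image_eqI[of _ _ "restrict g (carrier P0)"]) (auto intro!: restrict_ext)
      have "restrict f0 (carrier P1) \<notin> W"
      proof
        assume "restrict f0 (carrier P1) \<in> W"
        then obtain g where g: "g \<in> mod_hom \<Lambda> P0 N" "restrict f0 (carrier P1) = (\<lambda>x\<in>carrier P1. g (d x))"
          unfolding W_def V0s compose_alt by auto
        have "f0 x = g (d x)" if "x \<in> carrier P1" for x using fun_cong[OF g(2), of x] that by simp
        then show False using no L.mod_homD[OF g(1)] by blast
      qed
      then have WV: "W \<noteq> carrier V" unfolding Vs using L.restrict_mod_hom[OF f0 P1l] by auto
      obtain a gs where gs: "\<And>l. l < a \<Longrightarrow> L.lin P1 N (gs l)"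
        "\<And>g. L.lin P1 N g \<Longrightarrow> \<exists>r. (\<forall>l<a. r l \<in> carrier R) \<and>
          (\<forall>x\<in>carrier P1. g x = msum N (\<lambda>l. \<phi> (r l) \<odot>\<^bsub>N\<^esub> gs l x) a)"
        by (rule hom_fg[OF L.fg_projD(1)[OF P1] N]) (rule that)
      have msV: "msum V u m = (\<lambda>x\<in>carrier P1. msum N (\<lambda>i. u i x) m)"
        if "\<And>i. i < m \<Longrightarrow> u i \<in> extensional (carrier P1)" for u m
        unfolding V_def by (rule L.msum_hom_module[OF that])
      have "R.fgs V (carrier V)" unfolding R.fgs_def
      proof (intro exI[of _ a] exI[of _ "\<lambda>l. restrict (gs l) (carrier P1)"] conjI allI impI subsetI)
        show "restrict (gs l) (carrier P1) \<in> carrier V" if "l < a" for l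
          unfolding Vs by (rule L.restrict_mod_hom[OF gs(1)[OF that] P1l])
        fix g assume g: "g \<in> carrier V"
        then have "L.lin P1 N g" unfolding Vs by (rule L.mod_homD)
        then obtain r where r: "\<forall>l<a. r l \<in> carrier R" "\<forall>x\<in>carrier P1. g x = msum N (\<lambda>l. \<phi> (r l) \<odot>\<^bsub>N\<^esub> gs l x) a"
          using gs(2)[of g] by auto
        have "msum V (\<lambda>l. r l \<odot>\<^bsub>V\<^esub> restrict (gs l) (carrier P1)) a = g"
        proof (subst msV)
          show "(\<lambda>x\<in>carrier P1. msum N (\<lambda>i. (r i \<odot>\<^bsub>V\<^esub> restrict (gs i) (carrier P1)) x) a) = g"
            using g r(2) by (intro restrict_eqI) (auto simp: Vs L.mod_hom_iff intro!: L.msum_cong)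
        qed (simp add: Vs)
        then show "g \<in> R.lspan V a (\<lambda>l. restrict (gs l) (carrier P1))" unfolding R.lspan_def using r(1) by auto
      qed
      then have Vf: "V \<in> fg_mod R" by (rule R.fg_modI[OF Vl])
      obtain lam where l: "R.lin V J lam" "\<And>w. w \<in> W \<Longrightarrow> lam w = \<zero>\<^bsub>J\<^esub>" and l0: "\<exists>v\<in>carrier V. lam v \<noteq> \<zero>\<^bsub>J\<^esub>"
        using cogenerator_separates[OF J Vf W WV] by auto
      define t where "t f n = (\<lambda>x\<in>carrier P1. f x \<odot>\<^bsub>N\<^esub> n)" for f n
      have tV: "t f n \<in> carrier V" if "f \<in> carrier D1" "n \<in> carrier N" for f n
        unfolding t_def Vs by (rule L.restrict_mod_hom[OF lsm[OF that] P1l])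
      \<comment> \<open>The functional evaluated on elementary maps. Two representatives of a class
        in \<open>Y\<close> differ by a form through \<open>d\<close>, and \<open>lam\<close>
        vanishes on what this contributes.\<close>
      define h where "h = (\<lambda>n\<in>carrier N. \<lambda>y\<in>carrier Y. lam (t (SOME f. f \<in> carrier D1 \<and> \<rho> f = y) n))"
      have hr: "h n (\<rho> f) = lam (t f n)" if f: "f \<in> carrier D1" and n: "n \<in> carrier N" for f n
      proof -
        define f' where "f' = (SOME g. g \<in> carrier D1 \<and> \<rho> g = \<rho> f)"
        have f': "f' \<in> carrier D1" "\<rho> f' = \<rho> f"
          using someI[of "\<lambda>g. g \<in> carrier D1 \<and> \<rho> g = \<rho> f" f] f unfolding f'_def by auto
        have b: "f' \<ominus>\<^bsub>D1\<^esub> f \<in> B" using f' f O.coset_eq_iff[OF D1l B f'(1) f] by (simp add: \<rho>_def)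
        then obtain u where u: "u \<in> mod_hom \<Lambda> P0 (regular_module \<Lambda>)" "f' \<ominus>\<^bsub>D1\<^esub> f = (\<lambda>x\<in>carrier P1. u (d x))"
          unfolding B_def D0s compose_alt by auto
        have ul: "L.lin P0 (regular_module \<Lambda>) u" by (rule L.mod_homD[OF u(1)])
        have un: "L.lin P0 N (\<lambda>x. u x \<odot>\<^bsub>N\<^esub> n)"
          using n L.linD[OF ul] Nl by (intro L.linI) (auto simp: L.smult_distr)
        have "f' = (f' \<ominus>\<^bsub>D1\<^esub> f) \<oplus>\<^bsub>D1\<^esub> f" using O.diff_eq_iff[OF D1l f'(1) f, of "f' \<ominus>\<^bsub>D1\<^esub> f"] D1l f f' by simp
        then have "f' = (\<lambda>x\<in>carrier P1. (\<lambda>x\<in>carrier P1. u (d x)) x \<oplus>\<^bsub>\<Lambda>\<^esub> f x)" unfolding u(2) D1s(2) .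
        then have fx: "f' x = u (d x) \<oplus>\<^bsub>\<Lambda>\<^esub> f x" if "x \<in> carrier P1" for x
          using that by (metis (no_types, lifting) restrict_apply')
        have "t f' n = (\<lambda>x\<in>carrier P1. u (d x) \<odot>\<^bsub>N\<^esub> n) \<oplus>\<^bsub>V\<^esub> t f n"
          unfolding t_def Vs(2) using fx n Nl D1c[OF f] L.linD(1)[OF ul] dc
          by (intro restrict_ext) (simp add: L.smult_distr(1)[OF Nl])
        moreover have w: "(\<lambda>x\<in>carrier P1. u (d x) \<odot>\<^bsub>N\<^esub> n) \<in> W" by (rule WI[OF un]) simp
        ultimately have "lam (t f' n) = lam (t f n)"
          using R.linD(2)[OF l(1) R.subD(2)[OF W w] tV[OF f n]] l(2)[OF w] R.linD(1)[OF l(1) tV[OF f n]] Jl by simp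
        then show ?thesis using \<rho>c[OF f] n by (simp add: h_def f'_def)
      qed
      have Ysurj: "\<exists>f\<in>carrier D1. y = \<rho> f" if "y \<in> carrier Y" for y using that \<rho>(2) by auto
      have hn: "h n \<in> carrier ?D" if n: "n \<in> carrier N" for n
      proof -
        have "R.lin (restrict_scalars \<phi> Y) J (h n)"
        proof (rule R.linI)
          fix y assume "y \<in> carrier (restrict_scalars \<phi> Y)"
          then obtain f where f: "f \<in> carrier D1" "y = \<rho> f" using Ysurj by auto
          show "h n y \<in> carrier J" unfolding f(2) hr[OF f(1) n] by (rule R.linD(1)[OF l(1) tV[OF f(1) n]])
          { fix z assume "z \<in> carrier (restrict_scalars \<phi> Y)"
            then obtain g where g: "g \<in> carrier D1" "z = \<rho> g" using Ysurj by auto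
            have fg: "f \<oplus>\<^bsub>D1\<^esub> g \<in> carrier D1" using f g D1l by simp
            have "t (f \<oplus>\<^bsub>D1\<^esub> g) n = t f n \<oplus>\<^bsub>V\<^esub> t g n"
              unfolding t_def Vs(2) D1s(2) using D1c[OF f(1)] D1c[OF g(1)] n
              by (intro restrict_ext) (simp add: L.smult_distr(1)[OF Nl])
            then have "h n (\<rho> (f \<oplus>\<^bsub>D1\<^esub> g)) = h n (\<rho> f) \<oplus>\<^bsub>J\<^esub> h n (\<rho> g)"
              using hr[OF fg n] hr[OF f(1) n] hr[OF g(1) n] R.linD(2)[OF l(1) tV[OF f(1) n] tV[OF g(1) n]] by simp
            then show "h n (y \<oplus>\<^bsub>restrict_scalars \<phi> Y\<^esub> z) = h n y \<oplus>\<^bsub>J\<^esub> h n z"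
              using f g O.linD(2)[OF \<rho>(1) f(1) g(1)] by simp }
          { fix r assume r: "r \<in> carrier R"
            have fr: "\<phi> r \<odot>\<^bsub>D1\<^esub> f \<in> carrier D1" using O.lmod_simps(5)[OF D1l] f r by simp
            have "t (\<phi> r \<odot>\<^bsub>D1\<^esub> f) n = r \<odot>\<^bsub>V\<^esub> t f n"
              unfolding t_def Vs(3) D1s(3) using D1c[OF f(1)] n r
              by (intro restrict_ext) (simp add: L.smult_distr(3)[OF Nl, symmetric] phi_central)
            then have "h n (\<rho> (\<phi> r \<odot>\<^bsub>D1\<^esub> f)) = r \<odot>\<^bsub>J\<^esub> h n (\<rho> f)"
              using hr[OF fr n] hr[OF f(1) n] R.linD(3)[OF l(1) r tV[OF f(1) n]] by simp
            then show "h n (r \<odot>\<^bsub>restrict_scalars \<phi> Y\<^esub> y) = r \<odot>\<^bsub>J\<^esub> h n y"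
              using f r O.linD(3)[OF \<rho>(1), of "\<phi> r" f] by simp }
        qed
        moreover have "h n \<in> extensional (carrier Y)" using n by (simp add: h_def)
        ultimately show ?thesis unfolding Ds by (simp add: R.mod_hom_iff)
      qed
      have hext: "u = v" if "u \<in> carrier ?D" "v \<in> carrier ?D" "\<And>f. f \<in> carrier D1 \<Longrightarrow> u (\<rho> f) = v (\<rho> f)" for u v
      proof (rule extensionalityI[of _ "carrier Y"])
        show "u \<in> extensional (carrier Y)" "v \<in> extensional (carrier Y)" using that(1,2) by (auto simp: Ds R.mod_hom_iff)
        show "u y = v y" if "y \<in> carrier Y" for y using Ysurj[OF that] \<open>\<And>f. f \<in> carrier D1 \<Longrightarrow> u (\<rho> f) = v (\<rho> f)\<close> by auto
      qed
      have restD: "(\<lambda>y\<in>carrier Y. p y) \<in> carrier ?D" if "R.lin (restrict_scalars \<phi> Y) J p" for p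
        unfolding Ds using R.restrict_mod_hom[OF that Yl] by simp
      have hlin: "R.lin (restrict_scalars \<phi> Y) J (h n)" if "n \<in> carrier N" for n
        using hn[OF that] unfolding Ds by (rule R.mod_homD)
      have "L.lin N ?D h"
      proof (rule L.linI)
        show "h n \<in> carrier ?D" if "n \<in> carrier N" for n by (rule hn[OF that])
        fix n assume n: "n \<in> carrier N"
        { fix n' assume n': "n' \<in> carrier N"
          have nn: "n \<oplus>\<^bsub>N\<^esub> n' \<in> carrier N" using n n' Nl by simp
          show "h (n \<oplus>\<^bsub>N\<^esub> n') = h n \<oplus>\<^bsub>?D\<^esub> h n'"
          proof (rule hext[OF hn[OF nn]])
            show "h n \<oplus>\<^bsub>?D\<^esub> h n' \<in> carrier ?D" unfolding Ds(3)
              by (rule restD[OF R.lin_add[OF hlin[OF n] hlin[OF n'] Jl]])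
            fix f assume f: "f \<in> carrier D1"
            have "t f (n \<oplus>\<^bsub>N\<^esub> n') = t f n \<oplus>\<^bsub>V\<^esub> t f n'"
              unfolding t_def Vs(2) using D1c[OF f] n n' by (intro restrict_ext) (simp add: L.smult_distr(2)[OF Nl])
            then show "h (n \<oplus>\<^bsub>N\<^esub> n') (\<rho> f) = (h n \<oplus>\<^bsub>?D\<^esub> h n') (\<rho> f)"
              using hr[OF f nn] hr[OF f n] hr[OF f n'] R.linD(2)[OF l(1) tV[OF f n] tV[OF f n']] \<rho>c[OF f] by (simp add: Ds)
          qed }
        { fix a assume a: "a \<in> carrier \<Lambda>"
          have an: "a \<odot>\<^bsub>N\<^esub> n \<in> carrier N" using n a Nl by simp
          show "h (a \<odot>\<^bsub>N\<^esub> n) = a \<odot>\<^bsub>?D\<^esub> h n"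
          proof (rule hext[OF hn[OF an]])
            have "R.lin (restrict_scalars \<phi> Y) (restrict_scalars \<phi> Y) (\<lambda>y. a \<odot>\<^bsub>Y\<^esub> y)"
            proof (rule R.linI)
              show "r \<in> carrier R \<Longrightarrow> y \<in> carrier (rs Y) \<Longrightarrow> a \<odot>\<^bsub>Y\<^esub> (r \<odot>\<^bsub>restrict_scalars \<phi> Y\<^esub> y) = r \<odot>\<^bsub>restrict_scalars \<phi> Y\<^esub> (a \<odot>\<^bsub>Y\<^esub> y)" for r y
                using O.smult_distr(3)[OF \<rho>(4), of a "\<phi> r" y] O.smult_distr(3)[OF \<rho>(4), of "\<phi> r" a y] a by (simp add: phi_central)
            qed (use O.smult_distr(2)[OF \<rho>(4)] O.lmod_simps(5)[OF \<rho>(4)] a in auto)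
            then show "a \<odot>\<^bsub>?D\<^esub> h n \<in> carrier ?D" unfolding Ds(4) by (rule restD[OF R.lin_comp[OF _ hlin[OF n]]])
            fix f assume f: "f \<in> carrier D1"
            have fa: "a \<odot>\<^bsub>D1\<^esub> f \<in> carrier D1" using O.lmod_simps(5)[OF D1l] f a by simp
            have "t f (a \<odot>\<^bsub>N\<^esub> n) = t (a \<odot>\<^bsub>D1\<^esub> f) n"
              unfolding t_def D1s(3) using D1c[OF f] n a by (intro restrict_ext) (simp add: L.smult_distr(3)[OF Nl])
            then show "h (a \<odot>\<^bsub>N\<^esub> n) (\<rho> f) = (a \<odot>\<^bsub>?D\<^esub> h n) (\<rho> f)"
              using hr[OF f an] hr[OF fa n] O.linD(3)[OF \<rho>(1), of a f] f a \<rho>c[OF f] by (simp add: Ds)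
          qed }
      qed
      then have "h \<in> mod_hom \<Lambda> N ?D" by (simp add: L.mod_hom_iff h_def)
      then have hz: "h n = \<zero>\<^bsub>?D\<^esub>" if "n \<in> carrier N" for n using triv that by blast
      have tz: "lam (t f n) = \<zero>\<^bsub>J\<^esub>" if "f \<in> carrier D1" "n \<in> carrier N" for f n
        using hr[OF that] hz[OF that(2)] \<rho>c[OF that(1)] by (simp add: Ds)
      \<comment> \<open>By the dual basis, elementary maps span all maps from \<open>P1\<close> to
        \<open>N\<close>; a functional vanishing on them is zero, contrary to the choice of
        \<open>lam\<close>.\<close>
      have "lam v = \<zero>\<^bsub>J\<^esub>" if v: "v \<in> carrier V" for v
      proof -
        have vl: "L.lin P1 N v" using v unfolding Vs by (rule L.mod_homD)
        have vx: "v (xs i) \<in> carrier N" if "i < k" for i using L.linD(1)[OF vl db(1)[OF that]] .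
        have "msum V (\<lambda>i. t (F i) (v (xs i))) k = v"
        proof (subst msV)
          show "(\<lambda>x\<in>carrier P1. msum N (\<lambda>i. t (F i) (v (xs i)) x) k) = v"
          proof (rule restrict_eqI)
            show "v \<in> extensional (carrier P1)" using v by (simp add: Vs L.mod_hom_iff)
            show "msum N (\<lambda>i. t (F i) (v (xs i)) x) k = v x" if "x \<in> carrier P1" for x
              unfolding expand[OF Nl vl that] using that by (intro L.msum_cong) (simp add: t_def F_def)
          qed
        qed (simp add: t_def)
        then have "lam v = lam (msum V (\<lambda>i. t (F i) (v (xs i))) k)" by simp
        also have "\<dots> = msum J (\<lambda>i. lam (t (F i) (v (xs i)))) k"
          by (rule R.msum_lin[OF l(1) Vl Jl tV[OF F vx]])
        also have "\<dots> = \<zero>\<^bsub>J\<^esub>" using tz[OF F vx] by (intro R.msum_zero[OF Jl]) simp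
        finally show ?thesis .
      qed
      then show False using l0 by blast
    qed
  qed
qed

end

section \<open>Orthogonality expressed through the resolution\<close>

context rng begin

lemma trivial_quotient_iff:
  assumes V: "lmod V" and B: "sub B V"
  shows "trivial_group (add_monoid V Mod B) \<longleftrightarrow> B = carrier V"
proof -
  interpret V: left_module R V by (rule V)
  have cg: "comm_group (add_monoid V)" by (rule V.M.a_comm_group)
  have sg: "subgroup B (add_monoid V)" using B by (simp add: submodule_def)
  have g: "group (add_monoid V)" using cg by (rule comm_group.axioms(2))
  have n: "B \<lhd> add_monoid V" by (rule comm_group.subgroup_imp_normal[OF cg sg])
  show ?thesis
  proof
    assume "trivial_group (add_monoid V Mod B)"
    then have t: "rcosets\<^bsub>add_monoid V\<^esub> B = {B}" by (simp add: trivial_group_def FactGroup_def)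
    have "x \<in> B" if "x \<in> carrier V" for x
    proof -
      have "B #>\<^bsub>add_monoid V\<^esub> x \<in> rcosets\<^bsub>add_monoid V\<^esub> B" using that by (auto simp: RCOSETS_def)
      then have "B #>\<^bsub>add_monoid V\<^esub> x = B" using t by simp
      then show ?thesis using group.rcos_self[OF g, of x B] sg that by simp
    qed
    then show "B = carrier V" using subD(1)[OF B] by auto
  next
    assume e: "B = carrier V"
    have "B #>\<^bsub>add_monoid V\<^esub> x = B" if "x \<in> carrier V" for x
      using group.coset_join2[OF g, of x B] sg that e by simp
    then have "rcosets\<^bsub>add_monoid V\<^esub> B = {B}" using V by (auto simp: RCOSETS_def intro!: bexI[of _ "\<zero>\<^bsub>V\<^esub>"])
    then show "trivial_group (add_monoid V Mod B)"
      using normal.factorgroup_is_group[OF n] by (simp add: trivial_group_def FactGroup_def)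
  qed
qed

end

context artin_res begin

text \<open>For \<open>i < n\<close> this says \<open>Ext\<^sup>i(M, N) = 0\<close>, and for \<open>i = n\<close> it says \<open>Hom(N, \<tau>\<^sub>n M) = 0\<close>.\<close>

definition van :: "nat \<Rightarrow> nat \<Rightarrow> ('a, 'x) module \<Rightarrow> bool" where
  "van n i N \<longleftrightarrow> (\<forall>f. L.lin (obj P (- int i)) N f \<and>
      (i < n \<longrightarrow> (\<forall>x\<in>carrier (obj P (- int i - 1)). f (dif P (- int i - 1) x) = \<zero>\<^bsub>N\<^esub>)) \<longrightarrow>
     (\<exists>g. L.lin (obj P (- int i + 1)) N g \<and> (\<forall>x\<in>carrier (obj P (- int i)). f x = g (dif P (- int i) x))))"

text \<open>With the cocycles regarded as a submodule of the \<open>R\<close>-module of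
  homomorphisms, triviality of the quotient becomes equality of cocycles and coboundaries.
  Restricting to carriers mediates between extensional and arbitrary linear maps.\<close>

lemma trivial_ext_iff:
  assumes N: "N \<in> fg_mod \<Lambda>" and i: "i < n"
  shows "trivial_group (ext_group \<Lambda> i M N) \<longleftrightarrow> van n i N"
proof -
  note Nl = L.fg_modD(1)[OF N]
  let ?i = "- int i"
  let ?Q = "obj P ?i"
  define V where "V = L.hom_module ?Q N (rs N)"
  define V0 where "V0 = L.hom_module (obj P (?i + 1)) N (rs N)"
  have vl: "R.lmod (L.hom_module Q N (rs N))" if "L.lmod Q" for Q :: "('a, nat \<Rightarrow> 'a) module"
    by (rule L.hom_module_lmod[OF R.rng_axioms rs_lmod[OF Nl] Nl that])
      (use central_lin[OF Nl] in \<open>simp_all add: fun_eq_iff restrict_scalars_def\<close>)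
  have Vl: "R.lmod V" and V0l: "R.lmod V0" unfolding V_def V0_def by (rule vl[OF P_lmod])+
  have Vs: "carrier V = mod_hom \<Lambda> ?Q N" "\<And>f g. f \<oplus>\<^bsub>V\<^esub> g = (\<lambda>x\<in>carrier ?Q. f x \<oplus>\<^bsub>N\<^esub> g x)"
    "\<And>r f. r \<odot>\<^bsub>V\<^esub> f = (\<lambda>x\<in>carrier ?Q. \<phi> r \<odot>\<^bsub>N\<^esub> f x)" "\<zero>\<^bsub>V\<^esub> = (\<lambda>x\<in>carrier ?Q. \<zero>\<^bsub>N\<^esub>)"
    by (simp_all add: V_def L.hom_module_def)
  let ?Z = "ext_cocycles \<Lambda> i M N" and ?B = "ext_coboundaries \<Lambda> i M N"
  have Zd: "?Z = {f \<in> carrier V. \<forall>x\<in>carrier (obj P (?i - 1)). f (dif P (?i - 1) x) = \<zero>\<^bsub>N\<^esub>}"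
    by (simp add: ext_cocycles_def Let_def Vs)
  have dc: "dif P (?i - 1) x \<in> carrier ?Q" if "x \<in> carrier (obj P (?i - 1))" for x
    using L.linD(1)[OF P_lin[of "?i - 1"] that] by simp
  have dc': "dif P ?i x \<in> carrier (obj P (?i + 1))" if "x \<in> carrier ?Q" for x
    using L.linD(1)[OF P_lin[of ?i] that] .
  have Z: "R.sub ?Z V"
  proof (rule R.subI[OF Vl])
    show "\<zero>\<^bsub>V\<^esub> \<in> ?Z" using R.lmod_simps(1)[OF Vl] dc by (auto simp: Zd Vs(4))
    fix f assume f: "f \<in> ?Z"
    show "f \<oplus>\<^bsub>V\<^esub> g \<in> ?Z" if g: "g \<in> ?Z" for g
      using R.lmod_simps(2)[OF Vl, of f g] f g dc Nl by (auto simp: Zd Vs(2))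
    show "a \<odot>\<^bsub>V\<^esub> f \<in> ?Z" if a: "a \<in> carrier R" for a
      using R.lmod_simps(5)[OF Vl a, of f] f a dc Nl by (auto simp: Zd Vs(3))
  qed (auto simp: Zd)
  have "R.lin V0 V (\<lambda>g. compose (carrier ?Q) g (dif P ?i))"
  proof (rule R.linI)
    show "compose (carrier ?Q) g (dif P ?i) \<in> carrier V" if "g \<in> carrier V0" for g
      unfolding compose_alt Vs using that L.restrict_mod_hom[OF L.lin_comp[OF P_lin[of ?i] L.mod_homD] P_lmod]
      by (simp add: V0_def L.hom_module_def)
  qed (use dc' in \<open>auto simp: Vs V0_def L.hom_module_def compose_alt cong: restrict_cong\<close>)
  then have Bs: "R.sub ?B V"
    using R.sub_image[OF _ V0l Vl R.sub_carrier[OF V0l], of "\<lambda>g. compose (carrier ?Q) g (dif P ?i)"]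
    by (simp add: ext_coboundaries_def Let_def V0_def L.hom_module_def)
  have dd: "dif P ?i (dif P (?i - 1) x) = \<zero>\<^bsub>obj P (?i + 1)\<^esub>" if "x \<in> carrier (obj P (?i - 1))" for x
    using P_dd[OF that] by simp
  have BZ: "?B \<subseteq> ?Z"
  proof
    fix b assume b: "b \<in> ?B"
    then obtain g where g: "g \<in> mod_hom \<Lambda> (obj P (?i + 1)) N" "b = compose (carrier ?Q) g (dif P ?i)"
      by (auto simp: ext_coboundaries_def Let_def)
    then show "b \<in> ?Z" using R.subD(2)[OF Bs b] dc dd L.lin_zero[OF L.mod_homD[OF g(1)] P_lmod Nl]
      by (auto simp: Zd compose_alt)
  qed
  have BZs: "R.sub ?B (V\<lparr>carrier := ?Z\<rparr>)" using R.sub_sub[OF Vl Z] Bs BZ by simp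
  \<comment> \<open>A factor group reads only the carrier and the multiplication, so unfolding turns
    it into a quotient of additive groups of modules.\<close>
  have "ext_group \<Lambda> i M N = add_monoid (V\<lparr>carrier := ?Z\<rparr>) Mod ?B"
    by (simp add: ext_group_def hom_group_def V_def L.hom_module_def FactGroup_def RCOSETS_def r_coset_def set_mult_def[abs_def])
  then have "trivial_group (ext_group \<Lambda> i M N) \<longleftrightarrow> ?B = ?Z"
    using R.trivial_quotient_iff[OF R.lmod_sub[OF Vl Z] BZs] by simp
  also have "\<dots> \<longleftrightarrow> van n i N"
  proof
    assume e: "?B = ?Z"
    show "van n i N" unfolding van_def
    proof (intro allI impI, elim conjE)
      fix f assume f: "L.lin ?Q N f" "i < n \<longrightarrow> (\<forall>x\<in>carrier (obj P (?i - 1)). f (dif P (?i - 1) x) = \<zero>\<^bsub>N\<^esub>)"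
      have "restrict f (carrier ?Q) \<in> ?Z" using f i dc L.restrict_mod_hom[OF f(1) P_lmod] by (simp add: Zd Vs)
      then have "restrict f (carrier ?Q) \<in> ?B" using e by simp
      then obtain g where g: "g \<in> mod_hom \<Lambda> (obj P (?i + 1)) N" "restrict f (carrier ?Q) = (\<lambda>x\<in>carrier ?Q. g (dif P ?i x))"
        by (auto simp: ext_coboundaries_def Let_def compose_alt)
      have "f x = g (dif P ?i x)" if "x \<in> carrier ?Q" for x using fun_cong[OF g(2), of x] that by simp
      then show "\<exists>g. L.lin (obj P (?i + 1)) N g \<and> (\<forall>x\<in>carrier ?Q. f x = g (dif P ?i x))"
        using L.mod_homD[OF g(1)] by blast
    qed
  next
    assume v: "van n i N"
    have "f \<in> ?B" if f: "f \<in> ?Z" for f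
    proof -
      have fl: "L.lin ?Q N f" "f \<in> extensional (carrier ?Q)" using f by (auto simp: Zd Vs L.mod_hom_iff)
      then obtain g where g: "L.lin (obj P (?i + 1)) N g" "\<forall>x\<in>carrier ?Q. f x = g (dif P ?i x)"
        using v f unfolding van_def Zd by blast
      have "f = compose (carrier ?Q) (restrict g (carrier (obj P (?i + 1)))) (dif P ?i)"
        unfolding compose_alt using fl(2) g(2) dc' by (intro restrict_eqI[symmetric]) auto
      then show ?thesis unfolding ext_coboundaries_def Let_def using L.restrict_mod_hom[OF g(1) P_lmod] by blast
    qed
    then show "?B = ?Z" using BZ by blast
  qed
  finally show ?thesis .
qed

text \<open>For \<open>n = 1\<close> the transpose is formed from the resolution of \<open>M\<close>
  itself. For larger \<open>n\<close> it is formed from an independently chosen resolution of the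
  syzygy, while \<open>van\<close> refers to the terms of the resolution of \<open>M\<close>. Both
  are minimal presentations of the syzygy, and \<open>extends_along_transfer\<close> is applied in
  both directions.\<close>

lemma trivial_tau_iff:
  fixes J :: "('r, 'j) module"
  assumes J: "duality_cogenerator R J" and N: "N \<in> fg_mod \<Lambda>" and n: "n \<ge> 1"
  shows "trivial_group (hom_group \<Lambda> N (tau_n R \<Lambda> \<phi> J n M)) \<longleftrightarrow> van n n N"
proof -
  note Nl = L.fg_modD(1)[OF N]
  show ?thesis
  proof (cases "n = 1")
    case True
    show ?thesis
      using trivial_hom_duality_iff[OF J N P_proj[of 0] P_proj[of "-1"], of "dif P (-1)"] P_lin[of "-1"] True
      by (simp add: tau_n_def ar_translation_def transpose_module_def Let_def van_def)
  next
    case False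
    define X where "X = syzygy \<Lambda> (n - 1) M"
    have Xs: "X = syzygy_of M P \<epsilon> (n - 1)" by (simp add: X_def syzygy_def)
    have n2: "n \<ge> 2" using n False by simp
    have Xf: "X \<in> fg_mod \<Lambda>" unfolding Xs using n2 by (intro syzygy_fg) simp
    note Xl = L.fg_modD(1)[OF Xf]
    interpret X: artin_res R \<Lambda> \<phi> X by unfold_locales (rule Xf)
    have i: "1 - int n = - int (n - 1)" using n2 by simp
    have covQ0: "projective_cover \<Lambda> (obj P (1 - int n)) X (dif P (1 - int n))"
      unfolding i Xs using n2 by (intro cover) simp
    \<comment> \<open>\<open>X\<close> is cut out of the term in degree \<open>2 - n\<close> and
      shares its zero, so maps to \<open>X\<close> and to that term have the same kernel.\<close>
    have zX: "\<zero>\<^bsub>X\<^esub> = \<zero>\<^bsub>obj P (2 - int n)\<^esub>" unfolding Xs syzygy_of_def Let_def using n2 by (simp add: of_nat_diff)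
    have "syzygy_of M P \<epsilon> n = (obj P (1 - int n))\<lparr>carrier := a_kernel (obj P (1 - int n)) X (dif P (1 - int n))\<rparr>"
      unfolding syzygy_of_def Let_def using n2 zX by (simp add: a_kernel_def kernel_def)
    then have covQ1: "projective_cover \<Lambda> (obj P (- int n))
        ((obj P (1 - int n))\<lparr>carrier := a_kernel (obj P (1 - int n)) X (dif P (1 - int n))\<rparr>) (dif P (- int n))"
      using cover[OF n] by simp
    have covP1: "projective_cover \<Lambda> (obj X.P (- 1)) ((obj X.P 0)\<lparr>carrier := a_kernel (obj X.P 0) X X.\<epsilon>\<rparr>) (dif X.P (- 1))"
      using X.cover[of 1] by (simp add: syzygy_of_def Let_def)
    have "trivial_group (hom_group \<Lambda> N (tau_n R \<Lambda> \<phi> J n M)) \<longleftrightarrow>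
      (\<forall>f. L.lin (obj X.P (-1)) N f \<longrightarrow> (\<exists>g. L.lin (obj X.P 0) N g \<and> (\<forall>x\<in>carrier (obj X.P (-1)). f x = g (dif X.P (-1) x))))"
      using trivial_hom_duality_iff[OF J N X.P_proj[of 0] X.P_proj[of "-1"], of "dif X.P (-1)"] X.P_lin[of "-1"] False
      by (simp add: tau_n_def ar_translation_def transpose_module_def Let_def X_def)
    also have "\<dots> \<longleftrightarrow> (\<forall>f. L.lin (obj P (- int n)) N f \<longrightarrow> (\<exists>g. L.lin (obj P (1 - int n)) N g \<and> (\<forall>x\<in>carrier (obj P (- int n)). f x = g (dif P (- int n) x))))"
      using extends_along_transfer[OF L.rng_axioms Xl Nl X.cover0 covP1 covQ0 covQ1]
        extends_along_transfer[OF L.rng_axioms Xl Nl covQ0 covQ1 X.cover0 covP1] by blast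
    also have "\<dots> \<longleftrightarrow> van n n N" by (simp add: van_def)
    finally show ?thesis .
  qed
qed

lemma tau_n_perp_iff:
  fixes J :: "('r, 'j) module"
  assumes J: "duality_cogenerator R J" and n: "n \<ge> 1"
  shows "N \<in> tau_n_perp R \<Lambda> \<phi> J n M \<longleftrightarrow> N \<in> fg_mod \<Lambda> \<and> (\<forall>i\<in>{1..n}. van n i N)"
proof (cases "N \<in> fg_mod \<Lambda>")
  case True
  have "{1..n} = insert n {1..n - 1}" using n by auto
  moreover have "trivial_group (ext_group \<Lambda> i M N) \<longleftrightarrow> van n i N" if "i \<in> {1..n - 1}" for i
    using that by (intro trivial_ext_iff[OF True]) auto
  ultimately show ?thesis using True trivial_tau_iff[OF J True n] by (simp add: tau_n_perp_def)
qed (simp add: tau_n_perp_def)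

end

section \<open>Homotopy classes of maps into shifted complexes\<close>

context rng begin

abbreviation "cplx X \<equiv> is_complex R X"

text \<open>Neighbouring degrees are separate variables tied by equations, here and in the rules
  below, so that degrees written differently but equal, such as \<open>i - 1 + 1\<close> and
  \<open>i\<close>, are matched by arithmetic.\<close>

lemma cplxD:
  assumes "cplx X"
  shows "lmod (obj X i)" "k = i + 1 \<Longrightarrow> lin (obj X i) (obj X k) (dif X i)"
    "\<lbrakk>x \<in> carrier (obj X i); k = i + 1\<rbrakk> \<Longrightarrow> dif X i x \<in> carrier (obj X k)"
    "\<lbrakk>x \<in> carrier (obj X i); k = i + 1; m = i + 2\<rbrakk> \<Longrightarrow> dif X k (dif X i x) = \<zero>\<^bsub>obj X m\<^esub>"
    "dif X i \<in> extensional (carrier (obj X i))"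
proof -
  have l: "lin (obj X i) (obj X (i + 1)) (dif X i)" for i using assms by (simp add: is_complex_def mod_hom_iff)
  then show "\<lbrakk>x \<in> carrier (obj X i); k = i + 1\<rbrakk> \<Longrightarrow> dif X i x \<in> carrier (obj X k)"
    using linD(1)[OF l] by simp
qed (use assms in \<open>auto simp: is_complex_def mod_hom_iff\<close>)

text \<open>Chain maps of degree \<open>j\<close> carry no sign here, contrary to maps into \<open>shift_complex Y j\<close>; both notions are
  related by \<open>f i \<mapsto> (-1)^(i j) f i\<close>.\<close>

definition cmap :: "int \<Rightarrow> ('a, 'b) cochain_complex \<Rightarrow> ('a, 'c) cochain_complex \<Rightarrow> (int \<Rightarrow> 'b \<Rightarrow> 'c) \<Rightarrow> bool" where
  "cmap j X Y f \<longleftrightarrow> (\<forall>i. lin (obj X i) (obj Y (i + j)) (f i)) \<and>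
     (\<forall>i. \<forall>x\<in>carrier (obj X i). f (i + 1) (dif X i x) = dif Y (i + j) (f i x))"

text \<open>Anticommuting families arise from odd shifts, and they are the maps whose cocone can be
  formed without signs.\<close>

definition anti :: "int \<Rightarrow> ('a, 'b) cochain_complex \<Rightarrow> ('a, 'c) cochain_complex \<Rightarrow> (int \<Rightarrow> 'b \<Rightarrow> 'c) \<Rightarrow> bool" where
  "anti j X Y f \<longleftrightarrow> (\<forall>i. lin (obj X i) (obj Y (i + j)) (f i)) \<and>
     (\<forall>i. \<forall>x\<in>carrier (obj X i). f (i + 1) (dif X i x) = \<ominus>\<^bsub>obj Y (i + j + 1)\<^esub> dif Y (i + j) (f i x))"

definition nullh :: "int \<Rightarrow> ('a, 'b) cochain_complex \<Rightarrow> ('a, 'c) cochain_complex \<Rightarrow> (int \<Rightarrow> 'b \<Rightarrow> 'c) \<Rightarrow> bool" where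
  "nullh j X Y f \<longleftrightarrow> (\<exists>h. (\<forall>i. lin (obj X i) (obj Y (i + j - 1)) (h i)) \<and>
     (\<forall>i. \<forall>x\<in>carrier (obj X i). f i x = dif Y (i + j - 1) (h i x) \<oplus>\<^bsub>obj Y (i + j)\<^esub> h (i + 1) (dif X i x)))"

text \<open>Vanishing of the morphisms from \<open>X\<close> to \<open>Y\<close> shifted by
  \<open>j\<close> in the homotopy category, freed from quotient groups and signs.\<close>

definition orth :: "('a, 'b) cochain_complex \<Rightarrow> ('a, 'c) cochain_complex \<Rightarrow> int \<Rightarrow> bool" where
  "orth X Y j \<longleftrightarrow> (\<forall>f. cmap j X Y f \<longrightarrow> nullh j X Y f)"

lemma cmapI:
  assumes "\<And>i k. k = i + j \<Longrightarrow> lin (obj X i) (obj Y k) (f i)"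
    "\<And>i k m x. \<lbrakk>x \<in> carrier (obj X i); k = i + 1; m = i + j\<rbrakk> \<Longrightarrow> f k (dif X i x) = dif Y m (f i x)"
  shows "cmap j X Y f"
  using assms by (simp add: cmap_def)

lemma cmapD:
  assumes "cmap j X Y f"
  shows "k = i + j \<Longrightarrow> lin (obj X i) (obj Y k) (f i)"
    "\<lbrakk>x \<in> carrier (obj X i); k = i + j\<rbrakk> \<Longrightarrow> f i x \<in> carrier (obj Y k)"
    "\<lbrakk>x \<in> carrier (obj X i); k = i + 1; m = i + j\<rbrakk> \<Longrightarrow> f k (dif X i x) = dif Y m (f i x)"
proof -
  have l: "lin (obj X i) (obj Y (i + j)) (f i)" for i using assms by (simp add: cmap_def)
  then show "\<lbrakk>x \<in> carrier (obj X i); k = i + j\<rbrakk> \<Longrightarrow> f i x \<in> carrier (obj Y k)"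
    using linD(1)[OF l] by simp
qed (use assms in \<open>auto simp: cmap_def\<close>)

lemma antiI:
  assumes "\<And>i k. k = i + j \<Longrightarrow> lin (obj X i) (obj Y k) (f i)"
    "\<And>i k m p x. \<lbrakk>x \<in> carrier (obj X i); k = i + 1; m = i + j; p = i + j + 1\<rbrakk> \<Longrightarrow> f k (dif X i x) = \<ominus>\<^bsub>obj Y p\<^esub> dif Y m (f i x)"
  shows "anti j X Y f"
  using assms by (simp add: anti_def)

lemma antiD:
  assumes "anti j X Y f"
  shows "k = i + j \<Longrightarrow> lin (obj X i) (obj Y k) (f i)"
    "\<lbrakk>x \<in> carrier (obj X i); k = i + j\<rbrakk> \<Longrightarrow> f i x \<in> carrier (obj Y k)"
    "\<lbrakk>x \<in> carrier (obj X i); k = i + 1; m = i + j; p = i + j + 1\<rbrakk> \<Longrightarrow> f k (dif X i x) = \<ominus>\<^bsub>obj Y p\<^esub> dif Y m (f i x)"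
proof -
  have l: "lin (obj X i) (obj Y (i + j)) (f i)" for i using assms by (simp add: anti_def)
  then show "\<lbrakk>x \<in> carrier (obj X i); k = i + j\<rbrakk> \<Longrightarrow> f i x \<in> carrier (obj Y k)"
    using linD(1)[OF l] by simp
qed (use assms in \<open>auto simp: anti_def\<close>)

lemma nullhI:
  assumes "\<And>i k. k = i + j - 1 \<Longrightarrow> lin (obj X i) (obj Y k) (h i)"
    "\<And>i k m p x. \<lbrakk>x \<in> carrier (obj X i); m = i + j - 1; p = i + j; k = i + 1\<rbrakk> \<Longrightarrow>
      f i x = dif Y m (h i x) \<oplus>\<^bsub>obj Y p\<^esub> h k (dif X i x)"
  shows "nullh j X Y f"
  using assms unfolding nullh_def by (intro exI[of _ h]) simp

lemma nullhE:
  assumes "nullh j X Y f"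
  obtains h where "\<And>i k. k = i + j - 1 \<Longrightarrow> lin (obj X i) (obj Y k) (h i)"
    "\<And>i k m p x. \<lbrakk>x \<in> carrier (obj X i); m = i + j - 1; p = i + j; k = i + 1\<rbrakk> \<Longrightarrow>
      f i x = dif Y m (h i x) \<oplus>\<^bsub>obj Y p\<^esub> h k (dif X i x)"
proof -
  obtain h where "\<forall>i. lin (obj X i) (obj Y (i + j - 1)) (h i)"
    "\<forall>i. \<forall>x\<in>carrier (obj X i). f i x = dif Y (i + j - 1) (h i x) \<oplus>\<^bsub>obj Y (i + j)\<^esub> h (i + 1) (dif X i x)"
    using assms unfolding nullh_def by (elim exE conjE) (rule that)
  then show ?thesis by (intro that[of h]) simp_all
qed

lemma orthD: "orth X Y j \<Longrightarrow> cmap j X Y f \<Longrightarrow> nullh j X Y f"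
  by (simp add: orth_def)

definition sg :: "('a, 'b) module \<Rightarrow> int \<Rightarrow> 'b \<Rightarrow> 'b" where
  "sg M i x = (if even i then x else \<ominus>\<^bsub>M\<^esub> x)"

lemma lin_sg: "\<lbrakk>lin N M f; lmod M\<rbrakk> \<Longrightarrow> lin N M (\<lambda>x. sg M i (f x))"
  using lin_minus[of N M f] by (cases "even i") (simp_all add: sg_def)

text \<open>The sign (-1)^i in degree \<open>i\<close> exchanges commuting and anticommuting
  families.\<close>

lemma anti_sg:
  assumes W: "cplx W" and X: "cplx X" and v: "cmap j X W v"
  shows "anti j X W (\<lambda>i x. sg (obj W (i + j)) i (v i x))"
proof (rule antiI)
  show "lin (obj X i) (obj W k) (\<lambda>x. sg (obj W (i + j)) i (v i x))" if "k = i + j" for i k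
    unfolding that by (rule lin_sg[OF cmapD(1)[OF v refl] cplxD(1)[OF W]])
  fix i k m p x assume a: "x \<in> carrier (obj X i)" "k = i + 1" "m = i + j" "p = i + j + 1"
  have p: "k + j = p" using a by simp
  note vx = cmapD(2)[OF v a(1,3)]
  note W' = cplxD(1)[OF W]
  show "sg (obj W (k + j)) k (v k (dif X i x)) = \<ominus>\<^bsub>obj W p\<^esub> dif W m (sg (obj W (i + j)) i (v i x))"
    unfolding cmapD(3)[OF v a(1,2,3)] p
    using vx a lin_neg[OF cplxD(2)[OF W, of p m] W' W'] cplxD(3)[OF W vx, of p] W'
    by (simp add: sg_def)
qed

lemma cmap_sg:
  assumes W: "cplx W" and X: "cplx X" and v: "anti j X W v"
  shows "cmap j X W (\<lambda>i x. sg (obj W (i + j)) i (v i x))"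
proof (rule cmapI)
  show "lin (obj X i) (obj W k) (\<lambda>x. sg (obj W (i + j)) i (v i x))" if "k = i + j" for i k
    unfolding that by (rule lin_sg[OF antiD(1)[OF v refl] cplxD(1)[OF W]])
  fix i k m x assume a: "x \<in> carrier (obj X i)" "k = i + 1" "m = i + j"
  define p where "p = i + j + 1"
  have p: "k + j = p" using a p_def by simp
  note vx = antiD(2)[OF v a(1,3)]
  note W' = cplxD(1)[OF W]
  show "sg (obj W (k + j)) k (v k (dif X i x)) = dif W m (sg (obj W (i + j)) i (v i x))"
    unfolding antiD(3)[OF v a p_def] p
    using vx a p_def lin_neg[OF cplxD(2)[OF W, of p m] W' W'] cplxD(3)[OF W vx, of p] W'
    by (simp add: sg_def)
qed

text \<open>After the sign change of \<open>cmap_sg\<close> orthogonality applies; changing back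
  turns the sum of the two homotopy terms into a difference.\<close>

lemma orth_antiE:
  assumes W: "cplx W" and X: "cplx X" and o: "orth X W j" and v: "anti j X W v"
  obtains h where "\<And>i k. k = i + j - 1 \<Longrightarrow> lin (obj X i) (obj W k) (h i)"
    "\<And>i k m p x. \<lbrakk>x \<in> carrier (obj X i); m = i + j - 1; p = i + j; k = i + 1\<rbrakk> \<Longrightarrow>
      v i x = dif W m (h i x) \<ominus>\<^bsub>obj W p\<^esub> h k (dif X i x)"
proof -
  obtain h where h: "\<And>i k. k = i + j - 1 \<Longrightarrow> lin (obj X i) (obj W k) (h i)"
    "\<And>i k m p x. \<lbrakk>x \<in> carrier (obj X i); m = i + j - 1; p = i + j; k = i + 1\<rbrakk> \<Longrightarrow>
      sg (obj W (i + j)) i (v i x) = dif W m (h i x) \<oplus>\<^bsub>obj W p\<^esub> h k (dif X i x)"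
    by (rule nullhE[OF orthD[OF o cmap_sg[OF W X v]]]) (rule that)
  note W' = cplxD(1)[OF W]
  show ?thesis
  proof
    show "lin (obj X i) (obj W k) (\<lambda>x. sg (obj W (i + j - 1)) i (h i x))" if "k = i + j - 1" for i k
      unfolding that by (rule lin_sg[OF h(1)[OF refl] W'])
    fix i k m p x assume a: "x \<in> carrier (obj X i)" "m = i + j - 1" "p = i + j" "k = i + 1"
    have hx: "h i x \<in> carrier (obj W m)" by (rule linD(1)[OF h(1)[OF a(2)] a(1)])
    have hd: "h k (dif X i x) \<in> carrier (obj W p)"
      by (rule linD(1)[OF h(1) cplxD(3)[OF X a(1,4)]]) (use a in simp)
    have dh: "dif W m (h i x) \<in> carrier (obj W p)" by (rule cplxD(3)[OF W hx]) (use a in simp)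
    have vx: "v i x \<in> carrier (obj W p)" by (rule antiD(2)[OF v a(1,3)])
    have e: "sg (obj W p) i (v i x) = dif W m (h i x) \<oplus>\<^bsub>obj W p\<^esub> h k (dif X i x)"
      using h(2)[OF a] a(3) by simp
    have i: "i + j - 1 = m" "k + j - 1 = p" using a by auto
    have nd: "dif W m (\<ominus>\<^bsub>obj W m\<^esub> h i x) = \<ominus>\<^bsub>obj W p\<^esub> dif W m (h i x)"
      by (rule lin_neg[OF cplxD(2)[OF W] W' W' hx]) (use a in simp)
    show "v i x = dif W m (sg (obj W (i + j - 1)) i (h i x)) \<ominus>\<^bsub>obj W p\<^esub> sg (obj W (k + j - 1)) k (h k (dif X i x))"
    proof (cases "even i")
      case True
      then show ?thesis using e a(4) hd dh W' unfolding i by (simp add: sg_def a_minus_def)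
    next
      case False
      have "v i x = \<ominus>\<^bsub>obj W p\<^esub> (\<ominus>\<^bsub>obj W p\<^esub> v i x)" using vx W' by simp
      also have "\<dots> = \<ominus>\<^bsub>obj W p\<^esub> (dif W m (h i x) \<oplus>\<^bsub>obj W p\<^esub> h k (dif X i x))" using e False by (simp add: sg_def)
      also have "\<dots> = \<ominus>\<^bsub>obj W p\<^esub> dif W m (h i x) \<oplus>\<^bsub>obj W p\<^esub> \<ominus>\<^bsub>obj W p\<^esub> h k (dif X i x)"
        by (rule minus_distr[OF W' dh hd])
      finally show ?thesis using False a(4) nd unfolding i by (simp add: sg_def a_minus_def)
    qed
  qed
qed

text \<open>A retract up to homotopy. The notion covers isomorphisms in the homotopy category as
  well as direct summands, so one argument serves for both.\<close>

definition hret :: "('a, 'b) cochain_complex \<Rightarrow> ('a, 'c) cochain_complex \<Rightarrow> bool" where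
  "hret X' X \<longleftrightarrow> (\<exists>a b s. cmap 0 X' X a \<and> cmap 0 X X' b \<and>
     (\<forall>i. lin (obj X' i) (obj X' (i - 1)) (s i)) \<and>
     (\<forall>i. \<forall>x\<in>carrier (obj X' i). b i (a i x) = (dif X' (i - 1) (s i x) \<oplus>\<^bsub>obj X' i\<^esub> s (i + 1) (dif X' i x)) \<oplus>\<^bsub>obj X' i\<^esub> x))"

text \<open>If \<open>h\<close> contracts \<open>u b\<close>, then
  \<open>u = u b a - u (d s + s d)\<close> is contracted by \<open>h a - u s\<close>.\<close>

lemma orth_hret:
  assumes X': "cplx X'" and X: "cplx X" and W: "cplx W" and r: "hret X' X" and o: "orth X W j"
  shows "orth X' W j"
  unfolding orth_def
proof (intro allI impI)
  fix u assume u: "cmap j X' W u"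
  obtain a b s where a: "cmap 0 X' X a" and b: "cmap 0 X X' b"
    and s': "\<forall>i. lin (obj X' i) (obj X' (i - 1)) (s i)"
    "\<forall>i. \<forall>x\<in>carrier (obj X' i). b i (a i x) = (dif X' (i - 1) (s i x) \<oplus>\<^bsub>obj X' i\<^esub> s (i + 1) (dif X' i x)) \<oplus>\<^bsub>obj X' i\<^esub> x"
    using r unfolding hret_def by (elim exE conjE) (rule that)
  note s = s'[rule_format]
  have "cmap j X W (\<lambda>i x. u i (b i x))"
  proof (rule cmapI)
    show "lin (obj X i) (obj W k) (\<lambda>x. u i (b i x))" if "k = i + j" for i k
      by (rule lin_comp[OF cmapD(1)[OF b] cmapD(1)[OF u that]]) simp
    fix i k m x assume i: "x \<in> carrier (obj X i)" "k = i + 1" "m = i + j"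
    show "u k (b k (dif X i x)) = dif W m (u i (b i x))"
      using cmapD(3)[OF b i(1,2), of i] cmapD(3)[OF u cmapD(2)[OF b i(1)] i(2,3)] by simp
  qed
  then have "nullh j X W (\<lambda>i x. u i (b i x))" by (rule orthD[OF o])
  then obtain h where h: "\<And>i k. k = i + j - 1 \<Longrightarrow> lin (obj X i) (obj W k) (h i)"
    "\<And>i k m p x. \<lbrakk>x \<in> carrier (obj X i); m = i + j - 1; p = i + j; k = i + 1\<rbrakk> \<Longrightarrow>
      u i (b i x) = dif W m (h i x) \<oplus>\<^bsub>obj W p\<^esub> h k (dif X i x)"
    by (rule nullhE) (rule that)
  note W' = cplxD(1)[OF W] and X'l = cplxD(1)[OF X']
  have al: "lin (obj X' i) (obj X i) (a i)" for i using cmapD(1)[OF a] by simp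
  show "nullh j X' W u"
  proof (rule nullhI)
    fix i k assume k: "k = i + j - 1"
    show "lin (obj X' i) (obj W k) (\<lambda>x. h i (a i x) \<ominus>\<^bsub>obj W (i + j - 1)\<^esub> u (i - 1) (s i x))"
      unfolding k
      by (rule lin_sub[OF lin_comp[OF al h(1)[OF refl]] lin_comp[OF s(1) cmapD(1)[OF u]] W']) simp
  next
    fix i k m p x assume i: "x \<in> carrier (obj X' i)" "m = i + j - 1" "p = i + j" "k = i + 1"
    have ax: "a i x \<in> carrier (obj X i)" by (rule linD(1)[OF al i(1)])
    have dx: "dif X' i x \<in> carrier (obj X' k)" by (rule cplxD(3)[OF X' i(1,4)])
    have adx: "a k (dif X' i x) = dif X i (a i x)" using cmapD(3)[OF a i(1,4), of i] by simp
    have sx: "s i x \<in> carrier (obj X' (i - 1))" by (rule linD(1)[OF s(1) i(1)])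
    have sdx: "s k (dif X' i x) \<in> carrier (obj X' i)" using linD(1)[OF s(1)[of k] dx] i(4) by simp
    have dsx: "dif X' (i - 1) (s i x) \<in> carrier (obj X' i)" by (rule cplxD(3)[OF X' sx]) simp
    note uc = cmapD(2)[OF u _ i(3)]
    have ul: "lin (obj X' i) (obj W p) (u i)" by (rule cmapD(1)[OF u i(3)])
    have hax: "h i (a i x) \<in> carrier (obj W m)" by (rule linD(1)[OF h(1)[OF i(2)] ax])
    have usx: "u (i - 1) (s i x) \<in> carrier (obj W m)" by (rule cmapD(2)[OF u sx]) (use i in simp)
    have dW: "lin (obj W m) (obj W p) (dif W m)" by (rule cplxD(2)[OF W]) (use i in simp)
    have hadx: "h k (a k (dif X' i x)) \<in> carrier (obj W p)"
      unfolding adx by (rule linD(1)[OF h(1) cplxD(3)[OF X ax i(4)]]) (use i in simp)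
    have 1: "u i (b i (a i x)) = dif W m (h i (a i x)) \<oplus>\<^bsub>obj W p\<^esub> h k (a k (dif X' i x))"
      unfolding adx by (rule h(2)[OF ax i(2-4)])
    have "u i (b i (a i x)) = (u i (dif X' (i - 1) (s i x)) \<oplus>\<^bsub>obj W p\<^esub> u i (s k (dif X' i x))) \<oplus>\<^bsub>obj W p\<^esub> u i x"
      unfolding s(2)[OF i(1)] i(4)[symmetric] using dsx sdx i(1) X'l by (simp add: linD(2)[OF ul])
    also have "u i (dif X' (i - 1) (s i x)) = dif W m (u (i - 1) (s i x))"
      by (rule cmapD(3)[OF u sx]) (use i in simp_all)
    finally have 2: "u i (b i (a i x)) = u i x \<oplus>\<^bsub>obj W p\<^esub> (dif W m (u (i - 1) (s i x)) \<oplus>\<^bsub>obj W p\<^esub> u i (s k (dif X' i x)))"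
      using uc[OF i(1)] uc[OF sdx] linD(1)[OF dW usx] W' by (simp add: lmod_ac(2)[of "obj W p" "u i x"])
    have "u i x = (dif W m (h i (a i x)) \<oplus>\<^bsub>obj W p\<^esub> h k (a k (dif X' i x))) \<ominus>\<^bsub>obj W p\<^esub>
        (dif W m (u (i - 1) (s i x)) \<oplus>\<^bsub>obj W p\<^esub> u i (s k (dif X' i x)))"
      using 1 2 uc[OF i(1)] uc[OF sdx] linD(1)[OF dW usx] linD(1)[OF dW hax] hadx W'
        diff_eq_iff[OF W', of "u i (b i (a i x))" p "dif W m (u (i - 1) (s i x)) \<oplus>\<^bsub>obj W p\<^esub> u i (s k (dif X' i x))" "u i x"] by simp
    also have "\<dots> = (dif W m (h i (a i x)) \<ominus>\<^bsub>obj W p\<^esub> dif W m (u (i - 1) (s i x))) \<oplus>\<^bsub>obj W p\<^esub>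
        (h k (a k (dif X' i x)) \<ominus>\<^bsub>obj W p\<^esub> u i (s k (dif X' i x)))"
      by (rule add_diff_swap[OF W' linD(1)[OF dW hax] hadx linD(1)[OF dW usx] uc[OF sdx]])
    also have "dif W m (h i (a i x)) \<ominus>\<^bsub>obj W p\<^esub> dif W m (u (i - 1) (s i x)) =
        dif W m (h i (a i x) \<ominus>\<^bsub>obj W m\<^esub> u (i - 1) (s i x))"
      by (rule lin_diff[OF dW W' W' hax usx, symmetric])
    finally show "u i x = dif W m (h i (a i x) \<ominus>\<^bsub>obj W (i + j - 1)\<^esub> u (i - 1) (s i x)) \<oplus>\<^bsub>obj W p\<^esub>
        (h k (a k (dif X' i x)) \<ominus>\<^bsub>obj W (k + j - 1)\<^esub> u (k - 1) (s k (dif X' i x)))"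
      using i by simp
  qed
qed

lemma K_iso_hret:
  assumes X: "cplx X" and Y: "cplx Y" and k: "K_iso R X Y" shows "hret X Y" "hret Y X"
proof -
  have g: "hret X Y" if X: "cplx X" and Y: "cplx Y" and f: "f \<in> chain_maps R X Y" "g \<in> chain_maps R Y X"
    "homotopic R X X (chain_compose X g f) (chain_id X)" for X :: "('a, 'x) cochain_complex" and Y :: "('a, 'y) cochain_complex" and f g
  proof -
    note Xl = cplxD(1)[OF X]
    have c: "cmap 0 X Y f" "cmap 0 Y X g" using f(1,2) by (auto simp: chain_maps_def cmap_def mod_homD)
    obtain h where h: "\<And>i. h i \<in> mod_hom R (obj X i) (obj X (i - 1))"
      "\<And>i x. x \<in> carrier (obj X i) \<Longrightarrow> (\<lambda>x\<in>carrier (obj X i). chain_compose X g f i x \<ominus>\<^bsub>obj X i\<^esub> chain_id X i x) x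
        = dif X (i - 1) (h i x) \<oplus>\<^bsub>obj X i\<^esub> h (i + 1) (dif X i x)"
      using f(3) unfolding homotopic_def null_homotopic_def by auto
    have "g i (f i x) = (dif X (i - 1) (h i x) \<oplus>\<^bsub>obj X i\<^esub> h (i + 1) (dif X i x)) \<oplus>\<^bsub>obj X i\<^esub> x"
      if x: "x \<in> carrier (obj X i)" for i x
    proof -
      have e: "g i (f i x) \<ominus>\<^bsub>obj X i\<^esub> x = dif X (i - 1) (h i x) \<oplus>\<^bsub>obj X i\<^esub> h (i + 1) (dif X i x)"
        using h(2)[OF x] x by (simp add: chain_compose_def chain_id_def compose_def)
      have "g i (f i x) \<in> carrier (obj X i)" using cmapD(2)[OF c(2) cmapD(2)[OF c(1) x]] by simp
      then have "g i (f i x) = (g i (f i x) \<ominus>\<^bsub>obj X i\<^esub> x) \<oplus>\<^bsub>obj X i\<^esub> x"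
        using x Xl by (intro iffD1[OF diff_eq_iff[OF Xl]]) auto
      then show ?thesis using e by simp
    qed
    then show ?thesis unfolding hret_def using c mod_homD[OF h(1)] by blast
  qed
  obtain f g where "f \<in> chain_maps R X Y" "g \<in> chain_maps R Y X"
    "homotopic R X X (chain_compose X g f) (chain_id X)" "homotopic R Y Y (chain_compose Y f g) (chain_id Y)"
    using k unfolding K_iso_def by blast
  then show "hret X Y" "hret Y X" using g[OF X Y] g[OF Y X] by auto
qed

lemma shift_simps [simp]:
  "obj (shift_complex X s) i = obj X (i + s)"
  "x \<in> carrier (obj X (i + s)) \<Longrightarrow> dif (shift_complex X s) i x =
    (if even s then dif X (i + s) x else \<ominus>\<^bsub>obj X (i + s + 1)\<^esub> dif X (i + s) x)"
  by (simp_all add: shift_complex_def)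

lemma shift_cplx:
  assumes X: "cplx X" shows "cplx (shift_complex X s)"
proof -
  note Xl = cplxD(1)[OF X]
  have l: "lin (obj X (i + s)) (obj X (i + s + 1)) (\<lambda>x. if even s then dif X (i + s) x else \<ominus>\<^bsub>obj X (i + s + 1)\<^esub> dif X (i + s) x)" for i
    using cplxD(2)[OF X refl, of "i + s"] lin_minus[OF cplxD(2)[OF X refl] Xl, of "i + s"] by (cases "even s") simp_all
  have 1: "dif (shift_complex X s) i \<in> mod_hom R (obj X (i + s)) (obj X (i + 1 + s))" for i
    using restrict_mod_hom[OF l Xl, of i] by (simp add: shift_complex_def add.assoc add.commute[of 1])
  have 2: "dif (shift_complex X s) (i + 1) (dif (shift_complex X s) i x) = \<zero>\<^bsub>obj X (i + 2 + s)\<^esub>"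
    if x: "x \<in> carrier (obj X (i + s))" for i x
  proof -
    define k m where "k = i + s + 1" and "m = i + s + 2"
    have i: "i + 1 + s = k" "i + s + 1 = k" "k + 1 = m" "i + 2 + s = m" by (auto simp: k_def m_def)
    have dx: "dif X (i + s) x \<in> carrier (obj X k)" by (rule cplxD(3)[OF X x k_def])
    have dd: "dif X k (dif X (i + s) x) = \<zero>\<^bsub>obj X m\<^esub>" by (rule cplxD(4)[OF X x k_def m_def])
    have dn: "dif X k (\<ominus>\<^bsub>obj X k\<^esub> dif X (i + s) x) = \<ominus>\<^bsub>obj X m\<^esub> dif X k (dif X (i + s) x)"
      by (rule lin_neg[OF cplxD(2)[OF X] Xl Xl dx]) (simp add: i)
    have c: "y \<in> carrier (obj X k) \<Longrightarrow> dif (shift_complex X s) (i + 1) y = (if even s then dif X k y else \<ominus>\<^bsub>obj X m\<^esub> dif X k y)" for y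
      using shift_simps(2)[of y X "i + 1" s] by (simp add: i)
    show ?thesis using x dx dd dn Xl c by (simp add: i)
  qed
  show ?thesis unfolding is_complex_def using 1 2 Xl by simp
qed

text \<open>Reindexing gives a family of degree \<open>j - s\<close> out of \<open>X\<close>. For
  odd \<open>s\<close> the differential of the shift is negated, so the family anticommutes; hence
  the two cases.\<close>

lemma orth_shift:
  assumes X: "cplx X" and W: "cplx W" and o: "orth X W (j - s)"
  shows "orth (shift_complex X s) W j"
  unfolding orth_def
proof (intro allI impI)
  fix u assume u: "cmap j (shift_complex X s) W u"
  note W' = cplxD(1)[OF W] and X' = cplxD(1)[OF X]
  have ul: "lin (obj X i) (obj W k) (u (i - s))" if "k = i + (j - s)" for i k
    using cmapD(1)[OF u, of k "i - s"] that by simp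
  have comm: "dif W m (u (i - s) x) = (if even s then u (k - s) (dif X i x) else \<ominus>\<^bsub>obj W p\<^esub> u (k - s) (dif X i x))"
    if a: "x \<in> carrier (obj X i)" "k = i + 1" "m = i + (j - s)" "p = i + (j - s) + 1" for i k m p x
  proof -
    have dx: "dif X i x \<in> carrier (obj X k)" by (rule cplxD(3)[OF X a(1,2)])
    have "u (k - s) (dif (shift_complex X s) (i - s) x) = dif W m (u (i - s) x)"
      using cmapD(3)[OF u, of x "i - s" "k - s" m] a by simp
    moreover have "u (k - s) (\<ominus>\<^bsub>obj X k\<^esub> dif X i x) = \<ominus>\<^bsub>obj W p\<^esub> u (k - s) (dif X i x)"
      by (rule lin_neg[OF ul X' W' dx]) (use a in simp)
    moreover have "dif (shift_complex X s) (i - s) x = (if even s then dif X i x else \<ominus>\<^bsub>obj X k\<^esub> dif X i x)"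
      using shift_simps(2)[of x X "i - s" s] a by (cases "even s") simp_all
    ultimately show ?thesis using a(4) by (cases "even s") simp_all
  qed
  have uc: "u (i - s) x \<in> carrier (obj W k)" if "k = i + (j - s)" "x \<in> carrier (obj X i)" for i k x
    by (rule linD(1)[OF ul[OF that(1)] that(2)])
  show "nullh j (shift_complex X s) W u"
  proof (cases "even s")
    case True
    have "cmap (j - s) X W (\<lambda>i. u (i - s))"
      by (rule cmapI) (use ul comm True in auto)
    then have "nullh (j - s) X W (\<lambda>i. u (i - s))" by (rule orthD[OF o])
    then obtain h where h: "\<And>i k. k = i + (j - s) - 1 \<Longrightarrow> lin (obj X i) (obj W k) (h i)"
      "\<And>i k m p x. \<lbrakk>x \<in> carrier (obj X i); m = i + (j - s) - 1; p = i + (j - s); k = i + 1\<rbrakk> \<Longrightarrow>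
        u (i - s) x = dif W m (h i x) \<oplus>\<^bsub>obj W p\<^esub> h k (dif X i x)" by (rule nullhE) (rule that)
    show ?thesis
    proof (rule nullhI)
      show "lin (obj (shift_complex X s) i) (obj W k) (h (i + s))" if "k = i + j - 1" for i k
        using h(1)[of k "i + s"] that by simp
      fix i k m p x assume a: "x \<in> carrier (obj (shift_complex X s) i)" "m = i + j - 1" "p = i + j" "k = i + 1"
      show "u i x = dif W m (h (i + s) x) \<oplus>\<^bsub>obj W p\<^esub> h (k + s) (dif (shift_complex X s) i x)"
        using h(2)[of x "i + s" m p "k + s"] a True by simp
    qed
  next
    case False
    have "anti (j - s) X W (\<lambda>i. u (i - s))"
    proof (rule antiI)
      fix i k m p x assume a: "x \<in> carrier (obj X i)" "k = i + 1" "m = i + (j - s)" "p = i + (j - s) + 1"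
      have "u (k - s) (dif X i x) \<in> carrier (obj W p)"
        by (rule uc[OF _ cplxD(3)[OF X a(1,2)]]) (use a in simp)
      then show "u (k - s) (dif X i x) = \<ominus>\<^bsub>obj W p\<^esub> dif W m (u (i - s) x)"
        using comm[OF a] False W' by simp
    qed (rule ul)
    then obtain h where h: "\<And>i k. k = i + (j - s) - 1 \<Longrightarrow> lin (obj X i) (obj W k) (h i)"
      "\<And>i k m p x. \<lbrakk>x \<in> carrier (obj X i); m = i + (j - s) - 1; p = i + (j - s); k = i + 1\<rbrakk> \<Longrightarrow>
        u (i - s) x = dif W m (h i x) \<ominus>\<^bsub>obj W p\<^esub> h k (dif X i x)"
      by (rule orth_antiE[OF W X o]) (rule that)
    show ?thesis
    proof (rule nullhI)
      show "lin (obj (shift_complex X s) i) (obj W k) (h (i + s))" if "k = i + j - 1" for i k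
        using h(1)[of k "i + s"] that by simp
      fix i k m p x assume a: "x \<in> carrier (obj (shift_complex X s) i)" "m = i + j - 1" "p = i + j" "k = i + 1"
      have a': "x \<in> carrier (obj X (i + s))" using a by simp
      define q where "q = k + s"
      have q: "i + s + 1 = q" "k + s = q" "q = i + s + 1" "p = q + (j - s) - 1" "m = i + s + (j - s) - 1" "p = i + s + (j - s)"
        using a q_def by auto
      have "h q (\<ominus>\<^bsub>obj X q\<^esub> dif X (i + s) x) = \<ominus>\<^bsub>obj W p\<^esub> h q (dif X (i + s) x)"
        by (rule lin_neg[OF h(1)[OF q(4)] X' W' cplxD(3)[OF X a' q(3)]])
      then show "u i x = dif W m (h (i + s) x) \<oplus>\<^bsub>obj W p\<^esub> h (k + s) (dif (shift_complex X s) i x)"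
        unfolding shift_simps(2)[OF a'] q(1,2) using h(2)[OF a' q(5,6,3)] False by (simp add: a_minus_def)
    qed
  qed
qed

text \<open>The zero map is null-homotopic, so \<open>f\<close> lies in its own coset, and in a
  trivial quotient the only coset is the set of null-homotopic maps.\<close>

lemma K_hom_trivialD:
  assumes X: "cplx X" and Y: "cplx Y" and t: "trivial_group (K_hom R X Y)" and f: "f \<in> chain_maps R X Y"
  shows "f \<in> null_homotopic R X Y"
proof -
  note Xl = cplxD(1)[OF X] and Yl = cplxD(1)[OF Y]
  let ?G = "chain_map_group R X Y" and ?H = "null_homotopic R X Y"
  let ?z = "\<lambda>i. \<lambda>x\<in>carrier (obj X i). \<zero>\<^bsub>obj Y i\<^esub>"
  have z: "?z i \<in> mod_hom R (obj X i) (obj Y k)" if "k = i" for i k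
    unfolding that by (rule restrict_mod_hom[OF lin_const_zero[OF Yl] Xl])
  have d0: "dif Y i \<zero>\<^bsub>obj Y i\<^esub> = \<zero>\<^bsub>obj Y k\<^esub>" if "k = i + 1" for i k by (rule lin_zero[OF cplxD(2)[OF Y that] Yl Yl])
  have zc: "?z \<in> chain_maps R X Y"
    unfolding chain_maps_def using z d0 cplxD(3)[OF X _ refl] by auto
  have zH: "?z \<in> ?H" unfolding null_homotopic_def
  proof (intro CollectI conjI zc exI[of _ "\<lambda>i. \<lambda>x\<in>carrier (obj X i). \<zero>\<^bsub>obj Y (i - 1)\<^esub>"] allI ballI)
    show "(\<lambda>x\<in>carrier (obj X i). \<zero>\<^bsub>obj Y (i - 1)\<^esub>) \<in> mod_hom R (obj X i) (obj Y (i - 1))" for i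
      by (rule restrict_mod_hom[OF lin_const_zero[OF Yl] Xl])
    show "?z i x = dif Y (i - 1) ((\<lambda>x\<in>carrier (obj X i). \<zero>\<^bsub>obj Y (i - 1)\<^esub>) x) \<oplus>\<^bsub>obj Y i\<^esub>
        (\<lambda>x\<in>carrier (obj X (i + 1)). \<zero>\<^bsub>obj Y (i + 1 - 1)\<^esub>) (dif X i x)" if "x \<in> carrier (obj X i)" for i x
      using that d0[of i "i - 1"] cplxD(3)[OF X that refl] Yl by simp
  qed
  have "?H #>\<^bsub>?G\<^esub> f \<in> carrier (K_hom R X Y)" using f by (auto simp: K_hom_def FactGroup_def RCOSETS_def chain_map_group_def)
  moreover have "carrier (K_hom R X Y) = {?H}" using t by (simp add: trivial_group_def K_hom_def)
  ultimately have e: "?H #>\<^bsub>?G\<^esub> f = ?H" by simp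
  have fl: "lin (obj X i) (obj Y i) (f i)" "f i \<in> extensional (carrier (obj X i))" for i
    using f by (auto simp: chain_maps_def mod_hom_iff)
  have "?z \<otimes>\<^bsub>?G\<^esub> f = f"
  proof
    show "(?z \<otimes>\<^bsub>?G\<^esub> f) i = f i" for i
      unfolding chain_map_group_def using fl(2)[of i] linD(1)[OF fl(1)[of i]] Yl by (auto intro!: restrict_eqI)
  qed
  then have "f \<in> ?H #>\<^bsub>?G\<^esub> f" using zH unfolding r_coset_def by force
  then show ?thesis using e by simp
qed

lemma presilting_orth:
  assumes p: "presilting R X" and j: "j > 0" shows "orth X X j"
proof -
  have X: "cplx X" using p by (simp add: presilting_def Kb_proj_def)
  note Xl = cplxD(1)[OF X]
  note S = shift_cplx[OF X, of j]
  have null: "f \<in> null_homotopic R X (shift_complex X j)" if "f \<in> chain_maps R X (shift_complex X j)" for f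
    using p j by (intro K_hom_trivialD[OF X S _ that]) (simp add: presilting_def)
  show ?thesis unfolding orth_def
  proof (intro allI impI)
    fix f assume f: "cmap j X X f"
    \<comment> \<open>The sign (-1)^(i j) makes a chain map into the shifted complex out of the
      sign-free family.\<close>
    define g where "g i = (\<lambda>x\<in>carrier (obj X i). if even j then f i x else sg (obj X (i + j)) i (f i x))" for i
    have gl: "lin (obj X i) (obj X (i + j)) (\<lambda>x. if even j then f i x else sg (obj X (i + j)) i (f i x))" for i
      using cmapD(1)[OF f refl, of i] lin_sg[OF cmapD(1)[OF f refl] Xl, of i i] by (cases "even j") simp_all
    note an = antiD(3)[OF anti_sg[OF X X f]]
    have "g \<in> chain_maps R X (shift_complex X j)" unfolding chain_maps_def
    proof (intro CollectI allI conjI ballI)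
      show "g i \<in> mod_hom R (obj X i) (obj (shift_complex X j) i)" for i
        unfolding g_def using restrict_mod_hom[OF gl Xl] by simp
      fix i x assume x: "x \<in> carrier (obj X i)"
      have dx: "dif X i x \<in> carrier (obj X (i + 1))" by (rule cplxD(3)[OF X x refl])
      have gx: "g i x \<in> carrier (obj X (i + j))" unfolding g_def using x linD(1)[OF gl x] by simp
      show "g (i + 1) (dif X i x) = dif (shift_complex X j) i (g i x)"
        unfolding shift_simps(2)[OF gx] using an[OF x refl refl refl] cmapD(3)[OF f x refl refl] x dx by (simp add: g_def)
    qed
    from null[OF this] obtain h where h: "\<And>i. h i \<in> mod_hom R (obj X i) (obj X (i - 1 + j))"
      "\<And>i x. x \<in> carrier (obj X i) \<Longrightarrow> g i x = dif (shift_complex X j) (i - 1) (h i x) \<oplus>\<^bsub>obj X (i + j)\<^esub> h (i + 1) (dif X i x)"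
      unfolding null_homotopic_def by auto
    have hl: "lin (obj X i) (obj X k) (h i)" if "k = i + j - 1" for i k
    proof -
      have "i - 1 + j = k" using that by simp
      then show ?thesis using mod_homD[OF h(1)[of i]] by simp
    qed
    show "nullh j X X f"
    proof (rule nullhI)
      \<comment> \<open>The homotopy takes the sign (-1)^((i + 1) j): the additional factor (-1)^j
        cancels the sign of the shifted differential.\<close>
      show "lin (obj X i) (obj X k) (\<lambda>x. if even j then h i x else sg (obj X (i + j - 1)) (i + 1) (h i x))" if "k = i + j - 1" for i k
        unfolding that using hl[OF refl, of i] lin_sg[OF hl[OF refl] Xl, of i "i + 1"] by (cases "even j") simp_all
      fix i k m p x assume a: "x \<in> carrier (obj X i)" "m = i + j - 1" "p = i + j" "k = i + 1"
      have hx: "h i x \<in> carrier (obj X m)" by (rule linD(1)[OF hl[OF a(2)] a(1)])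
      have hd: "h k (dif X i x) \<in> carrier (obj X p)"
        by (rule linD(1)[OF hl cplxD(3)[OF X a(1,4)]]) (use a in simp)
      have dh: "dif X m (h i x) \<in> carrier (obj X p)" by (rule cplxD(3)[OF X hx]) (use a in simp)
      have fx: "f i x \<in> carrier (obj X p)" by (rule cmapD(2)[OF f a(1,3)])
      have nd: "dif X m (\<ominus>\<^bsub>obj X m\<^esub> h i x) = \<ominus>\<^bsub>obj X p\<^esub> dif X m (h i x)"
        by (rule lin_neg[OF cplxD(2)[OF X] Xl Xl hx]) (use a in simp)
      have i: "i - 1 + j = m" "i + j - 1 = m" "k + j - 1 = p" "i + j = p" "m + 1 = p" "i + 1 = k" using a by auto
      have e: "g i x = (if even j then dif X m (h i x) else \<ominus>\<^bsub>obj X p\<^esub> dif X m (h i x)) \<oplus>\<^bsub>obj X p\<^esub> h k (dif X i x)"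
        using h(2)[OF a(1)] shift_simps(2)[of "h i x" X "i - 1" j] hx by (simp add: i)
      show "f i x = dif X m (if even j then h i x else sg (obj X (i + j - 1)) (i + 1) (h i x)) \<oplus>\<^bsub>obj X p\<^esub>
          (if even j then h k (dif X i x) else sg (obj X (k + j - 1)) (k + 1) (h k (dif X i x)))"
      proof (cases "even j \<or> even i")
        case True
        show ?thesis
        proof (cases "even j")
          case True
          then show ?thesis using e a(1) by (simp add: g_def)
        next
          case False
          then have "even i" "odd (i + 1)" "even (k + 1)" using True a(4) by auto
          then show ?thesis using False e a(1) nd unfolding i(2,3) by (simp add: g_def sg_def)
        qed
      next
        case False
        have "f i x = \<ominus>\<^bsub>obj X p\<^esub> (\<ominus>\<^bsub>obj X p\<^esub> f i x)" using fx Xl by simp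
        also have "\<ominus>\<^bsub>obj X p\<^esub> f i x = \<ominus>\<^bsub>obj X p\<^esub> dif X m (h i x) \<oplus>\<^bsub>obj X p\<^esub> h k (dif X i x)"
          using e False a(1) by (simp add: g_def sg_def i)
        also have "\<ominus>\<^bsub>obj X p\<^esub> \<dots> = dif X m (h i x) \<oplus>\<^bsub>obj X p\<^esub> \<ominus>\<^bsub>obj X p\<^esub> h k (dif X i x)"
          using dh hd Xl by (simp add: minus_distr)
        finally have fx: "f i x = dif X m (h i x) \<oplus>\<^bsub>obj X p\<^esub> \<ominus>\<^bsub>obj X p\<^esub> h k (dif X i x)" .
        have "even (i + 1)" "odd (k + 1)" using False a(4) by auto
        then show ?thesis unfolding fx i(2,3) using False by (simp add: sg_def)
      qed
    qed
  qed
qed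

end

section \<open>The triangulated subcategory generated by a silting complex\<close>

context rng begin

lemma cplxI:
  assumes "\<And>i. lmod (obj X i)" "\<And>i k. k = i + 1 \<Longrightarrow> lin (obj X i) (obj X k) (dif X i)"
    "\<And>i. dif X i \<in> extensional (carrier (obj X i))"
    "\<And>i k m x. \<lbrakk>x \<in> carrier (obj X i); k = i + 1; m = i + 2\<rbrakk> \<Longrightarrow> dif X k (dif X i x) = \<zero>\<^bsub>obj X m\<^esub>"
  shows "cplx X"
  using assms by (simp add: is_complex_def mod_hom_iff)

lemma lin_restrict: "\<lbrakk>lin M N f; lmod M\<rbrakk> \<Longrightarrow> lin M N (restrict f (carrier M))"
  by (rule mod_homD[OF restrict_mod_hom])

lemma lin_power:
  assumes "lin A B f" shows "lin (direct_power A k) (direct_power B k) (\<lambda>u. \<lambda>l\<in>{..<k}. f (u l))"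
proof (rule linI)
  fix u assume u: "u \<in> carrier (direct_power A k)"
  have ul: "u l \<in> carrier A" if "l < k" for l using u that by auto
  show "(\<lambda>l\<in>{..<k}. f (u l)) \<in> carrier (direct_power B k)" using linD(1)[OF assms ul] by simp
  show "(\<lambda>l\<in>{..<k}. f ((u \<oplus>\<^bsub>direct_power A k\<^esub> v) l)) = (\<lambda>l\<in>{..<k}. f (u l)) \<oplus>\<^bsub>direct_power B k\<^esub> (\<lambda>l\<in>{..<k}. f (v l))"
    if v: "v \<in> carrier (direct_power A k)" for v
  proof -
    have "v l \<in> carrier A" if "l < k" for l using v that by auto
    then show ?thesis using linD(2)[OF assms ul] by (auto intro!: restrict_ext)
  qed
  show "(\<lambda>l\<in>{..<k}. f ((a \<odot>\<^bsub>direct_power A k\<^esub> u) l)) = a \<odot>\<^bsub>direct_power B k\<^esub> (\<lambda>l\<in>{..<k}. f (u l))"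
    if a: "a \<in> carrier R" for a
    using linD(3)[OF assms a ul] by (auto intro!: restrict_ext)
qed

definition incl :: "nat \<Rightarrow> ('a, 'b) module \<Rightarrow> nat \<Rightarrow> 'b \<Rightarrow> nat \<Rightarrow> 'b" where
  "incl k A l x = (\<lambda>m\<in>{..<k}. if m = l then x else \<zero>\<^bsub>A\<^esub>)"

lemma incl_lin: "lmod A \<Longrightarrow> lin A (direct_power A k) (incl k A l)"
  by (rule linI) (auto simp: incl_def intro!: restrict_ext)

lemma proj_lin: "l < k \<Longrightarrow> lin (direct_power A k) A (\<lambda>u. u l)"
  by (rule linI) auto

lemma incl_decomp:
  assumes A: "lmod A" and u: "u \<in> carrier (direct_power A k)"
  shows "msum (direct_power A k) (\<lambda>l. incl k A l (u l)) k = u"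
proof -
  have ul: "u l \<in> carrier A" if "l < k" for l using u that by auto
  have "msum (direct_power A k) (\<lambda>l. incl k A l (u l)) k = (\<lambda>i\<in>{..<k}. msum A (\<lambda>l. incl k A l (u l) i) k)"
    using linD(1)[OF incl_lin[OF A] ul] by (intro msum_power[OF A]) auto
  also have "\<dots> = u"
  proof (rule restrict_eqI)
    show "u \<in> extensional {..<k}" using u by (simp add: PiE_def)
    fix i assume i: "i \<in> {..<k}"
    have "msum A (\<lambda>l. incl k A l (u l) i) k = msum A (\<lambda>l. if l = i then u i else \<zero>\<^bsub>A\<^esub>) k"
      using i by (intro msum_cong) (auto simp: incl_def)
    then show "msum A (\<lambda>l. incl k A l (u l) i) k = u i" using msum_delta[OF A, of i k "u i"] i ul by simp
  qed
  finally show ?thesis .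
qed

lemma power_simps [simp]:
  "obj (complex_power X k) i = direct_power (obj X i) k"
  "u \<in> {..<k} \<rightarrow>\<^sub>E carrier (obj X i) \<Longrightarrow> dif (complex_power X k) i u = (\<lambda>l\<in>{..<k}. dif X i (u l))"
  by (simp_all add: complex_power_def)

lemma power_cplx:
  assumes X: "cplx X" shows "cplx (complex_power X k)"
proof (rule cplxI)
  show l: "lmod (obj (complex_power X k) i)" for i using lmod_power[OF cplxD(1)[OF X]] by simp
  show "lin (obj (complex_power X k) i) (obj (complex_power X k) m) (dif (complex_power X k) i)" if "m = i + 1" for i m
    using lin_restrict[OF lin_power[OF cplxD(2)[OF X that]] lmod_power[OF cplxD(1)[OF X]]]
    by (simp add: complex_power_def)
  show "dif (complex_power X k) i \<in> extensional (carrier (obj (complex_power X k) i))" for i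
    by (simp add: complex_power_def)
  fix i p m u assume u: "u \<in> carrier (obj (complex_power X k) i)" "p = i + 1" "m = i + 2"
  have ul: "u l \<in> carrier (obj X i)" if "l < k" for l using u that by auto
  have "(\<lambda>l\<in>{..<k}. dif X i (u l)) \<in> {..<k} \<rightarrow>\<^sub>E carrier (obj X p)" using cplxD(3)[OF X ul u(2)] by simp
  then show "dif (complex_power X k) p (dif (complex_power X k) i u) = \<zero>\<^bsub>obj (complex_power X k) m\<^esub>"
    using u(1) cplxD(4)[OF X ul u(2,3)] by (auto intro!: restrict_ext)
qed

text \<open>A map out of a power is the sum of its restrictions along the inclusions
  \<open>incl\<close>, and their homotopies add up.\<close>

lemma orth_power:
  assumes X: "cplx X" and W: "cplx W" and o: "orth X W j" shows "orth (complex_power X k) W j"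
  unfolding orth_def
proof (intro allI impI)
  fix u assume u: "cmap j (complex_power X k) W u"
  note X' = cplxD(1)[OF X] and W' = cplxD(1)[OF W]
  have ul: "lin (direct_power (obj X i) k) (obj W m) (u i)" if "m = i + j" for i m using cmapD(1)[OF u that] by simp
  have il: "lin (obj X i) (obj W m) (\<lambda>x. u i (incl k (obj X i) l x))" if "m = i + j" for i m l
    by (rule lin_comp[OF incl_lin[OF X'] ul[OF that]])
  define Q where "Q l h \<longleftrightarrow> (\<forall>i m. m = i + j - 1 \<longrightarrow> lin (obj X i) (obj W m) (h i)) \<and>
      (\<forall>i q m p x. x \<in> carrier (obj X i) \<and> m = i + j - 1 \<and> p = i + j \<and> q = i + 1 \<longrightarrow>
        u i (incl k (obj X i) l x) = dif W m (h i x) \<oplus>\<^bsub>obj W p\<^esub> h q (dif X i x))" for l h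
  have ex: "\<exists>h. Q l h" for l
  proof -
    have "cmap j X W (\<lambda>i x. u i (incl k (obj X i) l x))"
    proof (rule cmapI[OF il])
      fix i q m x assume a: "x \<in> carrier (obj X i)" "q = i + 1" "m = i + j"
      have ix: "incl k (obj X i) l x \<in> carrier (direct_power (obj X i) k)" by (rule linD(1)[OF incl_lin[OF X'] a(1)])
      have "dif (complex_power X k) i (incl k (obj X i) l x) = incl k (obj X q) l (dif X i x)"
        using ix lin_zero[OF cplxD(2)[OF X a(2)] X' X'] by (auto simp: incl_def intro!: restrict_ext)
      then show "u q (incl k (obj X q) l (dif X i x)) = dif W m (u i (incl k (obj X i) l x))"
        using cmapD(3)[OF u, of "incl k (obj X i) l x" i q m] ix a by simp
    qed
    then have "nullh j X W (\<lambda>i x. u i (incl k (obj X i) l x))" by (rule orthD[OF o])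
    then obtain h where "\<And>i k. k = i + j - 1 \<Longrightarrow> lin (obj X i) (obj W k) (h i)"
      "\<And>i q m p x. \<lbrakk>x \<in> carrier (obj X i); m = i + j - 1; p = i + j; q = i + 1\<rbrakk> \<Longrightarrow>
        u i (incl k (obj X i) l x) = dif W m (h i x) \<oplus>\<^bsub>obj W p\<^esub> h q (dif X i x)" by (rule nullhE) (rule that)
    then show ?thesis unfolding Q_def by (intro exI[of _ h]) auto
  qed
  then obtain h where h': "\<And>l. Q l (h l)" by metis
  have h: "\<And>l i m. m = i + j - 1 \<Longrightarrow> lin (obj X i) (obj W m) (h l i)"
    "\<And>l i q m p x. \<lbrakk>x \<in> carrier (obj X i); m = i + j - 1; p = i + j; q = i + 1\<rbrakk> \<Longrightarrow>
        u i (incl k (obj X i) l x) = dif W m (h l i x) \<oplus>\<^bsub>obj W p\<^esub> h l q (dif X i x)"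
    using h' by (simp_all add: Q_def)
  show "nullh j (complex_power X k) W u"
  proof (rule nullhI)
    show "lin (obj (complex_power X k) i) (obj W m) (\<lambda>v. msum (obj W (i + j - 1)) (\<lambda>l. h l i (v l)) k)" if "m = i + j - 1" for i m
      unfolding that power_simps
      by (rule lin_msum[OF lmod_power[OF X'] W']) (rule lin_comp[OF proj_lin h(1)[OF refl]])
    fix i q m p v assume a: "v \<in> carrier (obj (complex_power X k) i)" "m = i + j - 1" "p = i + j" "q = i + 1"
    have v: "v \<in> carrier (direct_power (obj X i) k)" using a by simp
    have vl: "v l \<in> carrier (obj X i)" if "l < k" for l using v that by auto
    have dvl: "dif X i (v l) \<in> carrier (obj X q)" if "l < k" for l by (rule cplxD(3)[OF X vl[OF that] a(4)])
    have hv: "h l i (v l) \<in> carrier (obj W m)" if "l < k" for l by (rule linD(1)[OF h(1)[OF a(2)] vl[OF that]])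
    have hdv: "h l q (dif X i (v l)) \<in> carrier (obj W p)" if "l < k" for l
      by (rule linD(1)[OF h(1) dvl[OF that]]) (use a in simp)
    have dl: "lin (obj W m) (obj W p) (dif W m)" by (rule cplxD(2)[OF W]) (use a in simp)
    have "u i v = u i (msum (direct_power (obj X i) k) (\<lambda>l. incl k (obj X i) l (v l)) k)" using incl_decomp[OF X' v] by simp
    also have "\<dots> = msum (obj W p) (\<lambda>l. u i (incl k (obj X i) l (v l))) k"
      by (rule msum_lin[OF ul[OF a(3)] lmod_power[OF X'] W' linD(1)[OF incl_lin[OF X'] vl]])
    also have "\<dots> = msum (obj W p) (\<lambda>l. dif W m (h l i (v l)) \<oplus>\<^bsub>obj W p\<^esub> h l q (dif X i (v l))) k"
      using h(2)[OF vl a(2-4)] by (intro msum_cong) simp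
    also have "\<dots> = msum (obj W p) (\<lambda>l. dif W m (h l i (v l))) k \<oplus>\<^bsub>obj W p\<^esub> msum (obj W p) (\<lambda>l. h l q (dif X i (v l))) k"
      by (rule msum_add[OF W' linD(1)[OF dl hv] hdv])
    also have "msum (obj W p) (\<lambda>l. dif W m (h l i (v l))) k = dif W m (msum (obj W m) (\<lambda>l. h l i (v l)) k)"
      by (rule msum_lin[OF dl W' W' hv, symmetric])
    also have "msum (obj W p) (\<lambda>l. h l q (dif X i (v l))) k
      = msum (obj W (q + j - 1)) (\<lambda>l. h l q (dif (complex_power X k) i v l)) k"
    proof -
      have qe: "q + j - 1 = p" using a by simp
      have "dif (complex_power X k) i v l = dif X i (v l)" if "l < k" for l
        using power_simps(2)[of v k X i] v that by simp
      then show ?thesis unfolding qe by (intro msum_cong) simp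
    qed
    finally show "u i v = dif W m (msum (obj W (i + j - 1)) (\<lambda>l. h l i (v l)) k) \<oplus>\<^bsub>obj W p\<^esub>
        msum (obj W (q + j - 1)) (\<lambda>l. h l q (dif (complex_power X k) i v l)) k" using a(2) by simp
  qed
qed

section \<open>Direct sums and cones\<close>

lemma sum_simps [simp]:
  "obj (complex_sum X Y) i = direct_sum (obj X i) (obj Y i)"
  "\<lbrakk>x \<in> carrier (obj X i); y \<in> carrier (obj Y i)\<rbrakk> \<Longrightarrow> dif (complex_sum X Y) i (x, y) = (dif X i x, dif Y i y)"
  by (simp_all add: complex_sum_def)

lemma sum_cplx:
  assumes X: "cplx X" and Y: "cplx Y" shows "cplx (complex_sum X Y)"
proof (rule cplxI)
  note X' = cplxD(1)[OF X] and Y' = cplxD(1)[OF Y]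
  show l: "lmod (obj (complex_sum X Y) i)" for i using lmod_direct_sum[OF X' Y'] by simp
  show "lin (obj (complex_sum X Y) i) (obj (complex_sum X Y) m) (dif (complex_sum X Y) i)" if "m = i + 1" for i m
    by (rule linI)
      (use X' Y' linD[OF cplxD(2)[OF X that]] linD[OF cplxD(2)[OF Y that]] in auto)
  show "dif (complex_sum X Y) i \<in> extensional (carrier (obj (complex_sum X Y) i))" for i
    by (simp add: complex_sum_def)
  fix i p m u assume "u \<in> carrier (obj (complex_sum X Y) i)" "p = i + 1" "m = i + 2"
  then show "dif (complex_sum X Y) p (dif (complex_sum X Y) i u) = \<zero>\<^bsub>obj (complex_sum X Y) m\<^esub>"
    using cplxD(3,4)[OF X] cplxD(3,4)[OF Y] by auto
qed

lemma hret_sum: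
  assumes X: "cplx X" and Y: "cplx Y" shows "hret X (complex_sum X Y)"
proof -
  note X' = cplxD(1)[OF X] and Y' = cplxD(1)[OF Y]
  have d0: "dif Z i \<zero>\<^bsub>obj Z i\<^esub> = \<zero>\<^bsub>obj Z k\<^esub>" if "cplx Z" "k = i + 1" for Z :: "('a, 'z) cochain_complex" and i k
    by (rule lin_zero[OF cplxD(2)[OF that] cplxD(1)[OF that(1)] cplxD(1)[OF that(1)]])
  have 1: "cmap 0 X (complex_sum X Y) (\<lambda>i x. (x, \<zero>\<^bsub>obj Y i\<^esub>))"
    by (rule cmapI) (use X' Y' d0[OF Y] in \<open>auto intro!: linI\<close>)
  have 2: "cmap 0 (complex_sum X Y) X (\<lambda>i. fst)"
    by (rule cmapI) (auto intro!: linI)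
  show ?thesis unfolding hret_def
    by (rule exI[of _ "\<lambda>i x. (x, \<zero>\<^bsub>obj Y i\<^esub>)"], rule exI[of _ "\<lambda>i. fst"], rule exI[of _ "\<lambda>i x. \<zero>\<^bsub>obj X (i - 1)\<^esub>"])
      (use 1 2 lin_const_zero[OF X'] X' d0[OF X] in auto)
qed

lemma cone_simps [simp]:
  "obj (cone X Y f) i = direct_sum (obj X (i + 1)) (obj Y i)"
  "\<lbrakk>x \<in> carrier (obj X (i + 1)); y \<in> carrier (obj Y i)\<rbrakk> \<Longrightarrow> dif (cone X Y f) i (x, y) =
     (\<ominus>\<^bsub>obj X (i + 2)\<^esub> dif X (i + 1) x, f (i + 1) x \<oplus>\<^bsub>obj Y (i + 1)\<^esub> dif Y i y)"
  by (simp_all add: cone_def)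

lemma cone_cplx:
  assumes X: "cplx X" and Y: "cplx Y" and f: "cmap 0 X Y f" shows "cplx (cone X Y f)"
proof (rule cplxI)
  note X' = cplxD(1)[OF X] and Y' = cplxD(1)[OF Y]
  show l: "lmod (obj (cone X Y f) i)" for i using lmod_direct_sum[OF X' Y'] by simp
  show "dif (cone X Y f) i \<in> extensional (carrier (obj (cone X Y f) i))" for i
    by (simp add: cone_def)
  show "lin (obj (cone X Y f) i) (obj (cone X Y f) m) (dif (cone X Y f) i)" if m: "m = i + 1" for i m
  proof -
    have i: "i + 2 = m + 1" "i + 1 = m" using m by auto
    have d1: "lin (obj X m) (obj X (m + 1)) (dif X m)" by (rule cplxD(2)[OF X refl])
    have d2: "lin (obj Y i) (obj Y m) (dif Y i)" by (rule cplxD(2)[OF Y m])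
    have fl: "lin (obj X m) (obj Y m) (f m)" using cmapD(1)[OF f, of m m] by simp
    show ?thesis
      by (rule linI)
        (use X' Y' linD[OF d1] linD[OF d2] linD[OF fl] in
          \<open>auto simp: cone_simps[unfolded i] cone_simps i minus_distr smult_minus smult_distr(2) lmod_ac\<close>)
  qed
  fix i p m u assume u: "u \<in> carrier (obj (cone X Y f) i)" "p = i + 1" "m = i + 2"
  obtain x y where xy: "u = (x, y)" "x \<in> carrier (obj X p)" "y \<in> carrier (obj Y i)" using u by auto
  have i: "i + 1 = p" "i + 2 = m" "p + 1 = m" "p + 2 = m + 1" using u by auto
  have dx: "dif X p x \<in> carrier (obj X m)" by (rule cplxD(3)[OF X xy(2)]) (simp add: i)
  have dy: "dif Y i y \<in> carrier (obj Y p)" by (rule cplxD(3)[OF Y xy(3) u(2)])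
  have fx: "f p x \<in> carrier (obj Y p)" using cmapD(2)[OF f xy(2), of p] by simp
  have 1: "dif (cone X Y f) i (x, y) = (\<ominus>\<^bsub>obj X m\<^esub> dif X p x, f p x \<oplus>\<^bsub>obj Y p\<^esub> dif Y i y)"
    using xy cone_simps(2)[of x X i y Y f] by (simp add: i)
  have nx: "\<ominus>\<^bsub>obj X m\<^esub> dif X p x \<in> carrier (obj X (p + 1))" using dx X' by (simp add: i)
  have ny: "f p x \<oplus>\<^bsub>obj Y p\<^esub> dif Y i y \<in> carrier (obj Y p)" using fx dy Y' by simp
  have dd: "dif X m (dif X p x) = \<zero>\<^bsub>obj X (m + 1)\<^esub>" by (rule cplxD(4)[OF X xy(2)]) (use i in auto)
  have ddy: "dif Y p (dif Y i y) = \<zero>\<^bsub>obj Y m\<^esub>" by (rule cplxD(4)[OF Y xy(3) u(2,3)])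
  have n1: "dif X m (\<ominus>\<^bsub>obj X m\<^esub> dif X p x) = \<ominus>\<^bsub>obj X (m + 1)\<^esub> dif X m (dif X p x)"
    by (rule lin_neg[OF cplxD(2)[OF X refl] X' X' dx])
  have fm: "lin (obj X m) (obj Y m) (f m)" using cmapD(1)[OF f, of m m] by simp
  have n2: "f m (\<ominus>\<^bsub>obj X m\<^esub> dif X p x) = \<ominus>\<^bsub>obj Y m\<^esub> f m (dif X p x)" by (rule lin_neg[OF fm X' Y' dx])
  have fd: "f m (dif X p x) = dif Y p (f p x)" using cmapD(3)[OF f xy(2), of m p] i by simp
  have dfx: "dif Y p (f p x) \<in> carrier (obj Y m)" by (rule cplxD(3)[OF Y fx]) (simp add: i)
  have a: "dif Y p (f p x \<oplus>\<^bsub>obj Y p\<^esub> dif Y i y) = dif Y p (f p x) \<oplus>\<^bsub>obj Y m\<^esub> dif Y p (dif Y i y)"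
    by (rule linD(2)[OF cplxD(2)[OF Y] fx dy]) (simp add: i)
  show "dif (cone X Y f) p (dif (cone X Y f) i u) = \<zero>\<^bsub>obj (cone X Y f) m\<^esub>"
    unfolding xy(1) 1 cone_simps(2)[OF nx ny] i
    using dd ddy n1 n2 fd dfx a X' Y' by (simp add: i)
qed

text \<open>The exact sequence of morphisms out of a triangle, carried out with homotopies: a
  contraction \<open>h\<close> of the restriction to \<open>Y\<close> corrects \<open>u\<close> to a
  map that lives on \<open>X\<close> alone, which has degree \<open>j - 1\<close> there because the
  cone contains \<open>X\<close> shifted by one.\<close>

lemma orth_cone:
  assumes X: "cplx X" and Y: "cplx Y" and f: "cmap 0 X Y f" and W: "cplx W"
    and o1: "orth X W (j - 1)" and o2: "orth Y W j"
  shows "orth (cone X Y f) W j"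
  unfolding orth_def
proof (intro allI impI)
  fix u assume u: "cmap j (cone X Y f) W u"
  note X' = cplxD(1)[OF X] and Y' = cplxD(1)[OF Y] and W' = cplxD(1)[OF W]
  have ul: "lin (direct_sum (obj X k) (obj Y i)) (obj W m) (u i)" if "m = i + j" "k = i + 1" for i k m
    using cmapD(1)[OF u that(1)] that(2) by simp
  have uY: "lin (obj Y i) (obj W m) (\<lambda>y. u i (\<zero>\<^bsub>obj X k\<^esub>, y))" if "m = i + j" "k = i + 1" for i k m
    by (rule lin_comp[OF _ ul[OF that]]) (use X' in \<open>auto intro!: linI\<close>)
  have uX: "lin (obj X k) (obj W m) (\<lambda>x. u i (x, \<zero>\<^bsub>obj Y i\<^esub>))" if "m = i + j" "k = i + 1" for i k m
    by (rule lin_comp[OF _ ul[OF that]]) (use Y' in \<open>auto intro!: linI\<close>)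
  have f': "lin (obj X i) (obj Y i) (f i)" for i using cmapD(1)[OF f, of i i] by simp
  have fd: "f k (dif X i x) = dif Y i (f i x)" if "x \<in> carrier (obj X i)" "k = i + 1" for i k x
    using cmapD(3)[OF f that, of i] by simp
  have d0: "dif Z i \<zero>\<^bsub>obj Z i\<^esub> = \<zero>\<^bsub>obj Z k\<^esub>" if "cplx Z" "k = i + 1" for Z :: "('a, 'z) cochain_complex" and i k
    by (rule lin_zero[OF cplxD(2)[OF that] cplxD(1)[OF that(1)] cplxD(1)[OF that(1)]])
  have cd: "dif (cone X Y f) i (x, y) = (\<ominus>\<^bsub>obj X p\<^esub> dif X k x, f k x \<oplus>\<^bsub>obj Y k\<^esub> dif Y i y)"
    if "x \<in> carrier (obj X k)" "y \<in> carrier (obj Y i)" "k = i + 1" "p = i + 2" for i k p x y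
    using cone_simps(2)[of x X i y Y f] that by simp
  have ud: "u k (\<ominus>\<^bsub>obj X p\<^esub> dif X k x, f k x \<oplus>\<^bsub>obj Y k\<^esub> dif Y i y) = dif W m (u i (x, y))"
    if "x \<in> carrier (obj X k)" "y \<in> carrier (obj Y i)" "k = i + 1" "p = i + 2" "m = i + j" for i k p m x y
    using cmapD(3)[OF u, of "(x, y)" i k m] cd[OF that(1-4)] that by simp
  have f0: "f i \<zero>\<^bsub>obj X i\<^esub> = \<zero>\<^bsub>obj Y i\<^esub>" for i by (rule lin_zero[OF f' X' Y'])
  have "cmap j Y W (\<lambda>i y. u i (\<zero>\<^bsub>obj X (i + 1)\<^esub>, y))"
  proof (rule cmapI)
    show "lin (obj Y i) (obj W k) (\<lambda>y. u i (\<zero>\<^bsub>obj X (i + 1)\<^esub>, y))" if "k = i + j" for i k by (rule uY[OF that refl])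
    fix i k m y assume a: "y \<in> carrier (obj Y i)" "k = i + 1" "m = i + j"
    define p where "p = i + 2"
    have p: "i + 1 = k" "k + 1 = p" and p3: "p = k + 1" using a p_def by auto
    show "u k (\<zero>\<^bsub>obj X (k + 1)\<^esub>, dif Y i y) = dif W m (u i (\<zero>\<^bsub>obj X (i + 1)\<^esub>, y))"
      using ud[OF lmod_simps(1)[OF X'] a(1,2) p_def a(3)] d0[OF X p3] f0[of k] cplxD(3)[OF Y a(1,2)] X' Y' unfolding p by simp
  qed
  then have "nullh j Y W (\<lambda>i y. u i (\<zero>\<^bsub>obj X (i + 1)\<^esub>, y))" by (rule orthD[OF o2])
  then obtain h where h: "\<And>i k. k = i + j - 1 \<Longrightarrow> lin (obj Y i) (obj W k) (h i)"
    "\<And>i k m p x. \<lbrakk>x \<in> carrier (obj Y i); m = i + j - 1; p = i + j; k = i + 1\<rbrakk> \<Longrightarrow>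
      u i (\<zero>\<^bsub>obj X (i + 1)\<^esub>, x) = dif W m (h i x) \<oplus>\<^bsub>obj W p\<^esub> h k (dif Y i x)"
    by (rule nullhE) (rule that)
  \<comment> \<open>What is left of \<open>u\<close> on \<open>X\<close> after subtracting the
    contribution of \<open>h\<close> through \<open>f\<close>. The cone negates the differential of
    \<open>X\<close>, so the family anticommutes.\<close>
  define v where "v i x = u (i - 1) (x, \<zero>\<^bsub>obj Y (i - 1)\<^esub>) \<ominus>\<^bsub>obj W (i + j - 1)\<^esub> h i (f i x)" for i x
  have vl: "lin (obj X i) (obj W k) (v i)" if "k = i + (j - 1)" for i k
  proof -
    have e: "k = i - 1 + j" "i = i - 1 + 1" "k = i + j - 1" using that by auto
    have hf: "lin (obj X i) (obj W k) (\<lambda>x. h i (f i x))" by (rule lin_comp[OF f' h(1)[OF e(3)]])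
    show ?thesis unfolding v_def[abs_def] e(3)[symmetric] by (rule lin_sub[OF uX[OF e(1,2)] hf W'])
  qed
  have vs: "v k x = u i (x, \<zero>\<^bsub>obj Y i\<^esub>) \<ominus>\<^bsub>obj W m\<^esub> h k (f k x)" if "k = i + 1" "m = i + j" for i k m x
  proof -
    have "k - 1 = i" "k + j - 1 = m" using that by auto
    then show ?thesis by (simp add: v_def)
  qed
  have "anti (j - 1) X W v"
  proof (rule antiI[OF vl])
    fix i k m p x assume a: "x \<in> carrier (obj X i)" "k = i + 1" "m = i + (j - 1)" "p = i + (j - 1) + 1"
    define q where "q = i - 1"
    have q: "i = q + 1" "k = q + 2" "m = q + j" "p = i + j" "k = i + 1" "p = m + 1" "q + 1 = i" using a q_def by auto
    have dx: "dif X i x \<in> carrier (obj X k)" by (rule cplxD(3)[OF X a(1,2)])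
    have fx: "f i x \<in> carrier (obj Y i)" by (rule linD(1)[OF f' a(1)])
    have fdx: "f k (dif X i x) = dif Y i (f i x)" by (rule fd[OF a(1,2)])
    have hfx: "h i (f i x) \<in> carrier (obj W m)" by (rule linD(1)[OF h(1) fx]) (use a in simp)
    have dfx: "dif Y i (f i x) \<in> carrier (obj Y k)" by (rule cplxD(3)[OF Y fx a(2)])
    have hdf: "h k (dif Y i (f i x)) \<in> carrier (obj W p)" by (rule linD(1)[OF h(1) dfx]) (use a in simp)
    have dW: "lin (obj W m) (obj W p) (dif W m)" by (rule cplxD(2)[OF W q(6)])
    have ux: "u q (x, \<zero>\<^bsub>obj Y q\<^esub>) \<in> carrier (obj W m)" by (rule linD(1)[OF uX[OF q(3,1)] a(1)])
    have udx: "u i (dif X i x, \<zero>\<^bsub>obj Y i\<^esub>) \<in> carrier (obj W p)" by (rule linD(1)[OF uX[OF q(4,5)] dx])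
    have uf: "u i (\<zero>\<^bsub>obj X k\<^esub>, f i x) \<in> carrier (obj W p)" by (rule linD(1)[OF uY[OF q(4,5)] fx])
    have 1: "dif W m (u q (x, \<zero>\<^bsub>obj Y q\<^esub>)) = u i (\<ominus>\<^bsub>obj X k\<^esub> dif X i x, f i x)"
      using ud[OF a(1) lmod_simps(1)[OF Y'] q(1-3)] d0[OF Y q(1)] fx Y' by simp
    have "(\<ominus>\<^bsub>obj X k\<^esub> dif X i x, f i x) = (\<ominus>\<^bsub>obj X k\<^esub> dif X i x, \<zero>\<^bsub>obj Y i\<^esub>) \<oplus>\<^bsub>direct_sum (obj X k) (obj Y i)\<^esub> (\<zero>\<^bsub>obj X k\<^esub>, f i x)"
      using dx fx X' Y' by simp
    then have 2: "u i (\<ominus>\<^bsub>obj X k\<^esub> dif X i x, f i x) = u i (\<ominus>\<^bsub>obj X k\<^esub> dif X i x, \<zero>\<^bsub>obj Y i\<^esub>) \<oplus>\<^bsub>obj W p\<^esub> u i (\<zero>\<^bsub>obj X k\<^esub>, f i x)"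
      using linD(2)[OF ul[OF q(4,5)], of "(\<ominus>\<^bsub>obj X k\<^esub> dif X i x, \<zero>\<^bsub>obj Y i\<^esub>)" "(\<zero>\<^bsub>obj X k\<^esub>, f i x)"] dx fx X' Y' by simp
    have 3: "u i (\<ominus>\<^bsub>obj X k\<^esub> dif X i x, \<zero>\<^bsub>obj Y i\<^esub>) = \<ominus>\<^bsub>obj W p\<^esub> u i (dif X i x, \<zero>\<^bsub>obj Y i\<^esub>)"
      by (rule lin_neg[OF uX[OF q(4,5)] X' W' dx])
    have 4: "u i (\<zero>\<^bsub>obj X k\<^esub>, f i x) = dif W m (h i (f i x)) \<oplus>\<^bsub>obj W p\<^esub> h k (dif Y i (f i x))"
      using h(2)[OF fx, of m p k] a by simp
    note dh = linD(1)[OF dW hfx]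
    have "dif W m (v i x) = dif W m (u q (x, \<zero>\<^bsub>obj Y q\<^esub>)) \<ominus>\<^bsub>obj W p\<^esub> dif W m (h i (f i x))"
      unfolding vs[OF q(1,3)] by (rule lin_diff[OF dW W' W' ux hfx])
    also have "\<dots> = \<ominus>\<^bsub>obj W p\<^esub> u i (dif X i x, \<zero>\<^bsub>obj Y i\<^esub>) \<oplus>\<^bsub>obj W p\<^esub> h k (dif Y i (f i x))"
      unfolding 1 2 3 4 using udx dh hdf W' by (subst diff_eq_iff[OF W']) (simp_all add: lmod_ac)
    finally have "\<ominus>\<^bsub>obj W p\<^esub> dif W m (v i x) = u i (dif X i x, \<zero>\<^bsub>obj Y i\<^esub>) \<oplus>\<^bsub>obj W p\<^esub> \<ominus>\<^bsub>obj W p\<^esub> h k (dif Y i (f i x))"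
      using udx hdf W' by (simp add: minus_distr)
    then show "v k (dif X i x) = \<ominus>\<^bsub>obj W p\<^esub> dif W m (v i x)"
      unfolding vs[OF q(5,4)] fdx by (simp add: a_minus_def)
  qed
  then obtain s where s: "\<And>i k. k = i + (j - 1) - 1 \<Longrightarrow> lin (obj X i) (obj W k) (s i)"
    "\<And>i k m p x. \<lbrakk>x \<in> carrier (obj X i); m = i + (j - 1) - 1; p = i + (j - 1); k = i + 1\<rbrakk> \<Longrightarrow>
      v i x = dif W m (s i x) \<ominus>\<^bsub>obj W p\<^esub> s k (dif X i x)"
    by (rule orth_antiE[OF W X o1]) (rule that)
  show "nullh j (cone X Y f) W u"
  proof (rule nullhI)
    fix i k assume k: "k = i + j - 1"
    have s1: "lin (direct_sum (obj X (i + 1)) (obj Y i)) (obj W k) (\<lambda>z. s (i + 1) (fst z))"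
      by (rule lin_comp[OF _ s(1)]) (use k in \<open>auto intro!: linI\<close>)
    have h1: "lin (direct_sum (obj X (i + 1)) (obj Y i)) (obj W k) (\<lambda>z. h i (snd z))"
      by (rule lin_comp[OF _ h(1)[OF k]]) (auto intro!: linI)
    \<comment> \<open>The contraction is \<open>h\<close> on the part from \<open>Y\<close> plus
      \<open>s\<close> on the part from \<open>X\<close>; the term \<open>h f\<close> subtracted in
      \<open>v\<close> comes back through the differential of the cone.\<close>
    show "lin (obj (cone X Y f) i) (obj W k) (\<lambda>z. h i (snd z) \<oplus>\<^bsub>obj W (i + j - 1)\<^esub> s (i + 1) (fst z))"
      using lin_add[OF h1 s1 W'] k by simp
  next
    fix i k m p z assume a: "z \<in> carrier (obj (cone X Y f) i)" "m = i + j - 1" "p = i + j" "k = i + 1"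
    obtain x y where z: "z = (x, y)" "x \<in> carrier (obj X k)" "y \<in> carrier (obj Y i)" using a by auto
    define q where "q = i + 2"
    have q: "k + 1 = q" "q = k + 1" "m = k + (j - 1) - 1" "p = k + (j - 1)" "p = q + (j - 1) - 1" "p = k + j - 1" "p = m + 1" "i + 1 = k" "k + j - 1 = p" "i + j - 1 = m"
      using a q_def by auto
    have dx: "dif X k x \<in> carrier (obj X q)" by (rule cplxD(3)[OF X z(2) q(2)])
    have dy: "dif Y i y \<in> carrier (obj Y k)" by (rule cplxD(3)[OF Y z(3) a(4)])
    have fx: "f k x \<in> carrier (obj Y k)" by (rule linD(1)[OF f' z(2)])
    have sx: "s k x \<in> carrier (obj W m)" by (rule linD(1)[OF s(1)[OF q(3)] z(2)])
    have sdx: "s q (dif X k x) \<in> carrier (obj W p)" by (rule linD(1)[OF s(1)[OF q(5)] dx])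
    have hy: "h i y \<in> carrier (obj W m)" by (rule linD(1)[OF h(1)[OF a(2)] z(3)])
    have hl: "lin (obj Y k) (obj W p) (h k)" by (rule h(1)[OF q(6)])
    have dW: "lin (obj W m) (obj W p) (dif W m)" by (rule cplxD(2)[OF W q(7)])
    note c = linD(1)[OF hl fx] linD(1)[OF hl dy] linD(1)[OF dW sx] linD(1)[OF dW hy] sdx
    have ux: "u i (x, \<zero>\<^bsub>obj Y i\<^esub>) \<in> carrier (obj W p)" by (rule linD(1)[OF uX[OF a(3,4)] z(2)])
    have 1: "u i (x, \<zero>\<^bsub>obj Y i\<^esub>) = (dif W m (s k x) \<ominus>\<^bsub>obj W p\<^esub> s q (dif X k x)) \<oplus>\<^bsub>obj W p\<^esub> h k (f k x)"
      using s(2)[OF z(2) q(3,4,2)] vs[OF a(4,3), of x] ux c W'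
        diff_eq_iff[OF W' ux c(1), of "dif W m (s k x) \<ominus>\<^bsub>obj W p\<^esub> s q (dif X k x)"] by simp
    have "(x, y) = (x, \<zero>\<^bsub>obj Y i\<^esub>) \<oplus>\<^bsub>direct_sum (obj X k) (obj Y i)\<^esub> (\<zero>\<^bsub>obj X k\<^esub>, y)"
      using z X' Y' by simp
    then have 2: "u i (x, y) = u i (x, \<zero>\<^bsub>obj Y i\<^esub>) \<oplus>\<^bsub>obj W p\<^esub> u i (\<zero>\<^bsub>obj X k\<^esub>, y)"
      using linD(2)[OF ul[OF a(3,4)], of "(x, \<zero>\<^bsub>obj Y i\<^esub>)" "(\<zero>\<^bsub>obj X k\<^esub>, y)"] z X' Y' by simp
    have 3: "u i (\<zero>\<^bsub>obj X k\<^esub>, y) = dif W m (h i y) \<oplus>\<^bsub>obj W p\<^esub> h k (dif Y i y)"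
      using h(2)[OF z(3) a(2,3,4)] a(4) by simp
    have 4: "s q (\<ominus>\<^bsub>obj X q\<^esub> dif X k x) = \<ominus>\<^bsub>obj W p\<^esub> s q (dif X k x)"
      by (rule lin_neg[OF s(1)[OF q(5)] X' W' dx])
    have 5: "h k (f k x \<oplus>\<^bsub>obj Y k\<^esub> dif Y i y) = h k (f k x) \<oplus>\<^bsub>obj W p\<^esub> h k (dif Y i y)" by (rule linD(2)[OF hl fx dy])
    have 6: "dif W m (h i y \<oplus>\<^bsub>obj W m\<^esub> s k x) = dif W m (h i y) \<oplus>\<^bsub>obj W p\<^esub> dif W m (s k x)" by (rule linD(2)[OF dW hy sx])
    have cdz: "dif (cone X Y f) i (x, y) = (\<ominus>\<^bsub>obj X q\<^esub> dif X k x, f k x \<oplus>\<^bsub>obj Y k\<^esub> dif Y i y)"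
      by (rule cd[OF z(2,3) a(4) q_def])
    have "u i (x, y) = dif W m (h i y \<oplus>\<^bsub>obj W m\<^esub> s k x) \<oplus>\<^bsub>obj W p\<^esub>
        (h k (f k x \<oplus>\<^bsub>obj Y k\<^esub> dif Y i y) \<oplus>\<^bsub>obj W p\<^esub> s q (\<ominus>\<^bsub>obj X q\<^esub> dif X k x))"
      unfolding 2 1 3 4 5 6 using c W' by (simp add: a_minus_def lmod_ac)
    then show "u i z = dif W m (h i (snd z) \<oplus>\<^bsub>obj W (i + j - 1)\<^esub> s (i + 1) (fst z)) \<oplus>\<^bsub>obj W p\<^esub>
        (h k (snd (dif (cone X Y f) i z)) \<oplus>\<^bsub>obj W (k + j - 1)\<^esub> s (k + 1) (fst (dif (cone X Y f) i z)))"
      unfolding z(1) cdz q(1,8,9,10) by simp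
  qed
qed

section \<open>Stalk complexes and exactness\<close>

definition exact_at :: "('a, 'b) cochain_complex \<Rightarrow> int \<Rightarrow> bool" where
  "exact_at Y j \<longleftrightarrow> (\<forall>y\<in>carrier (obj Y j). dif Y j y = \<zero>\<^bsub>obj Y (j + 1)\<^esub> \<longrightarrow> (\<exists>z\<in>carrier (obj Y (j - 1)). y = dif Y (j - 1) z))"

text \<open>A complex needs a module in every degree; \<open>Z\<close> supplies the zero module in
  all degrees but one, with its single element drawn from the same type.\<close>

definition stalk :: "('a, 'b) module \<Rightarrow> ('a, 'b) module \<Rightarrow> ('a, 'b) cochain_complex" where
  "stalk N Z = (let ob = (\<lambda>i::int. if i = 0 then N else Z) in
     \<lparr>obj = ob, dif = (\<lambda>i. \<lambda>x\<in>carrier (ob i). \<zero>\<^bsub>ob (i + 1)\<^esub>)\<rparr>)"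

lemma stalk_simps [simp]:
  "obj (stalk N Z) i = (if i = 0 then N else Z)"
  "x \<in> carrier (obj (stalk N Z) i) \<Longrightarrow> dif (stalk N Z) i x = \<zero>\<^bsub>obj (stalk N Z) (i + 1)\<^esub>"
  by (simp_all add: stalk_def Let_def)

lemma stalk_cplx:
  assumes N: "lmod N" and Z: "lmod Z" shows "cplx (stalk N Z)"
proof (rule cplxI)
  have ob: "obj (stalk N Z) = (\<lambda>i. if i = 0 then N else Z)" by (auto simp: fun_eq_iff)
  show l: "lmod (obj (stalk N Z) i)" for i using assms by simp
  show "lin (obj (stalk N Z) i) (obj (stalk N Z) k) (dif (stalk N Z) i)" if "k = i + 1" for i k
  proof -
    have "dif (stalk N Z) i = (\<lambda>x\<in>carrier (obj (stalk N Z) i). \<zero>\<^bsub>obj (stalk N Z) k\<^esub>)"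
      using that by (simp add: stalk_def Let_def)
    then show ?thesis using lin_restrict[OF lin_const_zero[OF l] l] by simp
  qed
  show "dif (stalk N Z) i \<in> extensional (carrier (obj (stalk N Z) i))" for i by (simp add: stalk_def Let_def)
  fix i k m x assume a: "x \<in> carrier (obj (stalk N Z) i)" "k = i + 1" "m = i + 2"
  have "dif (stalk N Z) i x = \<zero>\<^bsub>obj (stalk N Z) k\<^esub>" using stalk_simps(2)[OF a(1)] a(2) by simp
  moreover have "\<zero>\<^bsub>obj (stalk N Z) k\<^esub> \<in> carrier (obj (stalk N Z) k)" using l by (rule lmod_simps(1))
  then have "dif (stalk N Z) k \<zero>\<^bsub>obj (stalk N Z) k\<^esub> = \<zero>\<^bsub>obj (stalk N Z) m\<^esub>"
    using stalk_simps(2)[of "\<zero>\<^bsub>obj (stalk N Z) k\<^esub>" N Z k] a by (simp add: add.assoc)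
  ultimately show "dif (stalk N Z) k (dif (stalk N Z) i x) = \<zero>\<^bsub>obj (stalk N Z) m\<^esub>" by simp
qed

text \<open>A cocycle \<open>y\<close> in degree \<open>j\<close> is the image of the generator
  under a map from the free module of rank one, and a null homotopy evaluated at the generator is a
  preimage of \<open>y\<close>. The first power stands in for the regular module to have elements of
  the type required in \<open>Kb_proj\<close>.\<close>

lemma orth_regular_exact:
  assumes Y: "cplx Y" and Z: "lmod Z" "carrier Z = {\<zero>\<^bsub>Z\<^esub>}"
    and o: "orth (stalk (direct_power (regular_module R) 1) Z) Y j"
  shows "exact_at Y j"
  unfolding exact_at_def
proof (intro ballI impI)
  fix y assume y: "y \<in> carrier (obj Y j)" "dif Y j y = \<zero>\<^bsub>obj Y (j + 1)\<^esub>"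
  let ?F = "direct_power (regular_module R) 1"
  note Y' = cplxD(1)[OF Y] and F = lmod_power[OF lmod_regular, of 1]
  define f where "f i u = (if i = 0 then u 0 \<odot>\<^bsub>obj Y j\<^esub> y else \<zero>\<^bsub>obj Y (i + j)\<^esub>)" for i :: int and u :: "nat \<Rightarrow> 'a"
  have d0: "dif Y i \<zero>\<^bsub>obj Y i\<^esub> = \<zero>\<^bsub>obj Y k\<^esub>" if "k = i + 1" for i k
    by (rule lin_zero[OF cplxD(2)[OF Y that] Y' Y'])
  have l0: "lin ?F (obj Y j) (\<lambda>u. u 0 \<odot>\<^bsub>obj Y j\<^esub> y)"
  proof (rule lin_cong[OF lin_comb_map[OF Y', of 1 "\<lambda>_. y"] _ F])
    fix u assume "u \<in> carrier ?F"
    then have "u 0 \<in> carrier R" by auto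
    then show "msum (obj Y j) (\<lambda>i. u i \<odot>\<^bsub>obj Y j\<^esub> y) 1 = u 0 \<odot>\<^bsub>obj Y j\<^esub> y" using y Y' by simp
  qed (rule y)
  have "cmap j (stalk ?F Z) Y f"
  proof (rule cmapI)
    show "lin (obj (stalk ?F Z) i) (obj Y k) (f i)" if "k = i + j" for i k
      using l0 lin_const_zero[OF Y'] that by (cases "i = 0") (simp_all add: f_def[abs_def])
    fix i k m x assume a: "x \<in> carrier (obj (stalk ?F Z) i)" "k = i + 1" "m = i + j"
    have "f k (dif (stalk ?F Z) i x) = \<zero>\<^bsub>obj Y (m + 1)\<^esub>"
    proof (cases "k = 0")
      case True
      then have "dif (stalk ?F Z) i x = \<zero>\<^bsub>?F\<^esub>" using a stalk_simps(2)[OF a(1)] by simp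
      moreover have "m + 1 = j" using a True by simp
      ultimately show ?thesis using True y Y' by (simp add: f_def)
    next
      case False
      have "k + j = m + 1" using a by simp
      then show ?thesis using False by (simp add: f_def)
    qed
    also have "\<dots> = dif Y m (f i x)"
    proof (cases "i = 0")
      case True
      then have x0: "x 0 \<in> carrier R" "m = j" using a by auto
      have "dif Y j (x 0 \<odot>\<^bsub>obj Y j\<^esub> y) = x 0 \<odot>\<^bsub>obj Y (j + 1)\<^esub> dif Y j y"
        by (rule linD(3)[OF cplxD(2)[OF Y refl] x0(1) y(1)])
      then show ?thesis using True x0 y Y' by (simp add: f_def)
    next
      case False
      then show ?thesis using d0[OF refl] a by (simp add: f_def)
    qed
    finally show "f k (dif (stalk ?F Z) i x) = dif Y m (f i x)" .
  qed
  then have "nullh j (stalk ?F Z) Y f" by (rule orthD[OF o])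
  then obtain h where h: "\<And>i k. k = i + j - 1 \<Longrightarrow> lin (obj (stalk ?F Z) i) (obj Y k) (h i)"
    "\<And>i k m p x. \<lbrakk>x \<in> carrier (obj (stalk ?F Z) i); m = i + j - 1; p = i + j; k = i + 1\<rbrakk> \<Longrightarrow>
      f i x = dif Y m (h i x) \<oplus>\<^bsub>obj Y p\<^esub> h k (dif (stalk ?F Z) i x)" by (rule nullhE) (rule that)
  define e where "e = unit_vec 1 0"
  have e: "e \<in> carrier (obj (stalk ?F Z) 0)" "e 0 = \<one>" by (auto simp: e_def unit_vec_def)
  have he: "h 0 e \<in> carrier (obj Y (j - 1))" by (rule linD(1)[OF h(1) e(1)]) simp
  have "h 1 \<zero>\<^bsub>Z\<^esub> = \<zero>\<^bsub>obj Y j\<^esub>" using lin_zero[OF h(1)[of j 1] _ Y'] Z by simp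
  moreover have "dif (stalk ?F Z) 0 e = \<zero>\<^bsub>Z\<^esub>" using stalk_simps(2)[OF e(1)] by simp
  ultimately have "f 0 e = dif Y (j - 1) (h 0 e)"
    using h(2)[OF e(1), of "j - 1" j 1] cplxD(3)[OF Y he, of j] Y' by simp
  then have "y = dif Y (j - 1) (h 0 e)" using e(2) y Y' by (simp add: f_def)
  then show "\<exists>z\<in>carrier (obj Y (j - 1)). y = dif Y (j - 1) z" using he by blast
qed

text \<open>The element type is fixed because statements quantify over all such complexes; other
  complexes are brought to this type by \<open>transport_complex\<close>.\<close>

definition fgc :: "('a, nat \<Rightarrow> 'a) cochain_complex \<Rightarrow> bool" where
  "fgc Y \<longleftrightarrow> cplx Y \<and> (\<forall>i. obj Y i \<in> fg_mod R)"

text \<open>The complexes \<open>X\<close> for which orthogonality to \<open>X\<close> follows, in large degrees, from orthogonality to \<open>T\<close> form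
  a triangulated subcategory containing \<open>T\<close>, hence they include the ring itself.\<close>

lemma silting_bound:
  assumes s: "silting R T"
  shows "\<exists>c\<ge>0. \<forall>Y. fgc Y \<and> (\<forall>j>0. orth T Y j) \<longrightarrow> (\<forall>j>c. exact_at Y j)"
proof -
  define P where "P X c \<longleftrightarrow> c \<ge> 0 \<and> (\<forall>Y. fgc Y \<and> (\<forall>j>0. orth T Y j) \<longrightarrow> (\<forall>j>c. orth X Y j))"
    for X :: "('a, nat \<Rightarrow> 'a) cochain_complex" and c :: int
  define C where "C = {X \<in> Kb_proj R. \<exists>c. P X c}"
  have TK: "T \<in> Kb_proj R" using s by (simp add: silting_def presilting_def)
  have Kc: "cplx X" if "X \<in> Kb_proj R" for X using that by (simp add: Kb_proj_def)
  have Yc: "cplx Y" if "fgc Y" for Y using that by (simp add: fgc_def)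
  have TP: "P T 0" by (simp add: P_def)
  have "triangulated_subcategory R C" unfolding triangulated_subcategory_def
  proof (intro conjI ballI allI impI)
    show "C \<subseteq> Kb_proj R" by (auto simp: C_def)
    show "C \<noteq> {}" using TK TP by (auto simp: C_def)
  next
    fix X Y assume X: "X \<in> C" and Y: "Y \<in> Kb_proj R" and k: "K_iso R Y X"
    obtain c where c: "P X c" "X \<in> Kb_proj R" using X by (auto simp: C_def)
    have "P Y c" unfolding P_def
      using c(1) orth_hret[OF Kc[OF Y] Kc[OF c(2)] Yc K_iso_hret(1)[OF Kc[OF Y] Kc[OF c(2)] k]]
      by (simp add: P_def)
    then show "Y \<in> C" using Y by (auto simp: C_def)
  next
    fix X s assume X: "X \<in> C"
    obtain c where c: "P X c" "X \<in> Kb_proj R" using X by (auto simp: C_def)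
    \<comment> \<open>Maps from the shift in degree \<open>j\<close> are maps from \<open>X\<close>
      in degree \<open>j - s\<close>; the absolute value also keeps the bound nonnegative.\<close>
    have "P (shift_complex X s) (c + \<bar>s\<bar>)" unfolding P_def
    proof (intro conjI allI impI)
      fix W j assume "fgc W \<and> (\<forall>j>0. orth T W j)" "c + \<bar>s\<bar> < j"
      then show "orth (shift_complex X s) W j"
        using c(1) unfolding P_def by (intro orth_shift[OF Kc[OF c(2)] Yc]) auto
    qed (use c in \<open>simp add: P_def\<close>)
    moreover have "shift_complex X s \<in> Kb_proj R"
    proof -
      have "{i. carrier (obj (shift_complex X s) i) \<noteq> {\<zero>\<^bsub>obj (shift_complex X s) i\<^esub>}}
        = (\<lambda>i. i - s) ` {i. carrier (obj X i) \<noteq> {\<zero>\<^bsub>obj X i\<^esub>}}" (is "?A = _ ` ?B")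
      proof (rule equalityI; rule subsetI)
        fix i assume "i \<in> ?A"
        then show "i \<in> (\<lambda>i. i - s) ` ?B" by (intro image_eqI[of _ _ "i + s"]) auto
      qed auto
      then show ?thesis using c(2) shift_cplx[OF Kc[OF c(2)]] by (simp add: Kb_proj_def)
    qed
    ultimately show "shift_complex X s \<in> C" by (auto simp: C_def)
  next
    fix X Y f Z assume X: "X \<in> C" and Y: "Y \<in> C" and f: "f \<in> chain_maps R X Y"
      and Z: "Z \<in> Kb_proj R" and k: "K_iso R Z (cone X Y f)"
    obtain c d where c: "P X c" "X \<in> Kb_proj R" "P Y d" "Y \<in> Kb_proj R" using X Y by (auto simp: C_def)
    have f': "cmap 0 X Y f" using f by (auto simp: chain_maps_def cmap_def mod_homD)
    have cc: "cplx (cone X Y f)" by (rule cone_cplx[OF Kc[OF c(2)] Kc[OF c(4)] f'])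
    \<comment> \<open>The cone asks for degree \<open>j - 1\<close> on \<open>X\<close> and degree
      \<open>j\<close> on \<open>Y\<close>. As both bounds are nonnegative,
      \<open>j > c + d + 1\<close> is enough for either.\<close>
    have "P Z (c + d + 1)" unfolding P_def
    proof (intro conjI allI impI)
      fix W j assume W: "fgc W \<and> (\<forall>j>0. orth T W j)" and j: "c + d + 1 < j"
      then have o: "orth X W (j - 1)" "orth Y W j" using c(1,3) unfolding P_def by auto
      show "orth Z W j"
        using W by (intro orth_hret[OF Kc[OF Z] cc Yc K_iso_hret(1)[OF Kc[OF Z] cc k]]
            orth_cone[OF Kc[OF c(2)] Kc[OF c(4)] f' Yc o]) auto
    qed (use c in \<open>auto simp: P_def\<close>)
    then show "Z \<in> C" using Z by (auto simp: C_def)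
  qed
  moreover have "K_add R T \<subseteq> C"
  proof
    fix X assume "X \<in> K_add R T"
    then obtain k Z where X: "X \<in> Kb_proj R" "Z \<in> Kb_proj R" "K_iso R (complex_sum X Z) (complex_power T k)"
      by (auto simp: K_add_def)
    note sc = sum_cplx[OF Kc[OF X(1)] Kc[OF X(2)]] and pc = power_cplx[OF Kc[OF TK], of k]
    have "P X 0" unfolding P_def
    proof (intro conjI allI impI)
      fix W j assume W: "fgc W \<and> (\<forall>j>0. orth T W j)" and j: "(0::int) < j"
      then have w: "cplx W" "orth T W j" using Yc by auto
      have "orth (complex_sum X Z) W j"
        by (rule orth_hret[OF sc pc w(1) K_iso_hret(1)[OF sc pc X(3)] orth_power[OF Kc[OF TK] w]])
      then show "orth X W j" by (rule orth_hret[OF Kc[OF X(1)] sc w(1) hret_sum[OF Kc[OF X(1)] Kc[OF X(2)]]])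
    qed simp
    then show "X \<in> C" using X by (auto simp: C_def)
  qed
  ultimately have "Kb_proj R \<subseteq> C" using s unfolding silting_def by blast
  \<comment> \<open>The ring as a complex in degree \<open>0\<close>; orthogonality to it means
    exactness.\<close>
  moreover define S where "S = stalk (direct_power (regular_module R) 1) (direct_power (regular_module R) 0)"
  have Z0: "lmod (direct_power (regular_module R) 0)" "carrier (direct_power (regular_module R) 0) = {\<zero>\<^bsub>direct_power (regular_module R) 0\<^esub>}"
    using lmod_power[OF lmod_regular] by auto
  have "S \<in> Kb_proj R"
  proof -
    have "{i. carrier (obj S i) \<noteq> {\<zero>\<^bsub>obj S i\<^esub>}} \<subseteq> {0}" using Z0(2) by (auto simp: S_def)
    then have "finite {i. carrier (obj S i) \<noteq> {\<zero>\<^bsub>obj S i\<^esub>}}" by (rule finite_subset) simp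
    then show ?thesis unfolding Kb_proj_def
      using stalk_cplx[OF lmod_power[OF lmod_regular] Z0(1)] power_fg_proj by (simp add: S_def)
  qed
  ultimately obtain c where c: "P S c" by (auto simp: C_def)
  show ?thesis
  proof (intro exI[of _ c] conjI allI impI)
    show "c \<ge> 0" using c by (simp add: P_def)
    fix Y j assume "fgc Y \<and> (\<forall>j>0. orth T Y j)" "c < j"
    then have "orth S Y j" "cplx Y" using c Yc by (auto simp: P_def)
    then show "exact_at Y j" unfolding S_def by (intro orth_regular_exact[OF _ Z0])
  qed
qed

end

section \<open>Approximations by a silting complex\<close>

text \<open>Up to signs the cone shifted by -1. As the differential of \<open>Y\<close> enters
  unchanged, the square of the differential vanishes when \<open>f\<close> anticommutes.\<close>

definition cocone ::
    "('a, 'b) cochain_complex \<Rightarrow> ('a, 'c) cochain_complex \<Rightarrow> (int \<Rightarrow> 'b \<Rightarrow> 'c) \<Rightarrow> ('a, 'b \<times> 'c) cochain_complex" where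
  "cocone A Y f =
     \<lparr>obj = (\<lambda>i. direct_sum (obj A i) (obj Y (i - 1))),
      dif = (\<lambda>i. \<lambda>u\<in>carrier (obj A i) \<times> carrier (obj Y (i - 1)).
        (dif A i (fst u), f i (fst u) \<oplus>\<^bsub>obj Y i\<^esub> dif Y (i - 1) (snd u)))\<rparr>"

context rng begin

lemma cocone_simps [simp]:
  "obj (cocone A Y f) i = direct_sum (obj A i) (obj Y (i - 1))"
  "\<lbrakk>x \<in> carrier (obj A i); y \<in> carrier (obj Y (i - 1))\<rbrakk> \<Longrightarrow> dif (cocone A Y f) i (x, y) =
     (dif A i x, f i x \<oplus>\<^bsub>obj Y i\<^esub> dif Y (i - 1) y)"
  by (simp_all add: cocone_def)

lemma cocone_cplx:
  assumes A: "cplx A" and Y: "cplx Y" and f: "anti 0 A Y f" shows "cplx (cocone A Y f)"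
proof (rule cplxI)
  note A' = cplxD(1)[OF A] and Y' = cplxD(1)[OF Y]
  have fl: "lin (obj A i) (obj Y i) (f i)" for i using antiD(1)[OF f, of i i] by simp
  show "lmod (obj (cocone A Y f) i)" for i using lmod_direct_sum[OF A' Y'] by simp
  show "dif (cocone A Y f) i \<in> extensional (carrier (obj (cocone A Y f) i))" for i by (simp add: cocone_def)
  show "lin (obj (cocone A Y f) i) (obj (cocone A Y f) k) (dif (cocone A Y f) i)" if k: "k = i + 1" for i k
  proof -
    have i: "k - 1 = i" using k by simp
    have d1: "lin (obj A i) (obj A k) (dif A i)" by (rule cplxD(2)[OF A k])
    have d2: "lin (obj Y (i - 1)) (obj Y i) (dif Y (i - 1))" by (rule cplxD(2)[OF Y]) simp
    show ?thesis
      by (rule linI)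
        (use A' Y' linD[OF d1] linD[OF d2] linD[OF fl] in \<open>auto simp: i smult_distr(2) lmod_ac\<close>)
  qed
  fix i k m u assume u: "u \<in> carrier (obj (cocone A Y f) i)" "k = i + 1" "m = i + 2"
  obtain x y where xy: "u = (x, y)" "x \<in> carrier (obj A i)" "y \<in> carrier (obj Y (i - 1))" using u by auto
  have i: "k - 1 = i" "m = k + 1" using u by auto
  have dx: "dif A i x \<in> carrier (obj A k)" by (rule cplxD(3)[OF A xy(2) u(2)])
  have dy: "dif Y (i - 1) y \<in> carrier (obj Y i)" by (rule cplxD(3)[OF Y xy(3)]) simp
  have fx: "f i x \<in> carrier (obj Y i)" by (rule linD(1)[OF fl xy(2)])
  have dfx: "dif Y i (f i x) \<in> carrier (obj Y k)" by (rule cplxD(3)[OF Y fx u(2)])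
  have s: "f i x \<oplus>\<^bsub>obj Y i\<^esub> dif Y (i - 1) y \<in> carrier (obj Y (k - 1))" using fx dy Y' by (simp add: i)
  have fd: "f k (dif A i x) = \<ominus>\<^bsub>obj Y k\<^esub> dif Y i (f i x)" by (rule antiD(3)[OF f xy(2) u(2)]) (use u in auto)
  have da: "dif Y i (f i x \<oplus>\<^bsub>obj Y i\<^esub> dif Y (i - 1) y) = dif Y i (f i x) \<oplus>\<^bsub>obj Y k\<^esub> dif Y i (dif Y (i - 1) y)"
    by (rule linD(2)[OF cplxD(2)[OF Y u(2)] fx dy])
  have ddy: "dif Y i (dif Y (i - 1) y) = \<zero>\<^bsub>obj Y k\<^esub>" by (rule cplxD(4)[OF Y xy(3)]) (use u in auto)
  have ddx: "dif A k (dif A i x) = \<zero>\<^bsub>obj A m\<^esub>" by (rule cplxD(4)[OF A xy(2) u(2,3)])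
  show "dif (cocone A Y f) k (dif (cocone A Y f) i u) = \<zero>\<^bsub>obj (cocone A Y f) m\<^esub>"
    unfolding xy(1) cocone_simps(2)[OF xy(2,3)] cocone_simps(2)[OF dx s]
    using fd da ddy ddx dfx Y' by (simp add: i)
qed

text \<open>Exactness of the morphisms from \<open>T\<close> into a triangle: a map into the cocone
  is contractible if its component in \<open>A\<close> is, and if each map of degree
  \<open>j - 1\<close> into \<open>Y\<close> factors through \<open>f\<close> up to homotopy. The
  hypothesis \<open>app\<close> spells out such a factorisation, with \<open>m\<close> anticommuting
  and \<open>k\<close> the homotopy.\<close>

lemma orth_cocone:
  assumes T: "cplx T" and A: "cplx A" and Y: "cplx Y" and f: "anti 0 A Y f" and oA: "orth T A j"
    and app: "\<And>v. cmap (j - 1) T Y v \<Longrightarrow> \<exists>m k. (\<forall>i q. q = i + (j - 1) \<longrightarrow> lin (obj T i) (obj A q) (m i)) \<and>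
      (\<forall>i q p r x. x \<in> carrier (obj T i) \<and> q = i + 1 \<and> p = i + (j - 1) \<and> r = i + j \<longrightarrow>
        m q (dif T i x) = \<ominus>\<^bsub>obj A r\<^esub> dif A p (m i x)) \<and>
      (\<forall>i q. q = i + (j - 2) \<longrightarrow> lin (obj T i) (obj Y q) (k i)) \<and>
      (\<forall>i q p r x. x \<in> carrier (obj T i) \<and> q = i + 1 \<and> p = i + (j - 1) \<and> r = i + (j - 2) \<longrightarrow>
        v i x = f p (m i x) \<oplus>\<^bsub>obj Y p\<^esub> (dif Y r (k i x) \<oplus>\<^bsub>obj Y p\<^esub> k q (dif T i x)))"
  shows "orth T (cocone A Y f) j"
  unfolding orth_def
proof (intro allI impI)
  fix u assume u: "cmap j T (cocone A Y f) u"
  note T' = cplxD(1)[OF T] and A' = cplxD(1)[OF A] and Y' = cplxD(1)[OF Y]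
  have fl: "lin (obj A i) (obj Y i) (f i)" for i using antiD(1)[OF f, of i i] by simp
  have ul: "lin (obj T i) (direct_sum (obj A p) (obj Y q)) (u i)" if "p = i + j" "q = i + (j - 1)" for i p q
  proof -
    have "p - 1 = q" using that by simp
    then show ?thesis using cmapD(1)[OF u that(1)] by simp
  qed
  have uc: "fst (u i x) \<in> carrier (obj A p)" "snd (u i x) \<in> carrier (obj Y q)"
    if "x \<in> carrier (obj T i)" "p = i + j" "q = i + (j - 1)" for i p q x
    using linD(1)[OF ul[OF that(2,3)] that(1)] by auto
  have fsl: "lin (obj T i) (obj A p) (\<lambda>x. fst (u i x))" if "p = i + j" for i p
    by (rule lin_comp[OF ul[OF that refl]]) (auto intro!: linI)
  have sndl: "lin (obj T i) (obj Y q) (\<lambda>x. snd (u i x))" if "q = i + (j - 1)" for i q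
    by (rule lin_comp[OF ul[OF refl that]]) (auto intro!: linI)
  have ud: "fst (u k (dif T i x)) = dif A p (fst (u i x))"
    "snd (u k (dif T i x)) = f p (fst (u i x)) \<oplus>\<^bsub>obj Y p\<^esub> dif Y q (snd (u i x))"
    if "x \<in> carrier (obj T i)" "k = i + 1" "p = i + j" "q = i + (j - 1)" for i k p q x
  proof -
    have q: "p - 1 = q" using that by simp
    have "u k (dif T i x) = dif (cocone A Y f) p (fst (u i x), snd (u i x))"
      using cmapD(3)[OF u that(1-3)] by simp
    also have "\<dots> = (dif A p (fst (u i x)), f p (fst (u i x)) \<oplus>\<^bsub>obj Y p\<^esub> dif Y q (snd (u i x)))"
      using cocone_simps(2)[of "fst (u i x)" A p "snd (u i x)" Y f] uc[OF that(1,3,4)] by (simp add: q)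
    finally show "fst (u k (dif T i x)) = dif A p (fst (u i x))"
      "snd (u k (dif T i x)) = f p (fst (u i x)) \<oplus>\<^bsub>obj Y p\<^esub> dif Y q (snd (u i x))" by simp_all
  qed
  have "cmap j T A (\<lambda>i x. fst (u i x))"
    by (rule cmapI[OF fsl]) (use ud(1) in auto)
  then have "nullh j T A (\<lambda>i x. fst (u i x))" by (rule orthD[OF oA])
  then obtain h where h: "\<And>i k. k = i + j - 1 \<Longrightarrow> lin (obj T i) (obj A k) (h i)"
    "\<And>i k m p x. \<lbrakk>x \<in> carrier (obj T i); m = i + j - 1; p = i + j; k = i + 1\<rbrakk> \<Longrightarrow>
      fst (u i x) = dif A m (h i x) \<oplus>\<^bsub>obj A p\<^esub> h k (dif T i x)" by (rule nullhE) (rule that)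
  \<comment> \<open>The second component of \<open>u\<close>, corrected by the contraction
    \<open>h\<close> of the first; only with this correction does it commute with the
    differentials.\<close>
  define v where "v i x = snd (u i x) \<ominus>\<^bsub>obj Y (i + (j - 1))\<^esub> f (i + (j - 1)) (h i x)" for i x
  have fhl: "lin (obj T i) (obj Y q) (\<lambda>x. f q (h i x))" if "q = i + (j - 1)" for i q
    by (rule lin_comp[OF h(1) fl]) (use that in simp)
  have vl: "lin (obj T i) (obj Y q) (v i)" if "q = i + (j - 1)" for i q
    unfolding v_def[abs_def] that by (rule lin_sub[OF sndl[OF refl] fhl[OF refl] Y'])
  have "cmap (j - 1) T Y v"
  proof (rule cmapI[OF vl])
    fix i k q x assume a: "x \<in> carrier (obj T i)" "k = i + 1" "q = i + (j - 1)"
    define p where "p = i + j"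
    have p: "k + (j - 1) = p" "i + (j - 1) = q" "q = i + j - 1" "p = q + 1" "p = k + j - 1" using a p_def by auto
    have dx: "dif T i x \<in> carrier (obj T k)" by (rule cplxD(3)[OF T a(1,2)])
    have hx: "h i x \<in> carrier (obj A q)" by (rule linD(1)[OF h(1)[OF p(3)] a(1)])
    have hdx: "h k (dif T i x) \<in> carrier (obj A p)" by (rule linD(1)[OF h(1)[OF p(5)] dx])
    have dhx: "dif A q (h i x) \<in> carrier (obj A p)" by (rule cplxD(3)[OF A hx p(4)])
    have fhx: "f q (h i x) \<in> carrier (obj Y q)" by (rule linD(1)[OF fl hx])
    have dl: "lin (obj Y q) (obj Y p) (dif Y q)" by (rule cplxD(2)[OF Y p(4)])
    note sx = uc(2)[OF a(1) p_def a(3)]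
    note c = linD(1)[OF dl fhx] linD(1)[OF fl hdx] linD(1)[OF dl sx]
    have 1: "f p (fst (u i x)) = \<ominus>\<^bsub>obj Y p\<^esub> dif Y q (f q (h i x)) \<oplus>\<^bsub>obj Y p\<^esub> f p (h k (dif T i x))"
      unfolding h(2)[OF a(1) p(3) p_def a(2)] linD(2)[OF fl dhx hdx]
      using antiD(3)[OF f hx p(4), of q p] p(4) by simp
    have "v k (dif T i x) = snd (u k (dif T i x)) \<ominus>\<^bsub>obj Y p\<^esub> f p (h k (dif T i x))" by (simp add: v_def p(1))
    also have "\<dots> = dif Y q (snd (u i x)) \<ominus>\<^bsub>obj Y p\<^esub> dif Y q (f q (h i x))"
      unfolding ud(2)[OF a(1,2) p_def a(3)] 1 using c Y'
      by (subst diff_eq_iff[OF Y']) (simp_all add: a_minus_def lmod_ac)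
    also have "\<dots> = dif Y q (v i x)" unfolding v_def p(2) by (rule lin_diff[OF dl Y' Y' sx fhx, symmetric])
    finally show "v k (dif T i x) = dif Y q (v i x)" .
  qed
  from app[OF this] obtain m k where mk:
    "(\<forall>i q. q = i + (j - 1) \<longrightarrow> lin (obj T i) (obj A q) (m i))"
    "(\<forall>i q p r x. x \<in> carrier (obj T i) \<and> q = i + 1 \<and> p = i + (j - 1) \<and> r = i + j \<longrightarrow>
        m q (dif T i x) = \<ominus>\<^bsub>obj A r\<^esub> dif A p (m i x))"
    "(\<forall>i q. q = i + (j - 2) \<longrightarrow> lin (obj T i) (obj Y q) (k i))"
    "(\<forall>i q p r x. x \<in> carrier (obj T i) \<and> q = i + 1 \<and> p = i + (j - 1) \<and> r = i + (j - 2) \<longrightarrow>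
        v i x = f p (m i x) \<oplus>\<^bsub>obj Y p\<^esub> (dif Y r (k i x) \<oplus>\<^bsub>obj Y p\<^esub> k q (dif T i x)))"
    by (elim exE conjE) (rule that)
  have ml: "\<And>i q. q = i + (j - 1) \<Longrightarrow> lin (obj T i) (obj A q) (m i)"
    and md: "\<And>i q p r x. \<lbrakk>x \<in> carrier (obj T i); q = i + 1; p = i + (j - 1); r = i + j\<rbrakk> \<Longrightarrow>
        m q (dif T i x) = \<ominus>\<^bsub>obj A r\<^esub> dif A p (m i x)"
    and kl: "\<And>i q. q = i + (j - 2) \<Longrightarrow> lin (obj T i) (obj Y q) (k i)"
    and vk: "\<And>i q p r x. \<lbrakk>x \<in> carrier (obj T i); q = i + 1; p = i + (j - 1); r = i + (j - 2)\<rbrakk> \<Longrightarrow>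
        v i x = f p (m i x) \<oplus>\<^bsub>obj Y p\<^esub> (dif Y r (k i x) \<oplus>\<^bsub>obj Y p\<^esub> k q (dif T i x))"
    using mk by simp_all
  have hl: "\<And>i k. k = i + (j - 1) \<Longrightarrow> lin (obj T i) (obj A k) (h i)" by (rule h(1)) simp
  show "nullh j T (cocone A Y f) u"
  proof (rule nullhI)
    fix i q assume q: "q = i + j - 1"
    have l1: "lin (obj T i) (obj A q) (\<lambda>x. h i x \<oplus>\<^bsub>obj A q\<^esub> m i x)"
      by (rule lin_add[OF hl ml A']) (use q in auto)
    have l2: "lin (obj T i) (obj Y (q - 1)) (k i)" by (rule kl) (use q in auto)
    \<comment> \<open>As \<open>m\<close> anticommutes, adding it to \<open>h\<close> leaves the
      boundary unchanged in the component of \<open>A\<close>, while in the component of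
      \<open>Y\<close> it produces the missing term \<open>f m\<close>.\<close>
    show "lin (obj T i) (obj (cocone A Y f) q) (\<lambda>x. (h i x \<oplus>\<^bsub>obj A (i + j - 1)\<^esub> m i x, k i x))"
      unfolding q[symmetric] using linD[OF l1] linD[OF l2] by (intro linI) auto
  next
    fix i q p r x assume a: "x \<in> carrier (obj T i)" "p = i + j - 1" "r = i + j" "q = i + 1"
    define t where "t = i + (j - 2)"
    have i: "p = i + (j - 1)" "p - 1 = t" "r = p + 1" "r = q + (j - 1)" "p = q + (j - 2)" "i + j - 1 = p" "q + j - 1 = r" "i + j = r" "p = t + 1" "r - 1 = p" "p + 1 = r"
      using a t_def by auto
    have dx: "dif T i x \<in> carrier (obj T q)" by (rule cplxD(3)[OF T a(1,4)])
    have hx: "h i x \<in> carrier (obj A p)" by (rule linD(1)[OF hl[OF i(1)] a(1)])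
    have hdx: "h q (dif T i x) \<in> carrier (obj A r)" by (rule linD(1)[OF hl[OF i(4)] dx])
    have mx: "m i x \<in> carrier (obj A p)" by (rule linD(1)[OF ml[OF i(1)] a(1)])
    have mdx: "m q (dif T i x) = \<ominus>\<^bsub>obj A r\<^esub> dif A p (m i x)" by (rule md[OF a(1,4) i(1) a(3)])
    have kx: "k i x \<in> carrier (obj Y t)" by (rule linD(1)[OF kl[OF t_def] a(1)])
    have kdx: "k q (dif T i x) \<in> carrier (obj Y p)" by (rule linD(1)[OF kl[OF i(5)] dx])
    have dA: "lin (obj A p) (obj A r) (dif A p)" by (rule cplxD(2)[OF A i(3)])
    have dY: "lin (obj Y t) (obj Y p) (dif Y t)" by (rule cplxD(2)[OF Y i(9)])
    note c = linD(1)[OF dA hx] linD(1)[OF dA mx] linD(1)[OF dY kx] linD(1)[OF fl hx] linD(1)[OF fl mx] hdx kdx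
    have e1: "fst (u i x) = dif A p (h i x) \<oplus>\<^bsub>obj A r\<^esub> h q (dif T i x)" by (rule h(2)[OF a])
    have sx: "snd (u i x) \<in> carrier (obj Y p)" by (rule uc(2)[OF a(1,3) i(1)])
    have vx: "v i x \<in> carrier (obj Y p)" by (rule linD(1)[OF vl[OF i(1)] a(1)])
    have e2: "snd (u i x) = v i x \<oplus>\<^bsub>obj Y p\<^esub> f p (h i x)"
      using diff_eq_iff[OF Y' sx c(4) vx] unfolding v_def i(1)[symmetric] by simp
    have s1: "h i x \<oplus>\<^bsub>obj A p\<^esub> m i x \<in> carrier (obj A p)" using hx mx A' by simp
    have kx': "k i x \<in> carrier (obj Y (p - 1))" using kx i by simp
    have d: "dif (cocone A Y f) p (h i x \<oplus>\<^bsub>obj A p\<^esub> m i x, k i x) =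
      (dif A p (h i x) \<oplus>\<^bsub>obj A r\<^esub> dif A p (m i x), (f p (h i x) \<oplus>\<^bsub>obj Y p\<^esub> f p (m i x)) \<oplus>\<^bsub>obj Y p\<^esub> dif Y t (k i x))"
      unfolding cocone_simps(2)[OF s1 kx'] linD(2)[OF dA hx mx] linD(2)[OF fl hx mx] i(2) ..
    have "u i x = (fst (u i x), snd (u i x))" by simp
    also have "\<dots> = dif (cocone A Y f) p (h i x \<oplus>\<^bsub>obj A p\<^esub> m i x, k i x) \<oplus>\<^bsub>obj (cocone A Y f) r\<^esub>
        (h q (dif T i x) \<oplus>\<^bsub>obj A r\<^esub> m q (dif T i x), k q (dif T i x))"
      unfolding d e1 e2 vk[OF a(1,4) i(1) t_def] mdx
      using c A' Y' by (simp add: i(10) lmod_ac)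
    finally show "u i x = dif (cocone A Y f) p (h i x \<oplus>\<^bsub>obj A (i + j - 1)\<^esub> m i x, k i x) \<oplus>\<^bsub>obj (cocone A Y f) r\<^esub>
        (h q (dif T i x) \<oplus>\<^bsub>obj A (q + j - 1)\<^esub> m q (dif T i x), k q (dif T i x))" unfolding i(6,7) .
  qed
qed

text \<open>The pair with entries zero and \<open>y\<close> is a cocycle of the cocone one degree
  higher; if it is the boundary of the pair of \<open>t\<close> and \<open>z\<close>, the second
  entry reads off the decomposition of \<open>y\<close>.\<close>

lemma exact_cocone:
  assumes A: "cplx A" and Y: "cplx Y" and f: "anti 0 A Y f" and e: "exact_at (cocone A Y f) (j + 1)"
    and y: "y \<in> carrier (obj Y j)" "dif Y j y = \<zero>\<^bsub>obj Y (j + 1)\<^esub>"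
  shows "\<exists>t\<in>carrier (obj A j). \<exists>z\<in>carrier (obj Y (j - 1)). y = f j t \<oplus>\<^bsub>obj Y j\<^esub> dif Y (j - 1) z"
proof -
  note A' = cplxD(1)[OF A] and Y' = cplxD(1)[OF Y]
  have fl: "lin (obj A i) (obj Y i) (f i)" for i using antiD(1)[OF f, of i i] by simp
  have z: "\<zero>\<^bsub>obj A (j + 1)\<^esub> \<in> carrier (obj A (j + 1))" "y \<in> carrier (obj Y (j + 1 - 1))" using A' y by auto
  have d0: "dif A (j + 1) \<zero>\<^bsub>obj A (j + 1)\<^esub> = \<zero>\<^bsub>obj A (j + 1 + 1)\<^esub>" by (rule lin_zero[OF cplxD(2)[OF A refl] A' A'])
  have f0: "f (j + 1) \<zero>\<^bsub>obj A (j + 1)\<^esub> = \<zero>\<^bsub>obj Y (j + 1)\<^esub>" by (rule lin_zero[OF fl A' Y'])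
  have "dif (cocone A Y f) (j + 1) (\<zero>\<^bsub>obj A (j + 1)\<^esub>, y) = \<zero>\<^bsub>obj (cocone A Y f) (j + 1 + 1)\<^esub>"
    unfolding cocone_simps(2)[OF z] using d0 f0 y Y' by (simp add: add.commute)
  moreover have "(\<zero>\<^bsub>obj A (j + 1)\<^esub>, y) \<in> carrier (obj (cocone A Y f) (j + 1))" using z by simp
  ultimately obtain w where w: "w \<in> carrier (obj (cocone A Y f) (j + 1 - 1))"
    "(\<zero>\<^bsub>obj A (j + 1)\<^esub>, y) = dif (cocone A Y f) (j + 1 - 1) w"
    using e unfolding exact_at_def by blast
  then obtain t z where tz: "w = (t, z)" "t \<in> carrier (obj A j)" "z \<in> carrier (obj Y (j - 1))" by auto
  show ?thesis using w(2) cocone_simps(2)[OF tz(2,3), of f] tz by auto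
qed

lemma orth_power_right:
  assumes X: "cplx X" and W: "cplx W" and o: "orth X W j" shows "orth X (complex_power W k) j"
  unfolding orth_def
proof (intro allI impI)
  fix u assume u: "cmap j X (complex_power W k) u"
  note X' = cplxD(1)[OF X] and W' = cplxD(1)[OF W]
  have ul: "lin (obj X i) (direct_power (obj W m) k) (u i)" if "m = i + j" for i m using cmapD(1)[OF u that] by simp
  have uc: "u i x \<in> carrier (direct_power (obj W m) k)" if "m = i + j" "x \<in> carrier (obj X i)" for i m x
    by (rule linD(1)[OF ul[OF that(1)] that(2)])
  define Q where "Q l h \<longleftrightarrow> (\<forall>i m. m = i + j - 1 \<longrightarrow> lin (obj X i) (obj W m) (h i)) \<and>
      (\<forall>i q m p x. x \<in> carrier (obj X i) \<and> m = i + j - 1 \<and> p = i + j \<and> q = i + 1 \<longrightarrow>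
        u i x l = dif W m (h i x) \<oplus>\<^bsub>obj W p\<^esub> h q (dif X i x))" for l h
  have "\<exists>h. l < k \<longrightarrow> Q l h" for l
  proof (cases "l < k")
    case True
    have "cmap j X W (\<lambda>i x. u i x l)"
    proof (rule cmapI)
      show "lin (obj X i) (obj W m) (\<lambda>x. u i x l)" if "m = i + j" for i m
        by (rule lin_comp[OF ul[OF that] proj_lin[OF True]])
      fix i q m x assume a: "x \<in> carrier (obj X i)" "q = i + 1" "m = i + j"
      show "u q (dif X i x) l = dif W m (u i x l)"
        using cmapD(3)[OF u a] power_simps(2)[of "u i x" k W m] uc[OF a(3,1)] True by simp
    qed
    then have "nullh j X W (\<lambda>i x. u i x l)" by (rule orthD[OF o])
    then obtain h where "\<And>i k. k = i + j - 1 \<Longrightarrow> lin (obj X i) (obj W k) (h i)"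
      "\<And>i q m p x. \<lbrakk>x \<in> carrier (obj X i); m = i + j - 1; p = i + j; q = i + 1\<rbrakk> \<Longrightarrow>
        u i x l = dif W m (h i x) \<oplus>\<^bsub>obj W p\<^esub> h q (dif X i x)" by (rule nullhE) (rule that)
    then show ?thesis unfolding Q_def by (intro exI[of _ h]) auto
  qed simp
  then obtain h where h': "\<And>l. l < k \<Longrightarrow> Q l (h l)" by metis
  have h: "\<And>l i m. l < k \<Longrightarrow> m = i + j - 1 \<Longrightarrow> lin (obj X i) (obj W m) (h l i)"
    "\<And>l i q m p x. \<lbrakk>l < k; x \<in> carrier (obj X i); m = i + j - 1; p = i + j; q = i + 1\<rbrakk> \<Longrightarrow>
        u i x l = dif W m (h l i x) \<oplus>\<^bsub>obj W p\<^esub> h l q (dif X i x)"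
    using h' by (simp_all add: Q_def)
  show "nullh j X (complex_power W k) u"
  proof (rule nullhI)
    show "lin (obj X i) (obj (complex_power W k) m) (\<lambda>x. \<lambda>l\<in>{..<k}. h l i x)" if m: "m = i + j - 1" for i m
    proof (rule linI)
      fix x assume x: "x \<in> carrier (obj X i)"
      show "(\<lambda>l\<in>{..<k}. h l i x) \<in> carrier (obj (complex_power W k) m)"
        using linD(1)[OF h(1)[OF _ m] x] by simp
      show "(\<lambda>l\<in>{..<k}. h l i (x \<oplus>\<^bsub>obj X i\<^esub> y)) = (\<lambda>l\<in>{..<k}. h l i x) \<oplus>\<^bsub>obj (complex_power W k) m\<^esub> (\<lambda>l\<in>{..<k}. h l i y)"
        if y: "y \<in> carrier (obj X i)" for y
        using linD(2)[OF h(1)[OF _ m] x y] by (auto intro!: restrict_ext)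
      show "(\<lambda>l\<in>{..<k}. h l i (a \<odot>\<^bsub>obj X i\<^esub> x)) = a \<odot>\<^bsub>obj (complex_power W k) m\<^esub> (\<lambda>l\<in>{..<k}. h l i x)"
        if a: "a \<in> carrier R" for a
        using linD(3)[OF h(1)[OF _ m] a x] by (auto intro!: restrict_ext)
    qed
    fix i q m p x assume a: "x \<in> carrier (obj X i)" "m = i + j - 1" "p = i + j" "q = i + 1"
    have hc: "(\<lambda>l\<in>{..<k}. h l i x) \<in> {..<k} \<rightarrow>\<^sub>E carrier (obj W m)" using linD(1)[OF h(1)[OF _ a(2)] a(1)] by simp
    have "u i x = (\<lambda>l\<in>{..<k}. u i x l)" using uc[OF a(3,1)] by (simp add: PiE_def extensional_restrict)
    also have "\<dots> = (\<lambda>l\<in>{..<k}. dif W m (h l i x) \<oplus>\<^bsub>obj W p\<^esub> h l q (dif X i x))"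
      using h(2)[OF _ a] by (intro restrict_ext) simp
    finally show "u i x = dif (complex_power W k) m (\<lambda>l\<in>{..<k}. h l i x) \<oplus>\<^bsub>obj (complex_power W k) p\<^esub> (\<lambda>l\<in>{..<k}. h l q (dif X i x))"
      unfolding power_simps(2)[OF hc] by (simp cong: restrict_cong)
  qed
qed

section \<open>Isomorphic complexes and change of element type\<close>

definition ciso :: "('a, 'b) cochain_complex \<Rightarrow> ('a, 'c) cochain_complex \<Rightarrow> (int \<Rightarrow> 'b \<Rightarrow> 'c) \<Rightarrow> bool" where
  "ciso Y Y' e \<longleftrightarrow> cmap 0 Y Y' e \<and> (\<forall>i. bij_betw (e i) (carrier (obj Y i)) (carrier (obj Y' i)))"

lemma ciso_orth:
  assumes X: "cplx X" and Y: "cplx Y" and Y': "cplx Y'" and e: "ciso Y Y' e" and o: "orth X Y j"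
  shows "orth X Y' j"
  unfolding orth_def
proof (intro allI impI)
  fix u assume u: "cmap j X Y' u"
  note Yl = cplxD(1)[OF Y] and Yl' = cplxD(1)[OF Y']
  define g where "g i = inv_into (carrier (obj Y i)) (e i)" for i
  have ec: "cmap 0 Y Y' e" and eb: "bij_betw (e i) (carrier (obj Y i)) (carrier (obj Y' i))" for i
    using e by (auto simp: ciso_def)
  have el: "lin (obj Y i) (obj Y' i) (e i)" for i using cmapD(1)[OF ec, of i i] by simp
  have gl: "lin (obj Y' i) (obj Y i) (g i)" for i unfolding g_def by (rule lin_inverse[OF el eb Yl Yl'])
  have eg: "e i (g i y) = y" if "y \<in> carrier (obj Y' i)" for i y
    unfolding g_def using eb[of i] that by (simp add: bij_betw_def f_inv_into_f)
  have ge: "g i (e i y) = y" if "y \<in> carrier (obj Y i)" for i y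
    unfolding g_def using eb[of i] that by (simp add: bij_betw_def)
  have "cmap j X Y (\<lambda>i x. g (i + j) (u i x))"
  proof (rule cmapI)
    show "lin (obj X i) (obj Y k) (\<lambda>x. g (i + j) (u i x))" if "k = i + j" for i k
      unfolding that by (rule lin_comp[OF cmapD(1)[OF u refl] gl])
    fix i k m x assume a: "x \<in> carrier (obj X i)" "k = i + 1" "m = i + j"
    define p where "p = m + 1"
    have p: "k + j = p" "i + j = m" using a p_def by auto
    have ux: "u i x \<in> carrier (obj Y' m)" by (rule cmapD(2)[OF u a(1,3)])
    have gu: "g m (u i x) \<in> carrier (obj Y m)" by (rule linD(1)[OF gl ux])
    have dg: "dif Y m (g m (u i x)) \<in> carrier (obj Y p)" by (rule cplxD(3)[OF Y gu p_def])
    have "u k (dif X i x) = dif Y' m (e m (g m (u i x)))" using cmapD(3)[OF u a] eg[OF ux] by simp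
    also have "\<dots> = e p (dif Y m (g m (u i x)))" using cmapD(3)[OF ec gu p_def, of m] by simp
    finally show "g (k + j) (u k (dif X i x)) = dif Y m (g (i + j) (u i x))" unfolding p using ge[OF dg] by simp
  qed
  then have "nullh j X Y (\<lambda>i x. g (i + j) (u i x))" by (rule orthD[OF o])
  then obtain h where h: "\<And>i k. k = i + j - 1 \<Longrightarrow> lin (obj X i) (obj Y k) (h i)"
    "\<And>i k m p x. \<lbrakk>x \<in> carrier (obj X i); m = i + j - 1; p = i + j; k = i + 1\<rbrakk> \<Longrightarrow>
      g (i + j) (u i x) = dif Y m (h i x) \<oplus>\<^bsub>obj Y p\<^esub> h k (dif X i x)" by (rule nullhE) (rule that)
  show "nullh j X Y' u"
  proof (rule nullhI)
    show "lin (obj X i) (obj Y' k) (\<lambda>x. e (i + j - 1) (h i x))" if "k = i + j - 1" for i k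
      unfolding that by (rule lin_comp[OF h(1)[OF refl] el])
    fix i k m p x assume a: "x \<in> carrier (obj X i)" "m = i + j - 1" "p = i + j" "k = i + 1"
    have i: "i + j - 1 = m" "k + j - 1 = p" "p = m + 1" "i + j = p" "p = k + j - 1" using a by auto
    have hx: "h i x \<in> carrier (obj Y m)" by (rule linD(1)[OF h(1)[OF a(2)] a(1)])
    have hd: "h k (dif X i x) \<in> carrier (obj Y p)" by (rule linD(1)[OF h(1)[OF i(5)] cplxD(3)[OF X a(1,4)]])
    have "u i x = e p (g p (u i x))" using eg[OF cmapD(2)[OF u a(1,3)]] by simp
    also have "\<dots> = e p (dif Y m (h i x) \<oplus>\<^bsub>obj Y p\<^esub> h k (dif X i x))" using h(2)[OF a] i(4) by simp
    also have "\<dots> = e p (dif Y m (h i x)) \<oplus>\<^bsub>obj Y' p\<^esub> e p (h k (dif X i x))"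
      by (rule linD(2)[OF el cplxD(3)[OF Y hx i(3)] hd])
    also have "e p (dif Y m (h i x)) = dif Y' m (e m (h i x))" using cmapD(3)[OF ec hx i(3), of m] by simp
    finally show "u i x = dif Y' m (e (i + j - 1) (h i x)) \<oplus>\<^bsub>obj Y' p\<^esub> e (k + j - 1) (h k (dif X i x))"
      unfolding i(1,2) .
  qed
qed

lemma ciso_exact:
  assumes Y: "cplx Y" and Y': "cplx Y'" and e: "ciso Y Y' e" and x: "exact_at Y' j"
  shows "exact_at Y j"
  unfolding exact_at_def
proof (intro ballI impI)
  fix y assume y: "y \<in> carrier (obj Y j)" "dif Y j y = \<zero>\<^bsub>obj Y (j + 1)\<^esub>"
  note Yl = cplxD(1)[OF Y] and Yl' = cplxD(1)[OF Y']
  have ec: "cmap 0 Y Y' e" and eb: "bij_betw (e i) (carrier (obj Y i)) (carrier (obj Y' i))" for i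
    using e by (auto simp: ciso_def)
  have el: "lin (obj Y i) (obj Y' i) (e i)" for i using cmapD(1)[OF ec, of i i] by simp
  have "dif Y' j (e j y) = e (j + 1) (dif Y j y)" using cmapD(3)[OF ec y(1) refl, of j] by simp
  also have "\<dots> = \<zero>\<^bsub>obj Y' (j + 1)\<^esub>" unfolding y(2) by (rule lin_zero[OF el Yl Yl'])
  finally obtain z where z: "z \<in> carrier (obj Y' (j - 1))" "e j y = dif Y' (j - 1) z"
    using x linD(1)[OF el y(1)] unfolding exact_at_def by blast
  obtain w where w: "w \<in> carrier (obj Y (j - 1))" "z = e (j - 1) w"
    using eb[of "j - 1"] z(1) by (metis bij_betw_imp_surj_on imageE)
  have dw: "dif Y (j - 1) w \<in> carrier (obj Y j)" by (rule cplxD(3)[OF Y w(1)]) simp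
  have "e j y = e j (dif Y (j - 1) w)" using z(2) w(2) cmapD(3)[OF ec w(1), of j "j - 1"] by simp
  then have "y = dif Y (j - 1) w" using eb[of j] y(1) dw by (auto simp: bij_betw_def dest: inj_onD)
  then show "\<exists>z\<in>carrier (obj Y (j - 1)). y = dif Y (j - 1) z" using w(1) by blast
qed

text \<open>A cocone has elements of a product type. Moving it back to functions on
  \<open>nat\<close> allows the construction to be repeated within one class of complexes.\<close>

lemma transport_complex:
  fixes Y :: "('a, 'y) cochain_complex"
  assumes Y: "cplx Y" and fg: "\<And>i. obj Y i \<in> fg_mod R"
  obtains Y' e where "fgc Y'" "ciso Y Y' e"
proof -
  note Yl = cplxD(1)[OF Y]
  have "\<exists>e :: 'y \<Rightarrow> nat \<Rightarrow> 'a. inj_on e (carrier (obj Y i))" for i using fg_transport[OF fg] by metis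
  then obtain e :: "int \<Rightarrow> 'y \<Rightarrow> nat \<Rightarrow> 'a" where e: "\<And>i. inj_on (e i) (carrier (obj Y i))" by metis
  note T = transport[OF Yl e]
  define g where "g i = inv_into (carrier (obj Y i)) (e i)" for i
  have gl: "lin (transport (e i) (obj Y i)) (obj Y i) (g i)" for i
    unfolding g_def by (rule lin_inverse[OF T(2,3) Yl T(1)])
  have ge: "g i (e i y) = y" if "y \<in> carrier (obj Y i)" for i y unfolding g_def using e[of i] that by simp
  define d where "d i = restrict (\<lambda>z. e (i + 1) (dif Y i (g i z))) (carrier (transport (e i) (obj Y i)))" for i
  define Y' where "Y' = \<lparr>obj = (\<lambda>i. transport (e i) (obj Y i)), dif = d\<rparr>"
  have Y's: "obj Y' i = transport (e i) (obj Y i)" "dif Y' i = d i" for i by (simp_all add: Y'_def)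
  have dl: "lin (transport (e i) (obj Y i)) (transport (e (i + 1)) (obj Y (i + 1))) (d i)" for i
    unfolding d_def by (rule lin_restrict[OF lin_comp[OF lin_comp[OF gl cplxD(2)[OF Y refl]] T(2)] T(1)])
  have dx: "d i z = e (i + 1) (dif Y i (g i z))" if "z \<in> carrier (transport (e i) (obj Y i))" for i z
    using that by (simp add: d_def)
  have Y'c: "cplx Y'"
  proof (rule cplxI; unfold Y's)
    show "lmod (transport (e i) (obj Y i))" for i by (rule T(1))
    show "lin (transport (e i) (obj Y i)) (transport (e k) (obj Y k)) (d i)" if "k = i + 1" for i k
      unfolding that by (rule dl)
    show "d i \<in> extensional (carrier (transport (e i) (obj Y i)))" for i by (simp add: d_def)
    fix i k m z assume a: "z \<in> carrier (transport (e i) (obj Y i))" "k = i + 1" "m = i + 2"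
    have i: "i + 1 = k" "k + 1 = m" using a by auto
    have gz: "g i z \<in> carrier (obj Y i)" by (rule linD(1)[OF gl a(1)])
    have dg: "dif Y i (g i z) \<in> carrier (obj Y k)" by (rule cplxD(3)[OF Y gz a(2)])
    have dz: "d i z \<in> carrier (transport (e k) (obj Y k))" using linD(1)[OF dl a(1)] by (simp add: i)
    have "d k (d i z) = e m (dif Y k (dif Y i (g i z)))"
      unfolding dx[OF dz] i(2) unfolding dx[OF a(1)] i(1) ge[OF dg] ..
    also have "\<dots> = e m \<zero>\<^bsub>obj Y m\<^esub>" unfolding cplxD(4)[OF Y gz a(2,3)] ..
    also have "\<dots> = \<zero>\<^bsub>transport (e m) (obj Y m)\<^esub>" by (rule lin_zero[OF T(2) Yl T(1)])
    finally show "d k (d i z) = \<zero>\<^bsub>transport (e m) (obj Y m)\<^esub>" .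
  qed
  have f: "fgc Y'" unfolding fgc_def using Y'c transport_fg[OF fg e] by (simp add: Y's)
  have "cmap 0 Y Y' e"
  proof (rule cmapI)
    show "lin (obj Y i) (obj Y' k) (e i)" if "k = i + 0" for i k using T(2) that by (simp add: Y's)
    fix i k m y assume a: "y \<in> carrier (obj Y i)" "k = i + 1" "m = i + 0"
    have "e i y \<in> carrier (transport (e i) (obj Y i))" by (rule linD(1)[OF T(2) a(1)])
    then show "e k (dif Y i y) = dif Y' m (e i y)" using a ge[OF a(1)] by (simp add: Y's dx)
  qed
  then have "ciso Y Y' e" using T(3) by (simp add: ciso_def Y's)
  then show ?thesis using that f by blast
qed

end

section \<open>Right approximations and descent of exactness\<close>

context artin begin

text \<open>A family of maps is determined by its values on generators of the finitely many nonzero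
  terms of \<open>T\<close>; \<open>function_family_fg\<close> is applied with the pairs of a degree
  and a generator as indices.\<close>

lemma anti_fg:
  assumes T: "T \<in> Kb_proj \<Lambda>" and Y: "L.fgc Y"
  obtains a F where "\<And>l. l < a \<Longrightarrow> L.anti 0 T Y (F l)"
    "\<And>f. L.anti 0 T Y f \<Longrightarrow> \<exists>r. (\<forall>l<a. r l \<in> carrier R) \<and>
      (\<forall>i. \<forall>x\<in>carrier (obj T i). f i x = msum (obj Y i) (\<lambda>l. \<phi> (r l) \<odot>\<^bsub>obj Y i\<^esub> F l i x) a)"
proof -
  have Tc: "L.cplx T" and Tp: "\<And>i. obj T i \<in> fg_proj \<Lambda>" and Tf: "finite {i. carrier (obj T i) \<noteq> {\<zero>\<^bsub>obj T i\<^esub>}}"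
    using T by (auto simp: Kb_proj_def)
  have Yc: "L.cplx Y" and Yf: "\<And>i. obj Y i \<in> fg_mod \<Lambda>" using Y by (auto simp: L.fgc_def)
  note T' = L.cplxD(1)[OF Tc] and Y' = L.cplxD(1)[OF Yc]
  have "\<exists>S. finite S \<and> S \<subseteq> carrier (obj T i) \<and> (\<forall>G. L.sub G (obj T i) \<and> S \<subseteq> G \<longrightarrow> G = carrier (obj T i))" for i
    using L.fg_projD(1)[OF Tp[of i]] unfolding fg_mod_def finitely_generated_def by auto
  then obtain S where S: "\<And>i. finite (S i)" "\<And>i. S i \<subseteq> carrier (obj T i)"
    "\<And>i G. L.sub G (obj T i) \<Longrightarrow> S i \<subseteq> G \<Longrightarrow> G = carrier (obj T i)" by metis
  let ?I = "{i. carrier (obj T i) \<noteq> {\<zero>\<^bsub>obj T i\<^esub>}}"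
  let ?K = "Sigma ?I S"
  define F where "F = {v. L.anti 0 T Y (\<lambda>i x. v (i, x))}"
  have Fl: "L.lin (obj T i) (obj Y i) (\<lambda>x. v (i, x))" if "v \<in> F" for v i
    using L.antiD(1)[of 0 T Y "\<lambda>i x. v (i, x)" i i] that by (simp add: F_def)
  have comb: "L.anti 0 T Y (\<lambda>i x. f i x \<oplus>\<^bsub>obj Y i\<^esub> \<phi> r \<odot>\<^bsub>obj Y i\<^esub> g i x)"
    if f: "L.anti 0 T Y f" and g: "L.anti 0 T Y g" and r: "r \<in> carrier R" for f g r
  proof (rule L.antiI)
    have l: "L.lin (obj T i) (obj Y i) (f i)" "L.lin (obj T i) (obj Y i) (g i)" for i
      using L.antiD(1)[OF f, of i i] L.antiD(1)[OF g, of i i] by auto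
    show "L.lin (obj T i) (obj Y k) (\<lambda>x. f i x \<oplus>\<^bsub>obj Y i\<^esub> \<phi> r \<odot>\<^bsub>obj Y i\<^esub> g i x)" if "k = i + 0" for i k
      using L.lin_add[OF l(1) lin_central[OF l(2) Y' r] Y'] that by simp
    fix i k m p x assume a: "x \<in> carrier (obj T i)" "k = i + 1" "m = i + 0" "p = i + 0 + 1"
    have p: "p = k" "m = i" "k = m + 1" "p = m + 1" using a by auto
    have fx: "f i x \<in> carrier (obj Y m)" "g i x \<in> carrier (obj Y m)" using L.linD(1)[OF l(1) a(1)] L.linD(1)[OF l(2) a(1)] p by auto
    have dl: "L.lin (obj Y m) (obj Y k) (dif Y m)" by (rule L.cplxD(2)[OF Yc p(3)])
    show "f k (dif T i x) \<oplus>\<^bsub>obj Y k\<^esub> \<phi> r \<odot>\<^bsub>obj Y k\<^esub> g k (dif T i x) = \<ominus>\<^bsub>obj Y p\<^esub> dif Y m (f i x \<oplus>\<^bsub>obj Y i\<^esub> \<phi> r \<odot>\<^bsub>obj Y i\<^esub> g i x)"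
      unfolding L.antiD(3)[OF f a] L.antiD(3)[OF g a] unfolding p(1,2)[symmetric]
      unfolding p(1) using fx Y' r L.linD[OF dl]
      by (simp add: p(2)[symmetric] L.minus_distr L.smult_minus)
  qed
  have "\<exists>a vs. (\<forall>l<a. vs l \<in> F) \<and>
    (\<forall>v\<in>F. \<exists>r. (\<forall>l<a. r l \<in> carrier R) \<and> (\<forall>k\<in>?K. v k = msum (rs (obj Y (fst k))) (\<lambda>l. r l \<odot>\<^bsub>rs (obj Y (fst k))\<^esub> vs l k) a))"
  proof (rule R.function_family_fg)
    show "finite ?K" using Tf S(1) by auto
    show "R.lmod (rs (obj Y (fst k)))" "R.noe (rs (obj Y (fst k)))" for k :: "int \<times> (nat \<Rightarrow> 'a)"
      using rs_lmod[OF Y'] R_noe[OF rs_fg[OF Yf]] by auto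
    have "L.anti 0 T Y (\<lambda>i x. \<zero>\<^bsub>obj Y i\<^esub>)"
    proof (rule L.antiI)
      show "L.lin (obj T i) (obj Y k) (\<lambda>x. \<zero>\<^bsub>obj Y i\<^esub>)" if "k = i + 0" for i k
        using L.lin_const_zero[OF Y'] that by simp
      fix i k m p :: int and x assume "k = i + 1" "m = i + 0" "p = i + 0 + 1"
      then show "\<zero>\<^bsub>obj Y k\<^esub> = \<ominus>\<^bsub>obj Y p\<^esub> dif Y m \<zero>\<^bsub>obj Y i\<^esub>"
        using L.lin_zero[OF L.cplxD(2)[OF Yc refl] Y' Y', of i] Y' by simp
    qed
    then have "(\<lambda>(i, x). \<zero>\<^bsub>obj Y i\<^esub>) \<in> F" by (simp add: F_def)
    then show "F \<noteq> {}" by blast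
    show "v k \<in> carrier (rs (obj Y (fst k)))" if vF: "v \<in> F" and kK: "k \<in> ?K" for v k
    proof -
      obtain i x where k: "k = (i, x)" "x \<in> S i" using kK by auto
      have "x \<in> carrier (obj T i)" using k(2) S(2)[of i] by blast
      then show ?thesis using L.linD(1)[OF Fl[OF vF, of i], of x] k(1) by simp
    qed
    fix v w r assume "v \<in> F" "w \<in> F" "r \<in> carrier R"
    then have "(\<lambda>(i, x). v (i, x) \<oplus>\<^bsub>obj Y i\<^esub> \<phi> r \<odot>\<^bsub>obj Y i\<^esub> w (i, x)) \<in> F"
      using comb[of "\<lambda>i x. v (i, x)" "\<lambda>i x. w (i, x)" r] by (simp add: F_def)
    then show "\<exists>z\<in>F. \<forall>k\<in>?K. z k = v k \<oplus>\<^bsub>rs (obj Y (fst k))\<^esub> r \<odot>\<^bsub>rs (obj Y (fst k))\<^esub> w k"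
      by (rule rev_bexI) auto
  qed
  then obtain a vs where vs: "\<And>l. l < a \<Longrightarrow> vs l \<in> F"
    "\<forall>v\<in>F. \<exists>r. (\<forall>l<a. r l \<in> carrier R) \<and> (\<forall>k\<in>?K. v k = msum (rs (obj Y (fst k))) (\<lambda>l. r l \<odot>\<^bsub>rs (obj Y (fst k))\<^esub> vs l k) a)"
    by (elim exE conjE) (rule that, simp_all)
  show ?thesis
  proof (rule that[of a "\<lambda>l i x. vs l (i, x)"])
    show "L.anti 0 T Y (\<lambda>i x. vs l (i, x))" if "l < a" for l using vs(1)[OF that] by (simp add: F_def)
    fix f assume f: "L.anti 0 T Y f"
    have fl: "L.lin (obj T i) (obj Y i) (f i)" for i using L.antiD(1)[OF f, of i i] by simp
    have "(\<lambda>(i, x). f i x) \<in> F" using f by (simp add: F_def)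
    from bspec[OF vs(2) this] obtain r where r: "\<forall>l<a. r l \<in> carrier R"
      "\<forall>k\<in>?K. (\<lambda>(i, x). f i x) k = msum (rs (obj Y (fst k))) (\<lambda>l. r l \<odot>\<^bsub>rs (obj Y (fst k))\<^esub> vs l k) a"
      by (elim exE conjE) (rule that)
    show "\<exists>r. (\<forall>l<a. r l \<in> carrier R) \<and>
      (\<forall>i. \<forall>x\<in>carrier (obj T i). f i x = msum (obj Y i) (\<lambda>l. \<phi> (r l) \<odot>\<^bsub>obj Y i\<^esub> vs l (i, x)) a)"
    proof (intro exI[of _ r] conjI allI ballI impI r(1))
      fix i x assume x: "x \<in> carrier (obj T i)"
      let ?g = "\<lambda>x. msum (obj Y i) (\<lambda>l. \<phi> (r l) \<odot>\<^bsub>obj Y i\<^esub> vs l (i, x)) a"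
      have gl: "L.lin (obj T i) (obj Y i) ?g"
        using r(1) by (intro L.lin_msum[OF T' Y'] lin_central Y' Fl vs(1)) auto
      show "f i x = ?g x"
      proof (cases "i \<in> ?I")
        case True
        let ?D = "\<lambda>x. f i x \<ominus>\<^bsub>obj Y i\<^esub> ?g x"
        have Dl: "L.lin (obj T i) (obj Y i) ?D" by (rule L.lin_sub[OF fl gl Y'])
        have "S i \<subseteq> a_kernel (obj T i) (obj Y i) ?D"
        proof
          fix y assume y: "y \<in> S i"
          then have yc: "y \<in> carrier (obj T i)" using S(2) by blast
          have "f i y = ?g y" using r(2) True y by fastforce
          then have "f i y \<ominus>\<^bsub>obj Y i\<^esub> ?g y = \<zero>\<^bsub>obj Y i\<^esub>"
            using L.linD(1)[OF gl yc] Y' by (simp add: a_minus_def)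
          then show "y \<in> a_kernel (obj T i) (obj Y i) ?D" using yc by (simp add: L.a_kernel_iff)
        qed
        then have "a_kernel (obj T i) (obj Y i) ?D = carrier (obj T i)"
          by (rule S(3)[OF L.sub_kernel[OF Dl T' Y']])
        then have "x \<in> a_kernel (obj T i) (obj Y i) ?D" using x by simp
        then have "f i x \<ominus>\<^bsub>obj Y i\<^esub> ?g x = \<zero>\<^bsub>obj Y i\<^esub>" by (simp add: L.a_kernel_iff)
        then show ?thesis
          using L.linD(1)[OF fl x] L.linD(1)[OF gl x] Y' L.diff_eq_iff[OF Y', of "f i x" i "?g x" "\<zero>\<^bsub>obj Y i\<^esub>"] by simp
      next
        case False
        then have "x = \<zero>\<^bsub>obj T i\<^esub>" using x by auto
        then show ?thesis using L.lin_zero[OF fl T' Y'] L.lin_zero[OF gl T' Y'] by simp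
      qed
    qed (use r(1) in blast)
  qed
qed

lemma direct_sum_fg:
  assumes M: "M \<in> fg_mod \<Lambda>" and N: "N \<in> fg_mod \<Lambda>" shows "direct_sum M N \<in> fg_mod \<Lambda>"
proof -
  note Ml = L.fg_modD(1)[OF M] and Nl = L.fg_modD(1)[OF N]
  note S = L.lmod_direct_sum[OF Ml Nl]
  have f: "L.lin (direct_sum M N) M fst" by (auto intro!: L.linI)
  have "L.fgs (direct_sum M N) (carrier (direct_sum M N))"
  proof (rule L.fgs_extension[OF f S Ml L.sub_carrier[OF S]])
    have "fst ` carrier (direct_sum M N) = carrier M" using L.lmod_simps(1)[OF Nl] by (auto simp: fst_image_times)
    then show "L.fgs M (fst ` carrier (direct_sum M N))" using L.fg_modD(2)[OF M] by simp
    have g: "L.lin N (direct_sum M N) (\<lambda>y. (\<zero>\<^bsub>M\<^esub>, y))" using Ml by (auto intro!: L.linI)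
    have "(\<lambda>y. (\<zero>\<^bsub>M\<^esub>, y)) ` carrier N = carrier (direct_sum M N) \<inter> a_kernel (direct_sum M N) M fst"
      using Ml by (auto simp: L.a_kernel_iff)
    then show "L.fgs (direct_sum M N) (carrier (direct_sum M N) \<inter> a_kernel (direct_sum M N) M fst)"
      using L.fgs_image[OF g Nl S L.sub_carrier[OF Nl] L.fg_modD(2)[OF N]] by simp
  qed
  then show ?thesis by (rule L.fg_modI[OF S])
qed

lemma direct_power_fg:
  assumes M: "M \<in> fg_mod \<Lambda>" shows "direct_power M k \<in> fg_mod \<Lambda>"
proof (induction k)
  case 0
  have l: "L.lmod (direct_power M 0)" by (rule L.lmod_power[OF L.fg_modD(1)[OF M]])
  have "L.fgs (direct_power M 0) (carrier (direct_power M 0))" unfolding L.fgs_def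
    by (intro exI[of _ 0]) (auto simp: L.lspan_0 fun_eq_iff)
  then show ?case by (rule L.fg_modI[OF l])
next
  case (Suc k)
  note Ml = L.fg_modD(1)[OF M]
  let ?f = "\<lambda>(u, x). \<lambda>i\<in>{..<Suc k}. if i < k then u i else x"
  have fx: "?f (v, x) i \<in> carrier M" if "v \<in> carrier (direct_power M k)" "x \<in> carrier M" "i < Suc k" for v x i
    using that PiE_mem[of v "{..<k}" "\<lambda>_. carrier M" i] by simp
  have l: "L.lin (direct_sum (direct_power M k) M) (direct_power M (Suc k)) ?f"
  proof (rule L.linI)
    fix u assume "u \<in> carrier (direct_sum (direct_power M k) M)"
    then obtain v x where u: "u = (v, x)" "v \<in> carrier (direct_power M k)" "x \<in> carrier M" by auto
    have vi: "v i \<in> carrier M" if "i < k" for i using u(2) that by auto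
    show "?f u \<in> carrier (direct_power M (Suc k))" unfolding u(1) using u(3) vi by simp
    show "?f (u \<oplus>\<^bsub>direct_sum (direct_power M k) M\<^esub> u') = ?f u \<oplus>\<^bsub>direct_power M (Suc k)\<^esub> ?f u'" for u'
      unfolding u(1) by (cases u') (auto simp: fun_eq_iff restrict_def)
    show "?f (a \<odot>\<^bsub>direct_sum (direct_power M k) M\<^esub> u) = a \<odot>\<^bsub>direct_power M (Suc k)\<^esub> ?f u" for a
      unfolding u(1) by (auto simp: fun_eq_iff restrict_def)
  qed
  moreover have "?f ` carrier (direct_sum (direct_power M k) M) = carrier (direct_power M (Suc k))"
  proof (rule equalityI; rule subsetI)
    fix u assume u: "u \<in> carrier (direct_power M (Suc k))"
    have ui: "u i \<in> carrier M" if "i < Suc k" for i using PiE_mem[of u "{..<Suc k}" "\<lambda>_. carrier M" i] u that by simp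
    have ue: "u \<in> extensional {..<Suc k}" using u by (simp add: PiE_def)
    have "?f (restrict u {..<k}, u k) = u"
      unfolding prod.case by (rule restrict_eqI[OF ue]) (simp add: less_Suc_eq split: if_splits, blast)
    moreover have "(restrict u {..<k}, u k) \<in> carrier (direct_sum (direct_power M k) M)" using ui by simp
    ultimately show "u \<in> ?f ` carrier (direct_sum (direct_power M k) M)"
      by (intro image_eqI[of u ?f "(restrict u {..<k}, u k)"]) (rule sym)
  next
    fix w assume "w \<in> ?f ` carrier (direct_sum (direct_power M k) M)"
    then show "w \<in> carrier (direct_power M (Suc k))" by (elim imageE) (simp only: L.linD(1)[OF l])
  qed
  ultimately show ?case by (rule L.fg_image[OF direct_sum_fg[OF Suc M] _ L.lmod_power[OF Ml]])
qed

text \<open>\<open>Y'\<close> is a copy of the cocone of a right approximation of \<open>Y\<close> by a power of \<open>T\<close>.\<close>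

lemma approximation:
  assumes T: "T \<in> Kb_proj \<Lambda>" and TT: "\<And>j. j > 0 \<Longrightarrow> L.orth T T j"
    and Y: "L.fgc Y" and TY: "\<And>j. j > 0 \<Longrightarrow> L.orth T Y j"
  obtains a F Y' where "\<And>l. l < a \<Longrightarrow> L.anti 0 T Y (F l)" "L.fgc Y'" "\<And>j. j > 0 \<Longrightarrow> L.orth T Y' j"
    "\<And>j y. \<lbrakk>L.exact_at Y' (j + 1); y \<in> carrier (obj Y j); dif Y j y = \<zero>\<^bsub>obj Y (j + 1)\<^esub>\<rbrakk> \<Longrightarrow>
      \<exists>t z. (\<forall>l<a. t l \<in> carrier (obj T j)) \<and> z \<in> carrier (obj Y (j - 1)) \<and>
        y = msum (obj Y j) (\<lambda>l. F l j (t l)) a \<oplus>\<^bsub>obj Y j\<^esub> dif Y (j - 1) z"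
proof -
  have Tc: "L.cplx T" and Tp: "\<And>i. obj T i \<in> fg_proj \<Lambda>" using T by (auto simp: Kb_proj_def)
  have Yc: "L.cplx Y" and Yf: "\<And>i. obj Y i \<in> fg_mod \<Lambda>" using Y by (auto simp: L.fgc_def)
  note T' = L.cplxD(1)[OF Tc] and Y' = L.cplxD(1)[OF Yc]
  obtain a F where F: "\<And>l. l < a \<Longrightarrow> L.anti 0 T Y (F l)"
    "\<And>f. L.anti 0 T Y f \<Longrightarrow> \<exists>r. (\<forall>l<a. r l \<in> carrier R) \<and>
      (\<forall>i. \<forall>x\<in>carrier (obj T i). f i x = msum (obj Y i) (\<lambda>l. \<phi> (r l) \<odot>\<^bsub>obj Y i\<^esub> F l i x) a)"
    by (rule anti_fg[OF T Y]) (rule that)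
  have Fl: "L.lin (obj T i) (obj Y i) (F l i)" if "l < a" for l i using L.antiD(1)[OF F(1)[OF that], of i i] by simp
  define A where "A = complex_power T a"
  have Ac: "L.cplx A" unfolding A_def by (rule L.power_cplx[OF Tc])
  note A' = L.cplxD(1)[OF Ac]
  have Ao: "obj A i = direct_power (obj T i) a" for i by (simp add: A_def)
  \<comment> \<open>The approximation: all generators at once on a power of \<open>T\<close>. Every
    anticommuting family of degree \<open>0\<close> is an \<open>R\<close>-combination of the
    \<open>F l\<close> and so factors through it.\<close>
  define f where "f i t = msum (obj Y i) (\<lambda>l. F l i (t l)) a" for i t
  have fl: "L.lin (obj A i) (obj Y i) (f i)" for i
    unfolding f_def[abs_def] Ao by (rule L.lin_msum[OF L.lmod_power[OF T'] Y' L.lin_comp[OF L.proj_lin Fl]])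
  have fa: "L.anti 0 A Y f"
  proof (rule L.antiI)
    show "L.lin (obj A i) (obj Y k) (f i)" if "k = i + 0" for i k using fl that by simp
    fix i k m p t assume a: "t \<in> carrier (obj A i)" "k = i + 1" "m = i + 0" "p = i + 0 + 1"
    have tl: "t l \<in> carrier (obj T i)" if "l < a" for l using a(1) that by (auto simp: Ao)
    have i: "p = k" "m = i" using a by auto
    have dl: "L.lin (obj Y i) (obj Y k) (dif Y i)" by (rule L.cplxD(2)[OF Yc a(2)])
    have Ft: "F l i (t l) \<in> carrier (obj Y i)" if "l < a" for l by (rule L.linD(1)[OF Fl[OF that] tl[OF that]])
    have "f k (dif A i t) = msum (obj Y k) (\<lambda>l. F l k (dif T i (t l))) a"
      unfolding f_def using L.power_simps(2)[of t a T i] a(1) by (intro L.msum_cong) (simp add: A_def)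
    also have "\<dots> = msum (obj Y k) (\<lambda>l. \<ominus>\<^bsub>obj Y k\<^esub> dif Y i (F l i (t l))) a"
      using L.antiD(3)[where m = i and p = k, OF F(1) tl a(2)] a(2) by (intro L.msum_cong) simp
    also have "\<dots> = \<ominus>\<^bsub>obj Y k\<^esub> msum (obj Y k) (\<lambda>l. dif Y i (F l i (t l))) a"
      by (rule L.msum_lin[OF L.lin_minus[OF L.lin_id Y'] Y' Y' L.linD(1)[OF dl Ft], symmetric])
    also have "msum (obj Y k) (\<lambda>l. dif Y i (F l i (t l))) a = dif Y i (f i t)"
      unfolding f_def by (rule L.msum_lin[OF dl Y' Y' Ft, symmetric])
    finally show "f k (dif A i t) = \<ominus>\<^bsub>obj Y p\<^esub> dif Y m (f i t)" unfolding i .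
  qed
  let ?C = "cocone A Y f"
  have Cc: "L.cplx ?C" by (rule L.cocone_cplx[OF Ac Yc fa])
  have Cf: "obj ?C i \<in> fg_mod \<Lambda>" for i
    using direct_sum_fg[OF direct_power_fg[OF L.fg_projD(1)[OF Tp]] Yf] by (simp add: Ao)
  have oC: "L.orth T ?C j" if j: "j > 0" for j
  proof (rule L.orth_cocone[OF Tc Ac Yc fa])
    show "L.orth T A j" unfolding A_def by (rule L.orth_power_right[OF Tc Tc TT[OF j]])
    fix v assume v: "L.cmap (j - 1) T Y v"
    define Goal where "Goal m k \<longleftrightarrow> (\<forall>i q. q = i + (j - 1) \<longrightarrow> L.lin (obj T i) (obj A q) (m i)) \<and>
      (\<forall>i q p r x. x \<in> carrier (obj T i) \<and> q = i + 1 \<and> p = i + (j - 1) \<and> r = i + j \<longrightarrow>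
        m q (dif T i x) = \<ominus>\<^bsub>obj A r\<^esub> dif A p (m i x)) \<and>
      (\<forall>i q. q = i + (j - 2) \<longrightarrow> L.lin (obj T i) (obj Y q) (k i)) \<and>
      (\<forall>i q p r x. x \<in> carrier (obj T i) \<and> q = i + 1 \<and> p = i + (j - 1) \<and> r = i + (j - 2) \<longrightarrow>
        v i x = f p (m i x) \<oplus>\<^bsub>obj Y p\<^esub> (dif Y r (k i x) \<oplus>\<^bsub>obj Y p\<^esub> k q (dif T i x)))" for m k
    have d0: "dif Z i \<zero>\<^bsub>obj Z i\<^esub> = \<zero>\<^bsub>obj Z k\<^esub>" if "L.cplx Z" "k = i + 1" for Z :: "('a, 'z) cochain_complex" and i k
      by (rule L.lin_zero[OF L.cplxD(2)[OF that] L.cplxD(1)[OF that(1)] L.cplxD(1)[OF that(1)]])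
    have f0: "f i \<zero>\<^bsub>obj A i\<^esub> = \<zero>\<^bsub>obj Y i\<^esub>" for i by (rule L.lin_zero[OF fl A' Y'])
    have "\<exists>m k. Goal m k"
    proof (cases "j = 1")
      case False
      \<comment> \<open>For \<open>j > 1\<close> the map is already null-homotopic, and the
        factorisation is trivial, with \<open>m\<close> zero.\<close>
      then have "L.nullh (j - 1) T Y v" using TY[of "j - 1"] j v by (intro L.orthD) auto
      then obtain k where k: "\<And>i q. q = i + (j - 1) - 1 \<Longrightarrow> L.lin (obj T i) (obj Y q) (k i)"
        "\<And>i q m p x. \<lbrakk>x \<in> carrier (obj T i); m = i + (j - 1) - 1; p = i + (j - 1); q = i + 1\<rbrakk> \<Longrightarrow>
          v i x = dif Y m (k i x) \<oplus>\<^bsub>obj Y p\<^esub> k q (dif T i x)" by (rule L.nullhE) (rule that)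
      have "Goal (\<lambda>i x. \<zero>\<^bsub>obj A (i + (j - 1))\<^esub>) k" unfolding Goal_def
      proof (intro conjI allI impI; (elim conjE)?)
        show "L.lin (obj T i) (obj A q) (\<lambda>x. \<zero>\<^bsub>obj A (i + (j - 1))\<^esub>)" if "q = i + (j - 1)" for i q
          unfolding that by (rule L.lin_const_zero[OF A'])
        show "L.lin (obj T i) (obj Y q) (k i)" if "q = i + (j - 2)" for i q by (rule k(1)) (use that in simp)
        fix i q p r x assume x: "x \<in> carrier (obj T i)"
        show "\<zero>\<^bsub>obj A (q + (j - 1))\<^esub> = \<ominus>\<^bsub>obj A r\<^esub> dif A p \<zero>\<^bsub>obj A (i + (j - 1))\<^esub>"
          if h: "q = i + 1" "p = i + (j - 1)" "r = i + j"
        proof -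
          have "q + (j - 1) = r" "i + (j - 1) = p" "r = p + 1" using h by auto
          then have "dif A p \<zero>\<^bsub>obj A (i + (j - 1))\<^esub> = \<zero>\<^bsub>obj A r\<^esub>"
            using d0[OF Ac, of r p] by simp
          then show ?thesis unfolding \<open>q + (j - 1) = r\<close> using A'[of r] by simp
        qed
        show "v i x = f p \<zero>\<^bsub>obj A (i + (j - 1))\<^esub> \<oplus>\<^bsub>obj Y p\<^esub> (dif Y r (k i x) \<oplus>\<^bsub>obj Y p\<^esub> k q (dif T i x))"
          if h: "q = i + 1" "p = i + (j - 1)" "r = i + (j - 2)"
        proof -
          have vx: "v i x \<in> carrier (obj Y p)" by (rule L.cmapD(2)[OF v x h(2)])
          have "v i x = dif Y r (k i x) \<oplus>\<^bsub>obj Y p\<^esub> k q (dif T i x)" by (rule k(2)[OF x]) (use h in auto)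
          then show ?thesis using vx f0[of p] h(2) Y' by simp
        qed
      qed
      then show ?thesis by blast
    next
      case True
      have v0: "L.cmap 0 T Y v" using v True by simp
      from F(2)[OF L.anti_sg[OF Yc Tc v0]] obtain r where r: "\<forall>l<a. r l \<in> carrier R"
        "\<forall>i. \<forall>x\<in>carrier (obj T i). L.sg (obj Y (i + 0)) i (v i x) = msum (obj Y i) (\<lambda>l. \<phi> (r l) \<odot>\<^bsub>obj Y i\<^esub> F l i x) a"
        by (elim exE conjE) (rule that)
      \<comment> \<open>The coefficients of the signed \<open>v\<close> along the generators, as a
        map from \<open>T\<close> to its power. It is a chain map because scalars from
        \<open>R\<close> are central.\<close>
      define w where "w i x = (\<lambda>l\<in>{..<a}. \<phi> (r l) \<odot>\<^bsub>obj T i\<^esub> x)" for i x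
      have wl: "L.lin (obj T i) (obj A i) (w i)" for i unfolding Ao
      proof (rule L.linI)
        fix x assume x: "x \<in> carrier (obj T i)"
        show "w i x \<in> carrier (direct_power (obj T i) a)" using x r(1) T' by (simp add: w_def)
        show "w i (x \<oplus>\<^bsub>obj T i\<^esub> y) = w i x \<oplus>\<^bsub>direct_power (obj T i) a\<^esub> w i y" if "y \<in> carrier (obj T i)" for y
          using x that r(1) L.linD(2)[OF central_lin[OF T']] by (auto simp: w_def intro!: restrict_ext)
        show "w i (b \<odot>\<^bsub>obj T i\<^esub> x) = b \<odot>\<^bsub>direct_power (obj T i) a\<^esub> w i x" if "b \<in> carrier \<Lambda>" for b
          using x that r(1) L.linD(3)[OF central_lin[OF T']] by (auto simp: w_def intro!: restrict_ext)
      qed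
      have wc: "L.cmap 0 T A w"
      proof (rule L.cmapI)
        show "L.lin (obj T i) (obj A k) (w i)" if "k = i + 0" for i k using wl that by simp
        fix i k m x assume b: "x \<in> carrier (obj T i)" "k = i + 1" "m = i + 0"
        have "w i x \<in> {..<a} \<rightarrow>\<^sub>E carrier (obj T i)" using L.linD(1)[OF wl b(1)] by (simp add: Ao)
        then have "dif A i (w i x) = (\<lambda>l\<in>{..<a}. dif T i (w i x l))" by (simp add: A_def)
        also have "\<dots> = w k (dif T i x)"
          unfolding w_def using r(1) L.linD(3)[OF L.cplxD(2)[OF Tc b(2)] _ b(1)] by (auto intro!: restrict_ext)
        finally show "w k (dif T i x) = dif A m (w i x)" using b(3) by simp
      qed
      have fw: "f i (w i x) = L.sg (obj Y i) i (v i x)" if x: "x \<in> carrier (obj T i)" for i x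
      proof -
        have "f i (w i x) = msum (obj Y i) (\<lambda>l. \<phi> (r l) \<odot>\<^bsub>obj Y i\<^esub> F l i x) a"
          unfolding f_def w_def using r(1) L.linD(3)[OF Fl _ x] by (intro L.msum_cong) simp
        then show ?thesis using r(2) x by simp
      qed
      note an = L.anti_sg[OF Ac Tc wc]
      \<comment> \<open>The sign that made \<open>v\<close> anticommute is moved to
        \<open>w\<close>; the factorisation is then exact, with zero homotopy.\<close>
      have "Goal (\<lambda>i x. L.sg (obj A (i + 0)) i (w i x)) (\<lambda>i x. \<zero>\<^bsub>obj Y (i - 1)\<^esub>)" unfolding Goal_def
      proof (intro conjI allI impI; (elim conjE)?)
        show "L.lin (obj T i) (obj A q) (\<lambda>x. L.sg (obj A (i + 0)) i (w i x))" if "q = i + (j - 1)" for i q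
          using L.antiD(1)[OF an, of q i] that True by simp
        show "L.lin (obj T i) (obj Y q) (\<lambda>x. \<zero>\<^bsub>obj Y (i - 1)\<^esub>)" if "q = i + (j - 2)" for i q
          using L.lin_const_zero[OF Y'] that True by simp
        fix i q p r' x assume x: "x \<in> carrier (obj T i)"
        show "L.sg (obj A (q + 0)) q (w q (dif T i x)) = \<ominus>\<^bsub>obj A r'\<^esub> dif A p (L.sg (obj A (i + 0)) i (w i x))"
          if "q = i + 1" "p = i + (j - 1)" "r' = i + j"
          using L.antiD(3)[OF an x, of q p r'] that True by simp
        show "v i x = f p (L.sg (obj A (i + 0)) i (w i x)) \<oplus>\<^bsub>obj Y p\<^esub> (dif Y r' \<zero>\<^bsub>obj Y (i - 1)\<^esub> \<oplus>\<^bsub>obj Y p\<^esub> \<zero>\<^bsub>obj Y (q - 1)\<^esub>)"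
          if h: "q = i + 1" "p = i + (j - 1)" "r' = i + (j - 2)"
        proof -
          have p: "p = i" "r' = i - 1" "q - 1 = i" using h True by auto
          have z: "dif Y (i - 1) \<zero>\<^bsub>obj Y (i - 1)\<^esub> = \<zero>\<^bsub>obj Y i\<^esub>" by (rule d0[OF Yc]) simp
          have vx: "v i x \<in> carrier (obj Y i)" by (rule L.cmapD(2)[OF v0 x]) simp
          have wx: "w i x \<in> carrier (obj A i)" by (rule L.linD(1)[OF wl x])
          have "f i (L.sg (obj A i) i (w i x)) = L.sg (obj Y i) i (f i (w i x))"
            using L.lin_neg[OF fl A' Y' wx] by (simp add: L.sg_def)
          also have "\<dots> = v i x" unfolding fw[OF x] using vx Y' by (simp add: L.sg_def)
          finally show ?thesis unfolding p using z vx Y' by simp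
        qed
      qed
      then show ?thesis by blast
    qed
    then show "\<exists>m k. (\<forall>i q. q = i + (j - 1) \<longrightarrow> L.lin (obj T i) (obj A q) (m i)) \<and>
      (\<forall>i q p r x. x \<in> carrier (obj T i) \<and> q = i + 1 \<and> p = i + (j - 1) \<and> r = i + j \<longrightarrow>
        m q (dif T i x) = \<ominus>\<^bsub>obj A r\<^esub> dif A p (m i x)) \<and>
      (\<forall>i q. q = i + (j - 2) \<longrightarrow> L.lin (obj T i) (obj Y q) (k i)) \<and>
      (\<forall>i q p r x. x \<in> carrier (obj T i) \<and> q = i + 1 \<and> p = i + (j - 1) \<and> r = i + (j - 2) \<longrightarrow>
        v i x = f p (m i x) \<oplus>\<^bsub>obj Y p\<^esub> (dif Y r (k i x) \<oplus>\<^bsub>obj Y p\<^esub> k q (dif T i x)))"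
      unfolding Goal_def .
  qed
  obtain Y'' e where Y'': "L.fgc Y''" "L.ciso ?C Y'' e" by (rule L.transport_complex[OF Cc Cf]) (rule that)
  have Y''c: "L.cplx Y''" using Y''(1) by (simp add: L.fgc_def)
  show ?thesis
  proof (rule that[OF F(1) Y''(1)])
    show "L.orth T Y'' j" if "j > 0" for j by (rule L.ciso_orth[OF Tc Cc Y''c Y''(2) oC[OF that]])
    fix j y assume ex: "L.exact_at Y'' (j + 1)" and y: "y \<in> carrier (obj Y j)" "dif Y j y = \<zero>\<^bsub>obj Y (j + 1)\<^esub>"
    have "L.exact_at ?C (j + 1)" by (rule L.ciso_exact[OF Cc Y''c Y''(2) ex])
    then obtain t z where tz: "t \<in> carrier (obj A j)" "z \<in> carrier (obj Y (j - 1))" "y = f j t \<oplus>\<^bsub>obj Y j\<^esub> dif Y (j - 1) z"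
      using L.exact_cocone[OF Ac Yc fa _ y] by blast
    have "\<forall>l<a. t l \<in> carrier (obj T j)" using tz(1) by (auto simp: Ao)
    then show "\<exists>t z. (\<forall>l<a. t l \<in> carrier (obj T j)) \<and> z \<in> carrier (obj Y (j - 1)) \<and>
        y = msum (obj Y j) (\<lambda>l. F l j (t l)) a \<oplus>\<^bsub>obj Y j\<^esub> dif Y (j - 1) z"
      using tz(2,3) unfolding f_def by blast
  qed
qed

text \<open>Induction over the degree above which every orthogonal complex is exact, starting from
  the uniform bound. All complexes are treated together, since the step for \<open>Y\<close> uses
  exactness of the cocone of its approximation.\<close>

lemma perp_exact:
  assumes s: "silting \<Lambda> T" and T0: "\<And>i. i > 0 \<Longrightarrow> carrier (obj T i) = {\<zero>\<^bsub>obj T i\<^esub>}"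
    and Y: "L.fgc Y" and TY: "\<And>j. j > 0 \<Longrightarrow> L.orth T Y j" and j: "j > 0"
  shows "L.exact_at Y j"
proof -
  have T: "T \<in> Kb_proj \<Lambda>" and TT: "\<And>j. j > 0 \<Longrightarrow> L.orth T T j"
    using s L.presilting_orth[of T] by (auto simp: silting_def presilting_def)
  have Tc: "L.cplx T" using T by (simp add: Kb_proj_def)
  note T' = L.cplxD(1)[OF Tc]
  obtain c where c: "c \<ge> 0" "\<And>Y. L.fgc Y \<and> (\<forall>j>0. L.orth T Y j) \<longrightarrow> (\<forall>j>c. L.exact_at Y j)"
    using L.silting_bound[OF s] by blast
  have "\<forall>Y. L.fgc Y \<and> (\<forall>j>0. L.orth T Y j) \<longrightarrow> (\<forall>j>0. L.exact_at Y j)"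
    if "\<forall>Y. L.fgc Y \<and> (\<forall>j>0. L.orth T Y j) \<longrightarrow> (\<forall>j>int m. L.exact_at Y j)" for m
    using that
  proof (induction m)
    case (Suc m)
    have "\<forall>Y. L.fgc Y \<and> (\<forall>j>0. L.orth T Y j) \<longrightarrow> (\<forall>j>int m. L.exact_at Y j)"
    proof (intro allI impI)
      fix Y j assume Y: "L.fgc Y \<and> (\<forall>j>0. L.orth T Y j)" and j: "int m < j"
      have Yf: "L.fgc Y" and TY: "\<And>j. j > 0 \<Longrightarrow> L.orth T Y j" using Y by auto
      have Yc: "L.cplx Y" using Y by (simp add: L.fgc_def)
      note Y' = L.cplxD(1)[OF Yc]
      obtain a F Y' where F: "\<And>l. l < a \<Longrightarrow> L.anti 0 T Y (F l)" and Y'': "L.fgc Y'" "\<And>j. j > 0 \<Longrightarrow> L.orth T Y' j"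
        and e: "\<And>j y. \<lbrakk>L.exact_at Y' (j + 1); y \<in> carrier (obj Y j); dif Y j y = \<zero>\<^bsub>obj Y (j + 1)\<^esub>\<rbrakk> \<Longrightarrow>
          \<exists>t z. (\<forall>l<a. t l \<in> carrier (obj T j)) \<and> z \<in> carrier (obj Y (j - 1)) \<and>
            y = msum (obj Y j) (\<lambda>l. F l j (t l)) a \<oplus>\<^bsub>obj Y j\<^esub> dif Y (j - 1) z"
      proof (rule approximation[OF T _ Yf])
        show "L.orth T T j" if "j > 0" for j by (rule TT[OF that])
        show "L.orth T Y j" if "j > 0" for j by (rule TY[OF that])
      qed (rule that)
      have ex: "L.exact_at Y' (j + 1)" using Suc.prems Y'' j by auto
      show "L.exact_at Y j" unfolding L.exact_at_def
      proof (intro ballI impI)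
        fix y assume y: "y \<in> carrier (obj Y j)" "dif Y j y = \<zero>\<^bsub>obj Y (j + 1)\<^esub>"
        obtain t z where tz: "\<forall>l<a. t l \<in> carrier (obj T j)" "z \<in> carrier (obj Y (j - 1))"
          "y = msum (obj Y j) (\<lambda>l. F l j (t l)) a \<oplus>\<^bsub>obj Y j\<^esub> dif Y (j - 1) z" using e[OF ex y] by blast
        \<comment> \<open>The approximation contributes nothing here, since \<open>T\<close>
          vanishes in the positive degree \<open>j\<close>; thus a cocycle is left as a
          boundary.\<close>
        have "F l j (t l) = \<zero>\<^bsub>obj Y j\<^esub>" if "l < a" for l
        proof -
          have "t l = \<zero>\<^bsub>obj T j\<^esub>" using tz(1) that T0[of j] j by auto
          then show ?thesis using L.lin_zero[OF L.antiD(1)[OF F[OF that], of j j] T' Y'] by simp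
        qed
        then have "msum (obj Y j) (\<lambda>l. F l j (t l)) a = \<zero>\<^bsub>obj Y j\<^esub>" by (rule L.msum_zero[OF Y'])
        then have "y = dif Y (j - 1) z" using tz(3) L.cplxD(3)[OF Yc tz(2), of j] Y' by simp
        then show "\<exists>z\<in>carrier (obj Y (j - 1)). y = dif Y (j - 1) z" using tz(2) by blast
      qed
    qed
    then show ?case by (rule Suc.IH)
  qed simp
  from this[of "nat c"] show ?thesis using c Y TY j by simp
qed

end

section \<open>Modules orthogonal to a \<open>\<tau>\<^sub>n\<close>-tilting module\<close>

context rng begin

lemma lin_factor:
  assumes e: "lin A B e" and A: "lmod A" and B: "lmod B" and C: "lmod C" and f: "lin A C f"
    and sur: "e ` carrier A = carrier B"
    and ker: "\<And>x. \<lbrakk>x \<in> carrier A; e x = \<zero>\<^bsub>B\<^esub>\<rbrakk> \<Longrightarrow> f x = \<zero>\<^bsub>C\<^esub>"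
  obtains g where "lin B C g" "\<And>x. x \<in> carrier A \<Longrightarrow> g (e x) = f x"
proof -
  define s where "s = inv_into (carrier A) e"
  have s: "s y \<in> carrier A" "e (s y) = y" if "y \<in> carrier B" for y
    using that sur inv_into_into[of y e "carrier A"] f_inv_into_f[of y e "carrier A"] by (auto simp: s_def)
  have eq: "f x = f y" if x: "x \<in> carrier A" and y: "y \<in> carrier A" and xy: "e x = e y" for x y
  proof -
    have "e (x \<ominus>\<^bsub>A\<^esub> y) = \<zero>\<^bsub>B\<^esub>"
      using lin_diff[OF e A B x y] xy linD(1)[OF e y] B diff_eq_iff[OF B, of "e y" "e y" "\<zero>\<^bsub>B\<^esub>"] by simp
    then have "f (x \<ominus>\<^bsub>A\<^esub> y) = \<zero>\<^bsub>C\<^esub>" using ker x y A by simp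
    then have "f x \<ominus>\<^bsub>C\<^esub> f y = \<zero>\<^bsub>C\<^esub>" using lin_diff[OF f A C x y] by simp
    then show ?thesis
      using diff_eq_iff[OF C linD(1)[OF f x] linD(1)[OF f y], of "\<zero>\<^bsub>C\<^esub>"] linD(1)[OF f y] C by simp
  qed
  show ?thesis
  proof (rule that[of "\<lambda>y. f (s y)"])
    show "f (s (e x)) = f x" if "x \<in> carrier A" for x
      using s[OF linD(1)[OF e that]] that by (intro eq) auto
    show "lin B C (\<lambda>y. f (s y))"
    proof (rule linI)
      fix x y assume x: "x \<in> carrier B" and y: "y \<in> carrier B"
      show "f (s x) \<in> carrier C" by (rule linD(1)[OF f s(1)[OF x]])
      have "f (s (x \<oplus>\<^bsub>B\<^esub> y)) = f (s x \<oplus>\<^bsub>A\<^esub> s y)"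
        using s[OF x] s[OF y] s[of "x \<oplus>\<^bsub>B\<^esub> y"] x y A B linD(2)[OF e s(1)[OF x] s(1)[OF y]] by (intro eq) auto
      then show "f (s (x \<oplus>\<^bsub>B\<^esub> y)) = f (s x) \<oplus>\<^bsub>C\<^esub> f (s y)" using linD(2)[OF f s(1)[OF x] s(1)[OF y]] by simp
    next
      fix a x assume a: "a \<in> carrier R" and x: "x \<in> carrier B"
      have "f (s (a \<odot>\<^bsub>B\<^esub> x)) = f (a \<odot>\<^bsub>A\<^esub> s x)"
        using s[OF x] s[of "a \<odot>\<^bsub>B\<^esub> x"] a x A B linD(3)[OF e a s(1)[OF x]] by (intro eq) auto
      then show "f (s (a \<odot>\<^bsub>B\<^esub> x)) = a \<odot>\<^bsub>C\<^esub> f (s x)" using linD(3)[OF f a s(1)[OF x]] by simp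
    qed
  qed
qed

end

section \<open>Dimension shifting\<close>

context artin_res begin

lemma P_lin': "q = p + 1 \<Longrightarrow> L.lin (obj P p) (obj P q) (dif P p)"
  using P_lin by simp

lemma P_dd': "\<lbrakk>x \<in> carrier (obj P p); q = p + 1; r = p + 2\<rbrakk> \<Longrightarrow> dif P q (dif P p x) = \<zero>\<^bsub>obj P r\<^esub>"
  using P_dd by simp

lemma vanD:
  assumes v: "van n i N" and ix: "p = - int i" "q = p + 1" "r = p - 1" and f: "L.lin (obj P p) N f"
    and z: "\<And>x. \<lbrakk>i < n; x \<in> carrier (obj P r)\<rbrakk> \<Longrightarrow> f (dif P r x) = \<zero>\<^bsub>N\<^esub>"
  obtains g where "L.lin (obj P q) N g" "\<And>x. x \<in> carrier (obj P p) \<Longrightarrow> f x = g (dif P p x)"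
proof -
  have "\<exists>g. L.lin (obj P q) N g \<and> (\<forall>x\<in>carrier (obj P p). f x = g (dif P p x))"
    unfolding ix(2) ix(1) by (rule v[unfolded van_def, rule_format]) (use f z in \<open>auto simp: ix\<close>)
  then show ?thesis using that by blast
qed

lemma vanI:
  assumes "\<And>p q r f. \<lbrakk>p = - int i; q = p + 1; r = p - 1; L.lin (obj P p) N f;
      \<And>x. \<lbrakk>i < n; x \<in> carrier (obj P r)\<rbrakk> \<Longrightarrow> f (dif P r x) = \<zero>\<^bsub>N\<^esub>\<rbrakk> \<Longrightarrow>
    \<exists>g. L.lin (obj P q) N g \<and> (\<forall>x\<in>carrier (obj P p). f x = g (dif P p x))"
  shows "van n i N"
  unfolding van_def by (intro allI impI, elim conjE, rule assms) auto

lemma van_power: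
  assumes v: "van n i N" shows "van n i (direct_power N a)"
proof (rule vanI)
  fix p q r f assume ix: "p = - int i" "q = p + 1" "r = p - 1" and f: "L.lin (obj P p) (direct_power N a) f"
    and z: "\<And>x. \<lbrakk>i < n; x \<in> carrier (obj P r)\<rbrakk> \<Longrightarrow> f (dif P r x) = \<zero>\<^bsub>direct_power N a\<^esub>"
  have "\<exists>g. L.lin (obj P q) N g \<and> (\<forall>x\<in>carrier (obj P p). f x l = g (dif P p x))" if l: "l < a" for l
  proof -
    have fl: "L.lin (obj P p) N (\<lambda>x. f x l)" by (rule L.lin_comp[OF f L.proj_lin[OF l]])
    show ?thesis by (rule vanD[OF v ix fl]) (use z l in auto)
  qed
  then obtain g where g: "\<And>l. l < a \<Longrightarrow> L.lin (obj P q) N (g l)"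
    "\<And>l x. \<lbrakk>l < a; x \<in> carrier (obj P p)\<rbrakk> \<Longrightarrow> f x l = g l (dif P p x)" by metis
  have gl: "L.lin (obj P q) (direct_power N a) (\<lambda>y. \<lambda>l\<in>{..<a}. g l y)"
  proof (rule L.linI)
    show "(\<lambda>l\<in>{..<a}. g l y) \<in> carrier (direct_power N a)" if "y \<in> carrier (obj P q)" for y
      using L.linD(1)[OF g(1) that] by simp
    show "(\<lambda>l\<in>{..<a}. g l (x \<oplus>\<^bsub>obj P q\<^esub> y)) = (\<lambda>l\<in>{..<a}. g l x) \<oplus>\<^bsub>direct_power N a\<^esub> (\<lambda>l\<in>{..<a}. g l y)"
      if "x \<in> carrier (obj P q)" "y \<in> carrier (obj P q)" for x y
      using L.linD(2)[OF g(1) that] by (auto simp: fun_eq_iff restrict_def)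
    show "(\<lambda>l\<in>{..<a}. g l (b \<odot>\<^bsub>obj P q\<^esub> y)) = b \<odot>\<^bsub>direct_power N a\<^esub> (\<lambda>l\<in>{..<a}. g l y)"
      if "b \<in> carrier \<Lambda>" "y \<in> carrier (obj P q)" for b y
      using L.linD(3)[OF g(1) that] by (auto simp: fun_eq_iff restrict_def)
  qed
  have "f x = (\<lambda>l\<in>{..<a}. g l (dif P p x))" if x: "x \<in> carrier (obj P p)" for x
  proof -
    have "f x \<in> extensional {..<a}" using L.linD(1)[OF f x] by (simp add: PiE_def)
    then show ?thesis by (rule restrict_eqI[symmetric]) (use g(2) x in simp)
  qed
  then show "\<exists>g. L.lin (obj P q) (direct_power N a) g \<and> (\<forall>x\<in>carrier (obj P p). f x = g (dif P p x))"
    using gl by blast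
qed

lemma van_retract:
  assumes v: "van n i F" and F: "L.lmod F" and X: "L.lmod X"
    and j: "L.lin X F j" and s: "L.lin F X s" and sj: "\<And>x. x \<in> carrier X \<Longrightarrow> s (j x) = x"
  shows "van n i X"
proof (rule vanI)
  fix p q r f assume ix: "p = - int i" "q = p + 1" "r = p - 1" and f: "L.lin (obj P p) X f"
    and z: "\<And>x. \<lbrakk>i < n; x \<in> carrier (obj P r)\<rbrakk> \<Longrightarrow> f (dif P r x) = \<zero>\<^bsub>X\<^esub>"
  obtain g where g: "L.lin (obj P q) F g" "\<And>x. x \<in> carrier (obj P p) \<Longrightarrow> j (f x) = g (dif P p x)"
    by (rule vanD[OF v ix L.lin_comp[OF f j]]) (use z L.lin_zero[OF j X F] in auto)
  have "f x = s (g (dif P p x))" if "x \<in> carrier (obj P p)" for x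
    using sj[OF L.linD(1)[OF f that]] g(2)[OF that] by simp
  then show "\<exists>g. L.lin (obj P q) X g \<and> (\<forall>x\<in>carrier (obj P p). f x = g (dif P p x))"
    using L.lin_comp[OF g(1) s] by blast
qed

text \<open>The long exact sequence for the kernel of \<open>e\<close>, read off the resolution. A
  cocycle with values in \<open>X\<close> lifts to \<open>A\<close> by projectivity; its failure to
  be a cocycle there is a cocycle of degree \<open>i + 1\<close> with values in the kernel. For
  \<open>i = n\<close> there is no cocycle condition and the kernel plays no part.\<close>

lemma van_quotient:
  assumes v: "van n i A" and vK: "i < n \<Longrightarrow> van n (i + 1) (A\<lparr>carrier := a_kernel A X e\<rparr>)"
    and A: "L.lmod A" and X: "L.lmod X" and e: "L.lin A X e" and sur: "e ` carrier A = carrier X"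
  shows "van n i X"
proof (rule vanI)
  fix p q r f assume ix: "p = - int i" "q = p + 1" "r = p - 1" and f: "L.lin (obj P p) X f"
    and z: "\<And>x. \<lbrakk>i < n; x \<in> carrier (obj P r)\<rbrakk> \<Longrightarrow> f (dif P r x) = \<zero>\<^bsub>X\<^esub>"
  have p: "p \<le> 0" "r + 1 = p" "r = - int (i + 1)" "p = r + 1" using ix by auto
  have "\<exists>b\<in>carrier A. e b = f x" if "x \<in> carrier (obj P p)" for x
    using L.linD(1)[OF f that] sur by (metis imageE)
  then obtain h where h: "L.lin (obj P p) A h" "\<And>x. x \<in> carrier (obj P p) \<Longrightarrow> e (h x) = f x"
    by (rule L.proj_lift[OF P_proj[OF p(1)] A X e f]) (assumption, rule that)
  have dr: "L.lin (obj P r) (obj P p) (dif P r)" by (rule P_lin'[OF p(4)])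
  let ?K = "A\<lparr>carrier := a_kernel A X e\<rparr>"
  \<comment> \<open>A lift of \<open>f\<close> that is itself a cocycle: the arbitrary lift is
    corrected by a map into the kernel with the same composite with the differential.\<close>
  have "\<exists>k. L.lin (obj P p) A k \<and> (\<forall>x\<in>carrier (obj P p). e (k x) = f x) \<and>
      (i < n \<longrightarrow> (\<forall>x\<in>carrier (obj P r). k (dif P r x) = \<zero>\<^bsub>A\<^esub>))"
  proof (cases "i < n")
    case True
    have hd: "L.lin (obj P r) ?K (\<lambda>x. h (dif P r x))"
    proof (rule L.lin_into_sub[OF L.lin_comp[OF dr h(1)]])
      fix x assume x: "x \<in> carrier (obj P r)"
      note dx = L.linD(1)[OF dr x]
      show "h (dif P r x) \<in> a_kernel A X e"
        using L.linD(1)[OF h(1) dx] h(2)[OF dx] z[OF True x] by (simp add: L.a_kernel_iff)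
    qed
    obtain k where k: "L.lin (obj P p) ?K k" "\<And>x. x \<in> carrier (obj P r) \<Longrightarrow> h (dif P r x) = k (dif P r x)"
    proof (rule vanD[OF vK[OF True] p(3,4) refl hd])
      fix x assume x: "x \<in> carrier (obj P (r - 1))"
      have "dif P r (dif P (r - 1) x) = \<zero>\<^bsub>obj P p\<^esub>" by (rule P_dd'[OF x]) (use p in auto)
      then show "h (dif P r (dif P (r - 1) x)) = \<zero>\<^bsub>?K\<^esub>" using L.lin_zero[OF h(1) P_lmod A] by simp
    qed (rule that)
    have kA: "L.lin (obj P p) A k" by (rule L.lin_out_sub[OF k(1)]) (auto simp: L.a_kernel_iff)
    have ek: "e (k x) = \<zero>\<^bsub>X\<^esub>" if "x \<in> carrier (obj P p)" for x
      using L.linD(1)[OF k(1) that] by (simp add: L.a_kernel_iff)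
    show ?thesis
    proof (intro exI[of _ "\<lambda>x. h x \<ominus>\<^bsub>A\<^esub> k x"] conjI ballI impI L.lin_sub[OF h(1) kA A])
      fix x assume x: "x \<in> carrier (obj P p)"
      note c = L.linD(1)[OF h(1) x] L.linD(1)[OF kA x]
      show "e (h x \<ominus>\<^bsub>A\<^esub> k x) = f x"
        unfolding L.lin_diff[OF e A X c] h(2)[OF x] ek[OF x]
        using L.linD(1)[OF f x] X by (subst L.diff_eq_iff) auto
    next
      fix x assume x: "x \<in> carrier (obj P r)"
      have "k (dif P r x) \<in> carrier A" by (rule L.linD(1)[OF kA L.linD(1)[OF dr x]])
      then show "h (dif P r x) \<ominus>\<^bsub>A\<^esub> k (dif P r x) = \<zero>\<^bsub>A\<^esub>" unfolding k(2)[OF x]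
        using A by (subst L.diff_eq_iff) auto
    qed
  qed (use h in blast)
  then obtain k where k: "L.lin (obj P p) A k" "\<And>x. x \<in> carrier (obj P p) \<Longrightarrow> e (k x) = f x"
    "\<And>x. \<lbrakk>i < n; x \<in> carrier (obj P r)\<rbrakk> \<Longrightarrow> k (dif P r x) = \<zero>\<^bsub>A\<^esub>" by blast
  obtain g where g: "L.lin (obj P q) A g" "\<And>x. x \<in> carrier (obj P p) \<Longrightarrow> k x = g (dif P p x)"
    by (rule vanD[OF v ix k(1)]) (rule k(3), assumption+, rule that)
  have "f x = e (g (dif P p x))" if "x \<in> carrier (obj P p)" for x
    using k(2)[OF that] g(2)[OF that] by simp
  then show "\<exists>g. L.lin (obj P q) X g \<and> (\<forall>x\<in>carrier (obj P p). f x = g (dif P p x))"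
    using L.lin_comp[OF g(1) e] by blast
qed

lemma van_add_closure:
  assumes v: "van n i M" and X: "X \<in> add_closure \<Lambda> M" shows "van n i X"
proof -
  obtain k where k: "direct_summand \<Lambda> X (direct_power M k)" and Xl: "L.lmod X"
    using X L.fg_modD(1) by (auto simp: add_closure_def)
  have F: "L.lmod (direct_power M k)" by (rule L.lmod_power[OF Ml])
  obtain j s where "L.lin X (direct_power M k) j" "L.lin (direct_power M k) X s" "\<And>x. x \<in> carrier X \<Longrightarrow> s (j x) = x"
    by (rule L.summandE[OF k Xl F]) (rule that)
  then show ?thesis by (rule van_retract[OF van_power[OF v] F Xl])
qed

text \<open>Downward induction along the exact sequence: the kernel leaving \<open>L m\<close>
  satisfies the conditions of index greater than \<open>m\<close>. At \<open>m = n\<close> the range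
  is empty, which is why a sequence of length \<open>n\<close> suffices although the kernel of its
  last map is arbitrary.\<close>

lemma gen_n_van:
  assumes vM: "\<And>i. i \<in> {1..n} \<Longrightarrow> van n i M" and n: "n \<ge> 1" and X: "X \<in> gen_n \<Lambda> n M" and j: "j \<in> {1..n}"
  shows "van n j X"
proof -
  have Xl: "L.lmod X" using X L.fg_modD(1) by (auto simp: gen_n_def)
  obtain L :: "nat \<Rightarrow> ('a, nat \<Rightarrow> 'm) module" and f g where h: "\<forall>i\<in>{1..n}. L i \<in> add_closure \<Lambda> M" "\<forall>i\<in>{1..<n}. f i \<in> mod_hom \<Lambda> (L (i + 1)) (L i)"
    and g: "g \<in> mod_hom \<Lambda> (L 1) X" "g ` carrier (L 1) = carrier X"
    and h': "1 < n \<longrightarrow> f 1 ` carrier (L 2) = a_kernel (L 1) X g"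
      "\<forall>i. 1 \<le> i \<and> i + 1 < n \<longrightarrow> f (i + 1) ` carrier (L (i + 2)) = a_kernel (L (i + 1)) (L i) (f i)"
    using X unfolding gen_n_def mem_Collect_eq by (elim conjE exE) (rule that)
  note L = bspec[OF h(1)] and f = bspec[OF h(2)] and e1 = mp[OF h'(1)]
  have e: "\<lbrakk>1 \<le> i; i + 1 < n\<rbrakk> \<Longrightarrow> f (i + 1) ` carrier (L (i + 2)) = a_kernel (L (i + 1)) (L i) (f i)" for i
    using h'(2) by blast
  have Ll: "L.lmod (L i)" if "i \<in> {1..n}" for i using L[OF that] L.fg_modD(1) by (auto simp: add_closure_def)
  have vL: "van n j (L i)" if "i \<in> {1..n}" "j \<in> {1..n}" for i j by (rule van_add_closure[OF vM[OF that(2)] L[OF that(1)]])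
  define K where "K m = (if m = 1 then a_kernel (L 1) X g else a_kernel (L m) (L (m - 1)) (f (m - 1)))" for m
  have Kl: "K m \<subseteq> carrier (L m)" for m by (auto simp: K_def L.a_kernel_iff)
  have subK: "L.sub (K m) (L m)" if m: "m \<in> {1..n}" for m
  proof (cases "m = 1")
    case True
    then show ?thesis using L.sub_kernel[OF L.mod_homD[OF g(1)] Ll Xl] n by (simp add: K_def)
  next
    case False
    then have "m - 1 \<in> {1..<n}" "m - 1 \<in> {1..n}" "m - 1 + 1 = m" using m by auto
    then show ?thesis using L.sub_kernel[OF L.mod_homD[OF f[of "m - 1"]] Ll Ll] m False by (simp add: K_def)
  qed
  have fK: "f m ` carrier (L (m + 1)) = K m" if "m \<in> {1..<n}" for m
  proof (cases "m = 1")
    case True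
    then show ?thesis using e1 that by (simp add: K_def numeral_2_eq_2)
  next
    case False
    then have m: "1 \<le> m - 1" "m - 1 + 1 = m" "m - 1 + 2 = m + 1" using that by auto
    then show ?thesis using e[of "m - 1", unfolded m] that False by (simp add: K_def)
  qed
  \<comment> \<open>The conditions of index \<open>j\<close> for one kernel use those of index
    \<open>j + 1\<close> for the next, so the lower limit rises with \<open>m\<close>.\<close>
  have vK: "\<forall>j. m + 1 \<le> j \<and> j \<le> n \<longrightarrow> van n j ((L m)\<lparr>carrier := K m\<rparr>)" if "m \<le> n" "1 \<le> m" for m
    using that
  proof (induction m rule: inc_induct)
    case base
    then show ?case by auto
  next
    case (step m)
    have m: "m \<in> {1..<n}" "m \<in> {1..n}" "m + 1 \<in> {1..n}" using step by auto
    have IH: "\<And>j. m + 1 + 1 \<le> j \<and> j \<le> n \<Longrightarrow> van n j ((L (m + 1))\<lparr>carrier := K (m + 1)\<rparr>)"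
      using step.IH step.prems by auto
    let ?B = "(L m)\<lparr>carrier := K m\<rparr>"
    have fl: "L.lin (L (m + 1)) ?B (f m)"
      using fK[OF m(1)] by (intro L.lin_into_sub[OF L.mod_homD[OF f[OF m(1)]]]) auto
    have ker: "a_kernel (L (m + 1)) ?B (f m) = K (m + 1)"
      using m by (auto simp: K_def L.a_kernel_iff)
    show ?case
    proof (intro allI impI)
      fix j assume j: "m + 1 \<le> j \<and> j \<le> n"
      show "van n j ?B"
      proof (rule van_quotient[OF vL _ Ll L.lmod_sub[OF Ll subK] fl])
        show "van n (j + 1) ((L (m + 1))\<lparr>carrier := a_kernel (L (m + 1)) ?B (f m)\<rparr>)" if "j < n"
          unfolding ker using IH[of "j + 1"] j that by simp
      qed (use m j fK[OF m(1)] in auto)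
    qed
  qed
  show ?thesis
  proof (rule van_quotient[OF vL _ Ll Xl L.mod_homD[OF g(1)] g(2)])
    show "van n (j + 1) ((L 1)\<lparr>carrier := a_kernel (L 1) X g\<rparr>)" if "j < n"
      using vK[of 1] that j n by (simp add: K_def)
  qed (use j n in auto)
qed

end

section \<open>The truncated resolution and its orthogonal modules\<close>

locale tau_tilting = artin_res R \<Lambda> \<phi> M
    for R :: "'r ring" and \<Lambda> :: "'a ring" and \<phi> and M :: "('a, 'm) module" +
  fixes n :: nat
  assumes n: "n \<ge> 1" and tilting: "silting \<Lambda> (truncate_complex (min_res \<Lambda> M) n)"
begin

abbreviation "T \<equiv> truncate_complex P n"

lemma T_simps [simp]:
  "- int n \<le> i \<Longrightarrow> obj T i = obj P i" "i < - int n \<Longrightarrow> carrier (obj T i) = {\<zero>\<^bsub>obj T i\<^esub>}"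
  "x \<in> carrier (obj T i) \<Longrightarrow> dif T i x = dif P i x"
  by (auto simp: truncate_complex_def Let_def)

lemma T_silting: "T \<in> Kb_proj \<Lambda>" "L.cplx T" "presilting \<Lambda> T"
  using tilting by (auto simp: silting_def presilting_def Kb_proj_def)

lemma T_pos: "i > 0 \<Longrightarrow> carrier (obj T i) = {\<zero>\<^bsub>obj T i\<^esub>}"
  using P_pos[of i] by simp

lemma T_zeroD: "\<lbrakk>x \<in> carrier (obj T i); i < - int n \<or> i > 0\<rbrakk> \<Longrightarrow> x = \<zero>\<^bsub>obj T i\<^esub>"
  using T_pos[of i] by auto

text \<open>A map from \<open>T\<close> to a module placed in degree \<open>0\<close> is a single
  map in degree \<open>-j\<close>, and a homotopy is a single map one degree higher. For
  \<open>j > n\<close> the term of \<open>T\<close> is zero. For \<open>j < n\<close> the chain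
  condition is the cocycle condition, and for \<open>j = n\<close> truncation has removed it, in
  accordance with \<open>van\<close>.\<close>

lemma orth_stalk:
  assumes N: "L.lmod N" and Z: "L.lmod Z" "carrier Z = {\<zero>\<^bsub>Z\<^esub>}"
    and v: "\<And>i. i \<in> {1..n} \<Longrightarrow> van n i N" and j: "j > 0"
  shows "L.orth T (L.stalk N Z) j"
  unfolding L.orth_def
proof (intro allI impI)
  fix f assume f: "L.cmap j T (L.stalk N Z) f"
  let ?S = "L.stalk N Z"
  have Sc: "L.cplx ?S" by (rule L.stalk_cplx[OF N Z(1)])
  note S' = L.cplxD(1)[OF Sc] and T' = L.cplxD(1)[OF T_silting(2)]
  have S0: "y = \<zero>\<^bsub>obj ?S i\<^esub>" if "y \<in> carrier (obj ?S i)" "i \<noteq> 0" for y i using that Z by simp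
  define p where "p = - j"
  have "\<exists>g. L.lin (obj T (p + 1)) N g \<and> (\<forall>x\<in>carrier (obj T p). f p x = g (dif T p x))"
  proof (cases "j \<le> int n")
    case True
    define i where "i = nat j"
    have ix: "p = - int i" "i \<in> {1..n}" "- int n \<le> p" "- int n \<le> p + 1" "0 = p + j" using True j by (auto simp: i_def p_def)
    have fp: "L.lin (obj P p) N (f p)" using L.cmapD(1)[OF f ix(5)] ix(3) by simp
    obtain g where g: "L.lin (obj P (p + 1)) N g" "\<And>x. x \<in> carrier (obj P p) \<Longrightarrow> f p x = g (dif P p x)"
    proof (rule vanD[OF v[OF ix(2)] ix(1) refl refl fp])
      fix x assume i: "i < n" and x: "x \<in> carrier (obj P (p - 1))"
      \<comment> \<open>For \<open>i < n\<close> the term below \<open>p\<close> survives the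
        truncation, so the chain map condition is available there.\<close>
      have r: "- int n \<le> p - 1" using i ix(1) by auto
      then have x': "x \<in> carrier (obj T (p - 1))" using x by simp
      have "f p (dif T (p - 1) x) = dif ?S (- 1) (f (p - 1) x)"
        by (rule L.cmapD(3)[OF f x']) (auto simp: p_def)
      moreover have "f (p - 1) x \<in> carrier (obj ?S (- 1))" by (rule L.cmapD(2)[OF f x']) (simp add: p_def)
      ultimately show "f p (dif P (p - 1) x) = \<zero>\<^bsub>N\<^esub>" using x' by simp
    qed (rule that)
    then show ?thesis using ix by auto
  next
    case False
    then have p: "p < - int n" by (simp add: p_def)
    have l: "L.lin (obj T p) (obj ?S 0) (f p)" by (rule L.cmapD(1)[OF f]) (simp add: p_def)
    have "f p x = \<zero>\<^bsub>N\<^esub>" if "x \<in> carrier (obj T p)" for x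
      using T_zeroD[OF that] L.lin_zero[OF l T' S'] p by simp
    then show ?thesis using L.lin_const_zero[OF N] by (intro exI[of _ "\<lambda>x. \<zero>\<^bsub>N\<^esub>"]) auto
  qed
  then obtain g where g: "L.lin (obj T (p + 1)) N g" "\<And>x. x \<in> carrier (obj T p) \<Longrightarrow> f p x = g (dif T p x)" by blast
  \<comment> \<open>In degree \<open>p + 1\<close> the homotopy lands in degree \<open>0\<close> of
    the stalk, the only place where it can be nonzero.\<close>
  let ?h = "\<lambda>i. if i = p + 1 then g else (\<lambda>x. \<zero>\<^bsub>obj ?S (i + j - 1)\<^esub>)"
  have hl: "L.lin (obj T i) (obj ?S k) (?h i)" if k: "k = i + j - 1" for i k
  proof (cases "i = p + 1")
    case True
    then have "k = 0" using k by (simp add: p_def)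
    then show ?thesis using g(1) True by simp
  next
    case False
    show ?thesis unfolding if_not_P[OF False] k by (rule L.lin_const_zero[OF S'])
  qed
  show "L.nullh j T ?S f"
  proof (rule L.nullhI[OF hl])
    fix i k m q x assume x: "x \<in> carrier (obj T i)" and ix: "m = i + j - 1" "q = i + j" "k = i + 1"
    have km: "q = k + j - 1" "q = m + 1" using ix by auto
    have dx: "dif T i x \<in> carrier (obj T k)" by (rule L.cplxD(3)[OF T_silting(2) x ix(3)])
    have hd: "?h k (dif T i x) \<in> carrier (obj ?S q)" by (rule L.linD(1)[OF hl[OF km(1)] dx])
    have d0: "dif ?S m (?h i x) = \<zero>\<^bsub>obj ?S q\<^esub>"
      using L.stalk_simps(2)[OF L.linD(1)[OF hl[OF ix(1)] x]] unfolding km(2) .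
    have fx: "f i x \<in> carrier (obj ?S q)" by (rule L.cmapD(2)[OF f x ix(2)])
    have "f i x = ?h k (dif T i x)"
    proof (cases "q = 0")
      case True
      then have i: "i = p" "k = p + 1" using ix by (auto simp: p_def)
      then show ?thesis using g(2) x by simp
    next
      case False
      show ?thesis unfolding S0[OF fx False] S0[OF hd False] ..
    qed
    then show "f i x = dif ?S m (?h i x) \<oplus>\<^bsub>obj ?S q\<^esub> ?h k (dif T i x)"
      unfolding d0 using hd S'[of q] by (simp del: L.stalk_simps)
  qed
qed

text \<open>A map from the term in degree \<open>-i\<close> to \<open>M\<close> lifts along the
  resolution to a chain map from \<open>T\<close> to \<open>T\<close> of degree \<open>i\<close>,
  which is null-homotopic since \<open>T\<close> is presilting. In degree \<open>-i\<close>,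
  composing with the augmentation kills the part of the homotopy ending in a boundary and leaves
  \<open>f\<close> factored through the differential.\<close>

lemma van_self:
  assumes i: "i \<in> {1..n}" shows "van n i M"
proof (rule vanI)
  fix p q r f assume ix: "p = - int i" "q = p + 1" "r = p - 1" and f: "L.lin (obj P p) M f"
    and z: "\<And>x. \<lbrakk>i < n; x \<in> carrier (obj P r)\<rbrakk> \<Longrightarrow> f (dif P r x) = \<zero>\<^bsub>M\<^esub>"
  note T' = L.cplxD(1)[OF T_silting(2)]
  \<comment> \<open>The last clause is what the next lift needs: the composite of \<open>b\<close>
    with the differential takes boundaries as values. It is demanded only while the source degree
    stays within the truncation, because in degree \<open>-n\<close> the map \<open>f\<close> need
    not be a cocycle.\<close>
  define Inv where "Inv m b \<longleftrightarrow> L.lin (obj P (p - int m)) (obj P (- int m)) b \<and>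
    (m = 0 \<longrightarrow> (\<forall>x\<in>carrier (obj P p). \<epsilon> (b x) = f x)) \<and>
    (i + m < n \<longrightarrow> (\<forall>x\<in>carrier (obj P (p - int m - 1)).
      b (dif P (p - int m - 1) x) \<in> dif P (- int m - 1) ` carrier (obj P (- int m - 1))))" for m b
  define Step where "Step m b b' \<longleftrightarrow> (i + m < n \<longrightarrow> (\<forall>x\<in>carrier (obj P (p - int m - 1)).
      dif P (- int m - 1) (b' x) = b (dif P (p - int m - 1) x)))" for m and b b' :: "(nat \<Rightarrow> 'a) \<Rightarrow> (nat \<Rightarrow> 'a)"
  have "\<exists>b. \<forall>m. Inv m (b m) \<and> Step m (b m) (b (Suc m))"
  proof (rule dependent_nat_choice)
    have "\<exists>a\<in>carrier (obj P 0). \<epsilon> a = f x" if "x \<in> carrier (obj P p)" for x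
      using L.linD(1)[OF f that] eps_surj by (metis imageE)
    then obtain b where b: "L.lin (obj P p) (obj P 0) b" "\<And>x. x \<in> carrier (obj P p) \<Longrightarrow> \<epsilon> (b x) = f x"
      by (rule L.proj_lift[OF P_proj P_lmod Ml eps_lin f, rotated]) (assumption, rule that, use ix in auto)
    have "b (dif P r x) \<in> dif P (- 1) ` carrier (obj P (- 1))" if "i < n" "x \<in> carrier (obj P r)" for x
    proof -
      have "dif P r x \<in> carrier (obj P p)" by (rule L.linD(1)[OF P_lin' that(2)]) (simp add: ix)
      then show ?thesis using b(2) z[OF that] L.linD(1)[OF b(1)] by (simp add: exact0 L.a_kernel_iff)
    qed
    then show "\<exists>b. Inv 0 b" using b ix by (intro exI[of _ b]) (simp add: Inv_def)
  next
    fix b m assume I: "Inv m b"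
    define s where "s = p - int m - 1"
    define t where "t = - int m - 1"
    have st: "p - int m = s + 1" "- int m = t + 1" "t < 0" "s \<le> 0" "p - int (Suc m) = s" "- int (Suc m) = t"
      using ix by (auto simp: s_def t_def)
    have bl: "L.lin (obj P (s + 1)) (obj P (t + 1)) b" using I by (simp add: Inv_def st)
    show "\<exists>b'. Inv (Suc m) b' \<and> Step m b b'"
    proof (cases "i + m < n")
      case True
      have "L.lin (obj P s) (obj P (t + 1)) (\<lambda>x. b (dif P s x))" by (rule L.lin_comp[OF P_lin bl])
      moreover have "\<exists>a\<in>carrier (obj P t). dif P t a = b (dif P s x)" if "x \<in> carrier (obj P s)" for x
        using I True that unfolding Inv_def s_def t_def by fastforce
      ultimately obtain b' where b': "L.lin (obj P s) (obj P t) b'"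
        "\<And>x. x \<in> carrier (obj P s) \<Longrightarrow> dif P t (b' x) = b (dif P s x)"
        by (rule L.proj_lift[OF P_proj[OF st(4)] P_lmod P_lmod P_lin]) (assumption, rule that)
      have "b' (dif P (s - 1) x) \<in> dif P (t - 1) ` carrier (obj P (t - 1))" if x: "x \<in> carrier (obj P (s - 1))" for x
      proof -
        have dx: "dif P (s - 1) x \<in> carrier (obj P s)" by (rule L.linD(1)[OF P_lin' x]) simp
        have "dif P s (dif P (s - 1) x) = \<zero>\<^bsub>obj P (s + 1)\<^esub>" by (rule P_dd'[OF x]) auto
        then have "dif P t (b' (dif P (s - 1) x)) = \<zero>\<^bsub>obj P (t + 1)\<^esub>"
          using b'(2)[OF dx] L.lin_zero[OF bl P_lmod P_lmod] by simp
        then show ?thesis using L.linD(1)[OF b'(1) dx] by (simp add: exact[OF st(3)] L.a_kernel_iff)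
      qed
      then have "Inv (Suc m) b'" using b'(1) unfolding Inv_def st(5,6) by blast
      moreover have "Step m b b'" using b'(2) unfolding Step_def s_def t_def by blast
      ultimately show ?thesis by blast
    next
      case False
      then have "Inv (Suc m) (\<lambda>x. \<zero>\<^bsub>obj P t\<^esub>)" unfolding Inv_def st(5,6) by (simp add: L.lin_const_zero)
      then show ?thesis using False by (auto simp: Step_def)
    qed
  qed
  then obtain b where b: "\<And>m. Inv m (b m)" "\<And>m. Step m (b m) (b (Suc m))" by blast
  have bl: "L.lin (obj P (p - int m)) (obj P (- int m)) (b m)" for m using b(1)[of m] by (simp add: Inv_def)
  have b0: "\<epsilon> (b 0 x) = f x" if "x \<in> carrier (obj P p)" for x using b(1)[of 0] that by (simp add: Inv_def)
  have bs: "dif P (- int m - 1) (b (Suc m) x) = b m (dif P (p - int m - 1) x)"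
    if "i + m < n" "x \<in> carrier (obj P (p - int m - 1))" for m x
    using b(2)[of m] that by (simp add: Step_def)
  \<comment> \<open>Above \<open>p\<close> the target is in positive degree and below
    \<open>-n\<close> the source is zero, so the default zero map is the only choice in these
    degrees.\<close>
  define F where "F k = (if - int n \<le> k \<and> k \<le> p then b (nat (p - k)) else (\<lambda>x. \<zero>\<^bsub>obj T (k + int i)\<^esub>))" for k
  have Fl: "L.lin (obj T k) (obj T l) (F k)" if l: "l = k + int i" for k l
  proof (cases "- int n \<le> k \<and> k \<le> p")
    case True
    then have e: "p - int (nat (p - k)) = k" "- int (nat (p - k)) = l" "- int n \<le> l" using ix l i by auto
    show ?thesis using bl[of "nat (p - k)"] True unfolding e F_def by (simp add: e)
  next
    case False
    then show ?thesis unfolding F_def if_not_P[OF False] l by (intro L.lin_const_zero T')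
  qed
  have "L.cmap (int i) T T F"
  proof (rule L.cmapI[OF Fl])
    fix u v w x assume x: "x \<in> carrier (obj T u)" and uv: "v = u + 1" "w = u + int i"
    have dx: "dif T u x \<in> carrier (obj T v)" by (rule L.cplxD(3)[OF T_silting(2) x uv(1)])
    have c: "F v (dif T u x) \<in> carrier (obj T (w + 1))" by (rule L.linD(1)[OF Fl dx]) (use uv in auto)
    have c': "dif T w (F u x) \<in> carrier (obj T (w + 1))"
      by (rule L.cplxD(3)[OF T_silting(2) L.linD(1)[OF Fl[OF uv(2)] x] refl])
    consider "u < - int n" | "u \<ge> p" | "- int n \<le> u" "u < p" by linarith
    then show "F v (dif T u x) = dif T w (F u x)"
    proof cases
      case 1
      then have x0: "x = \<zero>\<^bsub>obj T u\<^esub>" using T_zeroD[OF x] by blast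
      show ?thesis unfolding x0 L.lin_zero[OF L.cplxD(2)[OF T_silting(2) uv(1)] T' T'] L.lin_zero[OF Fl[OF uv(2)] T' T']
          L.lin_zero[OF L.cplxD(2)[OF T_silting(2) refl] T' T']
        using L.lin_zero[OF Fl T' T', of "w + 1" v] uv by simp
    next
      case 2
      \<comment> \<open>Both sides lie in a term of positive degree, which is zero.\<close>
      then have "w + 1 > 0" using uv ix by auto
      then show ?thesis using T_zeroD[OF c] T_zeroD[OF c'] by simp
    next
      case 3
      define m where "m = nat (p - v)"
      have m: "p - int m - 1 = u" "- int m - 1 = w" "nat (p - u) = Suc m" "i + m < n" "- int n \<le> w" "- int n \<le> v" "v \<le> p"
        using 3 uv ix by (auto simp: m_def)
      have x': "x \<in> carrier (obj P u)" using x 3 by simp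
      have "dif P w (b (Suc m) x) = b m (dif P u x)" using bs[OF m(4), of x] x' unfolding m by simp
      moreover have "F u = b (Suc m)" "F v = b m" using 3 m by (auto simp: F_def m_def)
      moreover have "F u x \<in> carrier (obj T w)" by (rule L.linD(1)[OF Fl[OF uv(2)] x])
      ultimately show ?thesis using x by simp
    qed
  qed
  then have "L.nullh (int i) T T F"
    using L.presilting_orth[OF T_silting(3), of "int i"] i by (intro L.orthD) auto
  then obtain h where h: "\<And>u k. k = u + int i - 1 \<Longrightarrow> L.lin (obj T u) (obj T k) (h u)"
    "\<And>u k m w x. \<lbrakk>x \<in> carrier (obj T u); m = u + int i - 1; w = u + int i; k = u + 1\<rbrakk> \<Longrightarrow>
      F u x = dif T m (h u x) \<oplus>\<^bsub>obj T w\<^esub> h k (dif T u x)"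
    by (rule L.nullhE) (rule that)
  have ob: "obj T p = obj P p" "obj T q = obj P q" "obj T 0 = obj P 0" "obj T (- 1) = obj P (- 1)"
    using ix i n by simp_all
  have hq: "L.lin (obj P q) (obj P 0) (h q)" using h(1)[of 0 q] ix ob by simp
  have hp: "L.lin (obj P p) (obj P (- 1)) (h p)" using h(1)[of "- 1" p] ix ob by simp
  have "f x = \<epsilon> (h q (dif P p x))" if x: "x \<in> carrier (obj P p)" for x
  proof -
    have dx: "dif P p x \<in> carrier (obj P q)" by (rule L.linD(1)[OF P_lin'[OF ix(2)] x])
    have hx: "h p x \<in> carrier (obj P (- 1))" by (rule L.linD(1)[OF hp x])
    have dh: "dif P (- 1) (h p x) \<in> carrier (obj P 0)" "\<epsilon> (dif P (- 1) (h p x)) = \<zero>\<^bsub>M\<^esub>"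
      using imageI[OF hx, of "dif P (- 1)"] unfolding exact0 by (simp_all add: L.a_kernel_iff)
    \<comment> \<open>The homotopy identity in degree \<open>p\<close>: its first summand is a
      boundary in degree \<open>0\<close>, hence in the kernel of the augmentation.\<close>
    have "F p x = dif T (- 1) (h p x) \<oplus>\<^bsub>obj T 0\<^esub> h q (dif T p x)"
      using x unfolding ob(1)[symmetric] by (rule h(2)) (use ix in auto)
    then have "b 0 x = dif P (- 1) (h p x) \<oplus>\<^bsub>obj P 0\<^esub> h q (dif P p x)"
      using ix i x hx by (simp add: F_def ob)
    then have "\<epsilon> (b 0 x) = \<zero>\<^bsub>M\<^esub> \<oplus>\<^bsub>M\<^esub> \<epsilon> (h q (dif P p x))"
      using L.linD(2)[OF eps_lin dh(1) L.linD(1)[OF hq dx]] dh(2) by simp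
    then show ?thesis using b0[OF x] L.linD(1)[OF eps_lin L.linD(1)[OF hq dx]] by simp
  qed
  then show "\<exists>g. L.lin (obj P q) M g \<and> (\<forall>x\<in>carrier (obj P p). f x = g (dif P p x))"
    using L.lin_comp[OF hq eps_lin] by blast
qed

end

lemma (in rng) a_kernel_restrict: "a_kernel A B (restrict u (carrier A)) = a_kernel A B u"
  by (auto simp: a_kernel_iff)

section \<open>Covers of orthogonal modules by powers of the tilting module\<close>

context tau_tilting begin

definition perp :: "('a, 'x) module \<Rightarrow> bool" where
  "perp N \<longleftrightarrow> N \<in> fg_mod \<Lambda> \<and> (\<forall>i\<in>{1..n}. van n i N)"

text \<open>\<open>N\<close> is treated as a stalk complex. The cocone of its approximation is exact
  in degree \<open>1\<close>, so every element of \<open>N\<close> is a sum of values of the degree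
  \<open>0\<close> parts of the \<open>F l\<close>; these factor through the augmentation and
  thereby become maps from \<open>M\<close>.\<close>

lemma generated:
  assumes N: "perp N"
  obtains a gs where "\<And>l. l < a \<Longrightarrow> L.lin M N (gs l)"
    "\<And>y. y \<in> carrier N \<Longrightarrow> \<exists>ts. (\<forall>l<a. ts l \<in> carrier M) \<and> y = msum N (\<lambda>l. gs l (ts l)) a"
proof -
  have Nf: "N \<in> fg_mod \<Lambda>" and v: "\<And>i. i \<in> {1..n} \<Longrightarrow> van n i N" using N by (auto simp: perp_def)
  note Nl = L.fg_modD(1)[OF Nf]
  obtain e :: "_ \<Rightarrow> nat \<Rightarrow> 'a" where ei: "inj_on e (carrier N)" by (rule L.fg_transport[OF Nf])
  define N' where "N' = L.transport e N"
  note tr = L.transport[OF Nl ei, folded N'_def]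
  have N'f: "N' \<in> fg_mod \<Lambda>" unfolding N'_def by (rule L.transport_fg[OF Nf ei])
  define b where "b = inv_into (carrier N) e"
  have bl: "L.lin N' N b" unfolding b_def by (rule L.lin_inverse[OF tr(2,3) Nl tr(1)])
  have eb: "e (b y) = y" if "y \<in> carrier N'" for y
    using that tr(3) by (auto simp: b_def bij_betw_def intro: f_inv_into_f)
  have be: "b (e y) = y" if "y \<in> carrier N" for y using inv_into_f_f[OF ei that] by (simp add: b_def)
  have v': "van n i N'" if "i \<in> {1..n}" for i by (rule van_retract[OF v[OF that] Nl tr(1) bl tr(2) eb])
  define Z where "Z = N'\<lparr>carrier := {\<zero>\<^bsub>N'\<^esub>}\<rparr>"
  have Z0: "L.sub {\<zero>\<^bsub>N'\<^esub>} N'" by (rule L.sub_zero[OF tr(1)])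
  have Zl: "L.lmod Z" unfolding Z_def by (rule L.lmod_sub[OF tr(1) Z0])
  have Zf: "Z \<in> fg_mod \<Lambda>" unfolding Z_def by (rule fg_sub[OF N'f Z0])
  have Zc: "carrier Z = {\<zero>\<^bsub>Z\<^esub>}" by (simp add: Z_def)
  let ?Y = "L.stalk N' Z"
  have Yc: "L.cplx ?Y" by (rule L.stalk_cplx[OF tr(1) Zl])
  have Yf: "L.fgc ?Y" using Yc N'f Zf by (simp add: L.fgc_def)
  have TY: "L.orth T ?Y j" if "j > 0" for j by (rule orth_stalk[OF tr(1) Zl Zc v' that])
  obtain a F Y' where F: "\<And>l. l < a \<Longrightarrow> L.anti 0 T ?Y (F l)" and Y': "L.fgc Y'" "\<And>j. j > 0 \<Longrightarrow> L.orth T Y' j"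
    and ap: "\<And>j y. \<lbrakk>L.exact_at Y' (j + 1); y \<in> carrier (obj ?Y j); dif ?Y j y = \<zero>\<^bsub>obj ?Y (j + 1)\<^esub>\<rbrakk> \<Longrightarrow>
      \<exists>t z. (\<forall>l<a. t l \<in> carrier (obj T j)) \<and> z \<in> carrier (obj ?Y (j - 1)) \<and>
        y = msum (obj ?Y j) (\<lambda>l. F l j (t l)) a \<oplus>\<^bsub>obj ?Y j\<^esub> dif ?Y (j - 1) z"
  proof (rule approximation[OF T_silting(1) _ Yf])
    show "L.orth T T j" if "j > 0" for j by (rule L.presilting_orth[OF T_silting(3) that])
    show "L.orth T ?Y j" if "j > 0" for j by (rule TY[OF that])
  qed (rule that)
  have ex: "L.exact_at Y' (0 + 1)" by (rule perp_exact[OF tilting T_pos Y'(1)]) (use Y'(2) in auto)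
  have "\<exists>g. L.lin M N' g \<and> (\<forall>x\<in>carrier (obj P 0). g (\<epsilon> x) = F l 0 x)" if l: "l < a" for l
  proof -
    have Fl: "L.lin (obj P 0) N' (F l 0)" using L.antiD(1)[OF F[OF l], of 0 0] by simp
    have "F l 0 x = \<zero>\<^bsub>N'\<^esub>" if x: "x \<in> carrier (obj P 0)" "\<epsilon> x = \<zero>\<^bsub>M\<^esub>" for x
    proof -
      have "x \<in> dif P (- 1) ` carrier (obj P (- 1))" unfolding exact0 using x by (simp add: L.a_kernel_iff)
      then obtain w where w: "w \<in> carrier (obj P (- 1))" "x = dif P (- 1) w" by blast
      \<comment> \<open>Here \<open>n \<ge> 1\<close> keeps the term in degree \<open>-1\<close>
        inside the truncation; its image under \<open>F l\<close> lies in the zero module, so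
        \<open>F l\<close> vanishes on boundaries.\<close>
      have wT: "w \<in> carrier (obj T (- 1))" using w(1) n by simp
      have c: "F l (- 1) w \<in> carrier (obj ?Y (- 1))" by (rule L.antiD(2)[OF F[OF l] wT]) simp
      have "F l 0 (dif T (- 1) w) = \<ominus>\<^bsub>obj ?Y 0\<^esub> dif ?Y (- 1) (F l (- 1) w)"
        by (rule L.antiD(3)[OF F[OF l] wT]) auto
      then show ?thesis using wT c w(2) tr(1) by simp
    qed
    then show ?thesis using L.lin_factor[OF eps_lin P_lmod Ml tr(1) Fl eps_surj] by metis
  qed
  then obtain G where G: "\<And>l. l < a \<Longrightarrow> L.lin M N' (G l)"
    "\<And>l x. \<lbrakk>l < a; x \<in> carrier (obj P 0)\<rbrakk> \<Longrightarrow> G l (\<epsilon> x) = F l 0 x" by metis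
  show ?thesis
  proof (rule that[of a "\<lambda>l x. b (G l x)"])
    show "L.lin M N (\<lambda>x. b (G l x))" if "l < a" for l by (rule L.lin_comp[OF G(1)[OF that] bl])
    fix y assume y: "y \<in> carrier N"
    have ey: "e y \<in> carrier N'" by (rule L.linD(1)[OF tr(2) y])
    have "\<exists>t z. (\<forall>l<a. t l \<in> carrier (obj T 0)) \<and> z \<in> carrier (obj ?Y (0 - 1)) \<and>
        e y = msum (obj ?Y 0) (\<lambda>l. F l 0 (t l)) a \<oplus>\<^bsub>obj ?Y 0\<^esub> dif ?Y (0 - 1) z"
      by (rule ap[OF ex]) (use ey in simp_all)
    then obtain t z where tz: "\<forall>l<a. t l \<in> carrier (obj T 0)" "z \<in> carrier (obj ?Y (0 - 1))"
        "e y = msum (obj ?Y 0) (\<lambda>l. F l 0 (t l)) a \<oplus>\<^bsub>obj ?Y 0\<^esub> dif ?Y (0 - 1) z"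
      by (elim exE conjE) (rule that)
    have t: "t l \<in> carrier (obj P 0)" if "l < a" for l using tz(1) that by simp
    have dz: "dif ?Y (0 - 1) z = \<zero>\<^bsub>N'\<^esub>" using tz(2) by simp
    have Gt: "G l (\<epsilon> (t l)) \<in> carrier N'" "\<epsilon> (t l) \<in> carrier M" if "l < a" for l
      using L.linD(1)[OF G(1)[OF that]] L.linD(1)[OF eps_lin t[OF that]] by auto
    have s: "msum N' (\<lambda>l. F l 0 (t l)) a = msum N' (\<lambda>l. G l (\<epsilon> (t l))) a"
      using G(2) t by (intro L.msum_cong) simp
    have "e y = msum N' (\<lambda>l. G l (\<epsilon> (t l))) a"
      using tz(3) L.msum_closed[OF tr(1) Gt(1)] tr(1) unfolding dz by (simp add: s)
    then have "y = msum N (\<lambda>l. b (G l (\<epsilon> (t l)))) a"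
      using be[OF y] L.msum_lin[OF bl tr(1) Nl Gt(1)] by simp
    then show "\<exists>ts. (\<forall>l<a. ts l \<in> carrier M) \<and> y = msum N (\<lambda>l. b (G l (ts l))) a"
      using Gt(2) by (intro exI[of _ "\<lambda>l. \<epsilon> (t l)"]) auto
  qed
qed

text \<open>The generators of \<open>Hom(M, N)\<close> over \<open>R\<close> give a right
  approximation \<open>M^a \<rightarrow> N\<close>, onto because \<open>M\<close> generates
  \<open>N\<close>. For the kernel, a map is first extended to \<open>M^a\<close>, where the
  conditions hold; the extension is then moved back into the kernel by a correction that vanishes on
  boundaries.\<close>

lemma cover_step:
  assumes N: "perp N"
  obtains a g where "L.lin (direct_power M a) N g" "g ` carrier (direct_power M a) = carrier N"
    "perp ((direct_power M a)\<lparr>carrier := a_kernel (direct_power M a) N g\<rparr>)"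
proof -
  have Nf: "N \<in> fg_mod \<Lambda>" and v: "\<And>i. i \<in> {1..n} \<Longrightarrow> van n i N" using N by (auto simp: perp_def)
  note Nl = L.fg_modD(1)[OF Nf]
  obtain a gs where gs: "\<And>l. l < a \<Longrightarrow> L.lin M N (gs l)"
    "\<And>g. L.lin M N g \<Longrightarrow> \<exists>r. (\<forall>l<a. r l \<in> carrier R) \<and>
      (\<forall>x\<in>carrier M. g x = msum N (\<lambda>l. \<phi> (r l) \<odot>\<^bsub>N\<^esub> gs l x) a)"
    by (rule hom_fg[OF Mfg Nf]) (rule that)
  let ?A = "direct_power M a"
  have Al: "L.lmod ?A" by (rule L.lmod_power[OF Ml])
  define g where "g u = msum N (\<lambda>l. gs l (u l)) a" for u
  have gl: "L.lin ?A N g" unfolding g_def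
    by (rule L.lin_msum[OF Al Nl]) (rule L.lin_comp[OF L.proj_lin gs(1)])
  \<comment> \<open>Maps from \<open>M\<close> factor through \<open>g\<close> with central scalars
    as coefficients. This lifting property, rather than surjectivity, gives the condition of index
    \<open>1\<close> for the kernel.\<close>
  have lift: "\<exists>s. L.lin M ?A s \<and> (\<forall>x\<in>carrier M. g (s x) = u x)" if u: "L.lin M N u" for u
  proof -
    obtain r where r: "\<forall>l<a. r l \<in> carrier R" "\<forall>x\<in>carrier M. u x = msum N (\<lambda>l. \<phi> (r l) \<odot>\<^bsub>N\<^esub> gs l x) a"
      using gs(2)[OF u] by blast
    have rc: "L.lin M M (\<lambda>x. \<phi> (r l) \<odot>\<^bsub>M\<^esub> x)" if "l < a" for l using central_lin[OF Ml] r(1) that by simp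
    let ?s = "\<lambda>x. \<lambda>l\<in>{..<a}. \<phi> (r l) \<odot>\<^bsub>M\<^esub> x"
    have "L.lin M ?A ?s"
    proof (rule L.linI)
      show "?s x \<in> carrier ?A" if "x \<in> carrier M" for x using L.linD(1)[OF rc that] by simp
      show "?s (x \<oplus>\<^bsub>M\<^esub> y) = ?s x \<oplus>\<^bsub>?A\<^esub> ?s y" if "x \<in> carrier M" "y \<in> carrier M" for x y
        using L.linD(2)[OF rc that] by (auto simp: fun_eq_iff restrict_def)
      show "?s (b \<odot>\<^bsub>M\<^esub> x) = b \<odot>\<^bsub>?A\<^esub> ?s x" if "b \<in> carrier \<Lambda>" "x \<in> carrier M" for b x
        using L.linD(3)[OF rc that] by (auto simp: fun_eq_iff restrict_def)
    qed
    moreover have "g (?s x) = u x" if x: "x \<in> carrier M" for x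
      unfolding g_def r(2)[rule_format, OF x]
      using L.linD(3)[OF gs(1) phi(1) x] r(1) by (intro L.msum_cong) simp
    ultimately show ?thesis by blast
  qed
  have sur: "g ` carrier ?A = carrier N"
  proof
    show "g ` carrier ?A \<subseteq> carrier N" using L.linD(1)[OF gl] by blast
    show "carrier N \<subseteq> g ` carrier ?A"
    proof
      fix y assume y: "y \<in> carrier N"
      obtain c us where us: "\<And>l. l < c \<Longrightarrow> L.lin M N (us l)"
        "\<And>y. y \<in> carrier N \<Longrightarrow> \<exists>ts. (\<forall>l<c. ts l \<in> carrier M) \<and> y = msum N (\<lambda>l. us l (ts l)) c"
        by (rule generated[OF N]) (rule that)
      obtain ts where ts: "\<forall>l<c. ts l \<in> carrier M" "y = msum N (\<lambda>l. us l (ts l)) c" using us(2)[OF y] by blast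
      have sb: "L.sub (g ` carrier ?A) N" by (rule L.sub_image[OF gl Al Nl L.sub_carrier[OF Al]])
      have "us l (ts l) \<in> g ` carrier ?A" if l: "l < c" for l
      proof -
        obtain s where s: "L.lin M ?A s" "\<forall>x\<in>carrier M. g (s x) = us l x" using lift[OF us(1)[OF l]] by blast
        have tl: "ts l \<in> carrier M" using ts(1) l by blast
        show ?thesis using imageI[OF L.linD(1)[OF s(1) tl], of g] s(2) tl by simp
      qed
      then show "y \<in> g ` carrier ?A" unfolding ts(2) by (rule L.msum_sub[OF sb])
    qed
  qed
  let ?K = "?A\<lparr>carrier := a_kernel ?A N g\<rparr>"
  have "van n i ?K" if i: "i \<in> {1..n}" for i
  proof (rule vanI)
    fix p q r f assume ix: "p = - int i" "q = p + 1" "r = p - 1" and f: "L.lin (obj P p) ?K f"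
      and z: "\<And>x. \<lbrakk>i < n; x \<in> carrier (obj P r)\<rbrakk> \<Longrightarrow> f (dif P r x) = \<zero>\<^bsub>?K\<^esub>"
    have fA: "L.lin (obj P p) ?A f" by (rule L.lin_out_sub[OF f]) (simp add: L.a_kernel_iff subset_iff del: L.direct_power_simps)
    have gf: "g (f x) = \<zero>\<^bsub>N\<^esub>" if "x \<in> carrier (obj P p)" for x
      using L.linD(1)[OF f that] by (simp add: L.a_kernel_iff)
    obtain h where h: "L.lin (obj P q) ?A h" "\<And>x. x \<in> carrier (obj P p) \<Longrightarrow> f x = h (dif P p x)"
      by (rule vanD[OF van_power[OF van_self[OF i]] ix fA]) (use z in simp, rule that)
    have ghl: "L.lin (obj P q) N (\<lambda>x. g (h x))" by (rule L.lin_comp[OF h(1) gl])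
    have ghd: "g (h (dif P p x)) = \<zero>\<^bsub>N\<^esub>" if "x \<in> carrier (obj P p)" for x using gf[OF that] h(2)[OF that] by simp
    \<comment> \<open>The correction \<open>w\<close> has the same image in \<open>N\<close> as
      \<open>h\<close> and dies on boundaries, so \<open>h\<close> minus \<open>w\<close> still
      extends \<open>f\<close> and takes values in the kernel.\<close>
    have "\<exists>w. L.lin (obj P q) ?A w \<and> (\<forall>y\<in>carrier (obj P q). g (w y) = g (h y)) \<and>
        (\<forall>x\<in>carrier (obj P p). w (dif P p x) = \<zero>\<^bsub>?A\<^esub>)"
    proof (cases "i = 1")
      case True
      then have pq: "p = - 1" "q = 0" using ix by auto
      \<comment> \<open>In degree \<open>0\<close> the map \<open>g h\<close> vanishes on the kernel
        of the augmentation, so it descends to \<open>M\<close> and lifts by the approximation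
        property.\<close>
      have k0: "g (h x) = \<zero>\<^bsub>N\<^esub>" if x: "x \<in> carrier (obj P 0)" "\<epsilon> x = \<zero>\<^bsub>M\<^esub>" for x
      proof -
        have "x \<in> dif P (- 1) ` carrier (obj P (- 1))" unfolding exact0 using x by (simp add: L.a_kernel_iff)
        then show ?thesis using ghd unfolding pq by blast
      qed
      obtain u where u: "L.lin M N u" "\<And>x. x \<in> carrier (obj P 0) \<Longrightarrow> u (\<epsilon> x) = g (h x)"
        by (rule L.lin_factor[OF eps_lin P_lmod Ml Nl ghl[unfolded pq] eps_surj k0]) (assumption, assumption, rule that)
      obtain s where s: "L.lin M ?A s" "\<And>x. x \<in> carrier M \<Longrightarrow> g (s x) = u x" using lift[OF u(1)] by blast
      have "s (\<epsilon> (dif P (- 1) x)) = \<zero>\<^bsub>?A\<^esub>" if x: "x \<in> carrier (obj P (- 1))" for x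
      proof -
        have "\<epsilon> (dif P (- 1) x) = \<zero>\<^bsub>M\<^esub>"
          using imageI[OF x, of "dif P (- 1)"] unfolding exact0 by (simp add: L.a_kernel_iff)
        then show ?thesis using L.lin_zero[OF s(1) Ml Al] by simp
      qed
      then show ?thesis unfolding pq
        using L.lin_comp[OF eps_lin s(1)] s(2)[OF L.linD(1)[OF eps_lin]] u(2)
        by (intro exI[of _ "\<lambda>x. s (\<epsilon> x)"]) (simp del: L.direct_power_simps)
    next
      case False
      then have ix': "q = - int (i - 1)" "p = q - 1" "i - 1 \<in> {1..n}" "q + 1 \<le> 0" using ix i by auto
      \<comment> \<open>For larger \<open>i\<close> the condition of index \<open>i - 1\<close> on
        \<open>N\<close> writes the cocycle \<open>g h\<close> as a coboundary, whose other factor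
        \<open>k\<close> lifts to \<open>M^a\<close> by projectivity.\<close>
      obtain k where k: "L.lin (obj P (q + 1)) N k" "\<And>x. x \<in> carrier (obj P q) \<Longrightarrow> g (h x) = k (dif P q x)"
        by (rule vanD[OF v[OF ix'(3)] ix'(1) refl ix'(2) ghl]) (use ghd in simp, rule that)
      have "\<exists>b\<in>carrier ?A. g b = k x" if "x \<in> carrier (obj P (q + 1))" for x
        using L.linD(1)[OF k(1) that] sur by (metis imageE)
      then obtain k' where k': "L.lin (obj P (q + 1)) ?A k'" "\<And>x. x \<in> carrier (obj P (q + 1)) \<Longrightarrow> g (k' x) = k x"
        by (rule L.proj_lift[OF P_proj[OF ix'(4)] Al Nl gl k(1)]) (assumption, rule that)
      have "k' (dif P q (dif P p x)) = \<zero>\<^bsub>?A\<^esub>" if x: "x \<in> carrier (obj P p)" for x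
      proof -
        have "dif P q (dif P p x) = \<zero>\<^bsub>obj P (q + 1)\<^esub>" by (rule P_dd'[OF x]) (use ix' in auto)
        then show ?thesis using L.lin_zero[OF k'(1) P_lmod Al] by simp
      qed
      then show ?thesis
        using L.lin_comp[OF P_lin k'(1)] k'(2)[OF L.linD(1)[OF P_lin]] k(2)
        by (intro exI[of _ "\<lambda>x. k' (dif P q x)"]) (simp del: L.direct_power_simps)
    qed
    then obtain w where w: "L.lin (obj P q) ?A w" "\<And>y. y \<in> carrier (obj P q) \<Longrightarrow> g (w y) = g (h y)"
      "\<And>x. x \<in> carrier (obj P p) \<Longrightarrow> w (dif P p x) = \<zero>\<^bsub>?A\<^esub>" by blast
    let ?h = "\<lambda>x. h x \<ominus>\<^bsub>?A\<^esub> w x"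
    have "L.lin (obj P q) ?K ?h"
    proof (rule L.lin_into_sub[OF L.lin_sub[OF h(1) w(1) Al]])
      fix x assume x: "x \<in> carrier (obj P q)"
      note c = L.linD(1)[OF h(1) x] L.linD(1)[OF w(1) x]
      have "g (?h x) = \<zero>\<^bsub>N\<^esub>" unfolding L.lin_diff[OF gl Al Nl c] w(2)[OF x]
        using L.linD(1)[OF gl c(1)] Nl by (subst L.diff_eq_iff) auto
      then show "?h x \<in> a_kernel ?A N g" unfolding L.a_kernel_iff using L.lmod_simps(4)[OF Al c] by blast
    qed
    moreover have "f x = ?h (dif P p x)" if x: "x \<in> carrier (obj P p)" for x
    proof -
      have fx: "f x \<in> carrier ?A" by (rule L.linD(1)[OF fA x])
      have "f x \<ominus>\<^bsub>?A\<^esub> \<zero>\<^bsub>?A\<^esub> = f x"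
        by (subst L.diff_eq_iff[OF Al fx _ fx]) (use Al fx in \<open>simp_all del: L.direct_power_simps\<close>)
      then show ?thesis unfolding w(3)[OF x] h(2)[OF x, symmetric] by (rule sym)
    qed
    ultimately show "\<exists>g. L.lin (obj P q) ?K g \<and> (\<forall>x\<in>carrier (obj P p). f x = g (dif P p x))" by blast
  qed
  then have "perp ?K" unfolding perp_def
    using fg_sub[OF direct_power_fg[OF Mfg] L.sub_kernel[OF gl Al Nl]] by blast
  then show ?thesis by (rule that[OF gl sur])
qed

text \<open>The kernel of a cover by a power of \<open>M\<close> is orthogonal again, so covers can
  be chosen without end; the first \<open>n\<close> of them, spliced at the kernels, form the
  required exact sequence.\<close>

lemma perp_gen_n:
  assumes N: "perp N" shows "N \<in> gen_n \<Lambda> n M"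
proof -
  note Nl = L.fg_modD(1)[OF conjunct1[OF N[unfolded perp_def]]]
  define ker where "ker a h = (direct_power M a)\<lparr>carrier := h\<rparr>" for a h
  define Q where "Q s t \<longleftrightarrow> (\<exists>h. L.lin (direct_power M (fst t)) (ker (fst s) (snd s)) h \<and>
      h ` carrier (direct_power M (fst t)) = snd s \<and> snd t = a_kernel (direct_power M (fst t)) (direct_power M (fst s)) h)"
    for s t :: "nat \<times> (nat \<Rightarrow> 'm) set"
  have Al: "L.lmod (direct_power M a)" for a by (rule L.lmod_power[OF Ml])
  obtain a g where g: "L.lin (direct_power M a) N g" "g ` carrier (direct_power M a) = carrier N"
    and K: "perp (ker a (a_kernel (direct_power M a) N g))"
    by (rule cover_step[OF N]) (rule that, assumption, assumption, simp only: ker_def)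
  \<comment> \<open>The invariant for dependent choice: the current kernel is orthogonal, and for
    \<open>m = 0\<close> it is the kernel of the cover of \<open>N\<close> fixed before.\<close>
  define G where "G m s \<longleftrightarrow> perp (ker (fst s) (snd s)) \<and> snd s \<subseteq> carrier (direct_power M (fst s)) \<and>
      (m = 0 \<longrightarrow> s = (a, a_kernel (direct_power M a) N g))" for m :: nat and s
  have "\<exists>s. \<forall>m. G m (s m) \<and> Q (s m) (s (Suc m))"
  proof (rule dependent_nat_choice)
    show "\<exists>s. G 0 s" using K by (auto simp: G_def L.a_kernel_iff)
    fix s m assume G: "G m s"
    obtain c h where h: "L.lin (direct_power M c) (ker (fst s) (snd s)) h"
      "h ` carrier (direct_power M c) = carrier (ker (fst s) (snd s))"
      "perp ((direct_power M c)\<lparr>carrier := a_kernel (direct_power M c) (ker (fst s) (snd s)) h\<rparr>)"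
      using G unfolding G_def by (elim conjE) (erule cover_step, rule that)
    have k: "a_kernel (direct_power M c) (ker (fst s) (snd s)) h = a_kernel (direct_power M c) (direct_power M (fst s)) h"
      by (auto simp: L.a_kernel_iff ker_def)
    let ?t = "(c, a_kernel (direct_power M c) (direct_power M (fst s)) h)"
    have "G (Suc m) ?t" using h(3) unfolding k by (auto simp: G_def ker_def L.a_kernel_iff)
    moreover have "Q s ?t" using h(1,2) by (auto simp: Q_def ker_def)
    ultimately show "\<exists>t. G (Suc m) t \<and> Q s t" by blast
  qed
  then obtain s where s: "\<And>m. G m (s m)" "\<And>m. Q (s m) (s (Suc m))" by blast
  define c where "c m = fst (s m)" for m
  define H where "H m = snd (s m)" for m
  have c0: "c 0 = a" "H 0 = a_kernel (direct_power M a) N g" using s(1)[of 0] by (auto simp: G_def c_def H_def)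
  have Hs: "H m \<subseteq> carrier (direct_power M (c m))" for m using s(1)[of m] by (simp add: G_def c_def H_def)
  have "\<forall>m. \<exists>h. L.lin (direct_power M (c (Suc m))) (ker (c m) (H m)) h \<and>
      h ` carrier (direct_power M (c (Suc m))) = H m \<and>
      H (Suc m) = a_kernel (direct_power M (c (Suc m))) (direct_power M (c m)) h"
    using s(2) unfolding Q_def c_def H_def by blast
  then obtain h where h: "\<And>m. L.lin (direct_power M (c (Suc m))) (ker (c m) (H m)) (h m)"
      "\<And>m. h m ` carrier (direct_power M (c (Suc m))) = H m"
      "\<And>m. H (Suc m) = a_kernel (direct_power M (c (Suc m))) (direct_power M (c m)) (h m)" by metis
  have hl: "L.lin (direct_power M (c (Suc m))) (direct_power M (c m)) (h m)" for m
    by (rule L.lin_out_sub[OF h(1)[unfolded ker_def] Hs])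
  \<comment> \<open>The sequence of choices starts at \<open>0\<close> and the modules of
    \<open>gen_n\<close> at \<open>1\<close>, hence the shift by one here and in
    \<open>f\<close>.\<close>
  define L where "L i = direct_power M (c (i - 1))" for i
  define f where "f i = restrict (h (i - 1)) (carrier (L (i + 1)))" for i
  have add: "L i \<in> add_closure \<Lambda> M" for i
    unfolding L_def add_closure_def using direct_power_fg[OF Mfg] L.direct_summand_power[OF Ml] by blast
  have f: "f i \<in> mod_hom \<Lambda> (L (i + 1)) (L i)" if "1 \<le> i" for i
  proof -
    obtain m where m: "i = Suc m" using \<open>1 \<le> i\<close> by (cases i) auto
    show ?thesis unfolding f_def by (rule L.restrict_mod_hom) (use hl[of m] Al in \<open>simp_all add: m L_def del: L.direct_power_simps\<close>)
  qed
  have im: "f i ` carrier (L (i + 1)) = H (i - 1)" if "1 \<le> i" for i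
  proof -
    obtain m where m: "i = Suc m" using \<open>1 \<le> i\<close> by (cases i) auto
    show ?thesis using h(2)[of m] unfolding f_def image_restrict_eq m L_def by simp
  qed
  have ke: "a_kernel (L (i + 1)) (L i) (f i) = H i" if "1 \<le> i" for i
  proof -
    obtain m where m: "i = Suc m" using \<open>1 \<le> i\<close> by (cases i) auto
    show ?thesis unfolding f_def L.a_kernel_restrict using h(3)[of m] by (simp add: m L_def)
  qed
  have L1: "L 1 = direct_power M a" by (simp add: L_def c0)
  show ?thesis unfolding gen_n_def mem_Collect_eq
  proof (intro conjI exI[of _ L] exI[of _ f] exI[of _ "restrict g (carrier (L 1))"] ballI impI allI)
    show "N \<in> fg_mod \<Lambda>" using N by (simp add: perp_def)
    show "L i \<in> add_closure \<Lambda> M" for i by (rule add)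
    show "f i \<in> mod_hom \<Lambda> (L (i + 1)) (L i)" if "i \<in> {1..<n}" for i by (rule f) (use that in simp)
    show "restrict g (carrier (L 1)) \<in> mod_hom \<Lambda> (L 1) N"
      unfolding L1 by (rule L.restrict_mod_hom[OF g(1) Al])
    show "restrict g (carrier (L 1)) ` carrier (L 1) = carrier N"
      using g(2) unfolding L1 by auto
    show "f 1 ` carrier (L 2) = a_kernel (L 1) N (restrict g (carrier (L 1)))"
      using im[of 1] c0(2) unfolding L.a_kernel_restrict L1 by (simp add: numeral_2_eq_2)
    show "f (i + 1) ` carrier (L (i + 2)) = a_kernel (L (i + 1)) (L i) (f i)" if "1 \<le> i \<and> i + 1 < n" for i
      using im[of "i + 1"] ke[of i] that by simp
  qed
qed

lemma perp_eq_gen_n: "perp N \<longleftrightarrow> N \<in> gen_n \<Lambda> n M"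
proof
  assume N: "N \<in> gen_n \<Lambda> n M"
  then show "perp N" using gen_n_van[OF van_self n N] by (auto simp: perp_def gen_n_def)
qed (rule perp_gen_n)

end

theorem theorem4p2:
  fixes R :: "'r ring" and \<Lambda> :: "'a ring" and \<phi> :: "'r \<Rightarrow> 'a"
    and J :: "('r, 'j) module" and M :: "('a, 'm) module" and n :: nat
  assumes "artin_algebra R \<Lambda> \<phi>"
    and "duality_cogenerator R J"
    and "n \<ge> 1"
    and "M \<in> fg_mod \<Lambda>"
    and "tau_n_tilting \<Lambda> n M"
  shows "(tau_n_perp R \<Lambda> \<phi> J n M :: ('a, 'n) module set) = gen_n \<Lambda> n M"
proof -
  interpret tau_tilting R \<Lambda> \<phi> M n
    by unfold_locales (use assms in \<open>auto simp: tau_n_tilting_def\<close>)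
  show ?thesis
    using tau_n_perp_iff[OF assms(2,3)] perp_eq_gen_n unfolding perp_def by blast
qed

end
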